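(* Let $Q$ be an injective trace class operator on $H$, let $W^Q$ be a $Q$-Wiener process, and let $X_0$ be an $H$-valued random variable independent of $W^Q$ with $\mathbb E[\lVert X_0\rVert^2]<\infty$. Let $(X_t)_{t\in[0,T]}$ be the solution of $\mathrm dX_t=-\tfrac12\alpha_tX_t\,\mathrm dt+\sqrt{\alpha_t}\,\mathrm dW_t^Q$ with initial value $X_0$, and for $n\in\mathbb N$ let $(X_t^n)_{t\in[0,T]}$ be the solution of $$\mathrm dX_t^n=-\tfrac12\alpha_tX_t^n\,\mathrm dt+\sqrt{\alpha_t}\,\mathrm dW_t^{Q_n},\qquad X_0^n=\sum_{k=1}^n\langle X_0,e_k\rangle e_k,$$ and let $\hat X_0^n=\iota_n(X_0^n)\in\mathbb R^n$ admit a Lebesgue density. Let $(Y_t^n)_{t\in[0,T)}$ be a weak solution of the discretized reverse SDE $$\mathrm dY_t^n=\Big(\tfrac12\alpha_{T-t}Y_t^n+f^n(t,Y_t^n)\Big)\,\mathrm dt+\sqrt{\alpha_{T-t}}\,\mathrm d\hat W_t^{Q_n},\qquad Y_0^n\sim\mathbb P_{X_T^n}.$$ Then for $t\in[0,T)$, $$W_2^2(\mathbb P_{Y_t^n},\mathbb P_{X_{T-t}})\le 2\,a_{T-t}^{-2}\,\mathbb E\big[\lVert X_0-X_0^n\rVert^2\big]+2\,(1-a_{T-t}^{-2})\,\mathrm{tr}(Q-Q_n),$$ and the right-hand side tends to $0$ as $n\to\infty$.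
   Context: $(H,\lVert\cdot\rVert)$ is a real separable Hilbert space, $T>0$, $\alpha\in\mathcal C^1([0,T];\mathbb R_{>0})$, $a_t:=e^{\frac12\int_0^t\alpha_r\,\mathrm dr}$. A trace class operator $Q$ is a bounded self-adjoint positive semidefinite operator on $H$ with finite trace; $(e_k)_{k\in\mathbb N}$ is an orthonormal basis of $H$ of eigenvectors of $Q$ with eigenvalues $(\lambda_k)_{k\in\mathbb N}$ (all positive when $Q$ is injective). A $Q$-Wiener process is a continuous $H$-valued process $W^Q$ with $W^Q_0=0$, independent increments and $W^Q_t-W^Q_s\sim\mathcal N(0,(t-s)Q)$; it has the Karhunen–Loève decomposition $W_t^Q=\sum_k\sqrt{\lambda_k}\beta_k(t)e_k$ with independent standard real Brownian motions $\beta_k$. Put $H_n:=\mathrm{span}\{e_1,\dots,e_n\}$, $Q_n:=\sum_{k=1}^n\lambda_k\langle e_k,\cdot\rangle e_k$, $W_t^{Q_n}:=\sum_{k=1}^n\sqrt{\lambda_k}\beta_k(t)e_k$, and $\iota_n:H_n\to\mathbb R^n$, $\iota_n(x):=(\langle x,e_k\rangle)_{k=1}^n$. Discretized score: when $\hat X_0^n$ has a Lebesgue density, $\hat X_t^n:=\iota_n(X_t^n)$ has a positive, smooth Lebesgue density $p_t^n$ for every $t\in(0,T]$, and $f^n(t,\cdot):=\alpha_{T-t}\,Q_n\big(\iota_n^{-1}\circ\nabla\log p_{T-t}^n\circ\iota_n\big)$ on $H_n$ for $t\in[0,T)$. Weak solution: a filtered probability space with normal filtration, together with a $Q_n$-Wiener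 process $\hat W^{Q_n}$ with respect to it and an adapted continuous $H_n$-valued process $(Y_t^n)_{t\in[0,T)}$ with the prescribed initial law satisfying the integrated SDE almost surely for all $t\in[0,T)$. $\mathbb P_Z$ denotes the law of $Z$ and $W_2(\mu,\nu)=\big(\inf_{X\sim\mu,Y\sim\nu}\mathbb E[\lVert X-Y\rVert^2]\big)^{1/2}$ is the Wasserstein-2 distance on $H$. *)

theory Defs
  imports "HOL-Probability.Probability"
begin

section \<open>Trace class operators\<close>

definition orthonormal_basis :: "(nat \<Rightarrow> 'h::real_inner) \<Rightarrow> bool" where
  "orthonormal_basis e \<longleftrightarrow>
     (\<forall>i j. e i \<bullet> e j = (if i = j then 1 else 0)) \<and> closure (span (range e)) = UNIV"

definition has_op_trace :: "('h::real_inner \<Rightarrow> 'h) \<Rightarrow> real \<Rightarrow> bool" where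
  "has_op_trace A \<tau> \<longleftrightarrow> (\<forall>e. orthonormal_basis e \<longrightarrow> (\<lambda>k. A (e k) \<bullet> e k) sums \<tau>)"

definition op_trace :: "('h::real_inner \<Rightarrow> 'h) \<Rightarrow> real" where
  "op_trace A = (THE \<tau>. has_op_trace A \<tau>)"

definition trace_class_operator :: "('h::real_inner \<Rightarrow> 'h) \<Rightarrow> bool" where
  "trace_class_operator Q \<longleftrightarrow>
     bounded_linear Q \<and> (\<forall>x y. Q x \<bullet> y = x \<bullet> Q y) \<and> (\<forall>x. 0 \<le> Q x \<bullet> x) \<and>
     (\<exists>\<tau>. has_op_trace Q \<tau>)"


section \<open>Finite-dimensional truncations\<close>

text \<open>Bases are indexed from 0, so \<open>H_n\<close> is spanned by \<open>e 0, ..., e (n - 1)\<close>. The space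
  \<open>R^n\<close> is represented by the extensional functions on \<open>{..<n}\<close>.\<close>

definition Hn :: "(nat \<Rightarrow> 'h::real_inner) \<Rightarrow> nat \<Rightarrow> 'h set" where
  "Hn e n = span (e ` {..<n})"

definition truncate :: "(nat \<Rightarrow> 'h::real_inner) \<Rightarrow> nat \<Rightarrow> 'h \<Rightarrow> 'h" where
  "truncate e n x = (\<Sum>k<n. (x \<bullet> e k) *\<^sub>R e k)"

definition Qn :: "(nat \<Rightarrow> 'h::real_inner) \<Rightarrow> (nat \<Rightarrow> real) \<Rightarrow> nat \<Rightarrow> 'h \<Rightarrow> 'h" where
  "Qn e lam n x = (\<Sum>k<n. lam k *\<^sub>R (e k \<bullet> x) *\<^sub>R e k)"

definition Rn :: "nat \<Rightarrow> (nat \<Rightarrow> real) set" where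
  "Rn n = (\<Pi>\<^sub>E i\<in>{..<n}. UNIV)"

definition lborel_Rn :: "nat \<Rightarrow> (nat \<Rightarrow> real) measure" where
  "lborel_Rn n = (\<Pi>\<^sub>M i\<in>{..<n}. lborel)"

definition iota :: "(nat \<Rightarrow> 'h::real_inner) \<Rightarrow> nat \<Rightarrow> 'h \<Rightarrow> (nat \<Rightarrow> real)" where
  "iota e n x = (\<lambda>k\<in>{..<n}. x \<bullet> e k)"

definition has_Lebesgue_density :: "'w measure \<Rightarrow> nat \<Rightarrow> ('w \<Rightarrow> nat \<Rightarrow> real) \<Rightarrow> bool" where
  "has_Lebesgue_density M n X \<longleftrightarrow> (\<exists>p. distributed M (lborel_Rn n) X p)"

definition partial_deriv :: "nat \<Rightarrow> ((nat \<Rightarrow> real) \<Rightarrow> real) \<Rightarrow> (nat \<Rightarrow> real) \<Rightarrow> real" where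
  "partial_deriv i f x = deriv (\<lambda>s. f (x(i := s))) (x i)"

definition grad :: "nat \<Rightarrow> ((nat \<Rightarrow> real) \<Rightarrow> real) \<Rightarrow> (nat \<Rightarrow> real) \<Rightarrow> (nat \<Rightarrow> real)" where
  "grad n f x = (\<lambda>i\<in>{..<n}. partial_deriv i f x)"

text \<open>\<open>C\<close>-infinity: all iterated partial derivatives exist and are continuous.\<close>

definition smooth_Rn :: "nat \<Rightarrow> ((nat \<Rightarrow> real) \<Rightarrow> real) \<Rightarrow> bool" where
  "smooth_Rn n f \<longleftrightarrow> (\<forall>js. set js \<subseteq> {..<n} \<longrightarrow>
     continuous_on (Rn n) (foldr partial_deriv js f) \<and>
     (\<forall>i<n. \<forall>x\<in>Rn n. (\<lambda>s. foldr partial_deriv js f (x(i := s))) differentiable (at (x i))))"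

text \<open>The positive smooth Lebesgue density of a random vector; being continuous, it is unique
  on \<open>Rn n\<close> if it exists.\<close>

definition smooth_density ::
  "'w measure \<Rightarrow> nat \<Rightarrow> ('w \<Rightarrow> nat \<Rightarrow> real) \<Rightarrow> (nat \<Rightarrow> real) \<Rightarrow> real" where
  "smooth_density M n X =
     (SOME p. (\<forall>x\<in>Rn n. 0 < p x) \<and> smooth_Rn n p \<and>
        distributed M (lborel_Rn n) X (\<lambda>x. ennreal (p x)))"


section \<open>Wiener processes\<close>

definition normal_law :: "real \<Rightarrow> real \<Rightarrow> real measure" where
  "normal_law m v =
     (if v = 0 then return borel m else density lborel (\<lambda>x. ennreal (normal_density m (sqrt v) x)))"

definition gaussian_law :: "'h::real_inner measure \<Rightarrow> 'h \<Rightarrow> ('h \<Rightarrow> 'h) \<Rightarrow> bool" where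
  "gaussian_law \<mu> m C \<longleftrightarrow>
     sets \<mu> = sets borel \<and>
     (\<forall>h. distr \<mu> borel (\<lambda>x. x \<bullet> h) = normal_law (m \<bullet> h) (C h \<bullet> h))"

text \<open>Processes are indexed by a set \<open>I\<close> of times, in the applications \<open>{0..T}\<close> or \<open>{0..<T}\<close>;
  values at other times are irrelevant.\<close>

definition continuous_process ::
  "'w measure \<Rightarrow> real set \<Rightarrow> (real \<Rightarrow> 'w \<Rightarrow> 'h::real_normed_vector) \<Rightarrow> bool" where
  "continuous_process M I Y \<longleftrightarrow>
     (\<forall>t\<in>I. Y t \<in> borel_measurable M) \<and> (AE \<omega> in M. continuous_on I (\<lambda>t. Y t \<omega>))"

definition independent_increments ::
  "'w measure \<Rightarrow> real set \<Rightarrow> (real \<Rightarrow> 'w \<Rightarrow> 'h::real_normed_vector) \<Rightarrow> bool" where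
  "independent_increments M I W \<longleftrightarrow>
     (\<forall>m \<tau>. (\<forall>i\<le>m. \<tau> i \<in> I) \<and> (\<forall>i<m. \<tau> i \<le> \<tau> (Suc i)) \<longrightarrow>
        prob_space.indep_vars M (\<lambda>_. borel) (\<lambda>i \<omega>. W (\<tau> (Suc i)) \<omega> - W (\<tau> i) \<omega>) {..<m::nat})"

definition wiener_process ::
  "'w measure \<Rightarrow> real set \<Rightarrow> ('h::real_inner \<Rightarrow> 'h) \<Rightarrow> (real \<Rightarrow> 'w \<Rightarrow> 'h) \<Rightarrow> bool" where
  "wiener_process M I Q W \<longleftrightarrow>
     continuous_process M I W \<and>
     (AE \<omega> in M. W 0 \<omega> = 0) \<and>
     independent_increments M I W \<and>
     (\<forall>s\<in>I. \<forall>t\<in>I. s \<le> t \<longrightarrow>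
        gaussian_law (distr M borel (\<lambda>\<omega>. W t \<omega> - W s \<omega>)) 0 (\<lambda>x. (t - s) *\<^sub>R Q x))"

text \<open>Independence of a random variable and a whole process, i.e. of the generated
  \<open>\<sigma>\<close>-algebras; \<open>indep_var\<close> is limited to random variables with values in the same type.\<close>

definition independent_of_process ::
  "'w measure \<Rightarrow> real set \<Rightarrow> ('w \<Rightarrow> 'h::topological_space) \<Rightarrow> (real \<Rightarrow> 'w \<Rightarrow> 'h) \<Rightarrow> bool" where
  "independent_of_process M I X W \<longleftrightarrow>
     prob_space.indep_set M
       {X -` A \<inter> space M | A. A \<in> sets borel}
       {(\<lambda>\<omega>. \<lambda>t\<in>I. W t \<omega>) -` B \<inter> space M | B. B \<in> sets (\<Pi>\<^sub>M t\<in>I. borel)}"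

text \<open>Filtrations are indexed by \<open>{0..<T}\<close>.\<close>

definition normal_filtration :: "'w measure \<Rightarrow> real \<Rightarrow> (real \<Rightarrow> 'w measure) \<Rightarrow> bool" where
  "normal_filtration M T F \<longleftrightarrow>
     (\<forall>t\<in>{0..<T}. subalgebra M (F t)) \<and>
     (\<forall>s\<in>{0..<T}. \<forall>t\<in>{0..<T}. s \<le> t \<longrightarrow> sets (F s) \<subseteq> sets (F t)) \<and>
     null_sets M \<subseteq> sets (F 0) \<and>
     (\<forall>s\<in>{0..<T}. sets (F s) = (\<Inter>t\<in>{s<..<T}. sets (F t)))"

definition wiener_process_wrt ::
  "'w measure \<Rightarrow> (real \<Rightarrow> 'w measure) \<Rightarrow> real set \<Rightarrow> ('h::real_inner \<Rightarrow> 'h) \<Rightarrow>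
    (real \<Rightarrow> 'w \<Rightarrow> 'h) \<Rightarrow> bool" where
  "wiener_process_wrt M F I Q W \<longleftrightarrow>
     wiener_process M I Q W \<and>
     (\<forall>t\<in>I. W t \<in> borel_measurable (F t)) \<and>
     (\<forall>s\<in>I. \<forall>t\<in>I. s \<le> t \<longrightarrow>
        prob_space.indep_set M (sets (F s))
          {(\<lambda>\<omega>. W t \<omega> - W s \<omega>) -` A \<inter> space M | A. A \<in> sets borel})"

text \<open>The coefficients \<open>beta_k\<close> of the Karhunen--Loeve decomposition of a \<open>Q\<close>-Wiener process, and
  its truncation.\<close>

definition KL_coeff ::
  "(nat \<Rightarrow> 'h::real_inner) \<Rightarrow> (nat \<Rightarrow> real) \<Rightarrow> (real \<Rightarrow> 'w \<Rightarrow> 'h) \<Rightarrow> nat \<Rightarrow> real \<Rightarrow> 'w \<Rightarrow> real" where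
  "KL_coeff e lam W k t \<omega> = (W t \<omega> \<bullet> e k) / sqrt (lam k)"

definition wiener_truncation ::
  "(nat \<Rightarrow> 'h::real_inner) \<Rightarrow> (nat \<Rightarrow> real) \<Rightarrow> (real \<Rightarrow> 'w \<Rightarrow> 'h) \<Rightarrow> nat \<Rightarrow> real \<Rightarrow> 'w \<Rightarrow> 'h" where
  "wiener_truncation e lam W n t \<omega> = (\<Sum>k<n. (sqrt (lam k) * KL_coeff e lam W k t \<omega>) *\<^sub>R e k)"


section \<open>Stochastic differential equations with additive noise\<close>

text \<open>The Ito integral of a deterministic scalar integrand: \<open>J\<close> is (a version of) the stochastic
  integral of \<open>g\<close> over \<open>[0,t]\<close> with respect to \<open>W\<close> iff it is the limit in mean square of the
  integrals of step functions that converge to \<open>g\<close> in \<open>L^2([0,t])\<close>. The \<open>j\<close>-th step function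
  takes the value \<open>c j i\<close> on the \<open>i\<close>-th of \<open>m j\<close> partition intervals.\<close>

definition is_stoch_integral ::
  "'w measure \<Rightarrow> (real \<Rightarrow> 'w \<Rightarrow> 'h::real_inner) \<Rightarrow> (real \<Rightarrow> real) \<Rightarrow> real \<Rightarrow> ('w \<Rightarrow> 'h) \<Rightarrow> bool" where
  "is_stoch_integral M W g t J \<longleftrightarrow>
     J \<in> borel_measurable M \<and> set_borel_measurable lborel {0..t} g \<and>
     (\<exists>(m :: nat \<Rightarrow> nat) (\<tau> :: nat \<Rightarrow> nat \<Rightarrow> real) (c :: nat \<Rightarrow> nat \<Rightarrow> real).
        (\<forall>j. \<tau> j 0 = 0 \<and> \<tau> j (m j) = t \<and> (\<forall>i<m j. \<tau> j i \<le> \<tau> j (Suc i))) \<and>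
        (\<lambda>j. \<integral>\<^sup>+ r\<in>{0..t}.
            ennreal ((g r - (\<Sum>i<m j. c j i * indicator {\<tau> j i<..\<tau> j (Suc i)} r))\<^sup>2) \<partial>lborel)
          \<longlonglongrightarrow> 0 \<and>
        (\<lambda>j. \<integral>\<^sup>+ \<omega>.
            ennreal ((norm (J \<omega> - (\<Sum>i<m j. c j i *\<^sub>R (W (\<tau> j (Suc i)) \<omega> - W (\<tau> j i) \<omega>))))\<^sup>2) \<partial>M)
          \<longlonglongrightarrow> 0)"

text \<open>\<open>Y\<close> solves \<open>dY_t = b(t,Y_t) dt + g(t) dW_t\<close> on \<open>I\<close> with initial value \<open>\<xi>\<close>; \<open>Z\<close> is the process
  of stochastic integrals.\<close>

definition sde_solution ::
  "'w measure \<Rightarrow> real set \<Rightarrow> (real \<Rightarrow> 'w \<Rightarrow> 'h::{real_inner, banach, second_countable_topology}) \<Rightarrow>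
    (real \<Rightarrow> 'h \<Rightarrow> 'h) \<Rightarrow> (real \<Rightarrow> real) \<Rightarrow> ('w \<Rightarrow> 'h) \<Rightarrow> (real \<Rightarrow> 'w \<Rightarrow> 'h) \<Rightarrow> bool" where
  "sde_solution M I W b g \<xi> Y \<longleftrightarrow>
     continuous_process M I Y \<and>
     (\<exists>Z. (\<forall>t\<in>I. is_stoch_integral M W g t (Z t)) \<and>
        (AE \<omega> in M. \<forall>t\<in>I.
           set_integrable lborel {0..t} (\<lambda>r. b r (Y r \<omega>)) \<and>
           Y t \<omega> = \<xi> \<omega> + (LINT r:{0..t}|lborel. b r (Y r \<omega>)) + Z t \<omega>))"

definition C1_positive :: "real \<Rightarrow> (real \<Rightarrow> real) \<Rightarrow> bool" where
  "C1_positive T \<alpha> \<longleftrightarrow>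
     (\<forall>t\<in>{0..T}. 0 < \<alpha> t) \<and>
     (\<exists>\<alpha>'. continuous_on {0..T} \<alpha>' \<and>
        (\<forall>t\<in>{0..T}. (\<alpha> has_real_derivative \<alpha>' t) (at t within {0..T})))"

definition a_fun :: "(real \<Rightarrow> real) \<Rightarrow> real \<Rightarrow> real" where
  "a_fun \<alpha> t = exp (1 / 2 * (LINT r:{0..t}|lborel. \<alpha> r))"

definition forward_solution ::
  "'w measure \<Rightarrow> real \<Rightarrow> (real \<Rightarrow> real) \<Rightarrow>
    (real \<Rightarrow> 'w \<Rightarrow> 'h::{real_inner, banach, second_countable_topology}) \<Rightarrow>
    ('w \<Rightarrow> 'h) \<Rightarrow> (real \<Rightarrow> 'w \<Rightarrow> 'h) \<Rightarrow> bool" where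
  "forward_solution M T \<alpha> W \<xi> X \<longleftrightarrow>
     sde_solution M {0..T} W (\<lambda>t x. (- (1 / 2) * \<alpha> t) *\<^sub>R x) (\<lambda>t. sqrt (\<alpha> t)) \<xi> X"

text \<open>\<open>Xn\<close> stands for the \<open>n\<close>-th truncated forward process.\<close>

definition discrete_score ::
  "'w measure \<Rightarrow> real \<Rightarrow> (real \<Rightarrow> real) \<Rightarrow> (nat \<Rightarrow> 'h::real_inner) \<Rightarrow> (nat \<Rightarrow> real) \<Rightarrow> nat \<Rightarrow>
    (real \<Rightarrow> 'w \<Rightarrow> 'h) \<Rightarrow> real \<Rightarrow> 'h \<Rightarrow> 'h" where
  "discrete_score M T \<alpha> e lam n Xn t x =
     (let p = smooth_density M n (\<lambda>\<omega>. iota e n (Xn (T - t) \<omega>)) in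
      \<alpha> (T - t) *\<^sub>R Qn e lam n (inv_into (Hn e n) (iota e n) (grad n (\<lambda>y. ln (p y)) (iota e n x))))"

text \<open>\<open>(N, F, V, Y)\<close> is a weak solution of the discretized reverse equation, started in the law of
  \<open>Xn T\<close> under \<open>M\<close>.\<close>

definition reverse_weak_solution ::
  "'w measure \<Rightarrow> real \<Rightarrow> (real \<Rightarrow> real) \<Rightarrow>
    (nat \<Rightarrow> 'h::{real_inner, banach, second_countable_topology}) \<Rightarrow> (nat \<Rightarrow> real) \<Rightarrow> nat \<Rightarrow>
    (real \<Rightarrow> 'w \<Rightarrow> 'h) \<Rightarrow>
    'v measure \<Rightarrow> (real \<Rightarrow> 'v measure) \<Rightarrow> (real \<Rightarrow> 'v \<Rightarrow> 'h) \<Rightarrow> (real \<Rightarrow> 'v \<Rightarrow> 'h) \<Rightarrow> bool" where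
  "reverse_weak_solution M T \<alpha> e lam n Xn N F V Y \<longleftrightarrow>
     prob_space N \<and> normal_filtration N T F \<and>
     wiener_process_wrt N F {0..<T} (Qn e lam n) V \<and>
     (\<forall>t\<in>{0..<T}. Y t \<in> borel_measurable (F t)) \<and>
     (\<forall>t\<in>{0..<T}. \<forall>\<omega>\<in>space N. Y t \<omega> \<in> Hn e n) \<and>
     distr N borel (Y 0) = distr M borel (Xn T) \<and>
     sde_solution N {0..<T} V
       (\<lambda>t y. (1 / 2 * \<alpha> (T - t)) *\<^sub>R y + discrete_score M T \<alpha> e lam n Xn t y)
       (\<lambda>t. sqrt (\<alpha> (T - t))) (Y 0) Y"


section \<open>Wasserstein distance\<close>

definition couplings :: "'h::real_normed_vector measure \<Rightarrow> 'h measure \<Rightarrow> ('h \<times> 'h) measure set" where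
  "couplings \<mu> \<nu> = {\<pi>. sets \<pi> = sets (borel \<Otimes>\<^sub>M borel) \<and> distr \<pi> borel fst = \<mu> \<and> distr \<pi> borel snd = \<nu>}"

text \<open>The couplings are the joint laws of pairs \<open>(X,Y)\<close> with marginal laws \<open>\<mu>\<close> and \<open>\<nu>\<close>. The
  distance is extended-valued so that an infinite distance is not conflated with 0.\<close>

definition wasserstein2 :: "'h::real_normed_vector measure \<Rightarrow> 'h measure \<Rightarrow> ennreal" where
  "wasserstein2 \<mu> \<nu> =
     (let c = (INF \<pi>\<in>couplings \<mu> \<nu>. \<integral>\<^sup>+ z. ennreal ((norm (fst z - snd z))\<^sup>2) \<partial>\<pi>) in
      if c = \<top> then \<top> else ennreal (sqrt (enn2real c)))"

end

theory Submission
  imports Defs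
begin

text \<open>The law of the reverse process is identified without uniqueness theory for the reverse equation.
 Multiplying by \<open>a\<^bsub>T-t\<^esub>\<close> removes the linear drift and turns the score into the logarithmic gradient of
 \<open>h\<close>, the initial law convolved with a Gaussian of covariance \<open>th\<close> times \<open>Q\<^sub>n\<close>, \<open>th = a\<^sup>2 - 1\<close>. For any
 other nonnegative solution \<open>N\<close> of the same heat equation the quotient \<open>N / h\<close> along the rescaled path
 is a local martingale, hence a supermartingale; this is proved directly by a second order expansion
 over fine time grids, stopped when the path leaves a cube. Taking for \<open>N\<close> the heat kernel that
 concentrates at a point \<open>c\<close> at the final time shows that the expectation of the narrow Gaussian at
 \<open>c\<close> divided by \<open>h\<close> is at most 1, so the law of the reverse process is dominated by the law with density
 \<open>h\<close>, that is by the law of the truncated forward process; both are probabilities and therefore agree.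
 The Wasserstein distance is then bounded by the coupling through the common noise of the forward
 processes: their components below \<open>n\<close> coincide and those of the truncated process from \<open>n\<close> on vanish.\<close>

section \<open>Derivatives of Gaussian densities\<close>

text \<open>The obstacle is that the drift of the reverse equation, the gradient of
  \<open>log h\<close>, is controlled on bounded sets only, so a true martingale property is out of
  reach. What survives localisation is an inequality in one direction: quotients are nonnegative,
  killing the path when it leaves a cube only lowers them, and Fatou's lemma removes the cube. The
  quotient is Doob's h-transform read backwards: the drift of the rescaled path is exactly the one
  that makes the drift of \<open>N / h\<close> vanish. Equal total mass then turns domination into
  equality. Over an interval the noise is a mean-square limit of sums over uniform grids. Its first
  and second moments, weighted by bounded functions of the past, and its fourth moment carry the
  whole expansion: one step of variance \<open>dt\<close> costs an error of order \<open>dt\<close>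
  to the power 3/2, which vanishes after summation. The argument runs on closed intervals
  \<open>{0..t}\<close> with \<open>t < T\<close>, because the variance parameter \<open>th\<close>
  reaches 0 at \<open>T\<close> and all kernel estimates degenerate there.\<close>

fun hg :: "nat => real => real => real" where
 "hg 0 v y = exp (- (y\<^sup>2 / (2 * v))) / sqrt (2 * pi * v)"
| "hg (Suc 0) v y = - (y * hg 0 v y / v)"
| "hg (Suc (Suc d)) v y = - ((y * hg (Suc d) v y + real (Suc d) * hg d v y) / v)"

lemma hg_0_eq_normal_density: "0 < v ==> hg 0 v y = normal_density 0 (sqrt v) y" by (simp add: normal_density_def)

lemma hg_0_pos: "0 < v ==> 0 < hg 0 v y" by simp

text \<open>\<open>hg d v\<close> is the d-th derivative in y of the centred normal density of
  variance v; its recursion arises by differentiating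
  \<open>v * hg (Suc 0) v y = - y * hg 0 v y\<close> repeatedly. The density solves the heat
  equation, its derivative in v being half its second derivative in y, so the chain rule along a
  curve \<open>(V t, Y t)\<close> produces only the orders d + 1 and d + 2.\<close>

lemma hg_has_derivative:
 assumes "(V has_real_derivative V') (at t)" "(Y has_real_derivative Y') (at t)" "0 < V t"
 shows "((\<lambda>t. hg d (V t) (Y t)) has_real_derivative
  (Y' * hg (Suc d) (V t) (Y t) + V' / 2 * hg (Suc (Suc d)) (V t) (Y t))) (at t)"
proof (induction d rule: less_induct)
 case (less d)
 have V0: "V t \<noteq> 0" using assms(3) by simp
 have sq: "sqrt (2 * pi * V t) * sqrt (2 * pi * V t) = 2 * pi * V t" using assms(3) by simp
 have base: "((\<lambda>t. hg 0 (V t) (Y t)) has_real_derivative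
  (Y' * hg (Suc 0) (V t) (Y t) + V' / 2 * hg (Suc (Suc 0)) (V t) (Y t))) (at t)"
 proof -
  define q where "q = - ((2 * Y t * Y' * (2 * V t) - (Y t)\<^sup>2 * (2 * V')) / ((2 * V t) * (2 * V t)))"
  define E where "E = exp (- ((Y t)\<^sup>2 / (2 * V t)))"
  define s where "s = sqrt (2 * pi * V t)"
  have s0: "s > 0" using assms(3) by (simp add: s_def)
  have posV: "0 < pi * V t" using assms(3) by simp
  have "((\<lambda>t. exp (- ((Y t)\<^sup>2 / (2 * V t)))) has_real_derivative E * q) (at t)" unfolding E_def q_def using assms V0
   by (auto intro!: derivative_eq_intros simp: power2_eq_square)
  moreover have "((\<lambda>t. sqrt (2 * pi * V t)) has_real_derivative pi * V' / s) (at t)" unfolding s_def using assms V0 sq posV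
   by (auto intro!: derivative_eq_intros simp: field_simps mult_less_0_iff simp del: real_sqrt_mult)
  ultimately have "((\<lambda>t. exp (- ((Y t)\<^sup>2 / (2 * V t))) / sqrt (2 * pi * V t)) has_real_derivative
   (E * q * s - E * (pi * V' / s)) / (s * s)) (at t)" using s0 unfolding E_def s_def by (intro DERIV_divide) auto
  moreover have "(E * q * s - E * (pi * V' / s)) / (s * s) = E / s * (q - V' * (pi / (s * s)))" using s0 by (simp add: field_simps)
  moreover have "pi / (s * s) = 1 / (2 * V t)" using sq V0 unfolding s_def by (simp add: field_simps)
  moreover have "E / s * (q - V' * (1 / (2 * V t))) = 
    Y' * (- (Y t * (E / s) / V t)) + V' / 2 * (- ((Y t * (- (Y t * (E / s) / V t)) + real (Suc 0) * (E / s)) / V t))"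
  proof -
   have "q = - (Y t * Y' / V t) + Y t * Y t * V' / (2 * V t * V t)" unfolding q_def using V0 by (simp add: field_simps power2_eq_square)
   moreover have "G * (- (y * y' / v) + y * y * v' / (2 * v * v) - v' * (1 / (2 * v))) =
    y' * (- (y * G / v)) + v' / 2 * (- ((y * (- (y * G / v)) + real (Suc 0) * G) / v))"
    if "v \<noteq> 0" for G y y' v v' :: real using that by (simp add: field_simps)
   ultimately show ?thesis using V0 by (simp only: not_False_eq_True)
  qed
  ultimately show ?thesis by (simp only: hg.simps E_def s_def)
 qed
 show ?case
 proof (cases d)
  case 0 then show ?thesis using base by simp
 next
  case (Suc c)
  show ?thesis
  proof (cases c)
   case 0
   have "((\<lambda>t. - (Y t * hg 0 (V t) (Y t) / V t)) has_real_derivative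
    - ((Y' * hg 0 (V t) (Y t) + (Y' * hg (Suc 0) (V t) (Y t) + V' / 2 * hg (Suc (Suc 0)) (V t) (Y t)) * Y t) * V t
      - Y t * hg 0 (V t) (Y t) * V') / (V t * V t)) (at t)" using V0 by (auto intro!: derivative_eq_intros base assms simp: diff_divide_distrib simp del: hg.simps)
   then have *: "((\<lambda>t. hg (Suc 0) (V t) (Y t)) has_real_derivative
    - ((Y' * hg 0 (V t) (Y t) + (Y' * hg (Suc 0) (V t) (Y t) + V' / 2 * hg (Suc (Suc 0)) (V t) (Y t)) * Y t) * V t
      - Y t * hg 0 (V t) (Y t) * V') / (V t * V t)) (at t)" by (simp only: hg.simps(2))
   show ?thesis unfolding Suc 0
    apply (rule DERIV_cong[OF *]) using V0 unfolding hg.simps(2,3) by (simp add: field_simps del: hg.simps)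
  next
   case (Suc b)
   have d: "d = Suc (Suc b)" using \<open>d = Suc c\<close> Suc by simp
   have "Suc b < d" "b < d" using d by auto
   note IH1 = less.IH[OF this(1)] and IH0 = less.IH[OF this(2)]
   define A where "A = hg b (V t) (Y t)"
   define B where "B = hg (Suc b) (V t) (Y t)"
   define C where "C = hg (Suc (Suc b)) (V t) (Y t)"
   define D where "D = hg (Suc (Suc (Suc b))) (V t) (Y t)"
   have Ce: "C = - ((Y t * B + real (Suc b) * A) / V t)" by (simp add: A_def B_def C_def)
   have De: "D = - ((Y t * C + real (Suc (Suc b)) * B) / V t)" unfolding B_def C_def D_def by (rule hg.simps(3))
   have Ee: "hg (Suc (Suc (Suc (Suc b)))) (V t) (Y t) = - ((Y t * D + real (Suc (Suc (Suc b))) * C) / V t)" unfolding D_def C_def by (rule hg.simps(3))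
   have "((\<lambda>t. - ((Y t * hg (Suc b) (V t) (Y t) + real (Suc b) * hg b (V t) (Y t)) / V t)) has_real_derivative
    - (((Y' * B + (Y' * C + V' / 2 * D) * Y t) + real (Suc b) * (Y' * B + V' / 2 * C)) * V t
      - (Y t * B + real (Suc b) * A) * V') / (V t * V t)) (at t)" unfolding A_def B_def C_def D_def
    using V0 by (auto intro!: derivative_eq_intros IH1 IH0 assms simp: diff_divide_distrib simp del: hg.simps of_nat_Suc)
   then have *: "((\<lambda>t. hg (Suc (Suc b)) (V t) (Y t)) has_real_derivative
    - (((Y' * B + (Y' * C + V' / 2 * D) * Y t) + real (Suc b) * (Y' * B + V' / 2 * C)) * V t
      - (Y t * B + real (Suc b) * A) * V') / (V t * V t)) (at t)" by (simp only: hg.simps(3))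
   \<comment> \<open>\<open>AA\<close> and \<open>DD\<close> are instances of the recursion cleared
     of the denominator; they eliminate \<open>A\<close> and \<open>B\<close> from the
     numerator.\<close>
   have AA: "Y t * B + real (Suc b) * A = - (C * V t)" using Ce V0 by (simp add: field_simps)
   have DD: "Y t * C = - (D * V t) - real (Suc (Suc b)) * B" using De V0 by (simp add: field_simps)
   have num: "((Y' * B + (Y' * C + V' / 2 * D) * Y t) + real (Suc b) * (Y' * B + V' / 2 * C))
     = - (Y' * D * V t) + V' / 2 * (D * Y t + real (Suc b) * C)"
   proof -
    have "((Y' * B + (Y' * C + V' / 2 * D) * Y t) + real (Suc b) * (Y' * B + V' / 2 * C))
     = Y' * (B + Y t * C + real (Suc b) * B) + V' / 2 * (D * Y t + real (Suc b) * C)" by (simp add: algebra_simps)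
    also have "B + Y t * C + real (Suc b) * B = - (D * V t)" unfolding DD by (simp add: algebra_simps)
    finally show ?thesis by simp
   qed
   have fin: "- ((- (Y' * D * v) + V' / 2 * (D * Y t + r * C)) * v - (- (C * v)) * V') / (v * v)
     = Y' * D + V' / 2 * (- ((Y t * D + (r + 2) * C) / v))" if "v \<noteq> 0" for r v using that by (simp add: field_simps)
   show ?thesis unfolding d
    apply (rule DERIV_cong[OF *]) unfolding Ee AA D_def[symmetric] C_def[symmetric] num using fin[OF V0, of "real (Suc b)"] by (simp add: add_ac)
  qed
 qed
qed

lemma exp_neg_power_bound:
 fixes c :: real assumes "0 < c"
 shows "\<exists>C. \<forall>y. \<bar>y\<bar>^m * exp (- (c * y\<^sup>2)) \<le> C"
proof -
 \<comment> \<open>For \<open>|y| <= 1\<close> the product is at most 1. Otherwise the exponent m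
   may be doubled, and \<open>(c * y^2)^m / fact m\<close> is one term of the exponential series of
   \<open>c * y^2\<close>.\<close>
 have "fact m / c^m + 1 \<ge> \<bar>y\<bar>^m * exp (- (c * y\<^sup>2))" for y :: real
 proof (cases "\<bar>y\<bar> \<le> 1")
  case True
  have "\<bar>y\<bar>^m * exp (- (c * y\<^sup>2)) \<le> 1 * 1" by (rule mult_mono) (use True assms in \<open>auto simp: power_le_one\<close>)
  then show ?thesis using assms by (smt (verit) divide_nonneg_pos fact_ge_zero zero_less_power)
 next
  case False
  have "\<bar>y\<bar>^m \<le> \<bar>y\<bar>^(2*m)" by (rule power_increasing) (use False in auto)
  also have "\<dots> = (c * y\<^sup>2)^m / c^m" using assms by (simp add: power_mult power_mult_distrib)
  also have "\<dots> \<le> (fact m * exp (c * y\<^sup>2)) / c^m"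
  proof (rule divide_right_mono)
   have "(c * y\<^sup>2)^m / fact m \<le> exp (c * y\<^sup>2)"
   proof -
    have "(c * y\<^sup>2)^m / fact m \<le> (\<Sum>k\<le>m. (c * y\<^sup>2)^k / fact k)" by (rule member_le_sum) (use assms in auto)
    also have "\<dots> \<le> exp (c * y\<^sup>2)"
    proof -
     have "(\<lambda>k. (c * y\<^sup>2)^k / fact k) sums exp (c * y\<^sup>2)" using exp_converges[of "c * y\<^sup>2"] by (simp add: divide_inverse mult.commute)
     then show ?thesis using assms sum_le_suminf[of "\<lambda>k. (c * y\<^sup>2)^k / fact k" "{..m}"] by (auto simp: sums_iff)
    qed
    finally show ?thesis .
   qed
   then show "(c * y\<^sup>2)^m \<le> fact m * exp (c * y\<^sup>2)" by (simp add: field_simps)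
  qed (use assms in auto)
  finally have "\<bar>y\<bar>^m \<le> (fact m * exp (c * y\<^sup>2)) / c^m" .
  then have "\<bar>y\<bar>^m * exp (- (c * y\<^sup>2)) \<le> (fact m * exp (c * y\<^sup>2)) / c^m * exp (- (c * y\<^sup>2))" by (rule mult_right_mono) auto
  also have "\<dots> = fact m / c^m" by (simp add: exp_minus field_simps)
  finally show ?thesis by simp
 qed
 then show ?thesis by blast
qed

text \<open>The power of y belongs to the induction because the recursion multiplies by y: order d
  with power m is reduced to lower orders with powers m + 1 and m.\<close>

lemma hg_power_bounded:
 assumes "0 < lo" "lo \<le> hi"
 shows "\<exists>C. \<forall>v\<in>{lo..hi}. \<forall>y. \<bar>y\<bar>^m * \<bar>hg d v y\<bar> \<le> C"
proof (induction d arbitrary: m rule: less_induct)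
 case (less d)
 have base: "\<exists>C. \<forall>v\<in>{lo..hi}. \<forall>y. \<bar>y\<bar>^m * \<bar>hg 0 v y\<bar> \<le> C" for m
 proof -
  obtain C where C: "\<And>y. \<bar>y\<bar>^m * exp (- (1/(2*hi) * y\<^sup>2)) \<le> C" using exp_neg_power_bound[of "1/(2*hi)" m] assms by auto
  have C0: "C \<ge> 0" by (rule order_trans[OF _ C[of 0]]) simp
  have "\<bar>y\<bar>^m * \<bar>hg 0 v y\<bar> \<le> C / sqrt (2 * pi * lo)" if v: "v \<in> {lo..hi}" for v y
  proof -
   have "y\<^sup>2 / (2 * hi) \<le> y\<^sup>2 / (2 * v)" using v assms by (intro divide_left_mono) auto
   then have "exp (- (y\<^sup>2 / (2 * v))) \<le> exp (- (1/(2*hi) * y\<^sup>2))" by simp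
   then have "\<bar>y\<bar>^m * exp (- (y\<^sup>2 / (2 * v))) \<le> C" by (meson C mult_left_mono order_trans zero_le_power_abs)
   then have "\<bar>y\<bar>^m * exp (- (y\<^sup>2 / (2 * v))) / sqrt (2 * pi * v) \<le> C / sqrt (2 * pi * lo)" using v assms C0 by (intro frac_le) auto
   then show ?thesis using v assms by simp
  qed
  then show ?thesis by blast
 qed
 show ?case
 proof (cases d)
  case 0 then show ?thesis using base by simp
 next
  case (Suc c)
  show ?thesis
  proof (cases c)
   case 0
   obtain C where C: "\<And>v y. v \<in> {lo..hi} ==> \<bar>y\<bar>^Suc m * \<bar>hg 0 v y\<bar> \<le> C" using base[of "Suc m"] by blast
   have "\<bar>y\<bar>^m * \<bar>hg (Suc 0) v y\<bar> \<le> C / lo" if v: "v \<in> {lo..hi}" for v y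
   proof -
    have "\<bar>y\<bar>^m * \<bar>hg (Suc 0) v y\<bar> = \<bar>y\<bar>^Suc m * \<bar>hg 0 v y\<bar> / v"
     unfolding hg.simps(2) using v assms by (simp add: abs_mult del: hg.simps)
    also have "\<dots> \<le> C / lo"
    proof (rule frac_le)
     show "0 \<le> C" by (rule order_trans[OF _ C[OF v, of y]]) simp
    qed (use C[OF v, of y] v assms in auto)
    finally show ?thesis .
   qed
   then show ?thesis unfolding Suc 0 by blast
  next
   case (Suc b)
   have d: "d = Suc (Suc b)" using \<open>d = Suc c\<close> Suc by simp
   have "b < d" "Suc b < d" using d by auto
   obtain C where C: "\<And>v y. v \<in> {lo..hi} ==> \<bar>y\<bar>^Suc m * \<bar>hg (Suc b) v y\<bar> \<le> C" 
    using less[of "Suc b" "Suc m"] \<open>Suc b < d\<close> by blast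
   obtain D where D: "\<And>v y. v \<in> {lo..hi} ==> \<bar>y\<bar>^m * \<bar>hg b v y\<bar> \<le> D"  using less[of b m] \<open>b < d\<close> by blast
   have "\<bar>y\<bar>^m * \<bar>hg d v y\<bar> \<le> (C + real (Suc b) * D) / lo" if v: "v \<in> {lo..hi}" for v y
   proof -
    have "\<bar>hg d v y\<bar> \<le> (\<bar>y\<bar> * \<bar>hg (Suc b) v y\<bar> + real (Suc b) * \<bar>hg b v y\<bar>) / v" unfolding d hg.simps(3) using v assms 
      abs_triangle_ineq[of "y * hg (Suc b) v y" "real (Suc b) * hg b v y"] by (simp add: abs_mult divide_right_mono del: hg.simps)
    then have "\<bar>y\<bar>^m * \<bar>hg d v y\<bar> \<le> \<bar>y\<bar>^m * ((\<bar>y\<bar> * \<bar>hg (Suc b) v y\<bar> + real (Suc b) * \<bar>hg b v y\<bar>) / v)"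
     by (intro mult_left_mono) auto
    also have "\<dots> = (\<bar>y\<bar>^Suc m * \<bar>hg (Suc b) v y\<bar> + real (Suc b) * (\<bar>y\<bar>^m * \<bar>hg b v y\<bar>)) / v" by (simp add: algebra_simps)
    also have "\<dots> \<le> (C + real (Suc b) * D) / lo"
    proof (rule frac_le)
     show "\<bar>y\<bar>^Suc m * \<bar>hg (Suc b) v y\<bar> + real (Suc b) * (\<bar>y\<bar>^m * \<bar>hg b v y\<bar>) \<le> C + real (Suc b) * D"
      using C[OF v, of y] D[OF v, of y] by (intro add_mono mult_left_mono) auto
     have "0 \<le> C" "0 \<le> D" by (rule order_trans[OF _ C[OF v, of y]], simp, rule order_trans[OF _ D[OF v, of y]], simp)
     then show "0 \<le> C + real (Suc b) * D" by simp
    qed (use v assms in auto)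
    finally show ?thesis .
   qed
   then show ?thesis by blast
  qed
 qed
qed

lemma hg_bounded:
 assumes "0 < lo" "lo \<le> hi"
 shows "\<exists>C\<ge>0. \<forall>v\<in>{lo..hi}. \<forall>y. \<bar>hg d v y\<bar> \<le> C"
proof -
 obtain C where C: "\<forall>v\<in>{lo..hi}. \<forall>y. \<bar>y\<bar>^0 * \<bar>hg d v y\<bar> \<le> C" using hg_power_bounded[OF assms] by blast
 then show ?thesis using assms by (intro exI[of _ "max C 0"]) (auto simp: le_max_iff_disj)
qed

lemma continuous_hg: "0 < v ==> isCont (hg d v) y" using hg_has_derivative[of "\<lambda>_. v" 0 y "\<lambda>y. y" 1 d] DERIV_isCont by fastforce

lemma borel_measurable_hg: "0 < v ==> hg d v \<in> borel_measurable borel"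
 by (intro borel_measurable_continuous_onI continuous_at_imp_continuous_on ballI continuous_hg)

section \<open>Product kernels\<close>

abbreviation (input) z0 :: "nat => nat" where "z0 \<equiv> \<lambda>_. 0"

text \<open>Mixed partial derivatives, with orders \<open>d\<close>, of the density of independent
  centred normal variables with variances \<open>th * lam k\<close>. A single parameter
  \<open>th\<close> drives all variances, so the product again solves a heat equation, with
  \<open>th\<close> as time.\<close>

definition pk :: "nat => (nat => real) => (nat => nat) => real => (nat => real) => real" where
 "pk n lam d th y = (\<Prod>k<n. hg (d k) (th * lam k) (y k))"

definition bump :: "(nat => nat) => nat \<times> nat => nat => nat" where
 "bump d z = d(fst z := d (fst z) + snd z)"

definition moves :: "nat => (nat \<times> nat) set" where
 "moves n = {..<n} \<times> {1, 2}"

text \<open>Moving in space by \<open>de\<close> and in the variance parameter by \<open>dt\<close>, the kernel changes to first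
 order by \<open>de k\<close> times its first and, by the heat equation, \<open>dt * lam k / 2\<close> times its second
 derivative in coordinate \<open>k\<close>; these are the coefficients of the two \<open>moves\<close> at \<open>k\<close>.\<close>

definition mvc :: "(nat => real) => real => (nat => real) => nat \<times> nat => real" where
 "mvc lam dt de z = (if snd z = 1 then de (fst z) else dt * lam (fst z) / 2)"

abbreviation (input) mvs :: "nat => (nat => real) => real => (nat => real) => real" where
 "mvs n lam dt de \<equiv> \<Sum>z\<in>moves n. \<bar>mvc lam dt de z\<bar>"

lemma finite_moves [simp]: "finite (moves n)" by (simp add: moves_def)

lemma sum_moves: "(\<Sum>z\<in>moves n. f z) = (\<Sum>k<n. f (k, 1) + f (k, 2))"
 unfolding moves_def by (subst sum.cartesian_product[symmetric, of "\<lambda>a b. f (a, b)", simplified]) simp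

text \<open>Restriction to a line turns expansions in n + 1 variables into expansions in one:
  differentiating along the line amounts to applying the weighted sum over \<open>moves\<close>, and
  this can be iterated.\<close>

lemma pk_line_derivative:
 assumes "\<And>k. k < n ==> 0 < (th + t * dt) * lam k"
 shows "((\<lambda>t. pk n lam d (th + t * dt) (\<lambda>k. y k + t * de k)) has_real_derivative
  (\<Sum>z\<in>moves n. mvc lam dt de z * pk n lam (bump d z) (th + t * dt) (\<lambda>k. y k + t * de k))) (at t)"
proof -
 let ?h = "\<lambda>d k. hg d ((th + t * dt) * lam k) (y k + t * de k)"
 have "((\<lambda>t. pk n lam d (th + t * dt) (\<lambda>k. y k + t * de k)) has_real_derivative
  (\<Sum>k<n. (de k * ?h (Suc (d k)) k + (dt * lam k) / 2 * ?h (Suc (Suc (d k))) k)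
    * (\<Prod>j\<in>{..<n} - {k}. ?h (d j) j))) (at t)" unfolding pk_def by (rule has_field_derivative_prod, rule hg_has_derivative)
   (auto intro!: derivative_eq_intros assms)
 moreover have "(de k * ?h (Suc (d k)) k + (dt * lam k) / 2 * ?h (Suc (Suc (d k))) k)
    * (\<Prod>j\<in>{..<n} - {k}. ?h (d j) j) = 
   mvc lam dt de (k, 1) * pk n lam (bump d (k,1)) (th + t * dt) (\<lambda>k. y k + t * de k) +
   mvc lam dt de (k, 2) * pk n lam (bump d (k,2)) (th + t * dt) (\<lambda>k. y k + t * de k)"
  if k: "k < n" for k
 proof -
  \<comment> \<open>Raising the order at k changes the k-th factor only, so the product over the
    other indices is common to both moves at k.\<close>
  have "pk n lam (bump d (k,b)) (th + t * dt) (\<lambda>k. y k + t * de k) = 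
   ?h (d k + b) k * (\<Prod>j\<in>{..<n} - {k}. ?h (d j) j)" for b unfolding pk_def using k
   by (subst prod.remove[of _ k]) (auto simp: bump_def intro!: arg_cong2[where f="(*)"] prod.cong)
  then show ?thesis by (simp add: mvc_def algebra_simps del: hg.simps)
 qed
 ultimately show ?thesis by (simp add: sum_moves)
qed

lemma pk_bounded:
 assumes lo: "0 < lo" "lo \<le> hi" and lam: "\<And>k. k < n ==> 0 < lam k"
 shows "\<exists>C\<ge>0. \<forall>th\<in>{lo..hi}. \<forall>y. \<bar>pk n lam d th y\<bar> \<le> C"
proof -
 have "\<exists>C. 0 \<le> C \<and> (k < n --> (\<forall>v\<in>{lo * lam k..hi * lam k}. \<forall>y. \<bar>hg (d k) v y\<bar> \<le> C))" for k
 proof (cases "k < n")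
  case True
  then show ?thesis using hg_bounded[of "lo * lam k" "hi * lam k" "d k"] lo lam[of k] by (auto intro: mult_right_mono)
 qed (auto intro: exI[of _ 0])
 then obtain C where C: "\<And>k. 0 \<le> C k" 
  "\<And>k v y. k < n ==> v\<in>{lo * lam k..hi * lam k} ==> \<bar>hg (d k) v y\<bar> \<le> C k" by metis
 show ?thesis
 proof (intro exI[of _ "\<Prod>k<n. C k"] conjI ballI allI)
  show "0 \<le> (\<Prod>k<n. C k)" using C by (simp add: prod_nonneg)
  fix th y assume "th \<in> {lo..hi}"
  then show "\<bar>pk n lam d th y\<bar> \<le> (\<Prod>k<n. C k)"
   unfolding pk_def abs_prod using lam by (intro prod_mono conjI C(2)) (auto intro!: mult_right_mono less_imp_le[OF lam])
 qed
qed

lemma pk_0_pos: "0 < th ==> (\<And>k. k < n ==> 0 < lam k) ==> 0 < pk n lam z0 th y"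
 unfolding pk_def by (intro prod_pos) (auto simp: hg_0_pos)

lemma abs_weighted_sum_le:
 fixes f :: "'a => real"
 assumes "\<And>z. z \<in> S ==> \<bar>f z\<bar> \<le> B"
 shows "\<bar>\<Sum>z\<in>S. c z * f z\<bar> \<le> (\<Sum>z\<in>S. \<bar>c z\<bar>) * B"
proof -
 have "\<bar>\<Sum>z\<in>S. c z * f z\<bar> \<le> (\<Sum>z\<in>S. \<bar>c z\<bar> * \<bar>f z\<bar>)" using sum_abs[of "\<lambda>z. c z * f z" S] by (simp add: abs_mult)
 also have "\<dots> \<le> (\<Sum>z\<in>S. \<bar>c z\<bar> * B)" by (intro sum_mono mult_left_mono assms) auto
 finally show ?thesis by (simp add: sum_distrib_right)
qed

text \<open>Maclaurin's formula of order 3 along the segment; the remainder is uniform in y because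
  all third-order derivatives are bounded while the variance parameter stays in
  \<open>{lo..hi}\<close>. The displacements dt and de are treated alike here; that dt has the size
  of the square of the noise is exploited only later, in the error estimate for the
  quotient.\<close>

lemma pk_taylor:
 assumes lo: "0 < lo" "lo \<le> hi" and lam: "\<And>k. k < n ==> 0 < lam k"
 shows "\<exists>C\<ge>0. \<forall>th\<in>{lo..hi}. \<forall>dt y de. th + dt \<in> {lo..hi} -->
  \<bar>pk n lam d (th + dt) (\<lambda>k. y k + de k) - pk n lam d th y
    - (\<Sum>z\<in>moves n. mvc lam dt de z * pk n lam (bump d z) th y)
    - (\<Sum>z\<in>moves n. \<Sum>w'\<in>moves n. mvc lam dt de z * mvc lam dt de w' * pk n lam (bump (bump d z) w') th y) / 2\<bar>
   \<le> C * (mvs n lam dt de) ^ 3"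
proof -
 have "\<forall>e. \<exists>C. 0 \<le> C \<and> (\<forall>th\<in>{lo..hi}. \<forall>y. \<bar>pk n lam e th y\<bar> \<le> C)"
  using pk_bounded[of lo hi n lam] lo lam by auto
 then obtain B where "\<forall>e. 0 \<le> B e \<and> (\<forall>th\<in>{lo..hi}. \<forall>y. \<bar>pk n lam e th y\<bar> \<le> B e)"
  using choice[of "\<lambda>e C. 0 \<le> C \<and> (\<forall>th\<in>{lo..hi}. \<forall>y. \<bar>pk n lam e th y\<bar> \<le> C)"] by blast
 then have B: "\<And>e. 0 \<le> B e" "\<And>e th y. th \<in> {lo..hi} ==> \<bar>pk n lam e th y\<bar> \<le> B e" by auto
 define C where "C = (\<Sum>z\<in>moves n. \<Sum>w'\<in>moves n. \<Sum>x\<in>moves n. B (bump (bump (bump d z) w') x))"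
 have C0: "0 \<le> C" unfolding C_def by (intro sum_nonneg B)
 have BC: "B (bump (bump (bump d z) w') x) \<le> C" if "z \<in> moves n" "w' \<in> moves n" "x \<in> moves n" for z w' x
 proof -
  have "B (bump (bump (bump d z) w') x) \<le> (\<Sum>x\<in>moves n. B (bump (bump (bump d z) w') x))" by (rule member_le_sum[OF that(3)]) (auto intro: B)
  also have "\<dots> \<le> (\<Sum>w'\<in>moves n. \<Sum>x\<in>moves n. B (bump (bump (bump d z) w') x))" by (rule member_le_sum[OF that(2)]) (auto intro!: sum_nonneg B)
  also have "\<dots> \<le> (\<Sum>z\<in>moves n. \<Sum>w'\<in>moves n. \<Sum>x\<in>moves n. B (bump (bump (bump d z) w') x))"
   by (rule member_le_sum[OF that(1)]) (auto intro!: sum_nonneg B)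
  finally show ?thesis unfolding C_def .
 qed
 show ?thesis
 proof (intro exI[of _ C] conjI C0 ballI allI impI)
  fix th dt y de assume rng: "th \<in> {lo..hi}" "th + dt \<in> {lo..hi}"
  have seg: "th + t * dt \<in> {lo..hi}" if "0 \<le> t" "t \<le> 1" for t
  proof -
   have "th + t * dt = (1 - t) * th + t * (th + dt)" by (simp add: algebra_simps)
   then show ?thesis using rng that convex_bound_le[of th hi "th+dt" "1-t" t] 
    convex_bound_le[of "-th" "-lo" "-(th+dt)" "1-t" t] by (auto simp: algebra_simps)
  qed
  define c where "c = mvc lam dt de"
  define P where "P e t = pk n lam e (th + t * dt) (\<lambda>k. y k + t * de k)" for e t
  have dP: "(P e has_real_derivative (\<Sum>z\<in>moves n. c z * P (bump e z) t)) (at t)" if "0 \<le> t" "t \<le> 1" for e t unfolding P_def[abs_def] c_def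
   by (rule pk_line_derivative) (use seg[OF that] lo lam in \<open>auto intro!: mult_pos_pos\<close>)
  define diff where "diff i = (case i of 0 => P d | Suc 0 => (\<lambda>t. \<Sum>z\<in>moves n. c z * P (bump d z) t)
   | Suc (Suc 0) => (\<lambda>t. \<Sum>z\<in>moves n. c z * (\<Sum>w'\<in>moves n. c w' * P (bump (bump d z) w') t))
   | _ => (\<lambda>t. \<Sum>z\<in>moves n. c z * (\<Sum>w'\<in>moves n. c w' * (\<Sum>x\<in>moves n. c x * P (bump (bump (bump d z) w') x) t))))" for i :: nat
  have d3: "m < 3 ==> m = 0 \<or> m = Suc 0 \<or> m = Suc (Suc 0)" for m :: nat by auto
  have "\<exists>t>0. t < 1 \<and> P d 1 = (\<Sum>m<3. diff m 0 / fact m * 1 ^ m) + diff 3 t / fact 3 * 1 ^ 3"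
  proof (rule Maclaurin)
   show "diff 0 = P d" by (simp add: diff_def)
   show "\<forall>m t. m < 3 \<and> 0 \<le> t \<and> t \<le> 1 --> (diff m has_real_derivative diff (Suc m) t) (at t)"
   proof (intro allI impI)
    fix m :: nat and t :: real assume *: "m < 3 \<and> 0 \<le> t \<and> t \<le> 1"
    then show "(diff m has_real_derivative diff (Suc m) t) (at t)" using d3[of m] by (auto simp: diff_def eval_nat_numeral intro!: DERIV_sum DERIV_cmult dP)
   qed
  qed auto
  then obtain t where t: "0 < t" "t < 1" and eq: "P d 1 = (\<Sum>m<3. diff m 0 / fact m * 1 ^ m) + diff 3 t / fact 3 * 1 ^ 3" by blast
  have P0: "P e 0 = pk n lam e th y" for e by (simp add: P_def)
  have "\<bar>diff 3 t\<bar> \<le> C * (\<Sum>z\<in>moves n. \<bar>c z\<bar>) ^ 3"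
  proof -
   have "diff 3 t = (\<Sum>z\<in>moves n. c z * (\<Sum>w'\<in>moves n. c w' * (\<Sum>x\<in>moves n. c x * P (bump (bump (bump d z) w') x) t)))"
    by (simp add: diff_def eval_nat_numeral)
   also have "\<bar>\<dots>\<bar> \<le> (\<Sum>z\<in>moves n. \<bar>c z\<bar>) * ((\<Sum>z\<in>moves n. \<bar>c z\<bar>) * ((\<Sum>z\<in>moves n. \<bar>c z\<bar>) * C))"
    using t seg[of t] unfolding P_def by (intro abs_weighted_sum_le order_trans[OF B(2) BC]) auto
   also have "\<dots> = C * (\<Sum>z\<in>moves n. \<bar>c z\<bar>) ^ 3" by (simp add: power3_eq_cube)
   finally show ?thesis .
  qed
  moreover have "P d 1 = P d 0 + (\<Sum>z\<in>moves n. c z * P (bump d z) 0) + 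
    (\<Sum>z\<in>moves n. \<Sum>w'\<in>moves n. c z * c w' * P (bump (bump d z) w') 0) / 2 + diff 3 t / 6"
   unfolding eq by (simp add: diff_def eval_nat_numeral sum_distrib_left mult.assoc)
  ultimately have "\<bar>P d 1 - P d 0 - (\<Sum>z\<in>moves n. c z * P (bump d z) 0)
    - (\<Sum>z\<in>moves n. \<Sum>w'\<in>moves n. c z * c w' * P (bump (bump d z) w') 0) / 2\<bar> \<le> C * (\<Sum>z\<in>moves n. \<bar>c z\<bar>) ^ 3" by simp
  then show "\<bar>pk n lam d (th + dt) (\<lambda>k. y k + de k) - pk n lam d th y
    - (\<Sum>z\<in>moves n. mvc lam dt de z * pk n lam (bump d z) th y)
    - (\<Sum>z\<in>moves n. \<Sum>w'\<in>moves n. mvc lam dt de z * mvc lam dt de w' * pk n lam (bump (bump d z) w') th y) / 2\<bar>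
   \<le> C * (mvs n lam dt de) ^ 3" unfolding c_def P0 by (simp add: P_def)
 qed
qed

text \<open>The mean value theorem on the same segment. Its linear bound is what remains useful for
  displacements that are not small, where a cubic remainder says too little.\<close>

lemma pk_lipschitz:
 assumes lo: "0 < lo" "lo \<le> hi" and lam: "\<And>k. k < n ==> 0 < lam k"
 shows "\<exists>C\<ge>0. \<forall>th\<in>{lo..hi}. \<forall>dt y de. th + dt \<in> {lo..hi} -->
  \<bar>pk n lam d (th + dt) (\<lambda>k. y k + de k) - pk n lam d th y\<bar> \<le> C * (mvs n lam dt de)"
proof -
 have "\<forall>e. \<exists>C. 0 \<le> C \<and> (\<forall>th\<in>{lo..hi}. \<forall>y. \<bar>pk n lam e th y\<bar> \<le> C)"
  using pk_bounded[of lo hi n lam] lo lam by auto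
 then obtain B where "\<forall>e. 0 \<le> B e \<and> (\<forall>th\<in>{lo..hi}. \<forall>y. \<bar>pk n lam e th y\<bar> \<le> B e)"
  using choice[of "\<lambda>e C. 0 \<le> C \<and> (\<forall>th\<in>{lo..hi}. \<forall>y. \<bar>pk n lam e th y\<bar> \<le> C)"] by blast
 then have B: "\<And>e. 0 \<le> B e" "\<And>e th y. th \<in> {lo..hi} ==> \<bar>pk n lam e th y\<bar> \<le> B e" by auto
 define C where "C = (\<Sum>z\<in>moves n. B (bump d z))"
 have C0: "0 \<le> C" unfolding C_def by (intro sum_nonneg B)
 have BC: "B (bump d z) \<le> C" if "z \<in> moves n" for z unfolding C_def by (rule member_le_sum[OF that]) (auto intro: B)
 show ?thesis
 proof (intro exI[of _ C] conjI C0 ballI allI impI)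
  fix th dt y de assume rng: "th \<in> {lo..hi}" "th + dt \<in> {lo..hi}"
  have seg: "th + t * dt \<in> {lo..hi}" if "0 \<le> t" "t \<le> 1" for t
  proof -
   have "th + t * dt = (1 - t) * th + t * (th + dt)" by (simp add: algebra_simps)
   then show ?thesis using rng that convex_bound_le[of th hi "th+dt" "1-t" t] 
    convex_bound_le[of "-th" "-lo" "-(th+dt)" "1-t" t] by (auto simp: algebra_simps)
  qed
  define c where "c = mvc lam dt de"
  define P where "P e t = pk n lam e (th + t * dt) (\<lambda>k. y k + t * de k)" for e t
  have dP: "(P e has_real_derivative (\<Sum>z\<in>moves n. c z * P (bump e z) t)) (at t)" if "0 \<le> t" "t \<le> 1" for e t unfolding P_def[abs_def] c_def
   by (rule pk_line_derivative) (use seg[OF that] lo lam in \<open>auto intro!: mult_pos_pos\<close>)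
  obtain t where t: "0 < t" "t < 1" and eq: "P d 1 - P d 0 = (1 - 0) * (\<Sum>z\<in>moves n. c z * P (bump d z) t)"
   using MVT2[of 0 1 "P d" "\<lambda>t. \<Sum>z\<in>moves n. c z * P (bump d z) t"] dP by auto
  have "\<bar>P d 1 - P d 0\<bar> \<le> (\<Sum>z\<in>moves n. \<bar>c z\<bar>) * C" unfolding eq using t seg[of t] unfolding P_def
   by (simp, intro abs_weighted_sum_le order_trans[OF B(2) BC]) auto
  then show "\<bar>pk n lam d (th + dt) (\<lambda>k. y k + de k) - pk n lam d th y\<bar> \<le> C * (mvs n lam dt de)" unfolding c_def P_def by (simp add: mult.commute)
 qed
qed

lemma pk_cong: "(\<And>k. k < n ==> y k = y' k) ==> pk n lam d th y = pk n lam d th y'" unfolding pk_def by (intro prod.cong) auto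

lemma borel_measurable_pk:
 assumes "0 < th" "\<And>k. k < n ==> 0 < lam k" "\<And>k. k < n ==> (\<lambda>w. y w k) \<in> borel_measurable N"
 shows "(\<lambda>w. pk n lam d th (y w)) \<in> borel_measurable N" unfolding pk_def
 by (intro borel_measurable_prod measurable_compose[OF _ borel_measurable_hg] assms) (use assms in auto)

lemma pk_uminus_0: "pk n lam z0 th (\<lambda>k. - y k) = pk n lam z0 th y" unfolding pk_def by simp

lemma nn_integral_lborel_hg_0:
 assumes "0 < v" shows "(\<integral>\<^sup>+y. ennreal (hg 0 v (y - c)) \<partial>lborel) = 1"
proof -
 have "(\<integral>\<^sup>+y. ennreal (hg 0 v (y - c)) \<partial>lborel) = (\<integral>\<^sup>+y. ennreal (normal_density c (sqrt v) y) \<partial>lborel)"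
  using assms by (intro nn_integral_cong) (simp add: normal_density_def)
 also have "\<dots> = 1"  using assms by (subst nn_integral_eq_integral) auto
 finally show ?thesis .
qed

lemma nn_integral_lborel_Rn_pk:
 assumes "0 < th" "\<And>k. k < n ==> 0 < lam k"
 shows "(\<integral>\<^sup>+y. ennreal (pk n lam z0 th (\<lambda>k. y k - c k)) \<partial>lborel_Rn n) = 1"
proof -
 interpret product_sigma_finite "\<lambda>_. lborel :: real measure" ..
 have "(\<integral>\<^sup>+y. ennreal (pk n lam z0 th (\<lambda>k. y k - c k)) \<partial>lborel_Rn n) = 
   (\<integral>\<^sup>+y. (\<Prod>k<n. ennreal (hg 0 (th * lam k) (y k - c k))) \<partial>lborel_Rn n)" unfolding pk_def using assms
  by (intro nn_integral_cong, subst prod_ennreal) (auto intro!: less_imp_le[OF hg_0_pos] simp del: hg.simps)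
 also have "\<dots> = (\<Prod>k<n. \<integral>\<^sup>+y. ennreal (hg 0 (th * lam k) (y - c k)) \<partial>lborel)" unfolding lborel_Rn_def using assms
 proof (intro product_nn_integral_prod)
  fix k assume "k \<in> {..<n}"
  then have "0 < th * lam k" using assms by simp
  note [measurable] = borel_measurable_hg[OF this]
  show "(\<lambda>y. ennreal (hg 0 (th * lam k) (y - c k))) \<in> borel_measurable lborel" by measurable
 qed simp
 also have "\<dots> = 1" using assms by (simp add: nn_integral_lborel_hg_0 del: hg.simps)
 finally show ?thesis .
qed

section \<open>Gaussian mixtures\<close>

text \<open>For orders 0 this is the density of \<open>X\<close> plus independent Gaussian noise
  with variances \<open>th * lam k\<close>; for other orders it is the corresponding derivative,
  taken under the integral.\<close>

definition mix :: "'w' measure => ('w' => nat => real) => nat => (nat => real) => (nat => nat) => real => (nat => real) => real" where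
 "mix M X n lam d th y = (\<integral>w. pk n lam d th (\<lambda>k. y k - X w k) \<partial>M)"

section \<open>Estimates that Gaussian mixtures inherit from their kernels\<close>

locale mixture = prob_space M for M :: "'w' measure" +
 fixes X :: "'w' => nat => real" and n :: nat and lam :: "nat => real"
 assumes X_measurable: "\<And>k. k < n ==> (\<lambda>w. X w k) \<in> borel_measurable M"
  and lam_pos: "\<And>k. k < n ==> 0 < lam k"
begin

abbreviation "mx \<equiv> mix M X n lam"

lemma integrable_pk:
 assumes "0 < th"
 shows "integrable M (\<lambda>w. pk n lam d th (\<lambda>k. y k - X w k))"
proof -
 obtain C where C: "\<And>y. \<bar>pk n lam d th y\<bar> \<le> C" using pk_bounded[of th th n lam d] assms lam_pos by auto
 show ?thesis by (rule integrable_const_bound[of _ C])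
   (auto intro!: AE_I2 C borel_measurable_pk assms lam_pos X_measurable borel_measurable_diff)
qed

lemma mix_cong: "(\<And>k. k < n ==> y k = y' k) ==> mx d th y = mx d th y'"
 unfolding mix_def by (intro Bochner_Integration.integral_cong refl pk_cong) auto

lemma mix_bounded:
 assumes "0 < lo" "lo \<le> hi"
 shows "\<exists>C\<ge>0. \<forall>th\<in>{lo..hi}. \<forall>y. \<bar>mx d th y\<bar> \<le> C"
proof -
 obtain C where C: "0 \<le> C" "\<forall>th\<in>{lo..hi}. \<forall>y. \<bar>pk n lam d th y\<bar> \<le> C" using pk_bounded[of lo hi n lam d] assms lam_pos by auto
 have "\<bar>mx d th y\<bar> \<le> C" if "th \<in> {lo..hi}" for th y
 proof -
  have "\<bar>mx d th y\<bar> \<le> (\<integral>w. \<bar>pk n lam d th (\<lambda>k. y k - X w k)\<bar> \<partial>M)" unfolding mix_def by (rule integral_abs_bound)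
  also have "\<dots> \<le> (\<integral>w. C \<partial>M)" using that assms C by (intro integral_mono integrable_abs integrable_pk) auto
  finally show ?thesis by (simp add: prob_space)
 qed
 then show ?thesis using C(1) by blast
qed

text \<open>A linear estimate for the kernels that is uniform in y survives translation by
  \<open>X w\<close> and averaging over a probability measure. The index set \<open>S\<close> is
  arbitrary, so that the Lipschitz estimate (\<open>S\<close> empty) and the Taylor estimate are
  both instances.\<close>

lemma mix_expansion:
 fixes c :: "'z => real"
 assumes "0 < th" "0 < th'" "finite S"
  and le: "\<And>y. \<bar>pk n lam d th' (\<lambda>k. y k + de k) - pk n lam d th y - (\<Sum>z\<in>S. c z * pk n lam (D z) th y)\<bar> \<le> B"
 shows "\<bar>mx d th' (\<lambda>k. y k + de k) - mx d th y - (\<Sum>z\<in>S. c z * mx (D z) th y)\<bar> \<le> B"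
proof -
 let ?f = "\<lambda>w. pk n lam d th' (\<lambda>k. (y k + de k) - X w k) - pk n lam d th (\<lambda>k. y k - X w k) - (\<Sum>z\<in>S. c z * pk n lam (D z) th (\<lambda>k. y k - X w k))"
 have i: "integrable M ?f" by (intro Bochner_Integration.integrable_diff Bochner_Integration.integrable_sum integrable_mult_right integrable_pk assms)
 have eq: "mx d th' (\<lambda>k. y k + de k) - mx d th y - (\<Sum>z\<in>S. c z * mx (D z) th y) = (\<integral>w. ?f w \<partial>M)" unfolding mix_def
  using integrable_pk[OF assms(1)] integrable_pk[OF assms(2), of d "\<lambda>k. y k + de k"] by simp
 have "\<bar>\<integral>w. ?f w \<partial>M\<bar> \<le> (\<integral>w. \<bar>?f w\<bar> \<partial>M)" by (rule integral_abs_bound)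
 also have "\<dots> \<le> (\<integral>w. B \<partial>M)"
 proof (rule integral_mono)
  fix w
  have eq: "(\<lambda>k. (y k + de k) - X w k) = (\<lambda>k. (y k - X w k) + de k)" by auto
  show "\<bar>?f w\<bar> \<le> B" unfolding eq by (rule le)
 qed (rule integrable_abs[OF i], simp)
 finally show ?thesis unfolding eq by (simp add: prob_space)
qed

lemma mix_lipschitz:
 assumes "0 < lo" "lo \<le> hi"
 shows "\<exists>C\<ge>0. \<forall>th\<in>{lo..hi}. \<forall>dt y de. th + dt \<in> {lo..hi} -->
  \<bar>mx d (th + dt) (\<lambda>k. y k + de k) - mx d th y\<bar> \<le> C * (mvs n lam dt de)"
proof -
 obtain C where C: "0 \<le> C" "\<forall>th\<in>{lo..hi}. \<forall>dt y de. th + dt \<in> {lo..hi} -->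
  \<bar>pk n lam d (th + dt) (\<lambda>k. y k + de k) - pk n lam d th y\<bar> \<le> C * (mvs n lam dt de)" using pk_lipschitz[of lo hi n lam d] assms lam_pos by auto
 show ?thesis
 proof (intro exI[of _ C] conjI C(1) ballI allI impI)
  fix th dt y de assume rng: "th \<in> {lo..hi}" "th + dt \<in> {lo..hi}"
  then show "\<bar>mx d (th + dt) (\<lambda>k. y k + de k) - mx d th y\<bar> \<le> C * (mvs n lam dt de)"
   using mix_expansion[of th "th + dt" "{}" d de "\<lambda>_. 0" "\<lambda>_. d" _ y] C(2) assms by auto
 qed
qed

lemma mix_taylor:
 assumes "0 < lo" "lo \<le> hi"
 shows "\<exists>C\<ge>0. \<forall>th\<in>{lo..hi}. \<forall>dt y de. th + dt \<in> {lo..hi} -->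
  \<bar>mx d (th + dt) (\<lambda>k. y k + de k) - mx d th y
    - (\<Sum>z\<in>moves n. mvc lam dt de z * mx (bump d z) th y)
    - (\<Sum>z\<in>moves n. \<Sum>w'\<in>moves n. mvc lam dt de z * mvc lam dt de w' * mx (bump (bump d z) w') th y) / 2\<bar>
   \<le> C * (mvs n lam dt de) ^ 3"
proof -
 obtain C where C: "0 \<le> C" "\<forall>th\<in>{lo..hi}. \<forall>dt y de. th + dt \<in> {lo..hi} -->
  \<bar>pk n lam d (th + dt) (\<lambda>k. y k + de k) - pk n lam d th y
    - (\<Sum>z\<in>moves n. mvc lam dt de z * pk n lam (bump d z) th y)
    - (\<Sum>z\<in>moves n. \<Sum>w'\<in>moves n. mvc lam dt de z * mvc lam dt de w' * pk n lam (bump (bump d z) w') th y) / 2\<bar>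
   \<le> C * (mvs n lam dt de) ^ 3" using pk_taylor[of lo hi n lam d] assms lam_pos by auto
 show ?thesis
 proof (intro exI[of _ C] conjI C(1) ballI allI impI)
  fix th dt y de assume rng: "th \<in> {lo..hi}" "th + dt \<in> {lo..hi}"
  \<comment> \<open>The disjoint sum of single moves and pairs of moves puts the first- and
    second-order terms into one finite sum, the form that \<open>mix_expansion\<close>
    accepts.\<close>
  define S where "S = (Inl ` moves n :: (_ + (_ \<times> _)) set) \<union> Inr ` (moves n \<times> moves n)"
  define c where "c = case_sum (mvc lam dt de) (\<lambda>(z, w'). mvc lam dt de z * mvc lam dt de w' / 2)"
  define D where "D = case_sum (bump d) (\<lambda>(z, w'). bump (bump d z) w')"
  have S: "(\<Sum>z\<in>S. c z * f (D z)) = (\<Sum>z\<in>moves n. mvc lam dt de z * f (bump d z))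
    + (\<Sum>z\<in>moves n. \<Sum>w'\<in>moves n. mvc lam dt de z * mvc lam dt de w' * f (bump (bump d z) w')) / 2" for f unfolding S_def by (subst sum.union_disjoint)
    (auto simp: sum.reindex c_def D_def sum_divide_distrib sum.cartesian_product intro!: sum.cong)
  have "\<bar>mx d (th + dt) (\<lambda>k. y k + de k) - mx d th y - (\<Sum>z\<in>S. c z * mx (D z) th y)\<bar> \<le> C * (mvs n lam dt de) ^ 3"
  proof (rule mix_expansion)
   fix y
   show "\<bar>pk n lam d (th + dt) (\<lambda>k. y k + de k) - pk n lam d th y - (\<Sum>z\<in>S. c z * pk n lam (D z) th y)\<bar> \<le> C * (mvs n lam dt de) ^ 3"
    using C(2) rng unfolding S[of "\<lambda>d. pk n lam d th y"] by (simp add: diff_diff_eq add.assoc)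
  qed (use rng assms in \<open>auto simp: S_def\<close>)
  then show "\<bar>mx d (th + dt) (\<lambda>k. y k + de k) - mx d th y
    - (\<Sum>z\<in>moves n. mvc lam dt de z * mx (bump d z) th y)
    - (\<Sum>z\<in>moves n. \<Sum>w'\<in>moves n. mvc lam dt de z * mvc lam dt de w' * mx (bump (bump d z) w') th y) / 2\<bar>
   \<le> C * (mvs n lam dt de) ^ 3" unfolding S[of "\<lambda>d. mx d th y"] by (simp add: diff_diff_eq add.assoc)
 qed
qed

text \<open>The derivative is read off from the Taylor estimate with dt = 0 and a displacement in
  coordinate i alone, in place of a differentiation under the integral.\<close>

lemma mix_partial_derivative:
 assumes "0 < th" "i < n"
 shows "((\<lambda>s. mx d th (y(i := s))) has_real_derivative mx (bump d (i, 1)) th (y(i := t))) (at t)"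
proof -
 obtain C where C: "0 \<le> C" "\<And>dt y de. th + dt \<in> {th..th} ==>
  \<bar>mx d (th + dt) (\<lambda>k. y k + de k) - mx d th y
    - (\<Sum>z\<in>moves n. mvc lam dt de z * mx (bump d z) th y)
    - (\<Sum>z\<in>moves n. \<Sum>w'\<in>moves n. mvc lam dt de z * mvc lam dt de w' * mx (bump (bump d z) w') th y) / 2\<bar>
   \<le> C * (mvs n lam dt de) ^ 3" using mix_taylor[of th th d] assms by auto
 define a where "a = mx (bump d (i, 1)) th (y(i := t))"
 define b where "b = mx (bump (bump d (i, 1)) (i, 1)) th (y(i := t))"
 have taylor: "\<bar>mx d th (y(i := t + h)) - mx d th (y(i := t)) - h * a - h * h * b / 2\<bar> \<le> C * \<bar>h\<bar> ^ 3" for h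
 proof -
  define de where "de k = (if k = i then h else 0)" for k
  have S: "(\<Sum>z\<in>moves n. mvc lam 0 de z * f z) = h * f (i, 1)" for f using assms(2) unfolding sum_moves mvc_def de_def
   by (simp add: if_distrib[where f="\<lambda>x. x * _"] sum.delta cong: if_cong)
  have S2: "(\<Sum>z\<in>moves n. \<bar>mvc lam 0 de z\<bar>) = \<bar>h\<bar>" using assms(2) unfolding sum_moves mvc_def de_def
   by (simp add: if_distrib[where f="abs"] sum.delta cong: if_cong)
  have y: "(\<lambda>k. (y(i := t)) k + de k) = y(i := t + h)" by (auto simp: de_def)
  have SS: "(\<Sum>z\<in>moves n. \<Sum>w'\<in>moves n. mvc lam 0 de z * mvc lam 0 de w' * f z w') = h * (h * f (i, 1) (i, 1))" for f
   by (simp add: mult.assoc sum_distrib_left[symmetric] S)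
  show ?thesis using C(2)[of 0 "y(i:=t)" de] unfolding y S S2 SS a_def b_def by (simp add: mult.assoc)
 qed
 have "((\<lambda>h. (mx d th (y(i := t + h)) - mx d th (y(i := t))) / h) \<longlongrightarrow> a) (at 0)"
 proof (rule LIM_zero_cancel, rule Lim_null_comparison)
  show "\<forall>\<^sub>F h in at 0. norm ((mx d th (y(i := t + h)) - mx d th (y(i := t))) / h - a) \<le> \<bar>h\<bar> * \<bar>b\<bar> / 2 + C * \<bar>h\<bar> ^ 2"
   unfolding eventually_at
  proof (intro exI[of _ 1] conjI ballI impI)
   fix h :: real assume "h \<noteq> 0 \<and> dist h 0 < 1"
   then have h: "h \<noteq> 0" by simp
   have "\<bar>mx d th (y(i := t + h)) - mx d th (y(i := t)) - h * a\<bar> \<le> \<bar>h * h * b / 2\<bar> + C * \<bar>h\<bar> ^ 3" using taylor[of h] by linarith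
   also have "\<dots> = \<bar>h\<bar> * (\<bar>h\<bar> * \<bar>b\<bar> / 2 + C * \<bar>h\<bar> ^ 2)" by (simp add: abs_mult algebra_simps power2_eq_square power3_eq_cube)
   finally have "\<bar>mx d th (y(i := t + h)) - mx d th (y(i := t)) - h * a\<bar> / \<bar>h\<bar> \<le> \<bar>h\<bar> * \<bar>b\<bar> / 2 + C * \<bar>h\<bar> ^ 2"
    using h by (simp add: divide_le_eq mult.commute)
   moreover have "\<bar>mx d th (y(i := t + h)) - mx d th (y(i := t)) - h * a\<bar> / \<bar>h\<bar> = norm ((mx d th (y(i := t + h)) - mx d th (y(i := t))) / h - a)"
    using h by (simp add: abs_divide[symmetric] diff_divide_distrib)
   ultimately show "norm ((mx d th (y(i := t + h)) - mx d th (y(i := t))) / h - a) \<le> \<bar>h\<bar> * \<bar>b\<bar> / 2 + C * \<bar>h\<bar> ^ 2" by simp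
  qed simp
  show "((\<lambda>h. \<bar>h\<bar> * \<bar>b\<bar> / 2 + C * \<bar>h\<bar> ^ 2) \<longlongrightarrow> 0) (at 0)" by (auto intro!: tendsto_eq_intros)
 qed
 then show ?thesis unfolding a_def by (simp add: DERIV_def)
qed

lemma mix_pos:
 assumes "0 < th" shows "0 < mx z0 th y"
proof -
 have "0 < (\<integral>w. pk n lam z0 th (\<lambda>k. y k - X w k) \<partial>M)"
  using integral_less_AE_space[of "\<lambda>_. 0" "\<lambda>w. pk n lam z0 th (\<lambda>k. y k - X w k)"]
  by (simp add: emeasure_space_1 integrable_pk assms pk_0_pos lam_pos)
 then show ?thesis by (simp add: mix_def)
qed

text \<open>The events \<open>A R\<close> exhaust the space, so for some R the vector
  \<open>X\<close> lies in a cube with probability above 1/2. On that event the kernel is evaluated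
  at distance at most \<open>L\<close> and is at least \<open>m\<close>, which leaves
  \<open>m / 2\<close> for the average.\<close>

lemma mix_lower_bound:
 assumes lo: "0 < lo" "lo \<le> hi"
 shows "\<exists>m>0. \<forall>th\<in>{lo..hi}. \<forall>y. (\<forall>k<n. \<bar>y k\<bar> \<le> K) --> m \<le> mx z0 th y"
proof -
 define A where "A R = {w\<in>space M. \<forall>k\<in>{..<n}. \<bar>X w k\<bar> \<le> real R}" for R
 have A_sets [measurable]: "A R \<in> sets M" for R unfolding A_def
 proof (rule sets.sets_Collect_finite_All)
  fix k assume "k \<in> {..<n}"
  then have [measurable]: "(\<lambda>w. X w k) \<in> borel_measurable M" using X_measurable by simp
  show "{w \<in> space M. \<bar>X w k\<bar> \<le> real R} \<in> events" by measurable
 qed simp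
 have "(\<lambda>R. prob (A R)) \<longlonglongrightarrow> prob (\<Union>R. A R)"
 proof (rule finite_Lim_measure_incseq)
  show "incseq A" unfolding incseq_def A_def by (auto; meson of_nat_le_iff order_trans lessThan_iff)
 qed (use A_sets in auto)
 moreover have "(\<Union>R. A R) = space M"
 proof -
  have "\<exists>R. \<forall>k<n. \<bar>X w k\<bar> \<le> real R" for w
  proof -
   obtain R where "(\<Sum>k<n. \<bar>X w k\<bar>) \<le> real R" using real_arch_simple by blast
   then show ?thesis by (intro exI[of _ R] allI impI) 
     (meson abs_ge_zero finite_lessThan lessThan_iff member_le_sum order_trans)
  qed
  then show ?thesis unfolding A_def Ball_def lessThan_iff by blast
 qed
 ultimately have "(\<lambda>R. prob (A R)) \<longlonglongrightarrow> 1" by (simp add: prob_space)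
 then have "\<forall>\<^sub>F R in sequentially. 1/2 < prob (A R)" by (rule order_tendstoD) auto
 then obtain R where R: "1/2 < prob (A R)" by (auto simp: eventually_sequentially)
 define L where "L = \<bar>K\<bar> + real R"
 \<comment> \<open>The worst case over \<open>{lo..hi}\<close>: the smallest variance in the
   exponent, the largest in the normalisation.\<close>
 define m where "m = (\<Prod>k<n. exp (- (L\<^sup>2 / (2 * (lo * lam k)))) / sqrt (2 * pi * (hi * lam k)))"
 have m0: "0 < m" unfolding m_def using lo lam_pos by (intro prod_pos) auto
 have pkm: "m \<le> pk n lam z0 th y" if rng: "th \<in> {lo..hi}" and y: "\<forall>k<n. \<bar>y k\<bar> \<le> L" for th y unfolding m_def pk_def
 proof (intro prod_mono conjI)
  fix k assume "k \<in> {..<n}"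
  then have k: "k < n" by simp
  note lk = lam_pos[OF k]
  show "0 \<le> exp (- (L\<^sup>2 / (2 * (lo * lam k)))) / sqrt (2 * pi * (hi * lam k))" using lo lk by simp
  have "(y k)\<^sup>2 \<le> L\<^sup>2" using y k by (auto simp: abs_le_square_iff[symmetric])
  then have "(y k)\<^sup>2 / (2 * (th * lam k)) \<le> L\<^sup>2 / (2 * (lo * lam k))" using rng lo lk by (intro frac_le) (auto intro!: mult_right_mono)
  then show "exp (- (L\<^sup>2 / (2 * (lo * lam k)))) / sqrt (2 * pi * (hi * lam k)) \<le> hg 0 (th * lam k) (y k)"
   unfolding hg.simps using rng lo lk by (intro frac_le) (auto intro!: mult_right_mono)
 qed
 show ?thesis
 proof (intro exI[of _ "m / 2"] conjI ballI allI impI)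
  fix th y assume rng: "th \<in> {lo..hi}" and y: "\<forall>k<n. \<bar>y k\<bar> \<le> K"
  have "m / 2 \<le> m * prob (A R)" using R m0 by simp
  also have "\<dots> = (\<integral>w. m * indicator (A R) w \<partial>M)" by simp
  also have "\<dots> \<le> (\<integral>w. pk n lam z0 th (\<lambda>k. y k - X w k) \<partial>M)"
  proof (rule integral_mono)
   show "integrable M (\<lambda>w. m * indicator (A R) w)" by (intro integrable_mult_right integrable_real_indicator A_sets) (simp add: less_top[symmetric])
   show "integrable M (\<lambda>w. pk n lam z0 th (\<lambda>k. y k - X w k))" using rng lo by (intro integrable_pk) auto
  next
   fix w assume "w \<in> space M"
   show "m * indicator (A R) w \<le> pk n lam z0 th (\<lambda>k. y k - X w k)"
   proof (cases "w \<in> A R")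
    case True
    have "\<bar>y k - X w k\<bar> \<le> L" if "k < n" for k
    proof -
     have "\<bar>y k\<bar> \<le> K" "\<bar>X w k\<bar> \<le> real R" using y True that by (auto simp: A_def)
     then show ?thesis unfolding L_def by linarith
    qed
    then show ?thesis using True pkm[OF rng] by simp
   next
    case False then show ?thesis using pk_0_pos[of th n lam] rng lo lam_pos by (simp add: less_imp_le)
   qed
  qed
  finally show "m / 2 \<le> mx z0 th y" by (simp add: mix_def)
 qed (use m0 in auto)
qed

lemma borel_measurable_mix:
 assumes "0 < th" "\<And>k. k < n ==> (\<lambda>w. y w k) \<in> borel_measurable N"
 shows "(\<lambda>w. mx d th (y w)) \<in> borel_measurable N" unfolding mix_def
proof (rule borel_measurable_lebesgue_integral)
 show "(\<lambda>(w, wo). pk n lam d th (\<lambda>k. y w k - X wo k)) \<in> borel_measurable (N \<Otimes>\<^sub>M M)" unfolding split_beta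
  by (intro borel_measurable_pk assms lam_pos borel_measurable_diff)
   (auto intro!: measurable_compose[OF measurable_fst assms(2)] measurable_compose[OF measurable_snd X_measurable])
qed

lemma nn_integral_mix:
 assumes "0 < th"
 shows "(\<integral>\<^sup>+y. ennreal (mx z0 th y) \<partial>lborel_Rn n) = 1"
proof -
 interpret L: sigma_finite_measure "lborel_Rn n" unfolding lborel_Rn_def
  by (intro product_sigma_finite.sigma_finite) (auto intro: product_sigma_finite.intro sigma_finite_lborel)
 interpret P: pair_sigma_finite "lborel_Rn n" M ..
 have [measurable]: "k < n ==> (\<lambda>y. y k) \<in> borel_measurable (lborel_Rn n)" for k unfolding lborel_Rn_def by measurable
 have "(\<integral>\<^sup>+y. ennreal (mx z0 th y) \<partial>lborel_Rn n) = (\<integral>\<^sup>+y. \<integral>\<^sup>+w. ennreal (pk n lam z0 th (\<lambda>k. y k - X w k)) \<partial>M \<partial>lborel_Rn n)"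
  unfolding mix_def by (intro nn_integral_cong nn_integral_eq_integral[symmetric] integrable_pk assms AE_I2 less_imp_le pk_0_pos lam_pos)
 also have "\<dots> = (\<integral>\<^sup>+w. \<integral>\<^sup>+y. ennreal (pk n lam z0 th (\<lambda>k. y k - X w k)) \<partial>lborel_Rn n \<partial>M)"
  by (rule P.Fubini'[symmetric], unfold split_beta, intro measurable_compose[OF _ measurable_ennreal] borel_measurable_pk assms lam_pos borel_measurable_diff)
   (auto intro!: measurable_compose[OF measurable_fst] measurable_compose[OF measurable_snd X_measurable])
 also have "\<dots> = 1" using assms lam_pos by (simp add: nn_integral_lborel_Rn_pk emeasure_space_1)
 finally show ?thesis .
qed

end

section \<open>Quotients of solutions of the backward heat equation\<close>

text \<open>Here \<open>U\<close> bounds the quotient, \<open>a\<close> and \<open>d\<close> bound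
  the first differences of numerator and denominator, \<open>c\<close> the first- and second-order
  coefficients, and \<open>r\<close> the Taylor remainder. The next two products compare
  \<open>A * D\<close> with its leading part, \<open>a * U * d * d\<close> bounds the third-order
  term, and \<open>2 * c + c * U\<close> is a reserve that makes the right-hand side nonnegative for
  long steps.\<close>

definition qstep_const :: "real => real => real => real => real" where
 "qstep_const m B C1 C3 = (let U = B / m; a = (C1 + U * C1) / m; d = C1 / m; c = (B + U * B) / m; r = (C3 + U * C3) / m
  in r + (c + r + a) * d + c * (U + C3 / m + d) + a * U * d * d + 2 * c + c * U)"

lemma abs_mult_le:
 fixes x y :: real
 assumes "\<bar>x\<bar> \<le> a" "\<bar>y\<bar> \<le> b" shows "\<bar>x * y\<bar> \<le> a * b" unfolding abs_mult by (rule mult_mono[OF assms]) (use assms in auto)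

text \<open>With \<open>u = N / h\<close>, \<open>A = (dN - u dh) / h\<close> and \<open>D = dh / h\<close>, the increment of \<open>u\<close> satisfies
 the identity \<open>du = A - A D + du D\<^sup>2\<close>, whose last term is of third order.\<close>

lemma quotient_step:
 fixes N N' h h' :: real
 assumes m: "0 < m" "m \<le> h" and N: "0 \<le> N" "N \<le> B" and h: "h \<le> B" and W: "0 \<le> W" and C: "0 \<le> C1" "0 \<le> C3"
  and lip: "\<bar>N' - N\<bar> \<le> C1 * W" "\<bar>h' - h\<bar> \<le> C1 * W"
  and T1: "\<bar>T1\<bar> \<le> B * W" "\<bar>t1\<bar> \<le> B * W" and T2: "\<bar>T2\<bar> \<le> B * W\<^sup>2" "\<bar>t2\<bar> \<le> B * W\<^sup>2"
  and tay: "\<bar>N' - N - T1 - T2 / 2\<bar> \<le> C3 * W ^ 3" "\<bar>h' - h - t1 - t2 / 2\<bar> \<le> C3 * W ^ 3"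
 defines "u \<equiv> N / h" and "S1 \<equiv> (T1 - N / h * t1) / h" and "S2 \<equiv> (T2 - N / h * t2) / h" and "L \<equiv> t1 / h"
 shows "m \<le> h' ==> h' \<le> B ==> N' / h' \<le> u + S1 + S2 / 2 - S1 * L + qstep_const m B C1 C3 * W ^ 3"
  and "1 \<le> W ==> 0 \<le> u + S1 + S2 / 2 - S1 * L + qstep_const m B C1 C3 * W ^ 3"
proof -
 define U a d c r where "U = B / m" and "a = (C1 + U * C1) / m" and "d = C1 / m" and "c = (B + U * B) / m"
  and "r = (C3 + U * C3) / m"
 have h0: "0 < h" and B: "0 \<le> B" using m N by auto
 have nn: "0 \<le> U" "0 \<le> a" "0 \<le> d" "0 \<le> c" "0 \<le> r" using m B C by (simp_all add: U_def a_def d_def c_def r_def)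
 have u: "0 \<le> u" "u \<le> U" unfolding u_def U_def using m N h0 by (auto intro: frac_le)
 have div: "\<bar>x / h\<bar> \<le> b / m" if "\<bar>x\<bar> \<le> b" for x b unfolding abs_divide using m h0 that by (intro frac_le) auto
 have comb: "\<bar>(x - u * y) / h\<bar> \<le> (b + U * b) / m" if "\<bar>x\<bar> \<le> b" "\<bar>y\<bar> \<le> b" for x y b
 proof (rule div)
  have "\<bar>u * y\<bar> \<le> U * b" unfolding abs_mult using u nn that by (intro mult_mono) auto
  then show "\<bar>x - u * y\<bar> \<le> b + U * b" using that by linarith
 qed
 define A D where "A = ((N' - N) - u * (h' - h)) / h" and "D = (h' - h) / h"
 have A: "\<bar>A\<bar> \<le> a * W" unfolding A_def a_def using comb[OF lip] by (simp add: algebra_simps)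
 have D: "\<bar>D\<bar> \<le> d * W" unfolding D_def d_def using div[OF lip(2)] by simp
 have S1: "\<bar>S1\<bar> \<le> c * W" unfolding S1_def c_def u_def[symmetric] using comb[OF T1] by (simp add: algebra_simps)
 have S2: "\<bar>S2\<bar> \<le> c * W\<^sup>2" unfolding S2_def c_def u_def[symmetric] using comb[OF T2] by (simp add: algebra_simps)
 have L: "\<bar>L\<bar> \<le> U * W" unfolding L_def U_def using div[OF T1(2)] by simp
 have R1: "\<bar>A - S1 - S2 / 2\<bar> \<le> r * W ^ 3"
 proof -
  have "A - S1 - S2 / 2 = ((N' - N - T1 - T2 / 2) - u * (h' - h - t1 - t2 / 2)) / h" unfolding A_def S1_def S2_def u_def[symmetric]
   by (simp add: add_divide_distrib diff_divide_distrib algebra_simps)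
  then show ?thesis using comb[OF tay] by (simp add: r_def algebra_simps)
 qed
 define q where "q = t2 / h"
 have R2: "\<bar>D - L - q / 2\<bar> \<le> C3 / m * W ^ 3"
 proof -
  have "D - L - q / 2 = (h' - h - t1 - t2 / 2) / h" unfolding D_def L_def q_def by (simp add: add_divide_distrib diff_divide_distrib)
  then show ?thesis using div[OF tay(2)] by simp
 qed
 have t2: "\<bar>q\<bar> \<le> U * W\<^sup>2" unfolding U_def q_def using div[OF T2(2)] by simp
 have W32: "W ^ 3 \<le> W\<^sup>2" if "W \<le> 1" using W that by (intro power_decreasing) auto
 have W12: "W \<le> W\<^sup>2" if "1 \<le> W" using that by (simp add: power2_eq_square)
 have W23: "W\<^sup>2 \<le> W ^ 3" if "1 \<le> W" using that by (intro power_increasing) auto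
 \<comment> \<open>Two regimes: for \<open>W <= 1\<close> the Taylor remainder is below the square
   of \<open>W\<close>, and for longer steps the Lipschitz bound is. The same split gives
   \<open>s2\<close>.\<close>
 have s1: "\<bar>A - S1\<bar> \<le> (c + r + a) * W\<^sup>2"
 proof (cases "W \<le> 1")
  case True
  have "\<bar>A - S1\<bar> \<le> c * W\<^sup>2 / 2 + r * W ^ 3" using R1 S2 by linarith
  also have "\<dots> \<le> c * W\<^sup>2 + r * W\<^sup>2 + a * W\<^sup>2" using mult_left_mono[OF W32[OF True] nn(5)] mult_nonneg_nonneg[OF nn(4), of "W\<^sup>2"]
    mult_nonneg_nonneg[OF nn(2), of "W\<^sup>2"] by simp
  finally show ?thesis by (simp add: algebra_simps)
 next
  case False
  have "\<bar>A - S1\<bar> \<le> a * W + c * W" using A S1 by linarith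
  also have "\<dots> \<le> a * W\<^sup>2 + c * W\<^sup>2 + r * W\<^sup>2" using False
   mult_left_mono[OF W12 nn(2)] mult_left_mono[OF W12 nn(4)] mult_nonneg_nonneg[OF nn(5), of "W\<^sup>2"] by simp
  finally show ?thesis by (simp add: algebra_simps)
 qed
 have Cm: "0 \<le> C3 / m" using C m by simp
 have s2: "\<bar>D - L\<bar> \<le> (U + C3 / m + d) * W\<^sup>2"
 proof (cases "W \<le> 1")
  case True
  have "\<bar>D - L\<bar> \<le> U * W\<^sup>2 / 2 + C3 / m * W ^ 3" using R2 t2 by linarith
  also have "\<dots> \<le> U * W\<^sup>2 + C3 / m * W\<^sup>2 + d * W\<^sup>2" using mult_left_mono[OF W32[OF True] Cm] mult_nonneg_nonneg[OF nn(1), of "W\<^sup>2"]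
    mult_nonneg_nonneg[OF nn(3), of "W\<^sup>2"] by simp
  finally show ?thesis by (simp add: algebra_simps)
 next
  case False
  have "\<bar>D - L\<bar> \<le> d * W + U * W" using D L by linarith
  also have "\<dots> \<le> d * W\<^sup>2 + U * W\<^sup>2 + C3 / m * W\<^sup>2" using False
   mult_left_mono[OF W12 nn(3)] mult_left_mono[OF W12 nn(1)] mult_nonneg_nonneg[OF Cm, of "W\<^sup>2"] by simp
  finally show ?thesis by (simp add: algebra_simps)
 qed
 have AD: "\<bar>A * D - S1 * L\<bar> \<le> ((c + r + a) * d + c * (U + C3 / m + d)) * W ^ 3"
 proof -
  have "A * D - S1 * L = (A - S1) * D + S1 * (D - L)" by (simp add: algebra_simps)
  moreover have "\<bar>(A - S1) * D\<bar> \<le> (c + r + a) * W\<^sup>2 * (d * W)" by (rule abs_mult_le[OF s1 D])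
  moreover have "\<bar>S1 * (D - L)\<bar> \<le> c * W * ((U + C3 / m + d) * W\<^sup>2)" by (rule abs_mult_le[OF S1 s2])
  ultimately have "\<bar>A * D - S1 * L\<bar> \<le> (c + r + a) * W\<^sup>2 * (d * W) + c * W * ((U + C3 / m + d) * W\<^sup>2)" by linarith
  then show ?thesis by (simp add: algebra_simps power2_eq_square power3_eq_cube)
 qed
 have const: "qstep_const m B C1 C3 = r + (c + r + a) * d + c * (U + C3 / m + d) + a * U * d * d + 2 * c + c * U"
  by (simp add: qstep_const_def Let_def U_def a_def d_def c_def r_def)
 have W3: "0 \<le> W ^ 3" using W by simp
 show "N' / h' \<le> u + S1 + S2 / 2 - S1 * L + qstep_const m B C1 C3 * W ^ 3" if h': "m \<le> h'" "h' \<le> B"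
 proof -
  have h'0: "0 < h'" using h' m by auto
  define v where "v = N' / h' - u"
  have vA: "v = A * (h / h')" unfolding v_def A_def u_def using h0 h'0 by (simp add: field_simps)
  have v: "\<bar>v\<bar> \<le> a * W * U"
  proof -
   have "\<bar>h / h'\<bar> \<le> U" unfolding U_def abs_divide using h0 h'0 m h h' by (intro frac_le) auto
   then show ?thesis unfolding vA by (rule abs_mult_le[OF A])
  qed
  have id: "v = A - A * D + v * (D * D)" unfolding vA D_def using h0 h'0 by (simp add: field_simps)
  have "\<bar>v * (D * D)\<bar> \<le> (a * W * U) * ((d * W) * (d * W))" by (rule abs_mult_le[OF v abs_mult_le[OF D D]])
  then have "v * (D * D) \<le> a * U * d * d * W ^ 3" by (simp add: power3_eq_cube algebra_simps)
  moreover have "0 \<le> (2 * c + c * U) * W ^ 3" using nn W3 by simp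
  moreover have "A \<le> S1 + S2 / 2 + r * W ^ 3" using R1 by linarith
  moreover have "- (A * D) \<le> - (S1 * L) + ((c + r + a) * d + c * (U + C3 / m + d)) * W ^ 3" using AD by linarith
  ultimately have "v \<le> S1 + S2 / 2 - S1 * L + qstep_const m B C1 C3 * W ^ 3" unfolding const ring_distribs using id by linarith
  then show ?thesis by (simp add: v_def)
 qed
 \<comment> \<open>A step of length at least 1 may leave the region where the denominator is bounded
   below. Then only nonnegativity is claimed, and the reserved summands of the constant dominate the
   coefficients.\<close>
 show "0 \<le> u + S1 + S2 / 2 - S1 * L + qstep_const m B C1 C3 * W ^ 3" if W1: "1 \<le> W"
 proof -
  have "\<bar>S1\<bar> \<le> c * W ^ 3" "\<bar>S2 / 2\<bar> \<le> c * W ^ 3" 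
   using S1 S2 mult_left_mono[OF order_trans[OF W12[OF W1] W23[OF W1]] nn(4)] mult_left_mono[OF W23[OF W1] nn(4)] by linarith+
  moreover have "\<bar>S1 * L\<bar> \<le> c * U * W ^ 3"
  proof -
   have "\<bar>S1 * L\<bar> \<le> (c * W) * (U * W)"  by (rule abs_mult_le[OF S1 L])
   also have "\<dots> = c * U * W\<^sup>2" by (simp add: power2_eq_square)
   also have "\<dots> \<le> c * U * W ^ 3" using W23[OF W1] nn by (intro mult_left_mono) auto
   finally show ?thesis .
  qed
  moreover have "0 \<le> (r + (c + r + a) * d + c * (U + C3 / m + d) + a * U * d * d) * W ^ 3" using nn C m W3 by (intro mult_nonneg_nonneg add_nonneg_nonneg) auto
  moreover have "qstep_const m B C1 C3 * W ^ 3 = (r + (c + r + a) * d + c * (U + C3 / m + d) + a * U * d * d) * W ^ 3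
   + c * W ^ 3 + c * W ^ 3 + c * U * W ^ 3" unfolding const by (simp add: algebra_simps)
  ultimately show ?thesis using u(1) by linarith
 qed
qed

text \<open>The properties of a solution of the heat equation and its derivatives that the argument
  uses: uniform bounds, Lipschitz bounds and the expansion in which \<open>bump\<close> acts as
  differentiation. Numerator and denominator of the quotient are handled through this interface
  alike.\<close>

definition heat_family :: "nat => (nat => real) => real => real => ((nat => nat) => real => (nat => real) => real) => bool" where
 "heat_family n lam lo hi f \<longleftrightarrow>
  (\<forall>d. (\<exists>C\<ge>0. \<forall>th\<in>{lo..hi}. \<forall>y. \<bar>f d th y\<bar> \<le> C) \<and>
   (\<exists>C\<ge>0. \<forall>th\<in>{lo..hi}. \<forall>dt y de. th + dt \<in> {lo..hi} -->
    \<bar>f d (th + dt) (\<lambda>k. y k + de k) - f d th y\<bar> \<le> C * (mvs n lam dt de)) \<and>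
   (\<exists>C\<ge>0. \<forall>th\<in>{lo..hi}. \<forall>dt y de. th + dt \<in> {lo..hi} -->
  \<bar>f d (th + dt) (\<lambda>k. y k + de k) - f d th y
    - (\<Sum>z\<in>moves n. mvc lam dt de z * f (bump d z) th y)
    - (\<Sum>z\<in>moves n. \<Sum>w'\<in>moves n. mvc lam dt de z * mvc lam dt de w' * f (bump (bump d z) w') th y) / 2\<bar>
   \<le> C * (mvs n lam dt de) ^ 3))"

lemma (in mixture) heat_family_mix:
 assumes "0 < lo" "lo \<le> hi"
 shows "heat_family n lam lo hi mx" unfolding heat_family_def by (intro allI conjI mix_bounded mix_lipschitz mix_taylor assms)

text \<open>Shifting the variance parameter lets the numerator run on the clock of the denominator
  and still have any prescribed variance at the final time.\<close>

lemma heat_family_shift: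
 assumes "heat_family n lam (lo + s) (hi + s) f"
 shows "heat_family n lam lo hi (\<lambda>d th. f d (th + s))" unfolding heat_family_def
proof (intro allI conjI)
 fix d
 have iff: "th \<in> {lo..hi} \<longleftrightarrow> th + s \<in> {lo + s..hi + s}" for th by auto
 have ac: "th + dt + s = th + s + dt" for th dt by simp
 note * = assms[unfolded heat_family_def, rule_format, of d]
 obtain C where C: "C \<ge> 0" "\<forall>th\<in>{lo+s..hi+s}. \<forall>y. \<bar>f d th y\<bar> \<le> C" using * by blast
 show "\<exists>C\<ge>0. \<forall>th\<in>{lo..hi}. \<forall>y. \<bar>f d (th + s) y\<bar> \<le> C" using C iff by (intro exI[of _ C]) simp
 obtain C where C: "C \<ge> 0" "\<forall>th\<in>{lo+s..hi+s}. \<forall>dt y de. th + dt \<in> {lo+s..hi+s} -->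
    \<bar>f d (th + dt) (\<lambda>k. y k + de k) - f d th y\<bar> \<le> C * (mvs n lam dt de)" using * by blast
 show "\<exists>C\<ge>0. \<forall>th\<in>{lo..hi}. \<forall>dt y de. th + dt \<in> {lo..hi} -->
    \<bar>f d (th + dt + s) (\<lambda>k. y k + de k) - f d (th + s) y\<bar> \<le> C * (mvs n lam dt de)" using C unfolding Ball_def iff ac by (intro exI[of _ C]) blast
 obtain C where C: "C \<ge> 0" "\<forall>th\<in>{lo+s..hi+s}. \<forall>dt y de. th + dt \<in> {lo+s..hi+s} -->
   \<bar>f d (th + dt) (\<lambda>k. y k + de k) - f d th y
    - (\<Sum>z\<in>moves n. mvc lam dt de z * f (bump d z) th y)
    - (\<Sum>z\<in>moves n. \<Sum>w'\<in>moves n. mvc lam dt de z * mvc lam dt de w' * f (bump (bump d z) w') th y) / 2\<bar>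
   \<le> C * (mvs n lam dt de) ^ 3" using * by blast
 show "\<exists>C\<ge>0. \<forall>th\<in>{lo..hi}. \<forall>dt y de. th + dt \<in> {lo..hi} -->
   \<bar>f d (th + dt + s) (\<lambda>k. y k + de k) - f d (th + s) y
    - (\<Sum>z\<in>moves n. mvc lam dt de z * f (bump d z) (th + s) y)
    - (\<Sum>z\<in>moves n. \<Sum>w'\<in>moves n. mvc lam dt de z * mvc lam dt de w' * f (bump (bump d z) w') (th + s) y) / 2\<bar>
   \<le> C * (mvs n lam dt de) ^ 3" using C unfolding Ball_def iff ac by (intro exI[of _ C]) blast
qed

lemma heat_family_bounded:
 assumes "heat_family n lam lo hi f" "finite D"
 shows "\<exists>C\<ge>0. \<forall>d\<in>D. \<forall>th\<in>{lo..hi}. \<forall>y. \<bar>f d th y\<bar> \<le> C" using assms(2)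
proof induction
 case empty show ?case by auto
next
 case (insert d D)
 then obtain C where C: "0 \<le> C" "\<forall>d\<in>D. \<forall>th\<in>{lo..hi}. \<forall>y. \<bar>f d th y\<bar> \<le> C" by blast
 obtain C' where C': "0 \<le> C'" "\<forall>th\<in>{lo..hi}. \<forall>y. \<bar>f d th y\<bar> \<le> C'"
  using assms(1)[unfolded heat_family_def, rule_format, of d] by blast
 show ?case using C C' by (intro exI[of _ "max C C'"]) (auto simp: le_max_iff_disj)
qed

section \<open>Coefficients in the expansion of a quotient of two heat solutions\<close>

definition qu where "qu N h th y = N z0 th y / h z0 th y"
 for N h :: "(nat => nat) => real => (nat => real) => real"

text \<open>By the quotient rule this is the derivative of \<open>N / h\<close> in coordinate k when
  the move is \<open>(k, 1)\<close>.\<close>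

definition qc where "qc N h z th y = (N (bump z0 z) th y - qu N h th y * h (bump z0 z) th y) / h z0 th y"

text \<open>For the move \<open>(k, 1)\<close> this is the k-th component of the gradient of
  \<open>log h\<close>, that is, the score.\<close>

definition ql where "ql h z th y = h (bump z0 z) th y / h z0 th y"
 for h :: "(nat => nat) => real => (nat => real) => real"

definition qe where "qe N h z w' th y =
 (N (bump (bump z0 z) w') th y - qu N h th y * h (bump (bump z0 z) w') th y) / h z0 th y"

text \<open>After symmetrisation in k and l this is half of the second derivative of
  \<open>N / h\<close>: the coefficient of a product of two noise displacements.\<close>

definition qg where "qg N h k l th y = qe N h (k, 1) (l, 1) th y / 2 - qc N h (k, 1) th y * ql h (l, 1) th y"

text \<open>Two single moves in one coordinate are one double move. Through this identity the
  squared noise meets the term that the heat equation contributes, and the two cancel in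
  expectation.\<close>

lemma qe_diag: "qe N h (k, 1) (k, 1) th y = qc N h (k, 2) th y"
proof -
 have "bump (bump z0 (k, 1)) (k, 1) = bump z0 (k, 2)" by (auto simp: bump_def)
 then show ?thesis by (simp add: qe_def qc_def)
qed

text \<open>The lower bound on \<open>h\<close> is required on a cube larger by 1 than the one in
  which the path is kept: a step from the inner cube that leaves the outer one has length at least
  1, and for such steps a cruder argument suffices.\<close>

locale heat_quotient =
 fixes n :: nat and lam :: "nat => real" and lo hi K m :: real
  and N h :: "(nat => nat) => real => (nat => real) => real"
 assumes N: "heat_family n lam lo hi N" and h: "heat_family n lam lo hi h"
  and lam_nonneg: "\<And>k. k < n ==> 0 \<le> lam k"
  and N_nonneg: "\<And>th y. th \<in> {lo..hi} ==> 0 \<le> N z0 th y"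
  and h_pos: "\<And>th y. th \<in> {lo..hi} ==> 0 < h z0 th y"
  and m_pos: "0 < m"
  and h_lower: "\<And>th y. th \<in> {lo..hi} ==> (\<And>k. k < n ==> \<bar>y k\<bar> \<le> K + 1) ==> m \<le> h z0 th y"
begin

definition indices :: "(nat => nat) set" where
 "indices = insert (\<lambda>_. 0) (bump z0 ` moves n \<union> (\<lambda>(z, w'). bump (bump z0 z) w') ` (moves n \<times> moves n))"

lemma indices_bound:
 "\<exists>B\<ge>0. \<forall>d\<in>indices. \<forall>th\<in>{lo..hi}. \<forall>y. \<bar>N d th y\<bar> \<le> B \<and> \<bar>h d th y\<bar> \<le> B"
proof -
 have "finite indices" by (simp add: indices_def)
 obtain A where A: "0 \<le> A" "\<forall>d\<in>indices. \<forall>th\<in>{lo..hi}. \<forall>y. \<bar>N d th y\<bar> \<le> A"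
  using heat_family_bounded[OF N \<open>finite indices\<close>] by blast
 obtain B where B: "0 \<le> B" "\<forall>d\<in>indices. \<forall>th\<in>{lo..hi}. \<forall>y. \<bar>h d th y\<bar> \<le> B"
  using heat_family_bounded[OF h \<open>finite indices\<close>] by blast
 show ?thesis using A B by (intro exI[of _ "max A B"]) (auto simp: le_max_iff_disj)
qed

lemma coefficient_bounds:
 "\<exists>b\<ge>0. \<forall>th\<in>{lo..hi}. \<forall>y. (\<forall>k<n. \<bar>y k\<bar> \<le> K) -->
  \<bar>qu N h th y\<bar> \<le> b \<and>
  (\<forall>z\<in>moves n. \<bar>qc N h z th y\<bar> \<le> b \<and> \<bar>ql h z th y\<bar> \<le> b \<and> (\<forall>w'\<in>moves n. \<bar>qe N h z w' th y\<bar> \<le> b)) \<and>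
  (\<forall>k<n. \<forall>l<n. \<bar>qg N h k l th y\<bar> \<le> b)"
proof -
 obtain B where B: "0 \<le> B" "\<forall>d\<in>indices. \<forall>th\<in>{lo..hi}. \<forall>y. \<bar>N d th y\<bar> \<le> B \<and> \<bar>h d th y\<bar> \<le> B"
  using indices_bound by blast
 define U where "U = B / m"
 define c where "c = (B + U * B) / m"
 have U: "0 \<le> U" and c: "0 \<le> c" using B m_pos by (auto simp: U_def c_def)
 define b where "b = U + c + c * U"
 have b: "0 \<le> b" "U \<le> b" "c \<le> b" "c / 2 + c * U \<le> b" using U c by (auto simp: b_def)
 have "\<bar>qu N h th y\<bar> \<le> b \<and>
  (\<forall>z\<in>moves n. \<bar>qc N h z th y\<bar> \<le> b \<and> \<bar>ql h z th y\<bar> \<le> b \<and> (\<forall>w'\<in>moves n. \<bar>qe N h z w' th y\<bar> \<le> b)) \<and>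
  (\<forall>k<n. \<forall>l<n. \<bar>qg N h k l th y\<bar> \<le> b)"
  if rng: "th \<in> {lo..hi}" and y: "\<forall>k<n. \<bar>y k\<bar> \<le> K" for th y
 proof -
  have hm: "m \<le> h z0 th y" using rng y by (intro h_lower) auto
  have div: "\<bar>x / h z0 th y\<bar> \<le> b / m" if "\<bar>x\<bar> \<le> b" for x b unfolding abs_divide using hm m_pos that by (intro frac_le) auto
  have u: "\<bar>qu N h th y\<bar> \<le> U" unfolding qu_def U_def using B(2) rng by (intro div) (auto simp: indices_def)
  have comb: "\<bar>(N d th y - qu N h th y * h d th y) / h z0 th y\<bar> \<le> c" if "d \<in> indices" for d unfolding c_def
  proof (rule div)
   have "\<bar>qu N h th y * h d th y\<bar> \<le> U * B" using B(2) rng that by (intro abs_mult_le u) auto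
   moreover have "\<bar>N d th y\<bar> \<le> B" using B(2) rng that by auto
   ultimately show "\<bar>N d th y - qu N h th y * h d th y\<bar> \<le> B + U * B" by linarith
  qed
  have c': "\<bar>qc N h z th y\<bar> \<le> c" if "z \<in> moves n" for z unfolding qc_def using that by (intro comb) (auto simp: indices_def)
  have l: "\<bar>ql h z th y\<bar> \<le> U" if "z \<in> moves n" for z unfolding ql_def U_def using that B(2) rng by (intro div) (auto simp: indices_def)
  have e: "\<bar>qe N h z w' th y\<bar> \<le> c" if "z \<in> moves n" "w' \<in> moves n" for z w' unfolding qe_def using that by (intro comb) (auto simp: indices_def)
  have g: "\<bar>qg N h k l th y\<bar> \<le> c / 2 + c * U" if "k < n" "l < n" for k l
  proof -
   have mm: "(k, 1) \<in> moves n" "(l, 1) \<in> moves n" using that by (auto simp: moves_def)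
   show ?thesis unfolding qg_def using abs_mult_le[OF c'[OF mm(1)] l[OF mm(2)]] e[OF mm] by linarith
  qed
  show ?thesis using u c' l e g b by (meson order_trans)
 qed
 then show ?thesis using b(1) by blast
qed

text \<open>When the step ends outside the cube the new value is replaced by 0. As the quotient is
  nonnegative this is consistent with an upper bound, and the quotient need not be estimated where
  its denominator may be small.\<close>

lemma quotient_taylor:
 "\<exists>C\<ge>0. \<forall>th\<in>{lo..hi}. \<forall>dt y de. th + dt \<in> {lo..hi} --> (\<forall>k<n. \<bar>y k\<bar> \<le> K) -->
  (if \<forall>k<n. \<bar>y k + de k\<bar> \<le> K then qu N h (th + dt) (\<lambda>k. y k + de k) else 0) \<le>
   qu N h th y + (\<Sum>z\<in>moves n. mvc lam dt de z * qc N h z th y)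
    + (\<Sum>z\<in>moves n. \<Sum>w'\<in>moves n. mvc lam dt de z * mvc lam dt de w' * qe N h z w' th y) / 2
    - (\<Sum>z\<in>moves n. mvc lam dt de z * qc N h z th y) * (\<Sum>z\<in>moves n. mvc lam dt de z * ql h z th y)
    + C * (mvs n lam dt de) ^ 3"
proof -
 obtain B where B: "0 \<le> B" "\<forall>d\<in>indices. \<forall>th\<in>{lo..hi}. \<forall>y. \<bar>N d th y\<bar> \<le> B \<and> \<bar>h d th y\<bar> \<le> B"
  using indices_bound by blast
 let ?z = "\<lambda>_::nat. 0::nat"
 obtain C1 where C1: "0 \<le> C1" "\<forall>th\<in>{lo..hi}. \<forall>dt y de. th + dt \<in> {lo..hi} -->
    \<bar>N ?z (th + dt) (\<lambda>k. y k + de k) - N ?z th y\<bar> \<le> C1 * (mvs n lam dt de)" using N unfolding heat_family_def by blast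
 obtain C2 where C2: "0 \<le> C2" "\<forall>th\<in>{lo..hi}. \<forall>dt y de. th + dt \<in> {lo..hi} -->
    \<bar>h ?z (th + dt) (\<lambda>k. y k + de k) - h ?z th y\<bar> \<le> C2 * (mvs n lam dt de)" using h unfolding heat_family_def by blast
 obtain C3 where C3: "0 \<le> C3" "\<forall>th\<in>{lo..hi}. \<forall>dt y de. th + dt \<in> {lo..hi} -->
  \<bar>N ?z (th + dt) (\<lambda>k. y k + de k) - N ?z th y
    - (\<Sum>z\<in>moves n. mvc lam dt de z * N (bump ?z z) th y)
    - (\<Sum>z\<in>moves n. \<Sum>w'\<in>moves n. mvc lam dt de z * mvc lam dt de w' * N (bump (bump ?z z) w') th y) / 2\<bar>
   \<le> C3 * (mvs n lam dt de) ^ 3" using N unfolding heat_family_def by blast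
 obtain C4 where C4: "0 \<le> C4" "\<forall>th\<in>{lo..hi}. \<forall>dt y de. th + dt \<in> {lo..hi} -->
  \<bar>h ?z (th + dt) (\<lambda>k. y k + de k) - h ?z th y
    - (\<Sum>z\<in>moves n. mvc lam dt de z * h (bump ?z z) th y)
    - (\<Sum>z\<in>moves n. \<Sum>w'\<in>moves n. mvc lam dt de z * mvc lam dt de w' * h (bump (bump ?z z) w') th y) / 2\<bar>
   \<le> C4 * (mvs n lam dt de) ^ 3" using h unfolding heat_family_def by blast
 define Q where "Q = qstep_const m B (max C1 C2) (max C3 C4)"
 have "(if \<forall>k<n. \<bar>y k + de k\<bar> \<le> K then qu N h (th + dt) (\<lambda>k. y k + de k) else 0) \<le>
   qu N h th y + (\<Sum>z\<in>moves n. mvc lam dt de z * qc N h z th y)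
    + (\<Sum>z\<in>moves n. \<Sum>w'\<in>moves n. mvc lam dt de z * mvc lam dt de w' * qe N h z w' th y) / 2
    - (\<Sum>z\<in>moves n. mvc lam dt de z * qc N h z th y) * (\<Sum>z\<in>moves n. mvc lam dt de z * ql h z th y)
    + max Q 0 * (mvs n lam dt de) ^ 3"
  if rng: "th \<in> {lo..hi}" "th + dt \<in> {lo..hi}" and y: "\<forall>k<n. \<bar>y k\<bar> \<le> K" for th dt y de
 proof -
  define c where "c = mvc lam dt de"
  define W where "W = (\<Sum>z\<in>moves n. \<bar>c z\<bar>)"
  define T1 where "T1 f = (\<Sum>z\<in>moves n. c z * f (bump ?z z) th y)" for f :: "(nat => nat) => real => (nat => real) => real"
  define T2 where "T2 f = (\<Sum>z\<in>moves n. \<Sum>w'\<in>moves n. c z * c w' * f (bump (bump ?z z) w') th y)" for f :: "(nat => nat) => real => (nat => real) => real"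
  have W: "0 \<le> W" unfolding W_def by (intro sum_nonneg) auto
  define N0 h0 N' h' where "N0 = N ?z th y" and "h0 = h ?z th y" and "N' = N ?z (th + dt) (\<lambda>k. y k + de k)"
   and "h' = h ?z (th + dt) (\<lambda>k. y k + de k)"
  have Bs: "\<bar>N d th y\<bar> \<le> B" "\<bar>h d th y\<bar> \<le> B" if "d \<in> indices" for d using B(2) rng that by auto
  have T1b: "\<bar>T1 f\<bar> \<le> B * W" if "\<And>d. d \<in> indices ==> \<bar>f d th y\<bar> \<le> B" for f
   unfolding T1_def W_def mult.commute[of B] by (rule abs_weighted_sum_le, rule that) (auto simp: indices_def)
  have T2b: "\<bar>T2 f\<bar> \<le> B * W\<^sup>2" if "\<And>d. d \<in> indices ==> \<bar>f d th y\<bar> \<le> B" for f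
  proof -
   have "T2 f = (\<Sum>z\<in>moves n. c z * (\<Sum>w'\<in>moves n. c w' * f (bump (bump ?z z) w') th y))" unfolding T2_def by (simp add: sum_distrib_left mult.assoc)
   also have "\<bar>\<dots>\<bar> \<le> W * (W * B)" unfolding W_def by (intro abs_weighted_sum_le that) (auto simp: indices_def)
   finally show ?thesis by (simp add: power2_eq_square ac_simps)
  qed
  have z_in: "?z \<in> indices" by (simp add: indices_def)
  have pre: "0 < m" "m \<le> h0" "0 \<le> N0" "N0 \<le> B" "h0 \<le> B" "0 \<le> W" "0 \<le> max C1 C2" "0 \<le> max C3 C4"
   "\<bar>N' - N0\<bar> \<le> max C1 C2 * W" "\<bar>h' - h0\<bar> \<le> max C1 C2 * W"
   "\<bar>T1 N\<bar> \<le> B * W" "\<bar>T1 h\<bar> \<le> B * W" "\<bar>T2 N\<bar> \<le> B * W\<^sup>2" "\<bar>T2 h\<bar> \<le> B * W\<^sup>2"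
   "\<bar>N' - N0 - T1 N - T2 N / 2\<bar> \<le> max C3 C4 * W ^ 3" "\<bar>h' - h0 - T1 h - T2 h / 2\<bar> \<le> max C3 C4 * W ^ 3"
  proof -
   show "m \<le> h0" unfolding h0_def using rng y by (intro h_lower) auto
   show "0 \<le> N0" unfolding N0_def using rng by (intro N_nonneg) auto
   show "N0 \<le> B" "h0 \<le> B" using Bs[OF z_in] by (auto simp: N0_def h0_def)
   show "\<bar>T1 N\<bar> \<le> B * W" "\<bar>T1 h\<bar> \<le> B * W" "\<bar>T2 N\<bar> \<le> B * W\<^sup>2" "\<bar>T2 h\<bar> \<le> B * W\<^sup>2"
    by (intro T1b T2b Bs; assumption)+
   have "\<bar>N' - N0\<bar> \<le> C1 * W" "\<bar>h' - h0\<bar> \<le> C2 * W" unfolding N'_def N0_def h'_def h0_def W_def c_def using C1(2) C2(2) rng by blast+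
   then show "\<bar>N' - N0\<bar> \<le> max C1 C2 * W" "\<bar>h' - h0\<bar> \<le> max C1 C2 * W"
    using mult_right_mono[OF max.cobounded1[of C1 C2] W] mult_right_mono[OF max.cobounded2[of C2 C1] W] by linarith+
   have "\<bar>N' - N0 - T1 N - T2 N / 2\<bar> \<le> C3 * W ^ 3" "\<bar>h' - h0 - T1 h - T2 h / 2\<bar> \<le> C4 * W ^ 3"
    unfolding N'_def N0_def h'_def h0_def W_def c_def T1_def T2_def using C3(2) C4(2) rng by blast+
   moreover have W3: "0 \<le> W ^ 3" using W by simp
   ultimately show "\<bar>N' - N0 - T1 N - T2 N / 2\<bar> \<le> max C3 C4 * W ^ 3" "\<bar>h' - h0 - T1 h - T2 h / 2\<bar> \<le> max C3 C4 * W ^ 3"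
    using mult_right_mono[OF max.cobounded1[of C3 C4] W3] mult_right_mono[OF max.cobounded2[of C4 C3] W3] by linarith+
  qed (use m_pos W C1 C3 in auto)
  have S1: "(T1 N - N0 / h0 * T1 h) / h0 = (\<Sum>z\<in>moves n. c z * qc N h z th y)" unfolding T1_def qc_def qu_def N0_def h0_def
   by (simp add: sum_distrib_left sum_subtractf[symmetric] sum_divide_distrib algebra_simps)
  have S2: "(T2 N - N0 / h0 * T2 h) / h0 = (\<Sum>z\<in>moves n. \<Sum>w'\<in>moves n. c z * c w' * qe N h z w' th y)" unfolding T2_def qe_def qu_def N0_def h0_def
   by (simp add: sum_distrib_left sum_subtractf[symmetric] sum_divide_distrib algebra_simps)
  have L: "T1 h / h0 = (\<Sum>z\<in>moves n. c z * ql h z th y)" unfolding T1_def ql_def h0_def by (simp add: sum_divide_distrib)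
  note step = quotient_step[OF pre, unfolded S1 S2 L]
  have N'0: "0 \<le> N'" unfolding N'_def using rng by (intro N_nonneg) auto
  have h'0: "0 < h'" unfolding h'_def using rng by (intro h_pos) auto
  define R where "R = N0 / h0 + (\<Sum>z\<in>moves n. c z * qc N h z th y)
    + (\<Sum>z\<in>moves n. \<Sum>w'\<in>moves n. c z * c w' * qe N h z w' th y) / 2
    - (\<Sum>z\<in>moves n. c z * qc N h z th y) * (\<Sum>z\<in>moves n. c z * ql h z th y)"
  have "(if \<forall>k<n. \<bar>y k + de k\<bar> \<le> K then N' / h' else 0) \<le> R + Q * W ^ 3"
  \<comment> \<open>Inside the larger cube the new denominator is at least \<open>m\<close> and the
    expansion applies. Otherwise some coordinate has moved by at least 1, the left side is 0, and
    the right side is nonnegative.\<close>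
  proof (cases "\<forall>k<n. \<bar>y k + de k\<bar> \<le> K + 1")
   case True
   have "m \<le> h'" unfolding h'_def using rng True by (intro h_lower) auto
   moreover have "\<bar>h'\<bar> \<le> B" using B(2) rng z_in unfolding h'_def by blast
   then have "h' \<le> B" by simp
   ultimately have "N' / h' \<le> R + Q * W ^ 3" using step(1) by (simp add: R_def Q_def)
   then show ?thesis using N'0 h'0 by (auto intro: order_trans[rotated])
  next
   case False
   then obtain k where k: "k < n" "\<not> \<bar>y k + de k\<bar> \<le> K + 1" by auto
   then have "1 \<le> \<bar>de k\<bar>" using y by (smt (verit))
   also have "\<dots> = \<bar>c (k, 1)\<bar>" by (simp add: c_def mvc_def)
   also have "\<dots> \<le> W" unfolding W_def by (rule member_le_sum) (use k in \<open>auto simp: moves_def\<close>)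
   finally have "0 \<le> R + Q * W ^ 3" using step(2) by (simp add: R_def Q_def)
   moreover have "\<not> (\<forall>k<n. \<bar>y k + de k\<bar> \<le> K)" using k by (smt (verit))
   ultimately show ?thesis by (simp only: if_False)
  qed
  also have "\<dots> \<le> R + max Q 0 * W ^ 3" using W by (intro add_left_mono mult_right_mono) auto
  finally show ?thesis unfolding R_def N'_def h'_def N0_def h0_def W_def qu_def[symmetric] c_def .
 qed
 then show ?thesis by (intro exI[of _ "max Q 0"] conjI ballI allI impI) auto
qed

text \<open>With w' of size \<open>sqrt dt\<close> every term on the left is of order
  \<open>dt\<close> to the power 3/2. The odd powers of w' are traded for even ones by the
  inequality between arithmetic and geometric means, because the second and fourth moments of the
  noise are available.\<close>

lemma step_error_le:
 fixes dt w' D A B c :: real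
 assumes "0 < dt" "dt \<le> D" "0 \<le> w'" "0 \<le> A" "0 \<le> B" "0 \<le> c"
 shows "A * dt * (2 * w' + c * dt) + B * (w' + c * dt) ^ 3 \<le>
  (A * (1 + c * sqrt D) + B * (2 + 4 * c ^ 3 * D * sqrt D)) * (sqrt dt * (dt + w'\<^sup>2 + w' ^ 4 / dt))"
proof -
 define s where "s = sqrt dt"
 have s: "0 < s" "s * s = dt" "s \<le> sqrt D" using assms by (auto simp: s_def)
 define E where "E = s * (dt + w'\<^sup>2 + w' ^ 4 / dt)"
 have q: "0 \<le> w'\<^sup>2" "0 \<le> w' ^ 4 / dt" using assms by auto
 have "2 * (s * w') \<le> dt + w'\<^sup>2" using sum_squares_bound[of s w'] s by (simp add: power2_eq_square)
 then have "s * (2 * (s * w')) \<le> s * (dt + w'\<^sup>2 + w' ^ 4 / dt)" using s q by (intro mult_left_mono) auto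
 moreover have "s * (2 * (s * w')) = 2 * (dt * w')" using s(2) by (metis mult.assoc mult.left_commute)
 ultimately have 1: "dt * (2 * w') \<le> E" unfolding E_def by linarith
 have 2: "dt * dt \<le> sqrt D * E"
 proof -
  have "dt * dt = s * (s * dt)" using s(2) by (metis mult.assoc)
  also have "\<dots> \<le> sqrt D * (s * (dt + w'\<^sup>2 + w' ^ 4 / dt))" using s q assms by (intro mult_mono mult_left_mono) auto
  finally show ?thesis by (simp add: E_def)
 qed
 have 3: "w' ^ 3 \<le> E / 2"
 proof -
  have "2 * (w' * (w' * w' / s)) \<le> w'\<^sup>2 + (w' * w' / s)\<^sup>2" using sum_squares_bound[of w' "w' * w' / s"] by (simp add: power2_eq_square)
  also have "(w' * w' / s)\<^sup>2 = w' ^ 4 / dt" using s by (simp add: power2_eq_square power4_eq_xxxx)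
  finally have "s * (2 * (w' * (w' * w' / s))) \<le> s * (dt + w'\<^sup>2 + w' ^ 4 / dt)" using s assms by (intro mult_left_mono) auto
  then show ?thesis using s by (simp add: E_def power3_eq_cube)
 qed
 have 4: "dt ^ 3 \<le> D * sqrt D * E"
 proof -
  have "dt ^ 3 = dt * (dt * dt)" by (simp add: power3_eq_cube)
  also have "\<dots> \<le> D * (sqrt D * E)" using 2 assms by (intro mult_mono[OF assms(2) 2]) auto
  finally show ?thesis by simp
 qed
 have 5: "(w' + c * dt) ^ 3 \<le> 4 * w' ^ 3 + 4 * (c ^ 3 * dt ^ 3)"
 proof -
  have gen: "(x + y) ^ 3 \<le> 4 * x ^ 3 + 4 * y ^ 3" if "0 \<le> x" "0 \<le> y" for x y :: real
  proof -
   have "4 * x ^ 3 + 4 * y ^ 3 - (x + y) ^ 3 = 3 * (x + y) * (x - y)\<^sup>2" by (simp add: power3_eq_cube power2_eq_square algebra_simps)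
   moreover have "0 \<le> 3 * (x + y) * (x - y)\<^sup>2" using that by simp
   ultimately show ?thesis by linarith
  qed
  show ?thesis using gen[of w' "c * dt"] assms by (simp add: power_mult_distrib)
 qed
 have "A * dt * (2 * w' + c * dt) = A * (dt * (2 * w') + c * (dt * dt))" by (simp add: algebra_simps)
 also have "\<dots> \<le> A * (E + c * (sqrt D * E))" using 1 2 assms by (intro mult_left_mono add_mono) auto
 finally have I: "A * dt * (2 * w' + c * dt) \<le> A * (1 + c * sqrt D) * E" by (simp add: algebra_simps)
 have "B * (w' + c * dt) ^ 3 \<le> B * (4 * (E / 2) + 4 * (c ^ 3 * (D * sqrt D * E)))" using 3 4 assms by (intro mult_left_mono order_trans[OF 5] add_mono) auto
 then have II: "B * (w' + c * dt) ^ 3 \<le> B * (2 + 4 * c ^ 3 * D * sqrt D) * E" by (simp add: algebra_simps)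
 show ?thesis using add_mono[OF I II] unfolding ring_distribs(2)[symmetric] unfolding E_def s_def .
qed

text \<open>The displacement consists of a part \<open>be\<close> of order dt and a noise part
  \<open>j\<close>. Of the quadratic terms only the products of two noise components are kept; all
  others go into the error. The variance parameter decreases by dt, whence the minus sign in front
  of the second-order move.\<close>

lemma quotient_step_bound:
 assumes C0: "0 \<le> C0"
 shows "\<exists>C\<ge>0. \<forall>th\<in>{lo..hi}. \<forall>dt y be j. 0 < dt --> th - dt \<in> {lo..hi} --> (\<forall>k<n. \<bar>y k\<bar> \<le> K) -->
  (\<forall>k<n. \<bar>be k\<bar> \<le> C0 * dt) -->
  (if \<forall>k<n. \<bar>y k + (be k + j k)\<bar> \<le> K then qu N h (th - dt) (\<lambda>k. y k + (be k + j k)) else 0) \<le>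
   qu N h th y + (\<Sum>k<n. (be k + j k) * qc N h (k, 1) th y) - dt / 2 * (\<Sum>k<n. lam k * qc N h (k, 2) th y)
    + (\<Sum>k<n. \<Sum>l<n. j k * j l * qg N h k l th y)
    + C * (sqrt dt * (dt + (\<Sum>k<n. (j k)\<^sup>2 + (j k) ^ 4 / dt)))"
proof -
 obtain b where b: "0 \<le> b" "\<forall>th\<in>{lo..hi}. \<forall>y. (\<forall>k<n. \<bar>y k\<bar> \<le> K) -->
  \<bar>qu N h th y\<bar> \<le> b \<and>
  (\<forall>z\<in>moves n. \<bar>qc N h z th y\<bar> \<le> b \<and> \<bar>ql h z th y\<bar> \<le> b \<and> (\<forall>w'\<in>moves n. \<bar>qe N h z w' th y\<bar> \<le> b)) \<and>
  (\<forall>k<n. \<forall>l<n. \<bar>qg N h k l th y\<bar> \<le> b)" using coefficient_bounds by blast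
 obtain C1 where C1: "0 \<le> C1" "\<forall>th\<in>{lo..hi}. \<forall>dt y de. th + dt \<in> {lo..hi} --> (\<forall>k<n. \<bar>y k\<bar> \<le> K) -->
  (if \<forall>k<n. \<bar>y k + de k\<bar> \<le> K then qu N h (th + dt) (\<lambda>k. y k + de k) else 0) \<le>
   qu N h th y + (\<Sum>z\<in>moves n. mvc lam dt de z * qc N h z th y)
    + (\<Sum>z\<in>moves n. \<Sum>w'\<in>moves n. mvc lam dt de z * mvc lam dt de w' * qe N h z w' th y) / 2
    - (\<Sum>z\<in>moves n. mvc lam dt de z * qc N h z th y) * (\<Sum>z\<in>moves n. mvc lam dt de z * ql h z th y)
    + C1 * (mvs n lam dt de) ^ 3" using quotient_taylor by blast
 define C5 where "C5 = C0 + (\<Sum>k<n. lam k)"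
 define C6 where "C6 = 2 * real n * C5"
 define bg where "bg = b / 2 + b * b"
 have lams: "0 \<le> (\<Sum>k<n. lam k)" by (intro sum_nonneg) (auto simp: lam_nonneg)
 have C5: "0 \<le> C5" using C0 lams by (simp add: C5_def)
 have C6: "0 \<le> C6" using C5 by (simp add: C6_def)
 have bg: "0 \<le> bg" using b by (simp add: bg_def)
 define D where "D = hi - lo"
 define C7 where "C7 = bg * C6 * (1 + C6 * sqrt D) + C1 * (2 + 4 * C6 ^ 3 * D * sqrt D)"
 define C where "C = \<bar>C7\<bar> * (1 + real n + real n ^ 3)"
 have "(if \<forall>k<n. \<bar>y k + (be k + j k)\<bar> \<le> K then qu N h (th - dt) (\<lambda>k. y k + (be k + j k)) else 0) \<le>
   qu N h th y + (\<Sum>k<n. (be k + j k) * qc N h (k, 1) th y) - dt / 2 * (\<Sum>k<n. lam k * qc N h (k, 2) th y)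
    + (\<Sum>k<n. \<Sum>l<n. j k * j l * qg N h k l th y)
    + C * (sqrt dt * (dt + (\<Sum>k<n. (j k)\<^sup>2 + (j k) ^ 4 / dt)))"
  if rng: "th \<in> {lo..hi}" "0 < dt" "th - dt \<in> {lo..hi}" and y: "\<forall>k<n. \<bar>y k\<bar> \<le> K"
   and beta: "\<forall>k<n. \<bar>be k\<bar> \<le> C0 * dt" for th dt y be j
 proof -
  define de where "de = (\<lambda>k. be k + j k)"
  define c where "c = mvc lam (- dt) de"
  \<comment> \<open>\<open>J\<close> is the noise part of the coefficients; what remains,
    \<open>r\<close>, is of order dt for both kinds of moves.\<close>
  define J where "J z = (if snd z = 1 then j (fst z) else 0)" for z :: "nat \<times> nat"
  define r where "r z = c z - J z" for z
  define w' where "w' = (\<Sum>k<n. \<bar>j k\<bar>)"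
  define W where "W = (\<Sum>z\<in>moves n. \<bar>c z\<bar>)"
  define G where "G z v = qe N h z v th y / 2 - qc N h z th y * ql h v th y" for z v
  have w0: "0 \<le> w'" and W0: "0 \<le> W" by (simp_all add: w'_def W_def sum_nonneg)
  have r: "\<bar>r z\<bar> \<le> C5 * dt" if "z \<in> moves n" for z
  proof -
   obtain k i where zz: "z = (k, i)" by (cases z)
   then have z: "z = (k, i)" "k < n" "i = 1 \<or> i = 2" using that by (auto simp: moves_def)
   have "lam k \<le> (\<Sum>k<n. lam k)" using z by (intro member_le_sum) (auto simp: lam_nonneg)
   then have lk: "lam k / 2 \<le> C5" "C0 \<le> C5" using C0 lam_nonneg[OF z(2)] lams by (auto simp: C5_def)
   show ?thesis
   proof (cases "i = 1")
    case True
    then have "\<bar>r z\<bar> \<le> C0 * dt" using z beta by (simp add: r_def c_def mvc_def J_def de_def)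
    also have "\<dots> \<le> C5 * dt" using lk rng by (intro mult_right_mono) auto
    finally show ?thesis .
   next
    case False
    then have "\<bar>r z\<bar> = lam k / 2 * dt" using z rng lam_nonneg[OF z(2)] by (simp add: r_def c_def mvc_def J_def abs_mult)
    also have "\<dots> \<le> C5 * dt" using lk rng by (intro mult_right_mono) auto
    finally show ?thesis .
   qed
  qed
  have sr: "(\<Sum>z\<in>moves n. \<bar>r z\<bar>) \<le> C6 * dt"
  proof -
   have "(\<Sum>z\<in>moves n. \<bar>r z\<bar>) \<le> real (card (moves n)) * (C5 * dt)" by (rule sum_bounded_above) (rule r)
   also have "card (moves n) = n * 2" by (simp add: moves_def card_cartesian_product)
   finally show ?thesis by (simp add: C6_def)
  qed
  have sJ: "(\<Sum>z\<in>moves n. \<bar>J z\<bar>) = w'" unfolding sum_moves J_def w'_def by simp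
  have "W \<le> (\<Sum>z\<in>moves n. \<bar>J z\<bar> + \<bar>r z\<bar>)" unfolding W_def r_def by (intro sum_mono) linarith
  then have Ww: "W \<le> w' + C6 * dt" using sr sJ by (simp add: sum.distrib)
  have bs: "\<bar>qc N h z th y\<bar> \<le> b" "\<bar>ql h z th y\<bar> \<le> b" "z' \<in> moves n ==> \<bar>qe N h z z' th y\<bar> \<le> b" if "z \<in> moves n" for z z'
   using b(2) rng y that by auto
  have G: "\<bar>G z v\<bar> \<le> bg" if "z \<in> moves n" "v \<in> moves n" for z v
   unfolding G_def bg_def using abs_mult_le[OF bs(1)[OF that(1)] bs(2)[OF that(2)]] bs(3)[OF that] by linarith
  have lin: "(\<Sum>z\<in>moves n. c z * qc N h z th y) = (\<Sum>k<n. (be k + j k) * qc N h (k, 1) th y) - dt / 2 * (\<Sum>k<n. lam k * qc N h (k, 2) th y)"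
   unfolding sum_moves c_def mvc_def de_def by (simp add: sum.distrib sum_distrib_left sum_negf sum_subtractf mult.assoc)
  have quad: "(\<Sum>z\<in>moves n. \<Sum>w'\<in>moves n. c z * c w' * qe N h z w' th y) / 2
    - (\<Sum>z\<in>moves n. c z * qc N h z th y) * (\<Sum>z\<in>moves n. c z * ql h z th y)
    = (\<Sum>z\<in>moves n. \<Sum>v\<in>moves n. c z * c v * G z v)" unfolding G_def sum_product by (simp add: sum_divide_distrib sum_subtractf[symmetric] algebra_simps)
  have JJ: "(\<Sum>z\<in>moves n. \<Sum>v\<in>moves n. J z * J v * G z v) = (\<Sum>k<n. \<Sum>l<n. j k * j l * qg N h k l th y)"
   unfolding sum_moves J_def G_def qg_def by simp
  \<comment> \<open>In the bilinear form c is replaced by \<open>J\<close> in one argument at a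
    time; each of the two corrections contains a factor \<open>r\<close>.\<close>
  have diff: "(\<Sum>z\<in>moves n. \<Sum>v\<in>moves n. c z * c v * G z v) - (\<Sum>z\<in>moves n. \<Sum>v\<in>moves n. J z * J v * G z v)
   = (\<Sum>z\<in>moves n. r z * (\<Sum>v\<in>moves n. c v * G z v)) + (\<Sum>z\<in>moves n. J z * (\<Sum>v\<in>moves n. r v * G z v))"
   unfolding r_def by (simp add: sum_distrib_left sum_subtractf[symmetric] sum.distrib[symmetric] algebra_simps)
  have "\<bar>\<Sum>z\<in>moves n. r z * (\<Sum>v\<in>moves n. c v * G z v)\<bar> \<le> (\<Sum>z\<in>moves n. \<bar>r z\<bar>) * (W * bg)"
   unfolding W_def by (intro abs_weighted_sum_le G)
  also have "\<dots> \<le> C6 * dt * ((w' + C6 * dt) * bg)" using sr Ww bg W0 C6 rng by (intro mult_mono) auto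
  finally have d1: "\<bar>\<Sum>z\<in>moves n. r z * (\<Sum>v\<in>moves n. c v * G z v)\<bar> \<le> C6 * dt * ((w' + C6 * dt) * bg)" .
  have "\<bar>\<Sum>z\<in>moves n. J z * (\<Sum>v\<in>moves n. r v * G z v)\<bar> \<le> (\<Sum>z\<in>moves n. \<bar>J z\<bar>) * ((\<Sum>z\<in>moves n. \<bar>r z\<bar>) * bg)"
   by (intro abs_weighted_sum_le G)
  also have "\<dots> \<le> w' * (C6 * dt * bg)" unfolding sJ using sr bg w0 by (intro mult_left_mono mult_right_mono) auto
  finally have d2: "\<bar>\<Sum>z\<in>moves n. J z * (\<Sum>v\<in>moves n. r v * G z v)\<bar> \<le> w' * (C6 * dt * bg)" .
  have quad_le: "(\<Sum>z\<in>moves n. \<Sum>v\<in>moves n. c z * c v * G z v) \<le> (\<Sum>k<n. \<Sum>l<n. j k * j l * qg N h k l th y)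
    + bg * C6 * dt * (2 * w' + C6 * dt)"
  proof -
   have "C6 * dt * ((w' + C6 * dt) * bg) + w' * (C6 * dt * bg) = bg * C6 * dt * (2 * w' + C6 * dt)" by (simp add: algebra_simps)
   then show ?thesis using d1 d2 diff JJ by linarith
  qed
  have cub: "C1 * W ^ 3 \<le> C1 * (w' + C6 * dt) ^ 3" using Ww W0 C1 by (intro mult_left_mono power_mono) auto
  have D: "dt \<le> D" using rng by (auto simp: D_def)
  have err: "bg * C6 * dt * (2 * w' + C6 * dt) + C1 * (w' + C6 * dt) ^ 3 \<le> C7 * (sqrt dt * (dt + w'\<^sup>2 + w' ^ 4 / dt))"
   unfolding C7_def using rng D w0 bg C6 C1 by (intro step_error_le) auto
  \<comment> \<open>The Cauchy-Schwarz inequality, used twice more for \<open>w4\<close>, passes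
    from powers of a sum to sums of powers, whose expectations are known coordinate by
    coordinate.\<close>
  have w2: "w'\<^sup>2 \<le> real n * (\<Sum>k<n. (j k)\<^sup>2)"
   using sum_squared_le_sum_of_squares[of "\<lambda>k. \<bar>j k\<bar>" "{..<n}"] by (simp add: w'_def mult.commute)
  have w4: "w' ^ 4 \<le> real n ^ 3 * (\<Sum>k<n. (j k) ^ 4)"
  proof -
   have "w' ^ 4 = (w'\<^sup>2)\<^sup>2" by simp
   also have "\<dots> \<le> (real n * (\<Sum>k<n. (j k)\<^sup>2))\<^sup>2" by (intro power_mono w2) simp
   also have "\<dots> = (real n)\<^sup>2 * (\<Sum>k<n. (j k)\<^sup>2)\<^sup>2" by (simp add: power_mult_distrib)
   also have "\<dots> \<le> (real n)\<^sup>2 * (real n * (\<Sum>k<n. ((j k)\<^sup>2)\<^sup>2))"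
    (is "_ \<le> (real n)\<^sup>2 * (real n * ?s)")
    using sum_squared_le_sum_of_squares[of "\<lambda>k. (j k)\<^sup>2" "{..<n}"] by (intro mult_left_mono) (simp_all add: mult.commute)
   also have "(real n)\<^sup>2 * (real n * ?s) = real n ^ 3 * ?s" by (simp add: power2_eq_square power3_eq_cube)
   finally show ?thesis by simp
  qed
  have "C7 * (sqrt dt * (dt + w'\<^sup>2 + w' ^ 4 / dt)) \<le> \<bar>C7\<bar> * (sqrt dt * ((1 + real n + real n ^ 3) * (dt + (\<Sum>k<n. (j k)\<^sup>2 + (j k) ^ 4 / dt))))"
  proof (rule mult_mono)
   have "w' ^ 4 / dt \<le> real n ^ 3 * (\<Sum>k<n. (j k) ^ 4) / dt" using w4 rng by (intro divide_right_mono) auto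
   then have "dt + w'\<^sup>2 + w' ^ 4 / dt \<le> dt + real n * (\<Sum>k<n. (j k)\<^sup>2) + real n ^ 3 * ((\<Sum>k<n. (j k) ^ 4) / dt)" using w2 by simp
   also have "\<dots> \<le> (1 + real n + real n ^ 3) * dt + (1 + real n + real n ^ 3) * (\<Sum>k<n. (j k)\<^sup>2) + (1 + real n + real n ^ 3) * ((\<Sum>k<n. (j k) ^ 4) / dt)"
   proof (intro add_mono mult_right_mono)
    have "1 * dt \<le> (1 + real n + real n ^ 3) * dt" using rng by (intro mult_right_mono) auto
    then show "dt \<le> (1 + real n + real n ^ 3) * dt" by simp
   qed (use rng in \<open>auto intro!: sum_nonneg divide_nonneg_pos\<close>)
   also have "\<dots> = (1 + real n + real n ^ 3) * (dt + (\<Sum>k<n. (j k)\<^sup>2 + (j k) ^ 4 / dt))" by (simp add: sum.distrib sum_divide_distrib algebra_simps)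
   finally show "sqrt dt * (dt + w'\<^sup>2 + w' ^ 4 / dt) \<le> sqrt dt * ((1 + real n + real n ^ 3) * (dt + (\<Sum>k<n. (j k)\<^sup>2 + (j k) ^ 4 / dt)))"
    using rng by (intro mult_left_mono) auto
  qed (use rng w0 in auto)
  also have "\<dots> = C * (sqrt dt * (dt + (\<Sum>k<n. (j k)\<^sup>2 + (j k) ^ 4 / dt)))" by (simp add: C_def ac_simps)
  finally have err': "bg * C6 * dt * (2 * w' + C6 * dt) + C1 * (w' + C6 * dt) ^ 3 \<le> C * (sqrt dt * (dt + (\<Sum>k<n. (j k)\<^sup>2 + (j k) ^ 4 / dt)))"
   using err by linarith
  define lhs where "lhs = (if \<forall>k<n. \<bar>y k + de k\<bar> \<le> K then qu N h (th + (- dt)) (\<lambda>k. y k + de k) else 0)"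
  have rng': "th + - dt \<in> {lo..hi}" using rng by simp
  have "lhs \<le>
   qu N h th y + (\<Sum>z\<in>moves n. c z * qc N h z th y)
    + (\<Sum>z\<in>moves n. \<Sum>w'\<in>moves n. c z * c w' * qe N h z w' th y) / 2
    - (\<Sum>z\<in>moves n. c z * qc N h z th y) * (\<Sum>z\<in>moves n. c z * ql h z th y) + C1 * W ^ 3"
   unfolding c_def W_def lhs_def by (rule C1(2)[rule_format, OF rng(1) rng']) (use y in auto)
  then have "lhs \<le> qu N h th y + (\<Sum>z\<in>moves n. c z * qc N h z th y) + (\<Sum>k<n. \<Sum>l<n. j k * j l * qg N h k l th y)
    + C * (sqrt dt * (dt + (\<Sum>k<n. (j k)\<^sup>2 + (j k) ^ 4 / dt)))" using quad quad_le cub err' by linarith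
  moreover have "th + - dt = th - dt" by simp
  ultimately show ?thesis unfolding lhs_def de_def lin by (simp only: add_diff_eq)
 qed
 moreover have "0 \<le> C" unfolding C_def by simp
 ultimately show ?thesis by (intro exI[of _ C] conjI ballI allI impI) auto
qed

end

section \<open>Wiener integrals of deterministic functions\<close>

lemma power2_add_le: "(x + y)\<^sup>2 \<le> 2 * x\<^sup>2 + 2 * (y::real)\<^sup>2" using sum_squares_bound[of x y] by (simp add: power2_sum)

lemma nn_integral_power2_add_le:
 assumes [measurable]: "f \<in> borel_measurable M" "g \<in> borel_measurable M"
 shows "(\<integral>\<^sup>+x. ennreal ((f x + g x :: real)\<^sup>2) \<partial>M) \<le> 2 * (\<integral>\<^sup>+x. ennreal ((f x)\<^sup>2) \<partial>M) + 2 * (\<integral>\<^sup>+x. ennreal ((g x)\<^sup>2) \<partial>M)"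
proof -
 have "(\<integral>\<^sup>+x. ennreal ((f x + g x)\<^sup>2) \<partial>M) \<le> (\<integral>\<^sup>+x. 2 * ennreal ((f x)\<^sup>2) + 2 * ennreal ((g x)\<^sup>2) \<partial>M)"
 proof (rule nn_integral_mono)
  fix x
  have "ennreal ((f x + g x)\<^sup>2) \<le> ennreal (2 * (f x)\<^sup>2 + 2 * (g x)\<^sup>2)" by (intro ennreal_leI power2_add_le)
  then show "ennreal ((f x + g x)\<^sup>2) \<le> 2 * ennreal ((f x)\<^sup>2) + 2 * ennreal ((g x)\<^sup>2)" by (simp add: ennreal_plus ennreal_mult)
 qed
 also have "\<dots> = 2 * (\<integral>\<^sup>+x. ennreal ((f x)\<^sup>2) \<partial>M) + 2 * (\<integral>\<^sup>+x. ennreal ((g x)\<^sup>2) \<partial>M)"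
  by (simp add: nn_integral_add nn_integral_cmult)
 finally show ?thesis .
qed

lemma tendsto_power2_combination:
 fixes f g :: "nat => 'a => real"
 assumes [measurable]: "\<And>j. f j \<in> borel_measurable N" "\<And>j. g j \<in> borel_measurable N"
  and "(\<lambda>j. \<integral>\<^sup>+x. ennreal ((f j x)\<^sup>2) \<partial>N) \<longlonglongrightarrow> 0" "(\<lambda>j. \<integral>\<^sup>+x. ennreal ((g j x)\<^sup>2) \<partial>N) \<longlonglongrightarrow> 0"
 shows "(\<lambda>j. \<integral>\<^sup>+x. ennreal ((a * f j x + b * g j x)\<^sup>2) \<partial>N) \<longlonglongrightarrow> 0"
proof (rule tendsto_sandwich[OF _ _ tendsto_const])
 have "(\<integral>\<^sup>+x. ennreal ((a * f j x + b * g j x)\<^sup>2) \<partial>N) \<le> 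
  2 * (ennreal (a\<^sup>2) * (\<integral>\<^sup>+x. ennreal ((f j x)\<^sup>2) \<partial>N)) + 2 * (ennreal (b\<^sup>2) * (\<integral>\<^sup>+x. ennreal ((g j x)\<^sup>2) \<partial>N))" for j
  using nn_integral_power2_add_le[of "\<lambda>x. a * f j x" N "\<lambda>x. b * g j x"] by (simp add: power_mult_distrib ennreal_mult nn_integral_cmult)
 then show "\<forall>\<^sub>F j in sequentially. (\<integral>\<^sup>+x. ennreal ((a * f j x + b * g j x)\<^sup>2) \<partial>N) \<le> 
  2 * (ennreal (a\<^sup>2) * (\<integral>\<^sup>+x. ennreal ((f j x)\<^sup>2) \<partial>N)) + 2 * (ennreal (b\<^sup>2) * (\<integral>\<^sup>+x. ennreal ((g j x)\<^sup>2) \<partial>N))"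
  by simp
 have "(\<lambda>j. 2 * (ennreal (a\<^sup>2) * (\<integral>\<^sup>+x. ennreal ((f j x)\<^sup>2) \<partial>N)) + 2 * (ennreal (b\<^sup>2) * (\<integral>\<^sup>+x. ennreal ((g j x)\<^sup>2) \<partial>N)))
  \<longlonglongrightarrow> 2 * (ennreal (a\<^sup>2) * 0) + 2 * (ennreal (b\<^sup>2) * 0)" by (intro tendsto_add ennreal_tendsto_cmult assms) auto
 then show "(\<lambda>j. 2 * (ennreal (a\<^sup>2) * (\<integral>\<^sup>+x. ennreal ((f j x)\<^sup>2) \<partial>N)) + 2 * (ennreal (b\<^sup>2) * (\<integral>\<^sup>+x. ennreal ((g j x)\<^sup>2) \<partial>N))) \<longlonglongrightarrow> 0"
  by simp
qed simp

text \<open>A step function is a list of triples (height, left end, right end) whose intervals may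
  overlap. Sums are concatenations, so linearity requires no common refinement of
  partitions.\<close>

type_synonym step_list = "(real \<times> real \<times> real) list"

definition step_fun :: "step_list => real => real" where
 "step_fun l r = (\<Sum>(c, s, t)\<leftarrow>l. c * indicator {s<..t} r)"

definition step_int :: "(real => 'w' => real) => step_list => 'w' => real" where
 "step_int B l w = (\<Sum>(c, s, t)\<leftarrow>l. c * (B t w - B s w))"

definition scale_steps :: "real => step_list => step_list" where
 "scale_steps a l = map (\<lambda>(c, s, t). (a * c, s, t)) l"

lemma step_fun_simps [simp]:
 "step_fun [] r = 0" "step_fun ((c, s, t) # l) r = c * indicator {s<..t} r + step_fun l r"
 "step_fun (l @ l') r = step_fun l r + step_fun l' r"
 "step_fun (scale_steps a l) r = a * step_fun l r" by (auto simp: step_fun_def scale_steps_def o_def split_beta sum_list_const_mult[symmetric] mult.assoc)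

lemma step_int_simps [simp]:
 "step_int B [] w = 0" "step_int B ((c, s, t) # l) w = c * (B t w - B s w) + step_int B l w"
 "step_int B (l @ l') w = step_int B l w + step_int B l' w"
 "step_int B (scale_steps a l) w = a * step_int B l w" by (auto simp: step_int_def scale_steps_def o_def split_beta sum_list_const_mult[symmetric] mult.assoc)

lemma borel_measurable_step_fun [measurable]: "step_fun l \<in> borel_measurable borel"
proof (induction l)
 case Nil
 then show ?case by (simp add: step_fun_def[abs_def])
next
 case (Cons x l)
 obtain c s t where "x = (c, s, t)" by (cases x)
 then have "step_fun (x # l) = (\<lambda>r. c * indicator {s<..t} r + step_fun l r)" by (intro ext) simp
 then show ?case using Cons by simp
qed

text \<open>Only the covariance of increments enters the isometry: the overlap of the two time
  intervals, times a variance rate q. Any scalar component of a Wiener process has this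
  form.\<close>

locale wiener_isometry = prob_space M for M :: "'w' measure" +
 fixes B :: "real => 'w' => real" and I :: "real set" and q :: real
 assumes B_measurable: "\<And>t. t \<in> I ==> B t \<in> borel_measurable M"
  and q_nonneg: "0 \<le> q"
  and integrable_increments: "\<And>s t u v. s \<in> I ==> t \<in> I ==> u \<in> I ==> v \<in> I ==> s \<le> t ==> u \<le> v ==>
   integrable M (\<lambda>w. (B t w - B s w) * (B v w - B u w))"
  and cov_increments: "\<And>s t u v. s \<in> I ==> t \<in> I ==> u \<in> I ==> v \<in> I ==> s \<le> t ==> u \<le> v ==>
   (\<integral>w. (B t w - B s w) * (B v w - B u w) \<partial>M) = q * measure lborel ({s<..t} \<inter> {u<..v})"
begin

definition valid :: "step_list => bool" where
 "valid l \<longleftrightarrow> (\<forall>(c, s, t)\<in>set l. s \<in> I \<and> t \<in> I \<and> s \<le> t)"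

lemma valid_simps [simp]: "valid []" "valid ((c, s, t) # l) \<longleftrightarrow> s \<in> I \<and> t \<in> I \<and> s \<le> t \<and> valid l"
 "valid (l @ l') \<longleftrightarrow> valid l \<and> valid l'" "valid l ==> valid (scale_steps a l)"
 unfolding valid_def scale_steps_def set_append ball_Un by auto

lemma borel_measurable_step_int: "valid l ==> step_int B l \<in> borel_measurable M"
proof (induction l)
 case Nil
 then show ?case by (simp add: step_int_def[abs_def])
next
 case (Cons x l)
 obtain c s t where x: "x = (c, s, t)" by (cases x)
 then have "step_int B (x # l) = (\<lambda>w. c * (B t w - B s w) + step_int B l w)" by (intro ext) simp
 then show ?case using Cons x B_measurable by auto
qed

text \<open>The isometry is stated in polarised form because squares of sums would not permit an
  induction over each list separately.\<close>

lemma step_isometry_bilinear: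
 assumes "valid l" "valid l'"
 shows "integrable M (\<lambda>w. step_int B l w * step_int B l' w)"
  "integrable lborel (\<lambda>r. step_fun l r * step_fun l' r)"
  "(\<integral>w. step_int B l w * step_int B l' w \<partial>M) = q * (\<integral>r. step_fun l r * step_fun l' r \<partial>lborel)"
proof -
 have ind: "(\<lambda>r. indicator {s<..t} r * indicator {u<..v} r :: real) = indicator ({s<..t} \<inter> {u<..v})" for s t u v :: real by (auto simp: indicator_def)
 have fin: "emeasure lborel ({s<..t} \<inter> {u<..v}) < \<infinity>" for s t u v :: real
  by (rule le_less_trans[OF emeasure_mono[of _ "{s..t}"]]) (auto simp: emeasure_lborel_Icc_eq)
 have single: "integrable M (\<lambda>w. (B t w - B s w) * step_int B l' w) \<and>
  integrable lborel (\<lambda>r. indicator {s<..t} r * step_fun l' r) \<and>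
  (\<integral>w. (B t w - B s w) * step_int B l' w \<partial>M) = q * (\<integral>r. indicator {s<..t} r * step_fun l' r \<partial>lborel)"
  if st: "s \<in> I" "t \<in> I" "s \<le> t" for s t using assms(2)
 proof (induction l')
  case (Cons x l')
  obtain c u v where x: "x = (c, u, v)" by (cases x)
  note uv = Cons.prems[unfolded x, simplified]
  have i1: "integrable M (\<lambda>w. (B t w - B s w) * (B v w - B u w))" using uv st by (intro integrable_increments) auto
  have i2: "integrable lborel (\<lambda>r. indicator {s<..t} r * indicator {u<..v} r :: real)" unfolding ind by (intro integrable_real_indicator fin) auto
  have e1: "(\<lambda>w. (B t w - B s w) * step_int B (x # l') w) = 
    (\<lambda>w. c * ((B t w - B s w) * (B v w - B u w)) + (B t w - B s w) * step_int B l' w)" unfolding x by (simp add: algebra_simps)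
  have e2: "(\<lambda>r. indicator {s<..t} r * step_fun (x # l') r) = 
    (\<lambda>r. c * (indicator {s<..t} r * indicator {u<..v} r) + indicator {s<..t} r * step_fun l' r)" unfolding x by (simp add: algebra_simps)
  have ii: "(\<integral>w. (B t w - B s w) * (B v w - B u w) \<partial>M) = q * (\<integral>r. indicator {s<..t} r * indicator {u<..v} r \<partial>lborel)"
   unfolding ind using uv st by (subst cov_increments) auto
  have "valid l'" using uv by simp
  from Cons.IH[OF this] have IH: "integrable M (\<lambda>w. (B t w - B s w) * step_int B l' w)"
    "integrable lborel (\<lambda>r. indicator {s<..t} r * step_fun l' r)"
    "(\<integral>w. (B t w - B s w) * step_int B l' w \<partial>M) = q * (\<integral>r. indicator {s<..t} r * step_fun l' r \<partial>lborel)" by auto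
  show ?case unfolding e1 e2 Bochner_Integration.integral_add[OF integrable_mult_right[OF i1] IH(1)]
    Bochner_Integration.integral_add[OF integrable_mult_right[OF i2] IH(2)]
    integral_mult_right_zero ii IH(3) by (intro conjI Bochner_Integration.integrable_add integrable_mult_right i1 i2 IH) algebra
 qed simp
 have "integrable M (\<lambda>w. step_int B l w * step_int B l' w) \<and>
  integrable lborel (\<lambda>r. step_fun l r * step_fun l' r) \<and>
  (\<integral>w. step_int B l w * step_int B l' w \<partial>M) = q * (\<integral>r. step_fun l r * step_fun l' r \<partial>lborel)" using assms(1)
 proof (induction l)
  case (Cons x l)
  obtain c s t where x: "x = (c, s, t)" by (cases x)
  note st = Cons.prems[unfolded x, simplified]
  have e1: "(\<lambda>w. step_int B (x # l) w * step_int B l' w) = 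
    (\<lambda>w. c * ((B t w - B s w) * step_int B l' w) + step_int B l w * step_int B l' w)" unfolding x by (simp add: algebra_simps)
  have e2: "(\<lambda>r. step_fun (x # l) r * step_fun l' r) = 
    (\<lambda>r. c * (indicator {s<..t} r * step_fun l' r) + step_fun l r * step_fun l' r)" unfolding x by (simp add: algebra_simps)
  have "valid l" using st by simp
  from Cons.IH[OF this] have IH: "integrable M (\<lambda>w. step_int B l w * step_int B l' w)"
   "integrable lborel (\<lambda>r. step_fun l r * step_fun l' r)"
   "(\<integral>w. step_int B l w * step_int B l' w \<partial>M) = q * (\<integral>r. step_fun l r * step_fun l' r \<partial>lborel)" by auto
  have s: "integrable M (\<lambda>w. (B t w - B s w) * step_int B l' w)"
    "integrable lborel (\<lambda>r. indicator {s<..t} r * step_fun l' r)"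
    "(\<integral>w. (B t w - B s w) * step_int B l' w \<partial>M) = q * (\<integral>r. indicator {s<..t} r * step_fun l' r \<partial>lborel)" using single[of s t] st by auto
  show ?case unfolding e1 e2 Bochner_Integration.integral_add[OF integrable_mult_right[OF s(1)] IH(1)]
    Bochner_Integration.integral_add[OF integrable_mult_right[OF s(2)] IH(2)]
    integral_mult_right_zero s(3) IH(3) by (intro conjI Bochner_Integration.integrable_add integrable_mult_right s IH) algebra
 qed simp
 then show "integrable M (\<lambda>w. step_int B l w * step_int B l' w)"
  "integrable lborel (\<lambda>r. step_fun l r * step_fun l' r)"
  "(\<integral>w. step_int B l w * step_int B l' w \<partial>M) = q * (\<integral>r. step_fun l r * step_fun l' r \<partial>lborel)" by auto
qed

lemma step_isometry:
 assumes "valid l"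
 shows "(\<integral>\<^sup>+w. ennreal ((step_int B l w)\<^sup>2) \<partial>M) = ennreal q * (\<integral>\<^sup>+r. ennreal ((step_fun l r)\<^sup>2) \<partial>lborel)"
proof -
 note * = step_isometry_bilinear[OF assms assms, folded power2_eq_square]
 show ?thesis using * q_nonneg by (simp add: nn_integral_eq_integral ennreal_mult)
qed

text \<open>\<open>J\<close> is a version of the integral of \<open>f\<close> over the whole line.
  An integral up to time t is encoded by cutting \<open>f\<close> off at t, so that differences of
  such integrals are again integrals.\<close>

definition wint :: "(real => real) => ('w' => real) => bool" where
 "wint f J \<longleftrightarrow> f \<in> borel_measurable borel \<and> J \<in> borel_measurable M \<and>
  (\<exists>l. (\<forall>j::nat. valid (l j)) \<and>
    (\<lambda>j. \<integral>\<^sup>+r. ennreal ((f r - step_fun (l j) r)\<^sup>2) \<partial>lborel) \<longlonglongrightarrow> 0 \<and>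
    (\<lambda>j. \<integral>\<^sup>+w. ennreal ((J w - step_int B (l j) w)\<^sup>2) \<partial>M) \<longlonglongrightarrow> 0)"

lemma wint_step: "valid l ==> wint (step_fun l) (step_int B l)"
 unfolding wint_def using borel_measurable_step_int by (auto intro!: exI[of _ "\<lambda>_. l"])

text \<open>Passing to the approximating step functions and back uses
  \<open>(x + y)^2 <= 2 * x^2 + 2 * y^2\<close> twice, which is the origin of the factor 4. The
  bound is applied only to integrands that are zero almost everywhere or tend to 0.\<close>

lemma wint_bound:
 assumes "wint f J"
 shows "(\<integral>\<^sup>+w. ennreal ((J w)\<^sup>2) \<partial>M) \<le> ennreal (4 * q) * (\<integral>\<^sup>+r. ennreal ((f r)\<^sup>2) \<partial>lborel)"
proof -
 obtain l where [measurable]: "f \<in> borel_measurable borel" "J \<in> borel_measurable M" and l: "\<And>j::nat. valid (l j)"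
  and f: "(\<lambda>j. \<integral>\<^sup>+r. ennreal ((f r - step_fun (l j) r)\<^sup>2) \<partial>lborel) \<longlonglongrightarrow> 0"
  and J: "(\<lambda>j. \<integral>\<^sup>+w. ennreal ((J w - step_int B (l j) w)\<^sup>2) \<partial>M) \<longlonglongrightarrow> 0" using assms unfolding wint_def by blast
 let ?ep = "\<lambda>j. \<integral>\<^sup>+r. ennreal ((f r - step_fun (l j) r)\<^sup>2) \<partial>lborel"
 let ?de = "\<lambda>j. \<integral>\<^sup>+w. ennreal ((J w - step_int B (l j) w)\<^sup>2) \<partial>M"
 let ?F = "\<integral>\<^sup>+r. ennreal ((f r)\<^sup>2) \<partial>lborel"
 have le: "(\<integral>\<^sup>+w. ennreal ((J w)\<^sup>2) \<partial>M) \<le> ennreal (4 * q) * ?F + (ennreal (4 * q) * ?ep j + 2 * ?de j)" for j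
 proof -
  have [measurable]: "step_int B (l j) \<in> borel_measurable M" by (rule borel_measurable_step_int[OF l])
  have "(\<integral>\<^sup>+w. ennreal ((J w)\<^sup>2) \<partial>M) \<le> 2 * (\<integral>\<^sup>+w. ennreal ((step_int B (l j) w)\<^sup>2) \<partial>M) + 2 * ?de j"
   using nn_integral_power2_add_le[of "step_int B (l j)" M "\<lambda>w. J w - step_int B (l j) w"] by simp
  also have "(\<integral>\<^sup>+w. ennreal ((step_int B (l j) w)\<^sup>2) \<partial>M) = ennreal q * (\<integral>\<^sup>+r. ennreal ((step_fun (l j) r)\<^sup>2) \<partial>lborel)"
   by (rule step_isometry[OF l])
  also have "(\<integral>\<^sup>+r. ennreal ((step_fun (l j) r)\<^sup>2) \<partial>lborel) \<le> 2 * ?F + 2 * ?ep j"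
   using nn_integral_power2_add_le[of f lborel "\<lambda>r. step_fun (l j) r - f r"] by (simp add: power2_commute)
  finally have "(\<integral>\<^sup>+w. ennreal ((J w)\<^sup>2) \<partial>M) \<le> 2 * (ennreal q * (2 * ?F + 2 * ?ep j)) + 2 * ?de j" by (simp add: add_mono mult_left_mono)
  moreover have "ennreal (4 * q) = 2 * (ennreal q * 2)" using q_nonneg by (simp add: ennreal_mult' ac_simps)
  ultimately show ?thesis by (simp add: ring_distribs ac_simps)
 qed
 have "(\<lambda>j. ennreal (4 * q) * ?F + (ennreal (4 * q) * ?ep j + 2 * ?de j)) \<longlonglongrightarrow> ennreal (4 * q) * ?F + (ennreal (4 * q) * 0 + 2 * 0)"
  by (intro tendsto_add tendsto_const ennreal_tendsto_cmult f J) auto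
 then show ?thesis using le by (intro LIMSEQ_le_const[where X="\<lambda>j. ennreal (4 * q) * ?F + (ennreal (4 * q) * ?ep j + 2 * ?de j)"]) auto
qed

lemma wint_linear:
 assumes "wint f J" "wint g L"
 shows "wint (\<lambda>r. a * f r + b * g r) (\<lambda>w. a * J w + b * L w)"
proof -
 obtain l where [measurable]: "f \<in> borel_measurable borel" "J \<in> borel_measurable M" and l: "\<And>j::nat. valid (l j)"
  and f: "(\<lambda>j. \<integral>\<^sup>+r. ennreal ((f r - step_fun (l j) r)\<^sup>2) \<partial>lborel) \<longlonglongrightarrow> 0"
  and J: "(\<lambda>j. \<integral>\<^sup>+w. ennreal ((J w - step_int B (l j) w)\<^sup>2) \<partial>M) \<longlonglongrightarrow> 0"
  using assms(1) unfolding wint_def by blast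
 obtain k where [measurable]: "g \<in> borel_measurable borel" "L \<in> borel_measurable M" and k: "\<And>j::nat. valid (k j)"
  and g: "(\<lambda>j. \<integral>\<^sup>+r. ennreal ((g r - step_fun (k j) r)\<^sup>2) \<partial>lborel) \<longlonglongrightarrow> 0"
  and L: "(\<lambda>j. \<integral>\<^sup>+w. ennreal ((L w - step_int B (k j) w)\<^sup>2) \<partial>M) \<longlonglongrightarrow> 0"
  using assms(2) unfolding wint_def by blast
 have [measurable]: "step_int B (l j) \<in> borel_measurable M" "step_int B (k j) \<in> borel_measurable M" for j using borel_measurable_step_int l k by auto
 show ?thesis unfolding wint_def
 proof (intro conjI exI[of _ "\<lambda>j. scale_steps a (l j) @ scale_steps b (k j)"] allI)
  show "valid (scale_steps a (l j) @ scale_steps b (k j))" for j using l k by simp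
  have "(\<lambda>j. \<integral>\<^sup>+r. ennreal ((a * (f r - step_fun (l j) r) + b * (g r - step_fun (k j) r))\<^sup>2) \<partial>lborel) \<longlonglongrightarrow> 0"
   by (rule tendsto_power2_combination[OF _ _ f g]) auto
  then show "(\<lambda>j. \<integral>\<^sup>+r. ennreal ((a * f r + b * g r - step_fun (scale_steps a (l j) @ scale_steps b (k j)) r)\<^sup>2) \<partial>lborel) \<longlonglongrightarrow> 0"
   by (simp add: algebra_simps)
  have "(\<lambda>j. \<integral>\<^sup>+w. ennreal ((a * (J w - step_int B (l j) w) + b * (L w - step_int B (k j) w))\<^sup>2) \<partial>M) \<longlonglongrightarrow> 0"
   by (rule tendsto_power2_combination[OF _ _ J L]) auto
  then show "(\<lambda>j. \<integral>\<^sup>+w. ennreal ((a * J w + b * L w - step_int B (scale_steps a (l j) @ scale_steps b (k j)) w)\<^sup>2) \<partial>M) \<longlonglongrightarrow> 0"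
   by (simp add: algebra_simps)
 qed auto
qed

lemma wint_zero: "wint (\<lambda>_. 0) (\<lambda>_. 0)" using wint_step[of "[]"] by (simp add: step_fun_def[abs_def] step_int_def[abs_def])

lemma wint_sum:
 assumes "\<And>i. i < (m::nat) ==> wint (f i) (J i)"
 shows "wint (\<lambda>r. \<Sum>i<m. c i * f i r) (\<lambda>w. \<Sum>i<m. c i * J i w)" using assms
proof (induction m)
 case (Suc m)
 then have "wint (\<lambda>r. 1 * (\<Sum>i<m. c i * f i r) + c m * f m r) (\<lambda>w. 1 * (\<Sum>i<m. c i * J i w) + c m * J m w)" by (intro wint_linear) auto
 then show ?case by simp
qed (simp add: wint_zero)

lemma wint_stoch_integral:
 assumes "is_stoch_integral M B g t Z" "{0..t} \<subseteq> I"
 shows "wint (\<lambda>r. indicator {0..t} r * g r) Z"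
proof -
 obtain m :: "nat => nat" and ta c where Z [measurable]: "Z \<in> borel_measurable M" and g: "set_borel_measurable lborel {0..t} g"
  and part: "\<And>j. ta j 0 = 0" "\<And>j. ta j (m j) = t" "\<And>j i. i < m j ==> ta j i \<le> ta j (Suc i)"
  and f: "(\<lambda>j. \<integral>\<^sup>+ r\<in>{0..t}. ennreal ((g r - (\<Sum>i<m j. c j i * indicator {ta j i<..ta j (Suc i)} r))\<^sup>2) \<partial>lborel) \<longlonglongrightarrow> 0"
  and J: "(\<lambda>j. \<integral>\<^sup>+ w. ennreal ((norm (Z w - (\<Sum>i<m j. c j i *\<^sub>R (B (ta j (Suc i)) w - B (ta j i) w))))\<^sup>2) \<partial>M) \<longlonglongrightarrow> 0"
  using assms(1) unfolding is_stoch_integral_def by blast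
 define l where "l j = map (\<lambda>i. (c j i, ta j i, ta j (Suc i))) [0..<m j]" for j
 have mono: "ta j i \<le> ta j i'" if "i \<le> i'" "i' \<le> m j" for i i' j using that by (induction i' rule: dec_induct) (auto intro: order_trans[OF _ part(3)])
 have in_range: "0 \<le> ta j i \<and> ta j i \<le> t" if "i \<le> m j" for i j using mono[of 0 i j] mono[of i "m j" j] that part by auto
 have sf: "step_fun (l j) r = (\<Sum>i<m j. c j i * indicator {ta j i<..ta j (Suc i)} r)" for j r
  unfolding step_fun_def l_def by (simp add: o_def sum_list_sum_nth atLeast0LessThan)
 have si: "step_int B (l j) w = (\<Sum>i<m j. c j i *\<^sub>R (B (ta j (Suc i)) w - B (ta j i) w))" for j w
  unfolding step_int_def l_def by (simp add: o_def sum_list_sum_nth atLeast0LessThan)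
 \<comment> \<open>All partition points lie in \<open>{0..t}\<close>, so the approximation on
   \<open>{0..t}\<close> is an approximation of the cut-off integrand on the whole line.\<close>
 have out: "step_fun (l j) r = 0" if "r \<notin> {0..t}" for j r unfolding sf
 proof (intro sum.neutral ballI)
  fix i assume "i \<in> {..<m j}"
  then have "r \<notin> {ta j i<..ta j (Suc i)}" using that in_range[of i j] in_range[of "Suc i" j] by auto
  then show "c j i * indicator {ta j i<..ta j (Suc i)} r = 0" by simp
 qed
 show ?thesis unfolding wint_def
 proof (intro conjI exI[of _ l] allI)
  show "valid (l j)" for j using assms(2) in_range part(3) unfolding valid_def l_def by (auto simp: subset_iff less_eq_Suc_le)
  show "(\<lambda>r. indicator {0..t} r * g r) \<in> borel_measurable borel" using g by (simp add: set_borel_measurable_def)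
  have "(\<integral>\<^sup>+ r\<in>{0..t}. ennreal ((g r - (\<Sum>i<m j. c j i * indicator {ta j i<..ta j (Suc i)} r))\<^sup>2) \<partial>lborel) =
   (\<integral>\<^sup>+ r. ennreal ((indicator {0..t} r * g r - step_fun (l j) r)\<^sup>2) \<partial>lborel)" for j
   by (rule nn_integral_cong) (use out[of _ j] in \<open>auto simp: sf[symmetric] split: split_indicator\<close>)
  then show "(\<lambda>j. \<integral>\<^sup>+r. ennreal ((indicator {0..t} r * g r - step_fun (l j) r)\<^sup>2) \<partial>lborel) \<longlonglongrightarrow> 0"
   using f by simp
  show "(\<lambda>j. \<integral>\<^sup>+w. ennreal ((Z w - step_int B (l j) w)\<^sup>2) \<partial>M) \<longlonglongrightarrow> 0" using J unfolding si by simp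
 qed (rule Z)
qed

end

section \<open>Riemann sums along paths\<close>

text \<open>The uniform grid with \<open>Suc m\<close> cells, so that no m gives an empty
  partition.\<close>

definition grid :: "real => real => nat => nat => real" where
 "grid s s' m i = s + (s' - s) * (real i / real (Suc m))"

lemma grid_0 [simp]: "grid s s' m 0 = s" by (simp add: grid_def)

lemma grid_Suc_m [simp]: "grid s s' m (Suc m) = s'"
proof -
 have "real (Suc m) / real (Suc m) = 1" by (rule divide_self) simp
 then show ?thesis unfolding grid_def by simp
qed

lemma grid_mono: "s \<le> s' ==> i \<le> j ==> grid s s' m i \<le> grid s s' m j"
 unfolding grid_def by (intro add_left_mono mult_left_mono divide_right_mono) auto

lemma grid_range: "s \<le> s' ==> i \<le> Suc m ==> grid s s' m i \<in> {s..s'}"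
 using grid_mono[of s s' 0 i m] grid_mono[of s s' i "Suc m" m] by simp

lemma grid_step: "grid s s' m (Suc i) - grid s s' m i = (s' - s) / real (Suc m)" unfolding grid_def by (simp add: add_divide_distrib algebra_simps)

lemma grid_less: "s < s' ==> grid s s' m i < grid s s' m (Suc i)"
 using grid_step[of s s' m i] by (smt (verit) divide_pos_pos of_nat_0_less_iff zero_less_Suc)

lemma sum_indicator_partition:
 fixes ta :: "nat => real"
 assumes "\<And>i. i < m ==> ta i \<le> ta (Suc i)"
 shows "(\<Sum>i<m. indicator {ta i<..ta (Suc i)} r) = (indicator {ta 0<..ta m} r :: real)" using assms
proof (induction m)
 case (Suc m)
 have mono: "ta 0 \<le> ta m"
 proof -
  have "k \<le> m ==> ta 0 \<le> ta k" for k by (induction k) (use Suc.prems in \<open>auto intro: order_trans\<close>)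
  then show ?thesis by simp
 qed
 have "(\<Sum>i<Suc m. indicator {ta i<..ta (Suc i)} r) = (indicator {ta 0<..ta m} r + indicator {ta m<..ta (Suc m)} r :: real)" using Suc by simp
 also have "\<dots> = indicator {ta 0<..ta (Suc m)} r" using mono Suc.prems[of m] by (auto simp: indicator_def)
 finally show ?case .
qed simp

lemma abs_partition_sum_diff_le:
 fixes ta a b :: "nat => real"
 assumes "\<And>i. i < m ==> ta i \<le> ta (Suc i)"
  and "\<And>i. i < m ==> r \<in> {ta i<..ta (Suc i)} ==> \<bar>a i - b i\<bar> \<le> ep"
 shows "\<bar>(\<Sum>i<m. a i * indicator {ta i<..ta (Suc i)} r) - (\<Sum>i<m. b i * indicator {ta i<..ta (Suc i)} r)\<bar> \<le> ep * indicator {ta 0<..ta m} r"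
proof -
 have "(\<Sum>i<m. a i * indicator {ta i<..ta (Suc i)} r) - (\<Sum>i<m. b i * indicator {ta i<..ta (Suc i)} r)
   = (\<Sum>i<m. (a i - b i) * indicator {ta i<..ta (Suc i)} r)" by (simp add: sum_subtractf left_diff_distrib)
 then have "\<bar>(\<Sum>i<m. a i * indicator {ta i<..ta (Suc i)} r) - (\<Sum>i<m. b i * indicator {ta i<..ta (Suc i)} r)\<bar>
   \<le> (\<Sum>i<m. \<bar>(a i - b i) * indicator {ta i<..ta (Suc i)} r\<bar>)" by (simp only: sum_abs)
 also have "\<dots> \<le> (\<Sum>i<m. ep * indicator {ta i<..ta (Suc i)} r)" by (intro sum_mono) (use assms(2) in \<open>auto simp: indicator_def\<close>)
 also have "\<dots> = ep * indicator {ta 0<..ta m} r" unfolding sum_distrib_left[symmetric] by (subst sum_indicator_partition) (auto intro: assms(1))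
 finally show ?thesis .
qed

lemma continuous_on_Icc_bounded:
 fixes f :: "real => real"
 assumes "continuous_on {a..b} f" shows "\<exists>C\<ge>0. \<forall>r\<in>{a..b}. \<bar>f r\<bar> \<le> C"
proof -
 obtain C where "\<forall>r\<in>{a..b}. \<bar>f r\<bar> \<le> C" using compact_imp_bounded[OF compact_continuous_image[OF assms compact_Icc]] by (auto simp: bounded_iff)
 then show ?thesis by (intro exI[of _ "max C 0"]) (auto simp: le_max_iff_disj)
qed

lemma grid_oscillation:
 fixes ph :: "real => real"
 assumes "continuous_on {s..s'} ph" "s \<le> s'" "0 < ep"
 shows "\<forall>\<^sub>F m in sequentially. \<forall>i\<le>m. \<forall>r\<in>{grid s s' m i..grid s s' m (Suc i)}. \<forall>r'\<in>{grid s s' m i..grid s s' m (Suc i)}. \<bar>ph r - ph r'\<bar> \<le> ep"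
proof -
 have "uniformly_continuous_on {s..s'} ph" using assms by (intro compact_uniformly_continuous) auto
 then obtain d where d: "0 < d" "\<And>r r'. r \<in> {s..s'} ==> r' \<in> {s..s'} ==> dist r' r < d ==> dist (ph r') (ph r) < ep"
  using assms(3) unfolding uniformly_continuous_on_def by metis
 have "(\<lambda>m. (s' - s) / real (Suc m)) \<longlonglongrightarrow> 0" by (rule LIMSEQ_Suc[OF lim_const_over_n])
 then have "\<forall>\<^sub>F m in sequentially. (s' - s) / real (Suc m) < d" by (rule order_tendstoD) (rule d)
 then show ?thesis
 proof eventually_elim
  case (elim m)
  show ?case
  proof (intro allI impI ballI)
   fix i r r' assume i: "i \<le> m" and r: "r \<in> {grid s s' m i..grid s s' m (Suc i)}" "r' \<in> {grid s s' m i..grid s s' m (Suc i)}"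
   have "\<bar>r - r'\<bar> \<le> (s' - s) / real (Suc m)" using r unfolding grid_step[of s s' m i, symmetric] by auto
   moreover have "r \<in> {s..s'}" "r' \<in> {s..s'}" using r i grid_range[OF assms(2), of i m] grid_range[OF assms(2), of "Suc i" m] by auto
   ultimately have "dist (ph r) (ph r') < ep" using elim by (intro d(2)) (auto simp: dist_real_def)
   then show "\<bar>ph r - ph r'\<bar> \<le> ep" by (simp add: dist_real_def)
  qed
 qed
qed

text \<open>If the error on each cell is at most a small multiple of its length, uniformly over the
  cells, then the errors add up to that multiple of the total length while the increments of
  \<open>Ph\<close> telescope.\<close>

lemma tendsto_grid_sum:
 fixes Ph :: "real => real" and a :: "nat => nat => real"
 assumes ss: "s \<le> s'" and C: "0 \<le> C"
  and *: "\<And>ep. 0 < ep ==> \<forall>\<^sub>F m in sequentially. \<forall>i\<le>m. \<bar>Ph (grid s s' m (Suc i)) - Ph (grid s s' m i) - a m i\<bar> \<le> C * ep * (grid s s' m (Suc i) - grid s s' m i)"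
 shows "(\<lambda>m. \<Sum>i<Suc m. a m i) \<longlonglongrightarrow> Ph s' - Ph s"
proof (rule LIMSEQ_I)
 fix r :: real assume r: "0 < r"
 \<comment> \<open>The two added ones keep the denominator positive when \<open>C\<close> or the
   length of the interval is 0.\<close>
 define ep where "ep = r / (2 * (C + 1) * (s' - s + 1))"
 have "0 < ep" unfolding ep_def using r ss C by (intro divide_pos_pos mult_pos_pos) auto
 from *[OF this] obtain m0 where m0: "\<And>m i. m \<ge> m0 ==> i \<le> m ==> 
  \<bar>Ph (grid s s' m (Suc i)) - Ph (grid s s' m i) - a m i\<bar> \<le> C * ep * (grid s s' m (Suc i) - grid s s' m i)" unfolding eventually_sequentially by blast
 have le: "C * ep * (s' - s) < r"
 proof -
  have "C * ep * (s' - s) \<le> (C + 1) * ep * (s' - s + 1)" using C ss \<open>0 < ep\<close> by (intro mult_mono) auto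
  also have "\<dots> = r / 2"
  proof -
   have "P * (r / (2 * P * Q)) * Q = r / 2" if "P \<noteq> 0" "Q \<noteq> 0" for P Q :: real using that by simp
   from this[of "C + 1" "s' - s + 1"] show ?thesis unfolding ep_def using C ss by linarith
  qed
  finally show ?thesis using r by simp
 qed
 have "norm ((\<Sum>i<Suc m. a m i) - (Ph s' - Ph s)) < r" if m: "m \<ge> m0" for m
 proof -
  have tele: "(\<Sum>i<Suc m. f (grid s s' m (Suc i)) - f (grid s s' m i)) = f s' - f s" for f :: "real => real" by (subst sum_lessThan_telescope) simp
  have "(Ph s' - Ph s) - (\<Sum>i<Suc m. a m i) = (\<Sum>i<Suc m. Ph (grid s s' m (Suc i)) - Ph (grid s s' m i) - a m i)" unfolding sum_subtractf[of _ "a m"] tele ..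
  also have "\<bar>\<dots>\<bar> \<le> (\<Sum>i<Suc m. \<bar>Ph (grid s s' m (Suc i)) - Ph (grid s s' m i) - a m i\<bar>)" by (rule sum_abs)
  also have "\<dots> \<le> (\<Sum>i<Suc m. C * ep * (grid s s' m (Suc i) - grid s s' m i))" by (intro sum_mono m0 m) auto
  also have "\<dots> = C * ep * (s' - s)" unfolding sum_distrib_left[symmetric] using tele[of "\<lambda>x. x"] by simp
  finally show ?thesis using le by (simp add: abs_minus_commute)
 qed
 then show "\<exists>no. \<forall>m\<ge>no. norm ((\<Sum>i<Suc m. a m i) - (Ph s' - Ph s)) < r" by blast
qed

lemma riemann_sum_tendsto:
 fixes ph :: "real => real"
 assumes cont: "continuous_on {s..s'} ph" and ss: "s \<le> s'"
 shows "(\<lambda>m. \<Sum>i<Suc m. ph (grid s s' m i) * (grid s s' m (Suc i) - grid s s' m i)) \<longlonglongrightarrow> integral {s..s'} ph"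
proof -
 define Ph where "Ph r = integral {s..r} ph" for r
 have "(\<lambda>m. \<Sum>i<Suc m. ph (grid s s' m i) * (grid s s' m (Suc i) - grid s s' m i)) \<longlonglongrightarrow> Ph s' - Ph s"
 proof (rule tendsto_grid_sum[where C=1 and Ph=Ph and s=s and s'=s'])
  fix ep :: real assume "0 < ep"
  from grid_oscillation[OF cont ss this]
  show "\<forall>\<^sub>F m in sequentially. \<forall>i\<le>m. \<bar>Ph (grid s s' m (Suc i)) - Ph (grid s s' m i) - ph (grid s s' m i) * (grid s s' m (Suc i) - grid s s' m i)\<bar> \<le> 1 * ep * (grid s s' m (Suc i) - grid s s' m i)"
  proof eventually_elim
   case (elim m)
   show ?case
   proof (intro allI impI)
    fix i assume i: "i \<le> m"
    define u v where "u = grid s s' m i" and "v = grid s s' m (Suc i)"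
    have uv: "u \<le> v" "s \<le> u" "v \<le> s'" 
     unfolding u_def v_def using grid_mono[OF ss, of i "Suc i" m] grid_range[OF ss, of i m] grid_range[OF ss, of "Suc i" m] i by auto
    have c: "continuous_on {u..v} ph" by (rule continuous_on_subset[OF cont]) (use uv in auto)
    have int: "ph integrable_on {s..v}" by (rule integrable_continuous_real, rule continuous_on_subset[OF cont]) (use uv in auto)
    have "Ph v - Ph u = integral {u..v} ph" unfolding Ph_def using Henstock_Kurzweil_Integration.integral_combine[OF uv(2,1) int] by simp
    moreover have "integral {u..v} (\<lambda>r. ph r - ph u) = integral {u..v} ph - ph u * (v - u)"
     using uv by (subst Henstock_Kurzweil_Integration.integral_diff) (auto intro!: integrable_continuous_real c)
    moreover have "norm (integral {u..v} (\<lambda>r. ph r - ph u)) \<le> ep * (v - u)"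
    proof (rule integral_bound[OF uv(1)])
     show "continuous_on {u..v} (\<lambda>r. ph r - ph u)" by (intro continuous_intros c)
     fix r assume "r \<in> {u..v}"
     then show "norm (ph r - ph u) \<le> ep" using elim i uv(1) unfolding u_def v_def by auto
    qed
    ultimately show "\<bar>Ph (grid s s' m (Suc i)) - Ph (grid s s' m i) - ph (grid s s' m i) * (grid s s' m (Suc i) - grid s s' m i)\<bar> \<le> 1 * ep * (grid s s' m (Suc i) - grid s s' m i)"
     unfolding u_def[symmetric] v_def[symmetric] by simp
   qed
  qed
 qed (use ss in auto)
 then show ?thesis by (simp add: Ph_def)
qed

text \<open>Variation of constants: along a path of \<open>x = xi + \<integral> (c x + d) + Z\<close> the process \<open>A x - \<integral> A d\<close>,
 with \<open>A' = - c A\<close>, is the Riemann--Stieltjes integral of \<open>A\<close> against \<open>Z\<close>.\<close>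

lemma linear_equation_path:
 fixes x d c A Z :: "real => real"
 assumes ss: "0 \<le> s" "s \<le> s'" "s' \<le> b"
  and x: "continuous_on {0..b} x" and d: "continuous_on {0..b} d" and c: "continuous_on {0..b} c"
  and A: "\<And>r. r \<in> {0..b} ==> (A has_real_derivative - (c r * A r)) (at r within {0..b})"
  and eq: "\<And>r. r \<in> {0..b} ==> x r = xi + integral {0..r} (\<lambda>u. c u * x u + d u) + Z r"
 shows "(\<lambda>m. \<Sum>i<Suc m. A (grid s s' m i) * (Z (grid s s' m (Suc i)) - Z (grid s s' m i)))
  \<longlonglongrightarrow> A s' * x s' - A s * x s - integral {s..s'} (\<lambda>r. A r * d r)"
proof -
 have Ac: "continuous_on {0..b} A" using A by (intro DERIV_continuous_on) auto
 obtain Cx where Cx: "0 \<le> Cx" "\<forall>r\<in>{0..b}. \<bar>x r\<bar> \<le> Cx" using continuous_on_Icc_bounded[OF x] by blast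
 obtain Cd where Cd: "0 \<le> Cd" "\<forall>r\<in>{0..b}. \<bar>d r\<bar> \<le> Cd" using continuous_on_Icc_bounded[OF d] by blast
 obtain Cc where Cc: "0 \<le> Cc" "\<forall>r\<in>{0..b}. \<bar>c r\<bar> \<le> Cc" using continuous_on_Icc_bounded[OF c] by blast
 obtain CA where CA: "0 \<le> CA" "\<forall>r\<in>{0..b}. \<bar>A r\<bar> \<le> CA" using continuous_on_Icc_bounded[OF Ac] by blast
 note bounds = Cx(2)[rule_format] Cd(2)[rule_format] Cc(2)[rule_format] CA(2)[rule_format]
 note pos = Cx(1) Cd(1) Cc(1) CA(1)
 define C where "C = Cc * (Cx + CA) + Cd"
 have C: "0 \<le> C" using pos by (simp add: C_def)
 define Ph where "Ph r = A r * x r - integral {0..r} (\<lambda>r. A r * d r)" for r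
 have sub: "{s..s'} \<subseteq> {0..b}" using ss by auto
 have Ad: "continuous_on {0..b} (\<lambda>r. A r * d r)" by (intro continuous_intros Ac d)
 have "(\<lambda>m. \<Sum>i<Suc m. A (grid s s' m i) * (Z (grid s s' m (Suc i)) - Z (grid s s' m i))) \<longlonglongrightarrow> Ph s' - Ph s"
 proof (rule tendsto_grid_sum[OF ss(2) C])
  fix ep :: real assume "0 < ep"
  from grid_oscillation[OF continuous_on_subset[OF Ac sub] ss(2) this] grid_oscillation[OF continuous_on_subset[OF x sub] ss(2) this]
  show "\<forall>\<^sub>F m in sequentially. \<forall>i\<le>m. \<bar>Ph (grid s s' m (Suc i)) - Ph (grid s s' m i) - A (grid s s' m i) * (Z (grid s s' m (Suc i)) - Z (grid s s' m i))\<bar> \<le> C * ep * (grid s s' m (Suc i) - grid s s' m i)"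
  proof eventually_elim
   case (elim m)
   show ?case
   proof (intro allI impI)
    fix i assume i: "i \<le> m"
    define u v where "u = grid s s' m i" and "v = grid s s' m (Suc i)"
    have uv: "u \<le> v" "0 \<le> u" "v \<le> b" "u \<in> {0..b}" "v \<in> {0..b}"
     unfolding u_def v_def using grid_mono[OF ss(2), of i "Suc i" m] grid_range[OF ss(2), of i m] grid_range[OF ss(2), of "Suc i" m] i ss by auto
    have osc: "\<bar>A r - A r'\<bar> \<le> ep" "\<bar>x r - x r'\<bar> \<le> ep" if "r \<in> {u..v}" "r' \<in> {u..v}" for r r'
     using elim i that unfolding u_def v_def by blast+
    have suv: "{u..v} \<subseteq> {0..b}" using uv by auto
    note cuv = continuous_on_subset[OF Ac suv] continuous_on_subset[OF x suv] continuous_on_subset[OF d suv] continuous_on_subset[OF c suv]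
    have comb: "integral {0..v} f - integral {0..u} f = integral {u..v} f" if "continuous_on {0..b} f" for f :: "real => real"
    proof -
     have "f integrable_on {0..v}" by (rule integrable_continuous_real, rule continuous_on_subset[OF that]) (use uv in auto)
     from Henstock_Kurzweil_Integration.integral_combine[OF uv(2,1) this] show ?thesis by simp
    qed
    have i1: "A v - A u = integral {u..v} (\<lambda>r. - (c r * A r))"
    proof -
     have "((\<lambda>r. - (c r * A r)) has_integral (A v - A u)) {u..v}"
     proof (rule fundamental_theorem_of_calculus[OF uv(1)])
      fix r assume "r \<in> {u..v}"
      then have "(A has_real_derivative - (c r * A r)) (at r within {u..v})" using suv by (intro has_field_derivative_subset[OF A]) auto
      then show "(A has_vector_derivative - (c r * A r)) (at r within {u..v})" by (simp add: has_real_derivative_iff_has_vector_derivative)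
     qed
     then show ?thesis by (rule integral_unique[symmetric])
    qed
    have i2: "Ph v - Ph u = A v * x v - A u * x u - integral {u..v} (\<lambda>r. A r * d r)" using comb[OF Ad] by (simp add: Ph_def)
    have i3: "Z v - Z u = x v - x u - integral {u..v} (\<lambda>r. c r * x r + d r)"
     using eq[OF uv(4)] eq[OF uv(5)] comb[of "\<lambda>u. c u * x u + d u"] x c d by (simp add: continuous_intros)
    \<comment> \<open>The integrand of the defect on one cell. Regrouped below, each of its terms
      contains the oscillation of \<open>A\<close> or of \<open>x\<close> over the cell, which makes
      the defect small compared with the length of the cell.\<close>
    define e where "e r = x v * (- (c r * A r)) - A r * d r + A u * (c r * x r + d r)" for r
    have "integral {u..v} e = x v * integral {u..v} (\<lambda>r. - (c r * A r)) - integral {u..v} (\<lambda>r. A r * d r) + A u * integral {u..v} (\<lambda>r. c r * x r + d r)"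
    proof -
     have "integral {u..v} e = integral {u..v} (\<lambda>r. x v * (- (c r * A r)) - A r * d r) + integral {u..v} (\<lambda>r. A u * (c r * x r + d r))"
      unfolding e_def[abs_def] by (intro Henstock_Kurzweil_Integration.integral_add integrable_continuous_real continuous_intros cuv)
     also have "integral {u..v} (\<lambda>r. x v * (- (c r * A r)) - A r * d r) = integral {u..v} (\<lambda>r. x v * (- (c r * A r))) - integral {u..v} (\<lambda>r. A r * d r)"
      by (intro Henstock_Kurzweil_Integration.integral_diff integrable_continuous_real continuous_intros cuv)
     finally show ?thesis by simp
    qed
    then have e: "Ph v - Ph u - A u * (Z v - Z u) = integral {u..v} e" unfolding i2 i3 i1[symmetric] by (simp add: algebra_simps)
    have "norm (integral {u..v} e) \<le> (C * ep) * (v - u)"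
    proof (rule integral_bound[OF uv(1)])
     show "continuous_on {u..v} e" unfolding e_def[abs_def] by (intro continuous_intros cuv)
     fix r assume r: "r \<in> {u..v}"
     then have rb: "r \<in> {0..b}" using suv by auto
     have "e r = c r * ((A u - A r) * x r + A r * (x r - x v)) + (A u - A r) * d r" by (simp add: e_def algebra_simps)
     moreover have "\<bar>(A u - A r) * d r\<bar> \<le> ep * Cd" by (intro abs_mult_le osc bounds rb r) (use uv in auto)
     moreover have "\<bar>c r * ((A u - A r) * x r + A r * (x r - x v))\<bar> \<le> Cc * (ep * Cx + CA * ep)"
      by (intro abs_mult_le order_trans[OF abs_triangle_ineq] add_mono osc bounds rb r) (use uv in auto)
     ultimately have "\<bar>e r\<bar> \<le> Cc * (ep * Cx + CA * ep) + ep * Cd" by linarith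
     then show "norm (e r) \<le> C * ep" by (simp add: C_def algebra_simps)
    qed
    then show "\<bar>Ph (grid s s' m (Suc i)) - Ph (grid s s' m i) - A (grid s s' m i) * (Z (grid s s' m (Suc i)) - Z (grid s s' m i))\<bar> \<le> C * ep * (grid s s' m (Suc i) - grid s s' m i)"
     unfolding u_def[symmetric] v_def[symmetric] e by simp
   qed
  qed
 qed
 moreover have "Ph s' - Ph s = A s' * x s' - A s * x s - integral {s..s'} (\<lambda>r. A r * d r)"
 proof -
  have "(\<lambda>r. A r * d r) integrable_on {0..s'}" by (rule integrable_continuous_real, rule continuous_on_subset[OF Ad]) (use ss in auto)
  from Henstock_Kurzweil_Integration.integral_combine[OF ss(1,2) this] show ?thesis by (simp add: Ph_def)
 qed
 ultimately show ?thesis by simp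
qed

section \<open>Increments of linear equations as mean-square limits\<close>

context wiener_isometry
begin

text \<open>Two kinds of sums are compared. The sums \<open>R\<close> against the integral process
  converge along almost every path, by variation of constants; the sums \<open>S\<close> against the
  driving process are the ones whose moments can be computed. Both are Wiener integrals of step-like
  functions that converge uniformly to \<open>A * g\<close>, so their distance is small in mean
  square, and Fatou's lemma replaces \<open>R\<close> by its limit.\<close>

lemma linear_sde_increment:
 fixes g c A :: "real => real" and x d :: "'w' => real => real"
 assumes ss: "0 \<le> s" "s \<le> s'" "s' \<le> b" and I: "{0..b} \<subseteq> I"
  and g: "continuous_on {0..b} g" and c: "continuous_on {0..b} c"
  and A: "\<And>r. r \<in> {0..b} ==> (A has_real_derivative - (c r * A r)) (at r within {0..b})"
  and Z: "\<And>r. r \<in> {0..b} ==> is_stoch_integral M B g r (Z r)"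
  and path: "AE w in M. continuous_on {0..b} (x w) \<and> continuous_on {0..b} (d w) \<and>
   (\<forall>r\<in>{0..b}. x w r = x0 w + integral {0..r} (\<lambda>u. c u * x w u + d w u) + Z r w)"
 shows "\<exists>J\<in>borel_measurable M. (AE w in M. J w = A s' * x w s' - A s * x w s - integral {s..s'} (\<lambda>r. A r * d w r)) \<and>
  (\<lambda>m. \<integral>\<^sup>+w. ennreal ((J w - (\<Sum>i<Suc m. A (grid s s' m i) * g (grid s s' m i) * (B (grid s s' m (Suc i)) w - B (grid s s' m i) w)))\<^sup>2) \<partial>M) \<longlonglongrightarrow> 0"
proof -
 define R where "R m w = (\<Sum>i<Suc m. A (grid s s' m i) * (Z (grid s s' m (Suc i)) w - Z (grid s s' m i) w))" for m w
 define S where "S m w = (\<Sum>i<Suc m. A (grid s s' m i) * g (grid s s' m i) * (B (grid s s' m (Suc i)) w - B (grid s s' m i) w))" for m w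
 \<comment> \<open>The limit operator yields a function that is measurable as a whole, although the
   path equation is available almost surely only.\<close>
 define J where "J w = lim (\<lambda>m. R m w)" for w
 have gr: "grid s s' m i \<in> {0..b}" if "i \<le> Suc m" for m i using grid_range[OF ss(2) that] ss by auto
 have grI: "grid s s' m i \<in> I" if "i \<le> Suc m" for m i using gr[OF that] I by auto
 have Zm: "Z r \<in> borel_measurable M" if "r \<in> {0..b}" for r using Z[OF that] by (simp add: is_stoch_integral_def)
 have Rm [measurable]: "R m \<in> borel_measurable M" for m
  unfolding R_def[abs_def] by (intro borel_measurable_sum borel_measurable_times borel_measurable_const borel_measurable_diff Zm gr) auto
 have Sm [measurable]: "S m \<in> borel_measurable M" for m
  unfolding S_def[abs_def] by (intro borel_measurable_sum borel_measurable_times borel_measurable_const borel_measurable_diff B_measurable grI) auto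
 have Jm [measurable]: "J \<in> borel_measurable M" unfolding J_def[abs_def] by (rule borel_measurable_lim_metric) (rule Rm)
 have conv: "AE w in M. (\<lambda>m. R m w) \<longlonglongrightarrow> A s' * x w s' - A s * x w s - integral {s..s'} (\<lambda>r. A r * d w r)" using path
 proof eventually_elim
  case (elim w)
  then show ?case unfolding R_def by (intro linear_equation_path[OF ss _ _ c A, where xi="x0 w"]) auto
 qed
 then have J1: "AE w in M. J w = A s' * x w s' - A s * x w s - integral {s..s'} (\<lambda>r. A r * d w r)" by eventually_elim (auto simp: J_def limI)
 have J2: "AE w in M. (\<lambda>m. R m w) \<longlonglongrightarrow> J w" using conv J1 by eventually_elim simp
 have Ac: "continuous_on {0..b} A" using A by (intro DERIV_continuous_on) auto
 define ph where "ph r = A r * g r" for r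
 have sub: "{s..s'} \<subseteq> {0..b}" using ss by auto
 have phc: "continuous_on {s..s'} ph"  unfolding ph_def[abs_def] by (intro continuous_intros continuous_on_subset[OF Ac sub] continuous_on_subset[OF g sub])
 let ?i = "\<lambda>m i. indicator {grid s s' m i<..grid s s' m (Suc i)} :: real => real"
 define fS where "fS m r = (\<Sum>i<Suc m. ph (grid s s' m i) * ?i m i r)" for m r
 define fR where "fR m r = (\<Sum>i<Suc m. A (grid s s' m i) * (?i m i r * g r))" for m r
 have wS: "wint (fS m) (S m)" for m
 proof -
  have "wint (\<lambda>r. \<Sum>i<Suc m. ph (grid s s' m i) * step_fun [(1, grid s s' m i, grid s s' m (Suc i))] r)
   (\<lambda>w. \<Sum>i<Suc m. ph (grid s s' m i) * step_int B [(1, grid s s' m i, grid s s' m (Suc i))] w)" by (intro wint_sum wint_step) (auto intro!: grI grid_mono ss)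
  then show ?thesis unfolding fS_def[abs_def] S_def[abs_def] ph_def by simp
 qed
 have wZ: "wint (\<lambda>r. ?i m i r * g r) (\<lambda>w. Z (grid s s' m (Suc i)) w - Z (grid s s' m i) w)" if "i < Suc m" for m i
 proof -
  define u v where "u = grid s s' m i" and "v = grid s s' m (Suc i)"
  have uv: "u \<le> v" "u \<in> {0..b}" "v \<in> {0..b}" unfolding u_def v_def using gr[of i m] gr[of "Suc i" m] that grid_mono[OF ss(2), of i "Suc i" m] by auto
  have "wint (\<lambda>r. 1 * (indicator {0..v} r * g r) + (- 1) * (indicator {0..u} r * g r)) (\<lambda>w. 1 * Z v w + (- 1) * Z u w)"
   using uv I by (intro wint_linear wint_stoch_integral Z) auto
  moreover have "(\<lambda>r. 1 * (indicator {0..v} r * g r) + (- 1) * (indicator {0..u} r * g r)) = (\<lambda>r. indicator {u<..v} r * g r)"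
   using uv by (intro ext) (auto simp: indicator_def)
  ultimately show ?thesis unfolding u_def v_def by simp
 qed
 have wR: "wint (fR m) (R m)" for m unfolding fR_def[abs_def] R_def[abs_def] by (intro wint_sum wZ) auto
 obtain CA where CA: "\<And>r. r \<in> {0..b} ==> \<bar>A r\<bar> \<le> CA" using continuous_on_Icc_bounded[OF Ac] by blast
 obtain Cg where Cg: "\<And>r. r \<in> {0..b} ==> \<bar>g r\<bar> \<le> Cg" using continuous_on_Icc_bounded[OF g] by blast
 have Cg0: "0 \<le> Cg" and CA0: "0 \<le> CA" using Cg[of 0] CA[of 0] ss by (auto intro: order_trans[OF abs_ge_zero])
 \<comment> \<open>\<open>fS\<close> freezes both factors of the integrand at the left end of a
   cell, \<open>fR\<close> freezes \<open>A\<close> only; both are uniformly close to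
   \<open>ph\<close> on the interval.\<close>
 have conv_unif: "\<forall>\<^sub>F m in sequentially. \<forall>r. \<bar>fS m r - ph r * indicator {s<..s'} r\<bar> \<le> ep * indicator {s<..s'} r
   \<and> \<bar>fR m r - ph r * indicator {s<..s'} r\<bar> \<le> ep * Cg * indicator {s<..s'} r" if "0 < ep" for ep
  using grid_oscillation[OF phc ss(2) that] grid_oscillation[OF continuous_on_subset[OF Ac sub] ss(2) that]
 proof eventually_elim
  case (elim m)
  show ?case
  proof (intro allI conjI)
   fix r
   have p: "ph r * indicator {s<..s'} r = (\<Sum>i<Suc m. ph r * ?i m i r)"
    unfolding sum_distrib_left[symmetric] using sum_indicator_partition[of "Suc m" "grid s s' m" r] grid_mono[OF ss(2)] by simp
   have "\<bar>fS m r - ph r * indicator {s<..s'} r\<bar> \<le> ep * indicator {grid s s' m 0<..grid s s' m (Suc m)} r" unfolding fS_def p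
   proof (rule abs_partition_sum_diff_le)
    fix i assume i: "i < Suc m" and r: "r \<in> {grid s s' m i<..grid s s' m (Suc i)}"
    show "\<bar>ph (grid s s' m i) - ph r\<bar> \<le> ep" using elim(1)[rule_format, of i "grid s s' m i" r] i r by auto
   qed (auto intro!: grid_mono ss)
   then show "\<bar>fS m r - ph r * indicator {s<..s'} r\<bar> \<le> ep * indicator {s<..s'} r" by simp
   have fR: "fR m r = (\<Sum>i<Suc m. (A (grid s s' m i) * g r) * ?i m i r)" by (simp add: fR_def ac_simps)
   have "\<bar>fR m r - ph r * indicator {s<..s'} r\<bar> \<le> (ep * Cg) * indicator {grid s s' m 0<..grid s s' m (Suc m)} r" unfolding fR p
   proof (rule abs_partition_sum_diff_le)
    fix i assume i: "i < Suc m" and r: "r \<in> {grid s s' m i<..grid s s' m (Suc i)}"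
    have rb: "r \<in> {0..b}" using r gr[of i m] gr[of "Suc i" m] i by auto
    have "\<bar>A (grid s s' m i) - A r\<bar> \<le> ep" using elim(2)[rule_format, of i "grid s s' m i" r] i r by auto
    then have "\<bar>(A (grid s s' m i) - A r) * g r\<bar> \<le> ep * Cg" by (intro abs_mult_le Cg rb)
    then show "\<bar>A (grid s s' m i) * g r - ph r\<bar> \<le> ep * Cg" by (simp add: ph_def algebra_simps)
   qed (auto intro!: grid_mono ss)
   then show "\<bar>fR m r - ph r * indicator {s<..s'} r\<bar> \<le> ep * Cg * indicator {s<..s'} r" by simp
  qed
 qed
 have bound: "\<forall>\<^sub>F m in sequentially. (\<integral>\<^sup>+w. ennreal ((J w - S m w)\<^sup>2) \<partial>M) \<le> ennreal (4 * q * ((ep + ep * Cg)\<^sup>2 * (s' - s)))" if e: "0 < ep" for ep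
 proof -
  obtain m0 where m0: "\<And>m r. m \<ge> m0 ==> \<bar>fS m r - ph r * indicator {s<..s'} r\<bar> \<le> ep * indicator {s<..s'} r
   \<and> \<bar>fR m r - ph r * indicator {s<..s'} r\<bar> \<le> ep * Cg * indicator {s<..s'} r" using conv_unif[OF e] unfolding eventually_sequentially by blast
  have RS: "(\<integral>\<^sup>+w. ennreal ((R k w - S m w)\<^sup>2) \<partial>M) \<le> ennreal (4 * q * ((ep + ep * Cg)\<^sup>2 * (s' - s)))" if km: "m \<ge> m0" "k \<ge> m0" for m k
  proof -
   have "wint (\<lambda>r. 1 * fR k r + (- 1) * fS m r) (\<lambda>w. 1 * R k w + (- 1) * S m w)" by (intro wint_linear wR wS)
   then have "wint (\<lambda>r. fR k r - fS m r) (\<lambda>w. R k w - S m w)" by simp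
   from wint_bound[OF this]
   have "(\<integral>\<^sup>+w. ennreal ((R k w - S m w)\<^sup>2) \<partial>M) \<le> ennreal (4 * q) * (\<integral>\<^sup>+r. ennreal ((fR k r - fS m r)\<^sup>2) \<partial>lborel)" .
   also have "\<dots> \<le> ennreal (4 * q) * (\<integral>\<^sup>+r. ennreal ((ep + ep * Cg)\<^sup>2) * indicator {s<..s'} r \<partial>lborel)"
   proof (intro mult_left_mono nn_integral_mono)
    fix r
    have "\<bar>fR k r - fS m r\<bar> \<le> (ep + ep * Cg) * indicator {s<..s'} r" using m0[OF km(1), of r] m0[OF km(2), of r] by (simp add: distrib_right) linarith
    then have "(fR k r - fS m r)\<^sup>2 \<le> ((ep + ep * Cg) * indicator {s<..s'} r)\<^sup>2" by (metis abs_ge_zero power2_abs power_mono)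
    also have "\<dots> = (ep + ep * Cg)\<^sup>2 * indicator {s<..s'} r" by (auto simp: indicator_def)
    finally have "ennreal ((fR k r - fS m r)\<^sup>2) \<le> ennreal ((ep + ep * Cg)\<^sup>2 * indicator {s<..s'} r)" by (rule ennreal_leI)
    then show "ennreal ((fR k r - fS m r)\<^sup>2) \<le> ennreal ((ep + ep * Cg)\<^sup>2) * indicator {s<..s'} r" by (simp add: ennreal_mult ennreal_indicator)
   qed simp
   also have "\<dots> = ennreal (4 * q * ((ep + ep * Cg)\<^sup>2 * (s' - s)))" using ss q_nonneg by (simp add: nn_integral_cmult ennreal_mult[symmetric])
   finally show ?thesis .
  qed
  have "(\<integral>\<^sup>+w. ennreal ((J w - S m w)\<^sup>2) \<partial>M) \<le> ennreal (4 * q * ((ep + ep * Cg)\<^sup>2 * (s' - s)))" if m: "m \<ge> m0" for m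
  proof -
   have "(\<integral>\<^sup>+w. ennreal ((J w - S m w)\<^sup>2) \<partial>M) = (\<integral>\<^sup>+w. liminf (\<lambda>k. ennreal ((R k w - S m w)\<^sup>2)) \<partial>M)"
   proof (rule nn_integral_cong_AE)
    show "AE w in M. ennreal ((J w - S m w)\<^sup>2) = liminf (\<lambda>k. ennreal ((R k w - S m w)\<^sup>2))" using J2
    proof eventually_elim
     case (elim w)
     have "(\<lambda>k. ennreal ((R k w - S m w)\<^sup>2)) \<longlonglongrightarrow> ennreal ((J w - S m w)\<^sup>2)" by (intro tendsto_ennrealI tendsto_intros elim)
     then show ?case by (rule lim_imp_Liminf[OF trivial_limit_sequentially, symmetric])
    qed
   qed
   also have "\<dots> \<le> liminf (\<lambda>k. \<integral>\<^sup>+w. ennreal ((R k w - S m w)\<^sup>2) \<partial>M)" by (rule nn_integral_liminf) simp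
   also have "\<dots> \<le> ennreal (4 * q * ((ep + ep * Cg)\<^sup>2 * (s' - s)))" by (rule Liminf_le) (auto simp: eventually_sequentially intro!: exI[of _ m0] RS m)
   finally show ?thesis .
  qed
  then show ?thesis unfolding eventually_sequentially by blast
 qed
 have "(\<lambda>m. \<integral>\<^sup>+w. ennreal ((J w - S m w)\<^sup>2) \<partial>M) \<longlonglongrightarrow> 0"
 proof (rule order_tendstoI)
  fix e :: ennreal assume "0 < e"
  have "((\<lambda>ep. ennreal (4 * q * ((ep + ep * Cg)\<^sup>2 * (s' - s)))) \<longlongrightarrow> ennreal (4 * q * ((0 + 0 * Cg)\<^sup>2 * (s' - s)))) (at_right 0)"
   by (intro tendsto_ennrealI tendsto_intros)
  then have "\<forall>\<^sub>F ep in at_right 0. ennreal (4 * q * ((ep + ep * Cg)\<^sup>2 * (s' - s))) < e" by (rule order_tendstoD) (use \<open>0 < e\<close> in simp)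
  moreover have "\<forall>\<^sub>F ep::real in at_right 0. 0 < ep" by (simp add: eventually_at_right_less)
  ultimately have "\<forall>\<^sub>F ep in at_right 0. 0 < ep \<and> ennreal (4 * q * ((ep + ep * Cg)\<^sup>2 * (s' - s))) < e" by eventually_elim simp
  then obtain ep where ep: "0 < ep" "ennreal (4 * q * ((ep + ep * Cg)\<^sup>2 * (s' - s))) < e"
   using eventually_happens'[of "at_right (0::real)"] by (auto simp: trivial_limit_at_right_real)
  from bound[OF ep(1)] show "\<forall>\<^sub>F m in sequentially. (\<integral>\<^sup>+w. ennreal ((J w - S m w)\<^sup>2) \<partial>M) < e"
   by eventually_elim (use ep(2) in simp)
 qed simp
 then show ?thesis using J1 Jm unfolding S_def by blast
qed

end

section \<open>Centred normal laws\<close>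

lemma char_normal_law:
 assumes "0 \<le> v"
 shows "char (normal_law 0 v) u = complex_of_real (exp (- (u\<^sup>2 * v / 2)))"
proof (cases "v = 0")
 case True
 then show ?thesis by (simp add: normal_law_def char_def integral_return)
next
 case False
 then have v: "0 < v" using assms by simp
 interpret S: prob_space std_normal_distribution by (rule prob_space_normal_density) simp
 have "distributed std_normal_distribution lborel (\<lambda>x. x) std_normal_density" by (simp add: distributed_def distr_id2)
 from S.normal_density_affine[OF this, of "sqrt v" 0] v
 have "distributed std_normal_distribution lborel (\<lambda>x. sqrt v * x) (normal_density 0 (sqrt v))" by simp
 then have "distr std_normal_distribution lborel (\<lambda>x. sqrt v * x) = density lborel (normal_density 0 (sqrt v))" by (simp add: distributed_def)
 then have eq: "normal_law 0 v = distr std_normal_distribution borel (\<lambda>x. sqrt v * x)" using v by (simp add: normal_law_def cong: distr_cong)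
 have "char (normal_law 0 v) u = (CLINT x|std_normal_distribution. iexp (u * (sqrt v * x)))" unfolding eq char_def by (subst integral_distr) auto
 also have "\<dots> = char std_normal_distribution (u * sqrt v)" unfolding char_def by (simp add: mult.assoc)
 also have "\<dots> = complex_of_real (exp (- (u\<^sup>2 * v / 2)))" using v by (simp add: char_std_normal_distribution power_mult_distrib)
 finally show ?thesis .
qed

lemma sets_normal_law [simp]: "sets (normal_law m v) = sets borel" by (simp add: normal_law_def)

lemma prob_space_normal_law: "0 \<le> v ==> prob_space (normal_law m v)"
 unfolding normal_law_def by (auto intro: prob_space_return prob_space_normal_density)

lemma normal_law_moments:
 assumes "0 \<le> v"
 shows "integrable (normal_law 0 v) (\<lambda>x. x ^ k)"
  and "(\<integral>x. x \<partial>normal_law 0 v) = 0" and "(\<integral>x. x\<^sup>2 \<partial>normal_law 0 v) = v"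
  and "(\<integral>x. x ^ 4 \<partial>normal_law 0 v) = 3 * v\<^sup>2"
proof -
 have "integrable (normal_law 0 v) (\<lambda>x. x ^ k) \<and> (\<integral>x. x \<partial>normal_law 0 v) = 0 \<and> (\<integral>x. x\<^sup>2 \<partial>normal_law 0 v) = v
  \<and> (\<integral>x. x ^ 4 \<partial>normal_law 0 v) = 3 * v\<^sup>2"
 proof (cases "v = 0")
  case True
  have "integrable (return borel (0::real)) (\<lambda>x. x ^ k)" by (rule integrableI_bounded) (auto simp: nn_integral_return)
  then show ?thesis using True by (simp add: normal_law_def integral_return)
 next
  case False
  then have v: "0 < v" using assms by simp
  then have s: "0 < sqrt v" by simp
  have n: "normal_law 0 v = density lborel (\<lambda>x. ennreal (normal_density 0 (sqrt v) x))" using False by (simp add: normal_law_def)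
  have int: "integrable (normal_law 0 v) (\<lambda>x. x ^ k)" for k unfolding n using integrable_normal_moment[OF s, of 0 k] by (subst integrable_density) auto
  have e: "(\<integral>x. x ^ k \<partial>normal_law 0 v) = (\<integral>x. normal_density 0 (sqrt v) x * (x - 0) ^ k \<partial>lborel)" for k
   unfolding n by (subst integral_density) auto
  show ?thesis using int[of k] e[of 1] e[of "2 * 1"] e[of "2 * 2"] v by (simp only: integral_normal_moment_even[OF s])
    (use integral_normal_moment_odd[OF s, of 0 0] in \<open>simp add: fact_numeral power2_eq_square power_divide field_simps\<close>)
 qed
 then show "integrable (normal_law 0 v) (\<lambda>x. x ^ k)"
  and "(\<integral>x. x \<partial>normal_law 0 v) = 0" and "(\<integral>x. x\<^sup>2 \<partial>normal_law 0 v) = v"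
  and "(\<integral>x. x ^ 4 \<partial>normal_law 0 v) = 3 * v\<^sup>2" by auto
qed

lemma (in prob_space) normal_law_variable:
 assumes [measurable]: "D \<in> borel_measurable M" and law: "distr M borel D = normal_law 0 v" and v: "0 \<le> v"
 shows "integrable M (\<lambda>w. D w ^ k)" "expectation D = 0" "expectation (\<lambda>w. (D w)\<^sup>2) = v"
  "expectation (\<lambda>w. (D w) ^ 4) = 3 * v\<^sup>2"
proof -
 show "integrable M (\<lambda>w. D w ^ k)" using normal_law_moments(1)[OF v, of k] integrable_distr_eq[of D M borel "\<lambda>x. x ^ k"] unfolding law by simp
 have e: "expectation (\<lambda>w. f (D w)) = (\<integral>x. f x \<partial>normal_law 0 v)" if "f \<in> borel_measurable borel" for f :: "real => real"
  unfolding law[symmetric] using that by (intro integral_distr[symmetric]) auto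
 show "expectation D = 0" "expectation (\<lambda>w. (D w)\<^sup>2) = v" "expectation (\<lambda>w. (D w) ^ 4) = 3 * v\<^sup>2"
  using normal_law_moments(2-4)[OF v] e[of "\<lambda>x. x"] e[of "\<lambda>x. x\<^sup>2"] e[of "\<lambda>x. x ^ 4"] by auto
qed

lemma (in prob_space) normal_law_if_char:
 assumes [measurable]: "D \<in> borel_measurable M" and v: "0 \<le> v"
  and char: "\<And>u. char (distr M borel D) u = complex_of_real (exp (- (u\<^sup>2 * v / 2)))"
 shows "distr M borel D = normal_law 0 v"
proof (rule Levy_uniqueness)
 show "real_distribution (distr M borel D)" by (rule real_distribution_distr) simp
 show "real_distribution (normal_law 0 v)" using prob_space_normal_law[OF v, of 0]
  by (simp add: real_distribution_def real_distribution_axioms_def sets_eq_imp_space_eq[OF sets_normal_law])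
 show "char (distr M borel D) = char (normal_law 0 v)" using char char_normal_law[OF v] by auto
qed

section \<open>Limits in mean square\<close>

context prob_space
begin

lemma mean_square_limit_abs:
 assumes [measurable]: "J \<in> borel_measurable M" "\<And>m. S m \<in> borel_measurable M"
  and lim: "(\<lambda>m. \<integral>\<^sup>+w. ennreal ((J w - S m w)\<^sup>2) \<partial>M) \<longlonglongrightarrow> 0"
 shows "(\<lambda>m. \<integral>\<^sup>+w. ennreal \<bar>J w - S m w\<bar> \<partial>M) \<longlonglongrightarrow> 0"
proof (rule order_tendstoI)
 fix e :: ennreal assume e: "0 < e"
 obtain ep where ep: "0 < ep" "ennreal ep + ennreal ep < e"
 proof (cases e)
  case (real x)
  then show ?thesis using that[of "x / 3"] e by (simp add: ennreal_plus[symmetric] ennreal_less_iff del: ennreal_plus)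
 next
  case top
  then show ?thesis using that[of 1] by simp
 qed
 have "(\<lambda>m. ennreal (1 / ep) * (\<integral>\<^sup>+w. ennreal ((J w - S m w)\<^sup>2) \<partial>M)) \<longlonglongrightarrow> ennreal (1 / ep) * 0"
  by (intro ennreal_tendsto_cmult lim) simp
 then have "\<forall>\<^sub>F m in sequentially. ennreal (1 / ep) * (\<integral>\<^sup>+w. ennreal ((J w - S m w)\<^sup>2) \<partial>M) < ennreal ep"
  by (rule order_tendstoD) (use ep in simp)
 then show "\<forall>\<^sub>F m in sequentially. (\<integral>\<^sup>+w. ennreal \<bar>J w - S m w\<bar> \<partial>M) < e"
 proof eventually_elim
  case (elim m)
  \<comment> \<open>This inequality between arithmetic and geometric means bounds the first absolute
    moment by a small constant plus a multiple of the second moment.\<close>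
  have "\<bar>x\<bar> \<le> ep + 1 / ep * x\<^sup>2" for x :: real
  proof -
   have "2 * \<bar>x\<bar> * ep \<le> x\<^sup>2 + ep\<^sup>2" using sum_squares_bound[of "\<bar>x\<bar>" ep] by simp
   then have "\<bar>x\<bar> * ep \<le> ep\<^sup>2 + x\<^sup>2" using zero_le_power2[of x] zero_le_power2[of ep] by linarith
   then have "\<bar>x\<bar> \<le> (ep\<^sup>2 + x\<^sup>2) / ep" using ep(1) by (simp add: pos_le_divide_eq)
   then show ?thesis using ep(1) by (simp add: add_divide_distrib power2_eq_square)
  qed
  then have "(\<integral>\<^sup>+w. ennreal \<bar>J w - S m w\<bar> \<partial>M) \<le> (\<integral>\<^sup>+w. ennreal ep + ennreal (1 / ep) * ennreal ((J w - S m w)\<^sup>2) \<partial>M)"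
   using ep(1) by (intro nn_integral_mono) (simp add: ennreal_mult[symmetric] ennreal_plus[symmetric] del: ennreal_plus)
  also have "\<dots> = ennreal ep + ennreal (1 / ep) * (\<integral>\<^sup>+w. ennreal ((J w - S m w)\<^sup>2) \<partial>M)"
   by (simp add: nn_integral_add nn_integral_cmult emeasure_space_1)
  also have "\<dots> \<le> ennreal ep + ennreal ep" using elim by (intro add_left_mono) simp
  finally show ?case using ep(2) by simp
 qed
qed simp

lemma tendsto_integral_if_mean_square:
 fixes F :: "nat => 'a => 'b::{banach, second_countable_topology}"
 assumes J [measurable]: "J \<in> borel_measurable M" and S [measurable]: "\<And>m. S m \<in> borel_measurable M"
  and lim: "(\<lambda>m. \<integral>\<^sup>+w. ennreal ((J w - S m w)\<^sup>2) \<partial>M) \<longlonglongrightarrow> 0"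
  and F: "\<And>m. integrable M (F m)" "integrable M G"
  and le: "\<And>m w. norm (F m w - G w) \<le> C * \<bar>J w - S m w\<bar>" and C: "0 \<le> C"
 shows "(\<lambda>m. integral\<^sup>L M (F m)) \<longlonglongrightarrow> integral\<^sup>L M G"
proof (rule tendsto_L1_int[OF F])
 have "(\<lambda>m. ennreal C * (\<integral>\<^sup>+w. ennreal \<bar>J w - S m w\<bar> \<partial>M)) \<longlonglongrightarrow> ennreal C * 0"
  by (intro ennreal_tendsto_cmult mean_square_limit_abs lim) simp_all
 then have lim0: "(\<lambda>m. ennreal C * (\<integral>\<^sup>+w. ennreal \<bar>J w - S m w\<bar> \<partial>M)) \<longlonglongrightarrow> 0" by simp
 show "(\<lambda>m. \<integral>\<^sup>+w. ennreal (norm (F m w - G w)) \<partial>M) \<longlonglongrightarrow> 0"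
 proof (rule tendsto_sandwich[OF _ _ tendsto_const lim0])
  show "\<forall>\<^sub>F m in sequentially. (\<integral>\<^sup>+w. ennreal (norm (F m w - G w)) \<partial>M) \<le> ennreal C * (\<integral>\<^sup>+w. ennreal \<bar>J w - S m w\<bar> \<partial>M)"
  proof (rule always_eventually, rule allI)
   fix m
   have "(\<integral>\<^sup>+w. ennreal (norm (F m w - G w)) \<partial>M) \<le> (\<integral>\<^sup>+w. ennreal C * ennreal \<bar>J w - S m w\<bar> \<partial>M)"
    using le C by (intro nn_integral_mono) (simp add: ennreal_mult[symmetric])
   then show "(\<integral>\<^sup>+w. ennreal (norm (F m w - G w)) \<partial>M) \<le> ennreal C * (\<integral>\<^sup>+w. ennreal \<bar>J w - S m w\<bar> \<partial>M)"
    by (simp add: nn_integral_cmult)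
  qed
 qed simp
qed

text \<open>The function \<open>iexp (u * x)\<close> is Lipschitz in x with constant
  \<open>|u|\<close>, so convergence in mean suffices. The fixed summand \<open>U\<close> is there
  for the initial value.\<close>

lemma char_mean_square_limit:
 assumes J [measurable]: "J \<in> borel_measurable M" and S [measurable]: "\<And>m. S m \<in> borel_measurable M"
  and lim: "(\<lambda>m. \<integral>\<^sup>+w. ennreal ((J w - S m w)\<^sup>2) \<partial>M) \<longlonglongrightarrow> 0"
  and U [measurable]: "U \<in> borel_measurable M"
 shows "(\<lambda>m. char (distr M borel (\<lambda>w. U w + S m w)) u) \<longlonglongrightarrow> char (distr M borel (\<lambda>w. U w + J w)) u"
proof -
 have "(\<lambda>m. CLINT w|M. iexp (u * (U w + S m w))) \<longlonglongrightarrow> (CLINT w|M. iexp (u * (U w + J w)))"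
 proof (rule tendsto_integral_if_mean_square[OF J S lim, where C="\<bar>u\<bar>"])
  fix m w
  have "iexp (u * (U w + S m w)) - iexp (u * (U w + J w)) = iexp (u * (U w + J w)) * (iexp (u * (S m w - J w)) - 1)"
   by (simp add: right_diff_distrib mult_exp_exp algebra_simps)
  then have "norm (iexp (u * (U w + S m w)) - iexp (u * (U w + J w))) = norm (iexp (u * (S m w - J w)) - 1)" by (simp add: norm_mult)
  also have "\<dots> \<le> \<bar>u * (S m w - J w)\<bar>" using iexp_approx1[of "u * (S m w - J w)" 0] by simp
  finally show "norm (iexp (u * (U w + S m w)) - iexp (u * (U w + J w))) \<le> \<bar>u\<bar> * \<bar>J w - S m w\<bar>" by (simp add: abs_mult abs_minus_commute)
 qed (auto intro!: integrable_iexp)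
 then show ?thesis by (simp add: char_def integral_distr)
qed

text \<open>The weights will be bounded functions of the past. Moments against all such weights take
  the place of conditional expectations, and this lemma carries them to the limit.\<close>

lemma tendsto_weighted_mean_square:
 assumes J [measurable]: "J \<in> borel_measurable M" and S [measurable]: "\<And>m. S m \<in> borel_measurable M"
  and lim: "(\<lambda>m. \<integral>\<^sup>+w. ennreal ((J w - S m w)\<^sup>2) \<partial>M) \<longlonglongrightarrow> 0"
  and ps [measurable]: "ps \<in> borel_measurable M" and b: "\<And>w. \<bar>ps w\<bar> \<le> b"
  and iS: "\<And>m. integrable M (\<lambda>w. (S m w)\<^sup>2)" and iJ: "integrable M (\<lambda>w. (J w)\<^sup>2)"
 shows "(\<lambda>m. expectation (\<lambda>w. ps w * S m w)) \<longlonglongrightarrow> expectation (\<lambda>w. ps w * J w)"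
  and "(\<lambda>m. expectation (\<lambda>w. ps w * (S m w)\<^sup>2)) \<longlonglongrightarrow> expectation (\<lambda>w. ps w * (J w)\<^sup>2)"
proof -
 have b0: "0 \<le> b" using b by (meson abs_ge_zero order_trans)
 have i1: "integrable M X" if "integrable M (\<lambda>w. (X w)\<^sup>2)" and [measurable]: "X \<in> borel_measurable M" for X :: "'a => real"
  by (rule square_integrable_imp_integrable) (use that in auto)
 have iw: "integrable M (\<lambda>w. ps w * X w)" if "integrable M X" for X :: "'a => real"
  by (rule Bochner_Integration.integrable_bound[of M "\<lambda>w. b * X w"])
   (use that b b0 in \<open>auto simp: abs_mult intro!: mult_right_mono AE_I2\<close>)
 show "(\<lambda>m. expectation (\<lambda>w. ps w * S m w)) \<longlonglongrightarrow> expectation (\<lambda>w. ps w * J w)"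
 proof (rule tendsto_integral_if_mean_square[OF J S lim, where C=b])
  show "norm (ps w * S m w - ps w * J w) \<le> b * \<bar>J w - S m w\<bar>" for m w
   using b[of w] by (simp add: right_diff_distrib[symmetric] abs_mult abs_minus_commute mult_right_mono)
 qed (auto intro!: iw i1 iS iJ b0)
 show "(\<lambda>m. expectation (\<lambda>w. ps w * (S m w)\<^sup>2)) \<longlonglongrightarrow> expectation (\<lambda>w. ps w * (J w)\<^sup>2)"
 proof (rule tendsto_L1_int[OF iw[OF iS] iw[OF iJ]])
  define EJ where "EJ = (\<integral>\<^sup>+w. ennreal ((J w)\<^sup>2) \<partial>M)"
  have EJ: "EJ < \<top>" unfolding EJ_def using iJ by (simp add: nn_integral_eq_integral)
  \<comment> \<open>Young's inequality with a free parameter: the fixed second moment of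
    \<open>J\<close> gets a small coefficient, the difference a large one, which is harmless since
    the difference tends to 0.\<close>
  have ptw: "norm (ps w * (S m w)\<^sup>2 - ps w * (J w)\<^sup>2) \<le> (b * (1 + 1 / ep)) * (J w - S m w)\<^sup>2 + (b * ep) * (J w)\<^sup>2"
   if e: "0 < ep" for ep m w
  proof -
   define d j where "d = S m w - J w" and "j = J w"
   have "(S m w)\<^sup>2 - (J w)\<^sup>2 = d\<^sup>2 + 2 * (d * j)" by (simp add: d_def j_def power2_eq_square algebra_simps)
   moreover have "\<bar>2 * (d * j)\<bar> \<le> 1 / ep * d\<^sup>2 + ep * j\<^sup>2"
   proof -
    have s: "0 < sqrt ep" "sqrt ep * sqrt ep = ep" using e by auto
    have "2 * \<bar>d / sqrt ep\<bar> * \<bar>sqrt ep * j\<bar> \<le> (d / sqrt ep)\<^sup>2 + (sqrt ep * j)\<^sup>2"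
     using sum_squares_bound[of "\<bar>d / sqrt ep\<bar>" "\<bar>sqrt ep * j\<bar>"] unfolding power2_abs .
    then show ?thesis using s e by (simp add: abs_mult power_divide power_mult_distrib)
   qed
   ultimately have "\<bar>(S m w)\<^sup>2 - (J w)\<^sup>2\<bar> \<le> (1 + 1 / ep) * d\<^sup>2 + ep * j\<^sup>2"
    unfolding distrib_right mult_1 using zero_le_power2[of d] by linarith
   then have "\<bar>ps w * ((S m w)\<^sup>2 - (J w)\<^sup>2)\<bar> \<le> b * ((1 + 1 / ep) * d\<^sup>2 + ep * j\<^sup>2)" by (intro abs_mult_le b)
   then show ?thesis by (simp add: d_def j_def algebra_simps power2_commute)
  qed
  have int_le: "(\<integral>\<^sup>+w. ennreal (norm (ps w * (S m w)\<^sup>2 - ps w * (J w)\<^sup>2)) \<partial>M) \<le>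
   ennreal (b * (1 + 1 / ep)) * (\<integral>\<^sup>+w. ennreal ((J w - S m w)\<^sup>2) \<partial>M) + ennreal (b * ep) * EJ" if e: "0 < ep" for ep m
  proof -
   have "(\<integral>\<^sup>+w. ennreal (norm (ps w * (S m w)\<^sup>2 - ps w * (J w)\<^sup>2)) \<partial>M) \<le>
    (\<integral>\<^sup>+w. ennreal (b * (1 + 1 / ep)) * ennreal ((J w - S m w)\<^sup>2) + ennreal (b * ep) * ennreal ((J w)\<^sup>2) \<partial>M)"
    using ptw[OF e] e b0 by (intro nn_integral_mono) (simp add: ennreal_mult[symmetric] ennreal_plus[symmetric] del: ennreal_plus)
   then show ?thesis by (simp add: nn_integral_add nn_integral_cmult EJ_def)
  qed
  show "(\<lambda>m. \<integral>\<^sup>+w. ennreal (norm (ps w * (S m w)\<^sup>2 - ps w * (J w)\<^sup>2)) \<partial>M) \<longlonglongrightarrow> 0"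
  proof (rule order_tendstoI)
   fix e :: ennreal assume e: "0 < e"
   have "((\<lambda>ep. EJ * ennreal (b * ep)) \<longlongrightarrow> EJ * ennreal (b * 0)) (at_right 0)"
    by (intro ennreal_tendsto_cmult[OF EJ] tendsto_ennrealI tendsto_intros)
   then have "((\<lambda>ep. ennreal (b * ep) * EJ) \<longlongrightarrow> ennreal (b * 0) * EJ) (at_right 0)" by (simp add: mult.commute)
   then have "\<forall>\<^sub>F ep in at_right 0. ennreal (b * ep) * EJ < e" by (rule order_tendstoD) (use e in simp)
   then have "\<forall>\<^sub>F ep in at_right 0. 0 < ep \<and> ennreal (b * ep) * EJ < e" using eventually_at_right_less[of "0::real"] by eventually_elim simp
   then obtain ep where ep: "0 < ep" "ennreal (b * ep) * EJ < e" using eventually_happens'[of "at_right (0::real)"] by (auto simp: trivial_limit_at_right_real)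
   have "(\<lambda>m. ennreal (b * (1 + 1 / ep)) * (\<integral>\<^sup>+w. ennreal ((J w - S m w)\<^sup>2) \<partial>M) + ennreal (b * ep) * EJ)
    \<longlonglongrightarrow> ennreal (b * (1 + 1 / ep)) * 0 + ennreal (b * ep) * EJ" by (intro tendsto_add tendsto_const ennreal_tendsto_cmult lim) simp
   then have "\<forall>\<^sub>F m in sequentially. ennreal (b * (1 + 1 / ep)) * (\<integral>\<^sup>+w. ennreal ((J w - S m w)\<^sup>2) \<partial>M) + ennreal (b * ep) * EJ < e"
    by (rule order_tendstoD) (use ep in simp)
   then show "\<forall>\<^sub>F m in sequentially. (\<integral>\<^sup>+w. ennreal (norm (ps w * (S m w)\<^sup>2 - ps w * (J w)\<^sup>2)) \<partial>M) < e"
    by eventually_elim (rule le_less_trans[OF int_le[OF ep(1)]])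
  qed simp
 qed
qed

end

section \<open>Components of Hilbert space valued Wiener processes and equations\<close>

lemma inner_mean_square_tendsto:
 fixes F :: "nat => 'w' => 'h::real_inner"
 assumes "(\<lambda>j. \<integral>\<^sup>+w. ennreal ((norm (F j w))\<^sup>2) \<partial>M) \<longlonglongrightarrow> 0"
  and [measurable]: "\<And>j. (\<lambda>w. norm (F j w)) \<in> borel_measurable M"
 shows "(\<lambda>j. \<integral>\<^sup>+w. ennreal ((norm (F j w \<bullet> h))\<^sup>2) \<partial>M) \<longlonglongrightarrow> 0"
proof (rule tendsto_sandwich[OF _ _ tendsto_const])
 have "(\<lambda>j. ennreal ((norm h)\<^sup>2) * (\<integral>\<^sup>+w. ennreal ((norm (F j w))\<^sup>2) \<partial>M)) \<longlonglongrightarrow> ennreal ((norm h)\<^sup>2) * 0"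
  by (intro ennreal_tendsto_cmult assms) simp
 then show "(\<lambda>j. ennreal ((norm h)\<^sup>2) * (\<integral>\<^sup>+w. ennreal ((norm (F j w))\<^sup>2) \<partial>M)) \<longlonglongrightarrow> 0" by simp
 show "\<forall>\<^sub>F j in sequentially. (\<integral>\<^sup>+w. ennreal ((norm (F j w \<bullet> h))\<^sup>2) \<partial>M) \<le> ennreal ((norm h)\<^sup>2) * (\<integral>\<^sup>+w. ennreal ((norm (F j w))\<^sup>2) \<partial>M)"
 proof (rule always_eventually, rule allI)
  fix j
  have "(norm (x \<bullet> h))\<^sup>2 \<le> (norm h)\<^sup>2 * (norm x)\<^sup>2" for x :: 'h
   using power_mono[OF Cauchy_Schwarz_ineq2[of x h], of 2] by (simp add: power_mult_distrib mult.commute)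
  then have "(\<integral>\<^sup>+w. ennreal ((norm (F j w \<bullet> h))\<^sup>2) \<partial>M) \<le> (\<integral>\<^sup>+w. ennreal ((norm h)\<^sup>2) * ennreal ((norm (F j w))\<^sup>2) \<partial>M)"
   by (intro nn_integral_mono) (simp add: ennreal_mult[symmetric])
  then show "(\<integral>\<^sup>+w. ennreal ((norm (F j w \<bullet> h))\<^sup>2) \<partial>M) \<le> ennreal ((norm h)\<^sup>2) * (\<integral>\<^sup>+w. ennreal ((norm (F j w))\<^sup>2) \<partial>M)"
   by (simp add: nn_integral_cmult)
 qed
qed simp

lemma is_stoch_integral_inner:
 fixes W :: "real => 'w' => 'h::{real_inner, second_countable_topology}"
 assumes "is_stoch_integral M W g t Z" and W: "\<And>s. s \<in> {0..t} ==> W s \<in> borel_measurable M"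
 shows "is_stoch_integral M (\<lambda>t w. W t w \<bullet> h) g t (\<lambda>w. Z w \<bullet> h)"
proof -
 obtain m :: "nat => nat" and ta c where Z [measurable]: "Z \<in> borel_measurable M" and g: "set_borel_measurable lborel {0..t} g"
  and part: "\<forall>j. ta j 0 = 0 \<and> ta j (m j) = t \<and> (\<forall>i<m j. ta j i \<le> ta j (Suc i))"
  and f: "(\<lambda>j. \<integral>\<^sup>+ r\<in>{0..t}. ennreal ((g r - (\<Sum>i<m j. c j i * indicator {ta j i<..ta j (Suc i)} r))\<^sup>2) \<partial>lborel) \<longlonglongrightarrow> 0"
  and J: "(\<lambda>j. \<integral>\<^sup>+ w. ennreal ((norm (Z w - (\<Sum>i<m j. c j i *\<^sub>R (W (ta j (Suc i)) w - W (ta j i) w))))\<^sup>2) \<partial>M) \<longlonglongrightarrow> 0"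
  using assms(1) unfolding is_stoch_integral_def by blast
 have mono: "ta j i \<le> ta j i'" if "i \<le> i'" "i' \<le> m j" for i i' j
  using that by (induction i' rule: dec_induct) (use part in \<open>auto intro: order_trans\<close>)
 have in_range: "ta j i \<in> {0..t}" if "i \<le> m j" for i j using mono[of 0 i j] mono[of i "m j" j] that part by auto
 have meas: "(\<lambda>w. norm (Z w - (\<Sum>i<m j. c j i *\<^sub>R (W (ta j (Suc i)) w - W (ta j i) w)))) \<in> borel_measurable M" for j
  by (intro measurable_compose[OF _ borel_measurable_norm] borel_measurable_diff Z borel_measurable_sum borel_measurable_scaleR borel_measurable_const W in_range) auto
 show ?thesis unfolding is_stoch_integral_def
 proof (intro conjI g, simp, rule exI[of _ m], rule exI[of _ ta], rule exI[of _ c], intro conjI part f)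
  show "(\<lambda>j. \<integral>\<^sup>+ w. ennreal ((norm (Z w \<bullet> h - (\<Sum>i<m j. c j i *\<^sub>R (W (ta j (Suc i)) w \<bullet> h - W (ta j i) w \<bullet> h))))\<^sup>2) \<partial>M) \<longlonglongrightarrow> 0"
   using inner_mean_square_tendsto[OF J meas, of h] by (simp add: inner_diff_left inner_sum_left)
 qed
qed

text \<open>In a fixed direction h the vector-valued Lebesgue integral becomes a gauge integral of a
  real function, the form in which the pathwise argument is stated.\<close>

lemma sde_solution_component:
 fixes W :: "real => 'w' => 'h::{real_inner, banach, second_countable_topology}"
 assumes sol: "sde_solution M I W b g xi Y" and W: "\<And>s. s \<in> I ==> W s \<in> borel_measurable M"
  and I: "\<And>t. t \<in> I ==> {0..t} \<subseteq> I"
 shows "\<exists>Z. (\<forall>t\<in>I. is_stoch_integral M (\<lambda>t w. W t w \<bullet> h) g t (Z t)) \<and>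
  (AE w in M. continuous_on I (\<lambda>t. Y t w) \<and> continuous_on I (\<lambda>t. Y t w \<bullet> h) \<and>
   (\<forall>t\<in>I. Y t w \<bullet> h = xi w \<bullet> h + integral {0..t} (\<lambda>r. b r (Y r w) \<bullet> h) + Z t w))"
proof -
 obtain Z where cont: "AE w in M. continuous_on I (\<lambda>t. Y t w)"
  and Z: "\<And>t. t \<in> I ==> is_stoch_integral M W g t (Z t)"
  and eq: "AE w in M. \<forall>t\<in>I. set_integrable lborel {0..t} (\<lambda>r. b r (Y r w)) \<and>
     Y t w = xi w + (LINT r:{0..t}|lborel. b r (Y r w)) + Z t w" using sol unfolding sde_solution_def continuous_process_def by blast
 show ?thesis
 proof (intro exI[of _ "\<lambda>t w. Z t w \<bullet> h"] conjI ballI)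
  show "is_stoch_integral M (\<lambda>t w. W t w \<bullet> h) g t (\<lambda>w. Z t w \<bullet> h)" if "t \<in> I" for t
   using I[OF that] by (intro is_stoch_integral_inner Z that W) auto
  show "AE w in M. continuous_on I (\<lambda>t. Y t w) \<and> continuous_on I (\<lambda>t. Y t w \<bullet> h) \<and>
   (\<forall>t\<in>I. Y t w \<bullet> h = xi w \<bullet> h + integral {0..t} (\<lambda>r. b r (Y r w) \<bullet> h) + Z t w \<bullet> h)" using cont eq
  proof eventually_elim
   case (elim w)
   show ?case
   proof (intro conjI ballI continuous_on_inner elim continuous_on_const)
    fix t assume t: "t \<in> I"
    have si: "set_integrable lborel {0..t} (\<lambda>r. b r (Y r w))" using elim t by blast
    have si': "set_integrable lborel {0..t} (\<lambda>r. b r (Y r w) \<bullet> h)"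
     using integrable_inner_left[of h, OF si[unfolded set_integrable_def]] unfolding set_integrable_def by (simp add: inner_scaleR_left)
    have "(LINT r:{0..t}|lborel. b r (Y r w)) \<bullet> h = (LINT r:{0..t}|lborel. b r (Y r w) \<bullet> h)"
     unfolding set_lebesgue_integral_def using si[unfolded set_integrable_def] by (subst integral_inner_left[symmetric]) (auto simp: inner_scaleR_left)
    also have "\<dots> = integral {0..t} (\<lambda>r. b r (Y r w) \<bullet> h)" by (rule set_borel_integral_eq_integral(2)[OF si'])
    finally show "Y t w \<bullet> h = xi w \<bullet> h + integral {0..t} (\<lambda>r. b r (Y r w) \<bullet> h) + Z t w \<bullet> h" using elim t by (metis inner_add_left)
   qed
  qed
 qed
qed

section \<open>Scalar components of a Hilbert space valued Wiener process\<close>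

locale wiener = prob_space M for M :: "'w' measure" +
 fixes I :: "real set" and Q :: "'h::{real_inner, banach, second_countable_topology} => 'h" and W :: "real => 'w' => 'h"
 assumes wiener: "wiener_process M I Q W"
  and zero_in: "0 \<in> I" and nonneg: "\<And>t. t \<in> I ==> 0 \<le> t"
  and Q_nonneg: "\<And>h. 0 \<le> Q h \<bullet> h"
begin

lemma W_measurable [measurable]: "t \<in> I ==> W t \<in> borel_measurable M" using wiener by (simp add: wiener_process_def continuous_process_def)

lemma component_measurable: "t \<in> I ==> (\<lambda>w. W t w \<bullet> h) \<in> borel_measurable M" by simp

lemma increment_law:
 assumes "s \<in> I" "t \<in> I" "s \<le> t"
 shows "distr M borel (\<lambda>w. W t w \<bullet> h - W s w \<bullet> h) = normal_law 0 ((t - s) * (Q h \<bullet> h))"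
proof -
 have [measurable]: "W t \<in> borel_measurable M" "W s \<in> borel_measurable M" using assms by auto
 have "gaussian_law (distr M borel (\<lambda>w. W t w - W s w)) 0 (\<lambda>x. (t - s) *\<^sub>R Q x)" using wiener assms by (simp add: wiener_process_def)
 then have "distr (distr M borel (\<lambda>w. W t w - W s w)) borel (\<lambda>x. x \<bullet> h) = normal_law (0 \<bullet> h) (((t - s) *\<^sub>R Q h) \<bullet> h)"
  unfolding gaussian_law_def by blast
 then show ?thesis by (subst (asm) distr_distr) (auto simp: o_def inner_diff_left)
qed

lemma increment_moments:
 assumes "s \<in> I" "t \<in> I" "s \<le> t"
 shows "integrable M (\<lambda>w. (W t w \<bullet> h - W s w \<bullet> h) ^ k)"
  "expectation (\<lambda>w. W t w \<bullet> h - W s w \<bullet> h) = 0"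
  "expectation (\<lambda>w. (W t w \<bullet> h - W s w \<bullet> h)\<^sup>2) = (t - s) * (Q h \<bullet> h)"
proof -
 have v: "0 \<le> (t - s) * (Q h \<bullet> h)" using assms Q_nonneg by simp
 have m: "(\<lambda>w. W t w \<bullet> h - W s w \<bullet> h) \<in> borel_measurable M" using assms by simp
 note * = normal_law_variable[OF m increment_law[OF assms] v]
 show "integrable M (\<lambda>w. (W t w \<bullet> h - W s w \<bullet> h) ^ k)"
  "expectation (\<lambda>w. W t w \<bullet> h - W s w \<bullet> h) = 0"
  "expectation (\<lambda>w. (W t w \<bullet> h - W s w \<bullet> h)\<^sup>2) = (t - s) * (Q h \<bullet> h)" using * by auto
qed

lemma indep_increments:
 assumes "\<And>i. i \<le> m ==> ta i \<in> I" "\<And>i. i < m ==> ta i \<le> ta (Suc i)"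
 shows "indep_vars (\<lambda>_. borel) (\<lambda>i w. c i * (W (ta (Suc i)) w \<bullet> h - W (ta i) w \<bullet> h)) {..<m::nat}"
proof -
 have "indep_vars (\<lambda>_. borel) (\<lambda>i w. W (ta (Suc i)) w - W (ta i) w) {..<m}" using wiener assms by (simp add: wiener_process_def independent_increments_def)
 from indep_vars_compose2[OF this, of "\<lambda>i x. c i * (x \<bullet> h)" "\<lambda>_. borel"]
 show ?thesis by (simp add: inner_diff_left)
qed

lemma char_increment_sum:
 assumes "\<And>i. i \<le> m ==> ta i \<in> I" "\<And>i. i < m ==> ta i \<le> ta (Suc i)"
 shows "char (distr M borel (\<lambda>w. \<Sum>i<m. c i * (W (ta (Suc i)) w \<bullet> h - W (ta i) w \<bullet> h))) u =
  complex_of_real (exp (- (u\<^sup>2 * ((Q h \<bullet> h) * (\<Sum>i<m. (c i)\<^sup>2 * (ta (Suc i) - ta i))) / 2)))"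
proof -
 have "char (distr M borel (\<lambda>w. c i * (W (ta (Suc i)) w \<bullet> h - W (ta i) w \<bullet> h))) u =
  complex_of_real (exp (- (u\<^sup>2 * ((Q h \<bullet> h) * ((c i)\<^sup>2 * (ta (Suc i) - ta i))) / 2)))" if i: "i < m" for i
 proof -
  let ?D = "\<lambda>w. W (ta (Suc i)) w \<bullet> h - W (ta i) w \<bullet> h"
  have t: "ta i \<in> I" "ta (Suc i) \<in> I" "ta i \<le> ta (Suc i)" using assms i by auto
  then have [measurable]: "?D \<in> borel_measurable M" by simp
  have "char (distr M borel (\<lambda>w. c i * ?D w)) u = char (distr M borel ?D) (u * c i)" by (simp add: char_def integral_distr mult.assoc)
  also have "\<dots> = complex_of_real (exp (- ((u * c i)\<^sup>2 * ((ta (Suc i) - ta i) * (Q h \<bullet> h)) / 2)))"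
   unfolding increment_law[OF t] using t Q_nonneg by (intro char_normal_law) simp
  finally show ?thesis by (simp add: power_mult_distrib ac_simps)
 qed
 then have "char (distr M borel (\<lambda>w. \<Sum>i<m. c i * (W (ta (Suc i)) w \<bullet> h - W (ta i) w \<bullet> h))) u =
  (\<Prod>i<m. complex_of_real (exp (- (u\<^sup>2 * ((Q h \<bullet> h) * ((c i)\<^sup>2 * (ta (Suc i) - ta i))) / 2))))"
  using char_distr_sum[OF indep_increments[of m ta c h], of u] assms by simp
 also have "\<dots> = complex_of_real (exp (\<Sum>i<m. - (u\<^sup>2 * ((Q h \<bullet> h) * ((c i)\<^sup>2 * (ta (Suc i) - ta i))) / 2)))"
  by (simp add: exp_sum of_real_prod)
 also have "(\<Sum>i<m. - (u\<^sup>2 * ((Q h \<bullet> h) * ((c i)\<^sup>2 * (ta (Suc i) - ta i))) / 2)) = - (u\<^sup>2 * ((Q h \<bullet> h) * (\<Sum>i<m. (c i)\<^sup>2 * (ta (Suc i) - ta i))) / 2)"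
  by (simp add: sum_negf sum_distrib_left sum_divide_distrib)
 finally show ?thesis .
qed

text \<open>The covariance at times s and t is \<open>q * min s t\<close>; expanding the product of
  two increments into four such terms gives the length of the overlap of their intervals.\<close>

lemma wiener_isometry_component: "wiener_isometry M (\<lambda>t w. W t w \<bullet> h) I (Q h \<bullet> h)"
proof -
 define q where "q = Q h \<bullet> h"
 \<comment> \<open>The value at time 0 is subtracted since it vanishes almost surely only; the
   increments are unchanged.\<close>
 define B where "B t w = W t w \<bullet> h - W 0 w \<bullet> h" for t w
 have [measurable]: "t \<in> I ==> B t \<in> borel_measurable M" for t unfolding B_def[abs_def] using zero_in by simp
 have sq: "integrable M (\<lambda>w. (B t w)\<^sup>2)" "expectation (\<lambda>w. (B t w)\<^sup>2) = q * t" if "t \<in> I" for t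
  unfolding B_def using increment_moments[OF zero_in that nonneg[OF that], of h] by (auto simp: q_def)
 have cov': "integrable M (\<lambda>w. B s w * B t w) \<and> expectation (\<lambda>w. B s w * B t w) = q * s" if st: "s \<in> I" "t \<in> I" "s \<le> t" for s t
 proof -
  \<comment> \<open>The partition 0, s, t has two cells, whose independent increments split
    \<open>B t\<close> into \<open>B s\<close> and a centred remainder.\<close>
  define ta where "ta i = (if i = 0 then 0 else if i = 1 then s else t)" for i :: nat
  have "indep_vars (\<lambda>_. borel) (\<lambda>i w. 1 * (W (ta (Suc i)) w \<bullet> h - W (ta i) w \<bullet> h)) {..<2}"
   by (rule indep_increments) (use st zero_in nonneg in \<open>auto simp: ta_def\<close>)
  moreover have "{..<2} = insert 0 {1::nat}" by auto
  ultimately have "indep_vars (\<lambda>_. borel) (\<lambda>i w. W (ta (Suc i)) w \<bullet> h - W (ta i) w \<bullet> h) (insert 0 {1::nat})" by simp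
  from indep_vars_sum[OF _ _ this]
  have ind: "indep_var borel (B s) borel (\<lambda>w. W t w \<bullet> h - W s w \<bullet> h)" by (simp add: ta_def B_def[abs_def])
  have i1: "integrable M (B s)" "expectation (B s) = 0"
   unfolding B_def[abs_def] using increment_moments(1)[OF zero_in st(1) nonneg[OF st(1)], of h 1] increment_moments(2)[OF zero_in st(1) nonneg[OF st(1)], of h] by auto
  have i2: "integrable M (\<lambda>w. W t w \<bullet> h - W s w \<bullet> h)" "expectation (\<lambda>w. W t w \<bullet> h - W s w \<bullet> h) = 0"
   using increment_moments(1)[OF st, of h 1] increment_moments(2)[OF st, of h] by auto
  have p: "integrable M (\<lambda>w. B s w * (W t w \<bullet> h - W s w \<bullet> h))" "expectation (\<lambda>w. B s w * (W t w \<bullet> h - W s w \<bullet> h)) = 0"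
   using indep_var_integrable[OF ind i1(1) i2(1)] indep_var_lebesgue_integral[OF ind i1(1) i2(1)] i1 i2 by auto
  have e: "(\<lambda>w. B s w * B t w) = (\<lambda>w. (B s w)\<^sup>2 + B s w * (W t w \<bullet> h - W s w \<bullet> h))"
   by (auto simp: B_def power2_eq_square algebra_simps)
  show ?thesis unfolding e using p sq[OF st(1)] by simp
 qed
 have cov: "integrable M (\<lambda>w. B s w * B t w)" "expectation (\<lambda>w. B s w * B t w) = q * min s t" if "s \<in> I" "t \<in> I" for s t
  using cov'[of s t] cov'[of t s] that by (cases "s \<le> t"; simp add: mult.commute min_def)+
 show ?thesis
 proof
  show "(\<lambda>w. W t w \<bullet> h) \<in> borel_measurable M" if "t \<in> I" for t using that by simp
  show "0 \<le> Q h \<bullet> h" by (rule Q_nonneg)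
  fix s t u v assume i: "s \<in> I" "t \<in> I" "u \<in> I" "v \<in> I" and le: "s \<le> t" "u \<le> v"
  have e: "(\<lambda>w. (W t w \<bullet> h - W s w \<bullet> h) * (W v w \<bullet> h - W u w \<bullet> h)) =
   (\<lambda>w. B t w * B v w - B t w * B u w - B s w * B v w + B s w * B u w)" by (auto simp: B_def algebra_simps)
  show "integrable M (\<lambda>w. (W t w \<bullet> h - W s w \<bullet> h) * (W v w \<bullet> h - W u w \<bullet> h))"
   unfolding e using cov(1) i by (intro Bochner_Integration.integrable_add Bochner_Integration.integrable_diff) auto
  have "{s<..t} \<inter> {u<..v} = {max s u<..min t v}" by auto
  then have m: "measure lborel ({s<..t} \<inter> {u<..v}) = (if max s u \<le> min t v then min t v - max s u else 0)" by (auto simp: measure_def)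
  have "expectation (\<lambda>w. (W t w \<bullet> h - W s w \<bullet> h) * (W v w \<bullet> h - W u w \<bullet> h)) = q * min t v - q * min t u - q * min s v + q * min s u"
   unfolding e using cov i by simp
  also have "\<dots> = q * (min t v - min t u - min s v + min s u)" by (simp add: algebra_simps)
  also have "min t v - min t u - min s v + min s u = measure lborel ({s<..t} \<inter> {u<..v})" unfolding m using le by (auto simp: min_def max_def)
  finally show "expectation (\<lambda>w. (W t w \<bullet> h - W s w \<bullet> h) * (W v w \<bullet> h - W u w \<bullet> h)) = (Q h \<bullet> h) * measure lborel ({s<..t} \<inter> {u<..v})"
   by (simp add: q_def)
 qed
qed

end

section \<open>The forward equation\<close>

lemma C1_positive_continuous: "C1_positive T \<alpha> ==> continuous_on {0..T} \<alpha>" unfolding C1_positive_def by (auto intro: DERIV_continuous_on)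

lemma a_fun_eq:
 assumes "continuous_on {0..T} \<alpha>" "t \<in> {0..T}"
 shows "a_fun \<alpha> t = exp (1 / 2 * integral {0..t} \<alpha>)"
proof -
 have "set_integrable lborel {0..t} \<alpha>" by (rule borel_integrable_atLeastAtMost', rule continuous_on_subset[OF assms(1)]) (use assms(2) in auto)
 from set_borel_integral_eq_integral(2)[OF this] show ?thesis by (simp add: a_fun_def)
qed

lemma a_fun_0 [simp]: "a_fun \<alpha> 0 = 1"
proof -
 have "(\<lambda>r. indicator {0..0} r *\<^sub>R \<alpha> r) = (\<lambda>r. indicator {0::real} r *\<^sub>R \<alpha> 0)" by (auto simp: indicator_def)
 then have "(LINT r:{0..0}|lborel. \<alpha> r) = (LINT r|lborel. indicator {0::real} r *\<^sub>R \<alpha> 0)" unfolding set_lebesgue_integral_def by simp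
 then have "(LINT r:{0..0}|lborel. \<alpha> r) = 0" by simp
 then show ?thesis by (simp add: a_fun_def)
qed

lemma a_fun_pos: "0 < a_fun \<alpha> t" by (simp add: a_fun_def)

lemma a_fun_has_derivative:
 assumes "continuous_on {0..T} \<alpha>" "t \<in> {0..T}"
 shows "(a_fun \<alpha> has_real_derivative (1 / 2 * \<alpha> t * a_fun \<alpha> t)) (at t within {0..T})" unfolding has_field_derivative_def
proof (rule has_derivative_transform[OF assms(2)])
 have "((\<lambda>t. integral {0..t} \<alpha>) has_real_derivative \<alpha> t) (at t within {0..T})"
  using integral_has_vector_derivative[OF assms] by (simp add: has_real_derivative_iff_has_vector_derivative)
 then have "((\<lambda>t. exp (1 / 2 * integral {0..t} \<alpha>)) has_real_derivative (1 / 2 * \<alpha> t * a_fun \<alpha> t)) (at t within {0..T})"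
  unfolding a_fun_eq[OF assms] by (auto intro!: derivative_eq_intros)
 then show "((\<lambda>t. exp (1 / 2 * integral {0..t} \<alpha>)) has_derivative (*) (1 / 2 * \<alpha> t * a_fun \<alpha> t)) (at t within {0..T})"
  unfolding has_field_derivative_def .
qed (simp add: a_fun_eq[OF assms(1)])

lemma a_fun_mono:
 assumes "C1_positive T \<alpha>" "0 \<le> s" "s \<le> t" "t \<le> T"
 shows "a_fun \<alpha> s \<le> a_fun \<alpha> t" "s < t ==> a_fun \<alpha> s < a_fun \<alpha> t"
proof -
 note c = C1_positive_continuous[OF assms(1)]
 have d: "(a_fun \<alpha> has_real_derivative (1 / 2 * \<alpha> r * a_fun \<alpha> r)) (at r within {s..t})" if "r \<in> {s..t}" for r
  by (rule has_field_derivative_subset[OF a_fun_has_derivative[OF c]]) (use that assms in auto)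
 show lt: "a_fun \<alpha> s < a_fun \<alpha> t" if "s < t"
 proof (rule DERIV_pos_imp_increasing_open[OF that])
  fix r assume r: "s < r" "r < t"
  then have "(a_fun \<alpha> has_real_derivative (1 / 2 * \<alpha> r * a_fun \<alpha> r)) (at r)"
   using d[of r, unfolded at_within_Icc_at[OF r]] by (meson atLeastAtMost_iff less_imp_le)
  moreover have "0 < \<alpha> r" using assms(1)[unfolded C1_positive_def] assms r by simp
  then have "0 < 1 / 2 * \<alpha> r * a_fun \<alpha> r" using a_fun_pos[of \<alpha> r] by simp
  ultimately show "\<exists>y. (a_fun \<alpha> has_real_derivative y) (at r) \<and> 0 < y" by blast
 qed (rule DERIV_continuous_on, rule d)
 show "a_fun \<alpha> s \<le> a_fun \<alpha> t" using lt assms by (cases "s = t") auto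
qed

text \<open>The square of \<open>a_fun\<close> has derivative \<open>\<alpha>\<close> times itself.
  The integral is the variance, per unit of \<open>lam k\<close>, that the rescaled process collects
  between s and t.\<close>

lemma integral_a_fun_square:
 assumes C1: "C1_positive T \<alpha>" and st: "0 \<le> s" "s \<le> t" "t \<le> T"
 shows "integral {s..t} (\<lambda>r. (a_fun \<alpha> r * sqrt (\<alpha> r))\<^sup>2) = (a_fun \<alpha> t)\<^sup>2 - (a_fun \<alpha> s)\<^sup>2"
proof -
 note c = C1_positive_continuous[OF C1]
 have "((\<lambda>r. (a_fun \<alpha> r * sqrt (\<alpha> r))\<^sup>2) has_integral ((a_fun \<alpha> t)\<^sup>2 - (a_fun \<alpha> s)\<^sup>2)) {s..t}"
 proof (rule fundamental_theorem_of_calculus[OF st(2)])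
  fix r assume r: "r \<in> {s..t}"
  have "(a_fun \<alpha> has_real_derivative (1 / 2 * \<alpha> r * a_fun \<alpha> r)) (at r within {s..t})"
   by (rule has_field_derivative_subset[OF a_fun_has_derivative[OF c]]) (use r st in auto)
  then have "((\<lambda>r. (a_fun \<alpha> r)\<^sup>2) has_real_derivative (2 * a_fun \<alpha> r * (1 / 2 * \<alpha> r * a_fun \<alpha> r))) (at r within {s..t})"
   by (auto intro!: derivative_eq_intros)
  moreover have "0 \<le> \<alpha> r" using C1 r st by (auto simp: C1_positive_def intro: less_imp_le)
  ultimately show "((\<lambda>r. (a_fun \<alpha> r)\<^sup>2) has_vector_derivative (a_fun \<alpha> r * sqrt (\<alpha> r))\<^sup>2) (at r within {s..t})"
   by (simp add: has_real_derivative_iff_has_vector_derivative power_mult_distrib power2_eq_square ac_simps)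
 qed
 then show ?thesis by (rule integral_unique)
qed

text \<open>\<open>W'\<close> is either the full or the truncated noise; only its component in
  direction h matters. Solutions for both are approximated by the same sums over \<open>W\<close>,
  which later yields equal components for the two processes.\<close>

lemma (in wiener) forward_component:
 assumes C1: "C1_positive T \<alpha>" and I: "I = {0..T}" and r: "r \<in> {0..T}"
  and sol: "forward_solution M T \<alpha> W' xi X" and W': "\<And>t. t \<in> I ==> W' t \<in> borel_measurable M"
  and W'h: "\<And>t w. W' t w \<bullet> h = W t w \<bullet> h"
 shows "\<exists>J\<in>borel_measurable M. (AE w in M. a_fun \<alpha> r * (X r w \<bullet> h) = xi w \<bullet> h + J w) \<and>
  (\<lambda>m. \<integral>\<^sup>+w. ennreal ((J w - (\<Sum>i<Suc m. a_fun \<alpha> (grid 0 r m i) * sqrt (\<alpha> (grid 0 r m i)) *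
    (W (grid 0 r m (Suc i)) w \<bullet> h - W (grid 0 r m i) w \<bullet> h)))\<^sup>2) \<partial>M) \<longlonglongrightarrow> 0"
proof -
 interpret B: wiener_isometry M "\<lambda>t w. W t w \<bullet> h" I "Q h \<bullet> h" by (rule wiener_isometry_component)
 note c = C1_positive_continuous[OF C1]
 have "\<exists>Z. (\<forall>t\<in>{0..T}. is_stoch_integral M (\<lambda>t w. W' t w \<bullet> h) (\<lambda>t. sqrt (\<alpha> t)) t (Z t)) \<and>
  (AE w in M. continuous_on {0..T} (\<lambda>t. X t w) \<and> continuous_on {0..T} (\<lambda>t. X t w \<bullet> h) \<and>
   (\<forall>t\<in>{0..T}. X t w \<bullet> h = xi w \<bullet> h + integral {0..t} (\<lambda>r. ((- (1 / 2) * \<alpha> r) *\<^sub>R X r w) \<bullet> h) + Z t w))"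
  by (rule sde_solution_component[OF sol[unfolded forward_solution_def]]) (use W' I in auto)
 then obtain Z where Z: "\<And>t. t \<in> {0..T} ==> is_stoch_integral M (\<lambda>t w. W t w \<bullet> h) (\<lambda>t. sqrt (\<alpha> t)) t (Z t)"
  and path0: "AE w in M. continuous_on {0..T} (\<lambda>t. X t w) \<and> continuous_on {0..T} (\<lambda>t. X t w \<bullet> h) \<and>
   (\<forall>t\<in>{0..T}. X t w \<bullet> h = xi w \<bullet> h + integral {0..t} (\<lambda>r. ((- (1 / 2) * \<alpha> r) *\<^sub>R X r w) \<bullet> h) + Z t w)"
  unfolding W'h by blast
 have path: "AE w in M. continuous_on {0..T} (\<lambda>t. X t w \<bullet> h) \<and>
   (\<forall>t\<in>{0..T}. X t w \<bullet> h = xi w \<bullet> h + integral {0..t} (\<lambda>r. ((- (1 / 2) * \<alpha> r) *\<^sub>R X r w) \<bullet> h) + Z t w)"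
  using path0 by eventually_elim blast
 have "\<exists>J\<in>borel_measurable M. (AE w in M. J w = a_fun \<alpha> r * (X r w \<bullet> h) - a_fun \<alpha> 0 * (X 0 w \<bullet> h) - integral {0..r} (\<lambda>r. a_fun \<alpha> r * 0)) \<and>
  (\<lambda>m. \<integral>\<^sup>+w. ennreal ((J w - (\<Sum>i<Suc m. a_fun \<alpha> (grid 0 r m i) * sqrt (\<alpha> (grid 0 r m i)) *
    (W (grid 0 r m (Suc i)) w \<bullet> h - W (grid 0 r m i) w \<bullet> h)))\<^sup>2) \<partial>M) \<longlonglongrightarrow> 0"
 proof (rule B.linear_sde_increment[where b=T and c="\<lambda>r. - (1 / 2) * \<alpha> r" and x="\<lambda>w t. X t w \<bullet> h" and d="\<lambda>_ _. 0" and ?x0.0="\<lambda>w. xi w \<bullet> h" and Z=Z])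
  show "continuous_on {0..T} (\<lambda>t. sqrt (\<alpha> t))" "continuous_on {0..T} (\<lambda>r. - (1 / 2) * \<alpha> r)" by (intro continuous_intros c)+
  show "(a_fun \<alpha> has_real_derivative - (- (1 / 2) * \<alpha> r * a_fun \<alpha> r)) (at r within {0..T})" if "r \<in> {0..T}" for r
   using a_fun_has_derivative[OF c that] by simp
  show "AE w in M. continuous_on {0..T} (\<lambda>t. X t w \<bullet> h) \<and> continuous_on {0..T} (\<lambda>_. 0 :: real) \<and>
   (\<forall>r\<in>{0..T}. X r w \<bullet> h = xi w \<bullet> h + integral {0..r} (\<lambda>u. - (1 / 2) * \<alpha> u * (X u w \<bullet> h) + 0) + Z r w)"
   using path by eventually_elim simp
 qed (use r I Z in auto)
 then obtain J where J: "J \<in> borel_measurable M" "AE w in M. J w = a_fun \<alpha> r * (X r w \<bullet> h) - a_fun \<alpha> 0 * (X 0 w \<bullet> h) - integral {0..r} (\<lambda>r. a_fun \<alpha> r * 0)"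
  and lim: "(\<lambda>m. \<integral>\<^sup>+w. ennreal ((J w - (\<Sum>i<Suc m. a_fun \<alpha> (grid 0 r m i) * sqrt (\<alpha> (grid 0 r m i)) *
    (W (grid 0 r m (Suc i)) w \<bullet> h - W (grid 0 r m i) w \<bullet> h)))\<^sup>2) \<partial>M) \<longlonglongrightarrow> 0" by blast
 \<comment> \<open>The stochastic integral over \<open>{0..0}\<close> is given only as a mean-square
   limit, so its vanishing is derived from the bound by the norm of the integrand. It is needed to
   identify the value at time 0 with the initial value.\<close>
 have Z0: "AE w in M. Z 0 w = 0"
 proof -
  have [measurable]: "Z 0 \<in> borel_measurable M" using Z[of 0] r by (simp add: is_stoch_integral_def)
  have "B.wint (\<lambda>r. indicator {0..0} r * sqrt (\<alpha> r)) (Z 0)" using Z[of 0] r I by (intro B.wint_stoch_integral) auto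
  from B.wint_bound[OF this]
  have "(\<integral>\<^sup>+w. ennreal ((Z 0 w)\<^sup>2) \<partial>M) \<le> ennreal (4 * (Q h \<bullet> h)) * (\<integral>\<^sup>+r. ennreal ((indicator {0..0} r * sqrt (\<alpha> r))\<^sup>2) \<partial>lborel)" .
  also have "(\<integral>\<^sup>+r. ennreal ((indicator {0..0} r * sqrt (\<alpha> r))\<^sup>2) \<partial>lborel) = (\<integral>\<^sup>+r. 0 \<partial>(lborel :: real measure))"
   by (rule nn_integral_cong_AE, rule AE_mp[OF AE_lborel_singleton[of 0]]) (auto intro!: AE_I2)
  finally have "(\<integral>\<^sup>+w. ennreal ((Z 0 w)\<^sup>2) \<partial>M) = 0" by simp
  then have "AE w in M. ennreal ((Z 0 w)\<^sup>2) = 0" by (subst (asm) nn_integral_0_iff_AE) auto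
  then show ?thesis by eventually_elim simp
 qed
 have "AE w in M. a_fun \<alpha> r * (X r w \<bullet> h) = xi w \<bullet> h + J w" using J(2) Z0 path by eventually_elim (use r in auto)
 then show ?thesis using J(1) lim by blast
qed

lemma Int_stable_vimages: "Int_stable {f -` A \<inter> S | A. A \<in> sets N}" unfolding Int_stable_def
proof safe
 fix A B assume "A \<in> sets N" "B \<in> sets N"
 then show "\<exists>C. f -` A \<inter> S \<inter> (f -` B \<inter> S) = f -` C \<inter> S \<and> C \<in> sets N" by (intro exI[of _ "A \<inter> B"]) auto
qed

context prob_space
begin

lemma mean_square_limit_unique:
 assumes [measurable]: "J \<in> borel_measurable M" "J' \<in> borel_measurable M" "\<And>m. S m \<in> borel_measurable M"
  and "(\<lambda>m. \<integral>\<^sup>+w. ennreal ((J w - S m w)\<^sup>2) \<partial>M) \<longlonglongrightarrow> 0" "(\<lambda>m. \<integral>\<^sup>+w. ennreal ((J' w - S m w)\<^sup>2) \<partial>M) \<longlonglongrightarrow> 0"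
 shows "AE w in M. J w = J' w"
proof -
 have "(\<lambda>m. \<integral>\<^sup>+w. ennreal ((1 * (J w - S m w) + (- 1) * (J' w - S m w))\<^sup>2) \<partial>M) \<longlonglongrightarrow> 0"
  by (rule tendsto_power2_combination) (use assms(4,5) in auto)
 then have "(\<lambda>m::nat. \<integral>\<^sup>+w. ennreal ((J w - J' w)\<^sup>2) \<partial>M) \<longlonglongrightarrow> 0" by simp
 then have "(\<integral>\<^sup>+w. ennreal ((J w - J' w)\<^sup>2) \<partial>M) = 0" by (simp add: LIMSEQ_const_iff)
 then have "AE w in M. ennreal ((J w - J' w)\<^sup>2) = 0" by (subst (asm) nn_integral_0_iff_AE) auto
 then show ?thesis by eventually_elim simp
qed

end

section \<open>Law of the rescaled noise, and its independence of the initial value\<close>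

context wiener
begin

definition grid_sum :: "'h => (real => real) => real => real => nat => 'w' => real" where
 "grid_sum h c s s' m w = (\<Sum>i<Suc m. c (grid s s' m i) * (W (grid s s' m (Suc i)) w \<bullet> h - W (grid s s' m i) w \<bullet> h))"

text \<open>An integral of a deterministic function defined through one fixed sequence of
  approximations, the left-point sums over uniform grids. Fixing the sequence makes the limit almost
  surely unique and additive in h.\<close>

definition ms_limit :: "'h => (real => real) => real => real => ('w' => real) => bool" where
 "ms_limit h c s s' J \<longleftrightarrow> J \<in> borel_measurable M \<and>
  (\<lambda>m. \<integral>\<^sup>+w. ennreal ((J w - grid_sum h c s s' m w)\<^sup>2) \<partial>M) \<longlonglongrightarrow> 0"

lemma grid_in: "s \<le> s' ==> {s..s'} \<subseteq> I ==> i \<le> Suc m ==> grid s s' m i \<in> I" using grid_range by blast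

lemma borel_measurable_grid_sum:
 assumes "s \<le> s'" "{s..s'} \<subseteq> I" shows "grid_sum h c s s' m \<in> borel_measurable M" unfolding grid_sum_def[abs_def]
 by (intro borel_measurable_sum borel_measurable_times borel_measurable_const borel_measurable_diff component_measurable grid_in assms) auto

lemma char_grid_sum:
 assumes "s \<le> s'" "{s..s'} \<subseteq> I"
 shows "char (distr M borel (grid_sum h c s s' m)) u =
  complex_of_real (exp (- (u\<^sup>2 * ((Q h \<bullet> h) * (\<Sum>i<Suc m. (c (grid s s' m i))\<^sup>2 * (grid s s' m (Suc i) - grid s s' m i))) / 2)))"
 unfolding grid_sum_def[abs_def] by (rule char_increment_sum) (auto intro!: grid_in grid_mono assms)

lemma variance_grid_tendsto:
 assumes "s \<le> s'" "continuous_on {s..s'} c"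
 shows "(\<lambda>m. \<Sum>i<Suc m. (c (grid s s' m i))\<^sup>2 * (grid s s' m (Suc i) - grid s s' m i)) \<longlonglongrightarrow> integral {s..s'} (\<lambda>r. (c r)\<^sup>2)"
 by (rule riemann_sum_tendsto) (intro continuous_intros assms)+

lemma ms_limit_unique:
 assumes "s \<le> s'" "{s..s'} \<subseteq> I" "ms_limit h c s s' J" "ms_limit h c s s' J'"
 shows "AE w in M. J w = J' w" using assms(3,4) unfolding ms_limit_def
 by (intro mean_square_limit_unique[of J J' "grid_sum h c s s'"] borel_measurable_grid_sum assms) auto

text \<open>Additivity in the direction allows mixed moments of two components to be obtained by
  polarisation.\<close>

lemma ms_limit_add:
 assumes s: "s \<le> s'" "{s..s'} \<subseteq> I" and J: "ms_limit h c s s' J" "ms_limit h' c s s' J'"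
 shows "ms_limit (h + h') c s s' (\<lambda>w. J w + J' w)"
proof -
 have [measurable]: "J \<in> borel_measurable M" "J' \<in> borel_measurable M" using J by (auto simp: ms_limit_def)
 note [measurable] = borel_measurable_grid_sum[OF s]
 have "(\<lambda>m. \<integral>\<^sup>+w. ennreal ((1 * (J w - grid_sum h c s s' m w) + 1 * (J' w - grid_sum h' c s s' m w))\<^sup>2) \<partial>M) \<longlonglongrightarrow> 0"
  by (rule tendsto_power2_combination) (use J in \<open>auto simp: ms_limit_def\<close>)
 moreover have "grid_sum (h + h') c s s' m w = grid_sum h c s s' m w + grid_sum h' c s s' m w" for m w
  unfolding grid_sum_def sum.distrib[symmetric] by (intro sum.cong) (auto simp: inner_add_right algebra_simps)
 ultimately show ?thesis by (simp add: ms_limit_def algebra_simps)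
qed

text \<open>Sums of independent normal increments have explicit characteristic functions, and these
  converge together with the Riemann sums of their variances.\<close>

lemma ms_limit_law:
 assumes s: "s \<le> s'" "{s..s'} \<subseteq> I" and c: "continuous_on {s..s'} c" and J: "ms_limit h c s s' J"
 shows "distr M borel J = normal_law 0 ((Q h \<bullet> h) * integral {s..s'} (\<lambda>r. (c r)\<^sup>2))"
  and "0 \<le> (Q h \<bullet> h) * integral {s..s'} (\<lambda>r. (c r)\<^sup>2)"
proof -
 have [measurable]: "J \<in> borel_measurable M" using J by (simp add: ms_limit_def)
 show v: "0 \<le> (Q h \<bullet> h) * integral {s..s'} (\<lambda>r. (c r)\<^sup>2)"
  by (intro mult_nonneg_nonneg Q_nonneg integral_nonneg integrable_continuous_real continuous_intros c) auto
 show "distr M borel J = normal_law 0 ((Q h \<bullet> h) * integral {s..s'} (\<lambda>r. (c r)\<^sup>2))"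
 proof (rule normal_law_if_char[OF _ v])
  fix u
  have "(\<lambda>m. char (distr M borel (\<lambda>w. 0 + grid_sum h c s s' m w)) u) \<longlonglongrightarrow> char (distr M borel (\<lambda>w. 0 + J w)) u"
   by (rule char_mean_square_limit) (use J borel_measurable_grid_sum[OF s] in \<open>auto simp: ms_limit_def\<close>)
  then have "(\<lambda>m. complex_of_real (exp (- (u\<^sup>2 * ((Q h \<bullet> h) * (\<Sum>i<Suc m. (c (grid s s' m i))\<^sup>2 * (grid s s' m (Suc i) - grid s s' m i))) / 2)))) \<longlonglongrightarrow> char (distr M borel J) u"
   unfolding add_0 char_grid_sum[OF s] by (simp add: o_def)
  moreover have "(\<lambda>m. complex_of_real (exp (- (u\<^sup>2 * ((Q h \<bullet> h) * (\<Sum>i<Suc m. (c (grid s s' m i))\<^sup>2 * (grid s s' m (Suc i) - grid s s' m i))) / 2)))) \<longlonglongrightarrow>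
    complex_of_real (exp (- (u\<^sup>2 * ((Q h \<bullet> h) * integral {s..s'} (\<lambda>r. (c r)\<^sup>2)) / 2)))" by (intro tendsto_intros variance_grid_tendsto s c) auto
  ultimately show "char (distr M borel J) u = complex_of_real (exp (- (u\<^sup>2 * ((Q h \<bullet> h) * integral {s..s'} (\<lambda>r. (c r)\<^sup>2)) / 2)))"
   by (rule LIMSEQ_unique)
 qed simp
qed

text \<open>A grid sum evaluates the path at finitely many times, so it is a measurable function of
  the restricted path, to which the independence assumption applies.\<close>

lemma indep_grid_sum:
 assumes s: "s \<le> s'" "{s..s'} \<subseteq> I" and indep: "independent_of_process M I X0 W" and [measurable]: "X0 \<in> borel_measurable M"
 shows "indep_var borel (\<lambda>w. X0 w \<bullet> h) borel (grid_sum h c s s' m)"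
proof -
 define P where "P w = (\<lambda>t\<in>I. W t w)" for w
 define f where "f w' = (\<Sum>i<Suc m. c (grid s s' m i) * (w' (grid s s' m (Suc i)) \<bullet> h - w' (grid s s' m i) \<bullet> h))" for w' :: "real => 'h"
 have comp: "(\<lambda>w'. w' t \<bullet> h) \<in> borel_measurable (\<Pi>\<^sub>M t\<in>I. borel)" if "t \<in> I" for t
  using measurable_component_singleton[OF that, of "\<lambda>_. borel"] by measurable
 have f: "f \<in> borel_measurable (\<Pi>\<^sub>M t\<in>I. borel)" unfolding f_def[abs_def]
  by (intro borel_measurable_sum borel_measurable_times borel_measurable_const borel_measurable_diff comp grid_in s) auto
 have P: "P \<in> measurable M (\<Pi>\<^sub>M t\<in>I. borel)" unfolding P_def[abs_def] by (rule measurable_restrict) simp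
 have gs: "grid_sum h c s s' m = (\<lambda>w. f (P w))" unfolding grid_sum_def[abs_def] f_def P_def by (intro ext sum.cong) (auto simp: grid_in s)
 have ind: "indep_set {X0 -` A \<inter> space M | A. A \<in> sets borel} {P -` B \<inter> space M | B. B \<in> sets (\<Pi>\<^sub>M t\<in>I. borel)}"
  using indep unfolding independent_of_process_def P_def .
 have "indep_set {(\<lambda>w. X0 w \<bullet> h) -` A \<inter> space M | A. A \<in> sets borel} {(\<lambda>w. f (P w)) -` A \<inter> space M | A. A \<in> sets borel}"
  unfolding indep_sets2_eq
 proof (intro conjI ballI)
  show "{(\<lambda>w. X0 w \<bullet> h) -` A \<inter> space M |A. A \<in> sets borel} \<subseteq> events" by (auto intro!: measurable_sets)
  show "{(\<lambda>w. f (P w)) -` A \<inter> space M |A. A \<in> sets borel} \<subseteq> events" by (auto intro!: measurable_sets measurable_compose[OF P f])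
  fix a b assume "a \<in> {(\<lambda>w. X0 w \<bullet> h) -` A \<inter> space M |A. A \<in> sets borel}" "b \<in> {(\<lambda>w. f (P w)) -` A \<inter> space M |A. A \<in> sets borel}"
  then obtain A B where A: "a = (\<lambda>w. X0 w \<bullet> h) -` A \<inter> space M" "A \<in> sets borel" and B: "b = (\<lambda>w. f (P w)) -` B \<inter> space M" "B \<in> sets borel" by blast
  have "a = X0 -` ((\<lambda>x. x \<bullet> h) -` A) \<inter> space M" using A by auto
  moreover have "(\<lambda>x. x \<bullet> h) -` A \<in> sets borel" using measurable_sets[of "\<lambda>x. x \<bullet> h" borel borel A] A(2) by simp
  ultimately have a: "a \<in> {X0 -` A \<inter> space M | A. A \<in> sets borel}" by blast
  have "b = P -` (f -` B \<inter> space (\<Pi>\<^sub>M t\<in>I. borel)) \<inter> space M" using B measurable_space[OF P] by auto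
  moreover have "f -` B \<inter> space (\<Pi>\<^sub>M t\<in>I. borel) \<in> sets (\<Pi>\<^sub>M t\<in>I. borel)" using f B(2) by (rule measurable_sets)
  ultimately have b: "b \<in> {P -` B \<inter> space M | B. B \<in> sets (\<Pi>\<^sub>M t\<in>I. borel)}" by blast
  show "prob (a \<inter> b) = prob a * prob b" by (rule indep_setD[OF ind a b])
 qed
 then have "indep_var borel (\<lambda>w. X0 w \<bullet> h) borel (\<lambda>w. f (P w))" unfolding indep_var_eq
  by (intro conjI indep_set_sigma_sets measurable_compose[OF P f] Int_stable_vimages) auto
 then show ?thesis unfolding gs .
qed

text \<open>Independence of initial value and noise is used for the grid sums, where it factorises
  the characteristic function; the factorisation then passes to the limit.\<close>

lemma forward_char:
 assumes C1: "C1_positive T \<alpha>" and I: "I = {0..T}" and r: "r \<in> {0..T}"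
  and sol: "forward_solution M T \<alpha> W' xi X" and W': "\<And>t. t \<in> I ==> W' t \<in> borel_measurable M"
  and W'h: "\<And>t w. W' t w \<bullet> h = W t w \<bullet> h" and xih: "\<And>w. xi w \<bullet> h = X0 w \<bullet> h"
  and indep: "independent_of_process M I X0 W" and [measurable]: "X0 \<in> borel_measurable M"
 shows "char (distr M borel (\<lambda>w. a_fun \<alpha> r * (X r w \<bullet> h))) u =
  char (distr M borel (\<lambda>w. X0 w \<bullet> h)) u * complex_of_real (exp (- (u\<^sup>2 * ((Q h \<bullet> h) * ((a_fun \<alpha> r)\<^sup>2 - 1)) / 2)))"
proof -
 let ?c = "\<lambda>r. a_fun \<alpha> r * sqrt (\<alpha> r)"
 have s: "0 \<le> r" "{0..r} \<subseteq> I" using r I by auto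
 note c = C1_positive_continuous[OF C1]
 have "continuous_on {0..T} (a_fun \<alpha>)" using a_fun_has_derivative[OF c] by (rule DERIV_continuous_on)
 then have cc: "continuous_on {0..r} ?c" using c r by (intro continuous_intros) (auto elim!: continuous_on_subset)
 obtain J where J: "AE w in M. a_fun \<alpha> r * (X r w \<bullet> h) = X0 w \<bullet> h + J w" "ms_limit h ?c 0 r J"
  using forward_component[OF C1 I r sol W' W'h] unfolding ms_limit_def grid_sum_def xih by blast
 have [measurable]: "J \<in> borel_measurable M" using J(2) by (simp add: ms_limit_def)
 have [measurable]: "X r \<in> borel_measurable M" using sol r by (simp add: forward_solution_def sde_solution_def continuous_process_def)
 have "distr M borel (\<lambda>w. a_fun \<alpha> r * (X r w \<bullet> h)) = distr M borel (\<lambda>w. X0 w \<bullet> h + J w)" using J(1) by (intro distr_cong_AE) auto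
 moreover have "(\<lambda>m. char (distr M borel (\<lambda>w. X0 w \<bullet> h + grid_sum h ?c 0 r m w)) u) \<longlonglongrightarrow> char (distr M borel (\<lambda>w. X0 w \<bullet> h + J w)) u"
  by (rule char_mean_square_limit) (use J(2) borel_measurable_grid_sum[OF s] in \<open>auto simp: ms_limit_def\<close>)
 moreover have "(\<lambda>m. char (distr M borel (\<lambda>w. X0 w \<bullet> h + grid_sum h ?c 0 r m w)) u) \<longlonglongrightarrow>
   char (distr M borel (\<lambda>w. X0 w \<bullet> h)) u * complex_of_real (exp (- (u\<^sup>2 * ((Q h \<bullet> h) * ((a_fun \<alpha> r)\<^sup>2 - 1)) / 2)))"
 proof -
  have "integral {0..r} (\<lambda>r. (?c r)\<^sup>2) = (a_fun \<alpha> r)\<^sup>2 - 1" using integral_a_fun_square[OF C1, of 0 r] r by simp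
  then have "(\<lambda>m. \<Sum>i<Suc m. (?c (grid 0 r m i))\<^sup>2 * (grid 0 r m (Suc i) - grid 0 r m i)) \<longlonglongrightarrow> (a_fun \<alpha> r)\<^sup>2 - 1"
   using variance_grid_tendsto[OF s(1) cc] by simp
  then show ?thesis unfolding char_distr_add[OF indep_grid_sum[OF s indep \<open>X0 \<in> borel_measurable M\<close>]] char_grid_sum[OF s] by (intro tendsto_intros) auto
 qed
 ultimately show ?thesis by (auto dest: LIMSEQ_unique)
qed

lemma forward_second_moment:
 assumes C1: "C1_positive T \<alpha>" and I: "I = {0..T}" and r: "r \<in> {0..T}"
  and J: "ms_limit h (\<lambda>r. a_fun \<alpha> r * sqrt (\<alpha> r)) 0 r J"
 shows "integrable M (\<lambda>w. (J w)\<^sup>2)" "expectation (\<lambda>w. (J w)\<^sup>2) = (Q h \<bullet> h) * ((a_fun \<alpha> r)\<^sup>2 - 1)"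
proof -
 let ?c = "\<lambda>r. a_fun \<alpha> r * sqrt (\<alpha> r)"
 have s: "0 \<le> r" "{0..r} \<subseteq> I" using r I by auto
 note c = C1_positive_continuous[OF C1]
 have "continuous_on {0..T} (a_fun \<alpha>)" using a_fun_has_derivative[OF c] by (rule DERIV_continuous_on)
 then have cc: "continuous_on {0..r} ?c" using c r by (intro continuous_intros) (auto elim!: continuous_on_subset)
 have i: "integral {0..r} (\<lambda>r. (?c r)\<^sup>2) = (a_fun \<alpha> r)\<^sup>2 - 1" using integral_a_fun_square[OF C1, of 0 r] r by simp
 have "J \<in> borel_measurable M" using J by (simp add: ms_limit_def)
 from normal_law_variable[OF this ms_limit_law[OF s cc J]] show "integrable M (\<lambda>w. (J w)\<^sup>2)" "expectation (\<lambda>w. (J w)\<^sup>2) = (Q h \<bullet> h) * ((a_fun \<alpha> r)\<^sup>2 - 1)"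
  unfolding i by auto
qed

end

section \<open>Wiener processes with respect to a filtration\<close>

locale filtered_wiener = wiener M I Q W for M :: "'w' measure" and I and Q :: "'h::{real_inner, banach, second_countable_topology} => 'h" and W +
 fixes F :: "real => 'w' measure"
 assumes wrt: "wiener_process_wrt M F I Q W"
  and subalg: "\<And>t. t \<in> I ==> subalgebra M (F t)"
  and F_mono: "\<And>s t. s \<in> I ==> t \<in> I ==> s \<le> t ==> sets (F s) \<subseteq> sets (F t)"
begin

lemma measurable_F_M: "t \<in> I ==> f \<in> borel_measurable (F t) ==> f \<in> borel_measurable M"
 by (rule measurable_from_subalg[OF subalg])

lemma measurable_F_mono:
 assumes "s \<in> I" "t \<in> I" "s \<le> t" "f \<in> borel_measurable (F s)" shows "f \<in> borel_measurable (F t)"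
proof (rule measurable_from_subalg[OF _ assms(4)])
 show "subalgebra (F t) (F s)" using subalg[OF assms(1)] subalg[OF assms(2)] F_mono[OF assms(1-3)] by (simp add: subalgebra_def)
qed

lemma W_adapted: "t \<in> I ==> W t \<in> borel_measurable (F t)" using wrt by (simp add: wiener_process_wrt_def)

lemma indep_increment:
 fixes Y :: "'w' => real"
 assumes st: "s \<in> I" "t \<in> I" "s \<le> t" and Y: "Y \<in> borel_measurable (F s)"
 shows "indep_var borel Y borel (\<lambda>w. W t w \<bullet> h - W s w \<bullet> h)"
proof -
 have [measurable]: "W t \<in> borel_measurable M" "W s \<in> borel_measurable M" using st by auto
 have ind: "indep_set (sets (F s)) {(\<lambda>w. W t w - W s w) -` A \<inter> space M | A. A \<in> sets borel}" using wrt st by (simp add: wiener_process_wrt_def)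
 have sp: "space (F s) = space M" using subalg[OF st(1)] by (simp add: subalgebra_def)
 have "indep_set {Y -` A \<inter> space M | A. A \<in> sets borel} {(\<lambda>w. W t w \<bullet> h - W s w \<bullet> h) -` A \<inter> space M | A. A \<in> sets borel}"
  unfolding indep_sets2_eq
 proof (intro conjI ballI)
  show "{Y -` A \<inter> space M |A. A \<in> sets borel} \<subseteq> events" using measurable_F_M[OF st(1) Y] by (auto intro!: measurable_sets)
  show "{(\<lambda>w. W t w \<bullet> h - W s w \<bullet> h) -` A \<inter> space M |A. A \<in> sets borel} \<subseteq> events" by (auto intro!: measurable_sets)
  fix a b assume "a \<in> {Y -` A \<inter> space M |A. A \<in> sets borel}" "b \<in> {(\<lambda>w. W t w \<bullet> h - W s w \<bullet> h) -` A \<inter> space M |A. A \<in> sets borel}"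
  then obtain A B where A: "a = Y -` A \<inter> space M" "A \<in> sets borel" and B: "b = (\<lambda>w. W t w \<bullet> h - W s w \<bullet> h) -` B \<inter> space M" "B \<in> sets borel" by blast
  have a: "a \<in> sets (F s)" using measurable_sets[OF Y A(2)] by (simp add: A sp)
  have "b = (\<lambda>w. W t w - W s w) -` ((\<lambda>x. x \<bullet> h) -` B) \<inter> space M" using B by (auto simp: inner_diff_left)
  moreover have "(\<lambda>x. x \<bullet> h) -` B \<in> sets borel" using measurable_sets[of "\<lambda>x. x \<bullet> h" borel borel B] B(2) by simp
  ultimately have b: "b \<in> {(\<lambda>w. W t w - W s w) -` A \<inter> space M | A. A \<in> sets borel}" by blast
  show "prob (a \<inter> b) = prob a * prob b" by (rule indep_setD[OF ind a b])
 qed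
 then show ?thesis unfolding indep_var_eq using measurable_F_M[OF st(1) Y] by (intro conjI indep_set_sigma_sets Int_stable_vimages) auto
qed

text \<open>The isometry for sums of increments, conditional on the past. The claim includes
  measurability of the partial sum at its last time, because the next increment is independent of
  exactly such variables and the mixed terms vanish for this reason.\<close>

lemma weighted_sum_moments:
 assumes ta: "\<And>i. i \<le> m ==> ta i \<in> I" "\<And>i. i < m ==> ta i \<le> ta (Suc i)"
  and ps: "ps \<in> borel_measurable (F (ta 0))" and b: "\<And>w. \<bar>ps w\<bar> \<le> b"
 shows "(\<lambda>w. \<Sum>i<m. c i * (W (ta (Suc i)) w \<bullet> h - W (ta i) w \<bullet> h)) \<in> borel_measurable (F (ta m)) \<and>
  integrable M (\<lambda>w. (\<Sum>i<m. c i * (W (ta (Suc i)) w \<bullet> h - W (ta i) w \<bullet> h))\<^sup>2) \<and>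
  expectation (\<lambda>w. ps w * (\<Sum>i<m. c i * (W (ta (Suc i)) w \<bullet> h - W (ta i) w \<bullet> h))) = 0 \<and>
  expectation (\<lambda>w. ps w * (\<Sum>i<m. c i * (W (ta (Suc i)) w \<bullet> h - W (ta i) w \<bullet> h))\<^sup>2) =
   (Q h \<bullet> h) * (\<Sum>i<m. (c i)\<^sup>2 * (ta (Suc i) - ta i)) * expectation ps" using ta
proof (induction m)
 case 0
 then show ?case by simp
next
 case (Suc m)
 define S where "S w = (\<Sum>i<m. c i * (W (ta (Suc i)) w \<bullet> h - W (ta i) w \<bullet> h))" for w
 define D where "D w = W (ta (Suc m)) w \<bullet> h - W (ta m) w \<bullet> h" for w
 have t: "ta m \<in> I" "ta (Suc m) \<in> I" "ta m \<le> ta (Suc m)" using Suc.prems by auto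
 have t0: "ta 0 \<in> I" "ta 0 \<le> ta m"
 proof -
  have "k \<le> m ==> ta 0 \<le> ta k" for k by (induction k) (use Suc.prems in \<open>auto intro: order_trans\<close>)
  then show "ta 0 \<le> ta m" by simp
 qed (use Suc.prems in auto)
 have IH: "S \<in> borel_measurable (F (ta m))" "integrable M (\<lambda>w. (S w)\<^sup>2)"
  "expectation (\<lambda>w. ps w * S w) = 0"
  "expectation (\<lambda>w. ps w * (S w)\<^sup>2) = (Q h \<bullet> h) * (\<Sum>i<m. (c i)\<^sup>2 * (ta (Suc i) - ta i)) * expectation ps"
  using Suc.IH Suc.prems unfolding S_def by auto
 have psm: "ps \<in> borel_measurable (F (ta m))" by (rule measurable_F_mono[OF t0(1) t(1) t0(2) ps])
 have [measurable]: "S \<in> borel_measurable M" "ps \<in> borel_measurable M" using measurable_F_M[OF t(1)] IH(1) psm by auto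
 have [measurable]: "D \<in> borel_measurable M" unfolding D_def[abs_def] using t by simp
 have Sum: "(\<Sum>i<Suc m. c i * (W (ta (Suc i)) w \<bullet> h - W (ta i) w \<bullet> h)) = S w + c m * D w" for w by (simp add: S_def D_def)
 have iD: "integrable M (\<lambda>w. D w ^ k)" for k using increment_moments(1)[OF t, of h k] by (simp add: D_def)
 have eD: "expectation D = 0" "expectation (\<lambda>w. (D w)\<^sup>2) = (ta (Suc m) - ta m) * (Q h \<bullet> h)"
  using increment_moments(2,3)[OF t, of h] by (simp_all add: D_def[abs_def])
 have b0: "0 \<le> b" using b by (meson abs_ge_zero order_trans)
 have iw: "integrable M (\<lambda>w. ps w * X w)" if "integrable M X" for X :: "'w' => real"
  by (rule Bochner_Integration.integrable_bound[of M "\<lambda>w. b * X w"])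
   (use that b b0 in \<open>auto simp: abs_mult intro!: mult_right_mono AE_I2\<close>)
 have iS: "integrable M S" by (rule square_integrable_imp_integrable) (use IH in auto)
 have ips: "integrable M ps" using iw[of "\<lambda>_. 1"] by simp
 have ind: "indep_var borel Y borel D" if "Y \<in> borel_measurable (F (ta m))" for Y :: "'w' => real"
  unfolding D_def[abs_def] by (rule indep_increment[OF t that])
 have Dm: "D \<in> borel_measurable (F (ta (Suc m)))"
  unfolding D_def[abs_def] using W_adapted[OF t(2)] measurable_F_mono[OF t W_adapted[OF t(1), THEN borel_measurable_inner[OF _ borel_measurable_const]]] by auto
 have p1: "integrable M (\<lambda>w. S w * D w)" using indep_var_integrable[OF ind[OF IH(1)] iS] iD[of 1] by simp
 have psS: "(\<lambda>w. ps w * S w) \<in> borel_measurable (F (ta m))" using psm IH(1) by simp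
 have e1: "expectation (\<lambda>w. (ps w * S w) * D w) = 0" using indep_var_lebesgue_integral[OF ind[OF psS] iw[OF iS]] iD[of 1] eD by simp
 have e2: "expectation (\<lambda>w. ps w * D w) = 0" using indep_var_lebesgue_integral[OF ind[OF psm] ips] iD[of 1] eD by simp
 have e3: "expectation (\<lambda>w. ps w * (D w)\<^sup>2) = expectation ps * ((ta (Suc m) - ta m) * (Q h \<bullet> h))"
 proof -
  have "indep_var borel ((\<lambda>x. x) \<circ> ps) borel ((\<lambda>x. x\<^sup>2) \<circ> D)" by (rule indep_var_compose[OF ind[OF psm]]) auto
  then have "indep_var borel ps borel (\<lambda>w. (D w)\<^sup>2)" by (simp add: comp_def)
  from indep_var_lebesgue_integral[OF this ips iD[of 2]] show ?thesis by (simp add: eD)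
 qed
 have sq: "(\<lambda>w. (S w + c m * D w)\<^sup>2) = (\<lambda>w. (S w)\<^sup>2 + (2 * c m) * (S w * D w) + (c m)\<^sup>2 * (D w)\<^sup>2)"
  by (auto simp: power2_eq_square algebra_simps)
 have isq: "integrable M (\<lambda>w. (S w + c m * D w)\<^sup>2)" unfolding sq by (intro Bochner_Integration.integrable_add integrable_mult_right IH p1 iD)
 have "expectation (\<lambda>w. ps w * (S w + c m * D w)) = expectation (\<lambda>w. ps w * S w + c m * (ps w * D w))" by (simp add: algebra_simps)
 also have "\<dots> = 0" using IH(3) e2 iw[OF iS] iw[of D] iD[of 1] by simp
 finally have E1: "expectation (\<lambda>w. ps w * (S w + c m * D w)) = 0" .
 have "(\<lambda>w. ps w * (S w + c m * D w)\<^sup>2) = (\<lambda>w. ps w * (S w)\<^sup>2 + (2 * c m) * ((ps w * S w) * D w) + (c m)\<^sup>2 * (ps w * (D w)\<^sup>2))"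
  by (auto simp: power2_eq_square algebra_simps)
 moreover have "integrable M (\<lambda>w. ps w * (S w)\<^sup>2)" "integrable M (\<lambda>w. (ps w * S w) * D w)" "integrable M (\<lambda>w. ps w * (D w)\<^sup>2)"
  using iw[OF IH(2)] iw[OF p1] iw[OF iD[of 2]] by (simp_all add: mult.assoc)
 ultimately have "expectation (\<lambda>w. ps w * (S w + c m * D w)\<^sup>2) = expectation (\<lambda>w. ps w * (S w)\<^sup>2) + (c m)\<^sup>2 * expectation (\<lambda>w. ps w * (D w)\<^sup>2)"
  using e1 by simp
 then have E2: "expectation (\<lambda>w. ps w * (S w + c m * D w)\<^sup>2) = (Q h \<bullet> h) * (\<Sum>i<Suc m. (c i)\<^sup>2 * (ta (Suc i) - ta i)) * expectation ps"
  unfolding IH(4) e3 by (simp add: algebra_simps)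
 have "(\<lambda>w. S w + c m * D w) \<in> borel_measurable (F (ta (Suc m)))" using measurable_F_mono[OF t IH(1)] Dm by simp
 then show ?case unfolding Sum using isq E1 E2 by blast
qed

text \<open>Unweighted moments come from the normal law of the limit; the weighted ones come from
  the grid sums, for which independence of the past is available.\<close>

lemma ms_limit_moments:
 assumes s: "s \<le> s'" "{s..s'} \<subseteq> I" and c: "continuous_on {s..s'} c" and J: "ms_limit h c s s' J"
 defines "v \<equiv> (Q h \<bullet> h) * integral {s..s'} (\<lambda>r. (c r)\<^sup>2)"
 shows "integrable M (\<lambda>w. J w ^ k)" "expectation (\<lambda>w. J w ^ 4) = 3 * v\<^sup>2"
  "\<And>ps b. ps \<in> borel_measurable (F s) ==> (\<And>w. \<bar>ps w\<bar> \<le> b) ==> expectation (\<lambda>w. ps w * J w) = 0"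
  "\<And>ps b. ps \<in> borel_measurable (F s) ==> (\<And>w. \<bar>ps w\<bar> \<le> b) ==> expectation (\<lambda>w. ps w * (J w)\<^sup>2) = v * expectation ps"
proof -
 have Jm: "J \<in> borel_measurable M" using J by (simp add: ms_limit_def)
 note law = ms_limit_law[OF s c J, folded v_def]
 note nl = normal_law_variable[OF Jm law]
 show "integrable M (\<lambda>w. J w ^ k)" "expectation (\<lambda>w. J w ^ 4) = 3 * v\<^sup>2" using nl by auto
 fix ps :: "'w' => real" and b assume ps: "ps \<in> borel_measurable (F s)" and b: "\<And>w. \<bar>ps w\<bar> \<le> b"
 have sI: "s \<in> I" using s by auto
 have psM: "ps \<in> borel_measurable M" by (rule measurable_F_M[OF sI ps])
 have S: "integrable M (\<lambda>w. (grid_sum h c s s' m w)\<^sup>2)" "expectation (\<lambda>w. ps w * grid_sum h c s s' m w) = 0"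
  "expectation (\<lambda>w. ps w * (grid_sum h c s s' m w)\<^sup>2) = (Q h \<bullet> h) * (\<Sum>i<Suc m. (c (grid s s' m i))\<^sup>2 * (grid s s' m (Suc i) - grid s s' m i)) * expectation ps" for m
  unfolding grid_sum_def using weighted_sum_moments[of "Suc m" "grid s s' m" ps b "\<lambda>i. c (grid s s' m i)" h] ps b grid_in[OF s] grid_mono[OF s(1)] by auto
 note lim = tendsto_weighted_mean_square[OF Jm borel_measurable_grid_sum[OF s] J[unfolded ms_limit_def, THEN conjunct2] psM b S(1) nl(1)[of 2]]
 show "expectation (\<lambda>w. ps w * J w) = 0" using lim(1) unfolding S(2) by (simp add: LIMSEQ_const_iff)
 have "(\<lambda>m. (Q h \<bullet> h) * (\<Sum>i<Suc m. (c (grid s s' m i))\<^sup>2 * (grid s s' m (Suc i) - grid s s' m i)) * expectation ps) \<longlonglongrightarrow> v * expectation ps"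
  unfolding v_def by (intro tendsto_intros variance_grid_tendsto s c)
 with lim(2) show "expectation (\<lambda>w. ps w * (J w)\<^sup>2) = v * expectation ps" unfolding S(3) by (rule LIMSEQ_unique)
qed

end

section \<open>A supermartingale inequality for the reverse process\<close>

lemma heat_family_path_continuous:
 assumes f: "heat_family n lam lo hi f" and th: "continuous_on S th" "\<And>r. r \<in> S ==> th r \<in> {lo..hi}"
  and u: "\<And>k. k < n ==> continuous_on S (\<lambda>r. u r k)"
 shows "continuous_on S (\<lambda>r. f d (th r) (u r))" unfolding continuous_on_def
proof
 fix r assume r: "r \<in> S"
 obtain C where C: "0 \<le> C" "\<forall>th\<in>{lo..hi}. \<forall>dt y de. th + dt \<in> {lo..hi} -->
    \<bar>f d (th + dt) (\<lambda>k. y k + de k) - f d th y\<bar> \<le> C * (mvs n lam dt de)" using f unfolding heat_family_def by blast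
 show "((\<lambda>r. f d (th r) (u r)) \<longlongrightarrow> f d (th r) (u r)) (at r within S)"
 proof (rule LIM_zero_cancel, rule Lim_null_comparison)
  show "\<forall>\<^sub>F x in at r within S. norm (f d (th x) (u x) - f d (th r) (u r)) \<le> C * (\<Sum>k<n. \<bar>u x k - u r k\<bar> + \<bar>(th x - th r) * lam k / 2\<bar>)"
  proof (rule eventually_at_filter[THEN iffD2], rule always_eventually, intro allI impI)
   fix x assume "x \<noteq> r" "x \<in> S"
   then have x: "th r + (th x - th r) \<in> {lo..hi}" using th(2) by simp
   from C(2)[rule_format, OF th(2)[OF r] x, of "u r" "\<lambda>k. u x k - u r k"]
   show "norm (f d (th x) (u x) - f d (th r) (u r)) \<le> C * (\<Sum>k<n. \<bar>u x k - u r k\<bar> + \<bar>(th x - th r) * lam k / 2\<bar>)"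
    by (simp add: sum_moves mvc_def)
  qed
  have "((\<lambda>x. C * (\<Sum>k<n. \<bar>u x k - u r k\<bar> + \<bar>(th x - th r) * lam k / 2\<bar>)) \<longlongrightarrow> C * (\<Sum>k<n. \<bar>u r k - u r k\<bar> + \<bar>(th r - th r) * lam k / 2\<bar>)) (at r within S)"
  proof (intro tendsto_intros)
   show "((\<lambda>x. u x k) \<longlongrightarrow> u r k) (at r within S)" if "k \<in> {..<n}" for k using u[of k] that r by (simp add: continuous_on_def)
   show "(th \<longlongrightarrow> th r) (at r within S)" using th(1) r by (simp add: continuous_on_def)
  qed simp_all
  then show "((\<lambda>x. C * (\<Sum>k<n. \<bar>u x k - u r k\<bar> + \<bar>(th x - th r) * lam k / 2\<bar>)) \<longlongrightarrow> 0) (at r within S)" by simp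
 qed
qed

text \<open>This makes the event of staying in a cube measurable, as countably many times suffice.
  Times r > 0 are approached by rationals from the left, which keeps these inside the interval; at r
  = 0 the time itself is rational.\<close>

lemma continuous_bounded_on_rationals:
 fixes f :: "real => real"
 assumes f: "continuous_on {0..s} f" and le: "\<And>q. q \<in> {0..s} \<inter> \<rat> ==> \<bar>f q\<bar> \<le> K" and r: "r \<in> {0..s}"
 shows "\<bar>f r\<bar> \<le> K"
proof (cases "r = 0")
 case True then show ?thesis using le r by simp
next
 case False
 show ?thesis
 proof (rule ccontr)
  assume "\<not> \<bar>f r\<bar> \<le> K"
  then have "0 < \<bar>f r\<bar> - K" by simp
  then obtain d where d: "0 < d" "\<And>x. x \<in> {0..s} ==> dist x r < d ==> dist (f x) (f r) < \<bar>f r\<bar> - K"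
   using f r unfolding continuous_on_iff by blast
  obtain q where q: "q \<in> \<rat>" "max 0 (r - d) < q" "q < r" using Rats_dense_in_real[of "max 0 (r - d)" r] r False d(1) by auto
  then have "q \<in> {0..s}" "dist q r < d" using r by (auto simp: dist_real_def)
  then have "\<bar>f q - f r\<bar> < \<bar>f r\<bar> - K" using d(2) by (simp add: dist_real_def)
  moreover have "\<bar>f q\<bar> \<le> K" using q \<open>q \<in> {0..s}\<close> by (intro le) auto
  ultimately show False by linarith
 qed
qed

text \<open>An abstraction of the rescaled reverse process: \<open>th\<close> is the remaining
  variance, \<open>ka\<close> the rate at which it decreases, and \<open>J s s' k\<close> the noise
  of coordinate k over the interval from s to s'. The noise is described through its weighted first
  and second moments and its fourth moment, so that no stochastic integral occurs from here to the
  supermartingale inequality.\<close>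

locale reverse_process = prob_space P for P :: "'v measure" +
 fixes F :: "real => 'v measure" and t :: real and n :: nat and lam :: "nat => real"
  and th ka :: "real => real" and U :: "real => 'v => nat => real" and J :: "real => real => nat => 'v => real"
  and N h :: "(nat => nat) => real => (nat => real) => real"
 assumes t: "0 < t" and lam: "\<And>k. k < n ==> 0 < lam k"
  and th_cont: "continuous_on {0..t} th" and ka_cont: "continuous_on {0..t} ka" and ka_nonneg: "\<And>r. r \<in> {0..t} ==> 0 \<le> ka r"
  and th_dec: "\<And>s s'. 0 \<le> s ==> s < s' ==> s' \<le> t ==> th s' < th s"
  and th_ka: "\<And>s s'. 0 \<le> s ==> s \<le> s' ==> s' \<le> t ==> integral {s..s'} ka = th s - th s'"
  and N: "heat_family n lam (th t) (th 0) N" and h: "heat_family n lam (th t) (th 0) h"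
  and N_nonneg: "\<And>th' y. th' \<in> {th t..th 0} ==> 0 \<le> N z0 th' y"
  and h_pos: "\<And>th' y. th' \<in> {th t..th 0} ==> 0 < h z0 th' y"
  and h_lower: "\<And>K. \<exists>m>0. \<forall>th'\<in>{th t..th 0}. \<forall>y. (\<forall>k<n. \<bar>y k\<bar> \<le> K) --> m \<le> h z0 th' y"
  and N_measurable: "\<And>d th' y G. th' \<in> {th t..th 0} ==> (\<And>k. k < n ==> (\<lambda>w::'v. y w k) \<in> borel_measurable G) ==> (\<lambda>w. N d th' (y w)) \<in> borel_measurable G"
  and h_measurable: "\<And>d th' y G. th' \<in> {th t..th 0} ==> (\<And>k. k < n ==> (\<lambda>w::'v. y w k) \<in> borel_measurable G) ==> (\<lambda>w. h d th' (y w)) \<in> borel_measurable G"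
  and subalg: "\<And>s. s \<in> {0..t} ==> subalgebra P (F s)"
  and F_mono: "\<And>s s'. 0 \<le> s ==> s \<le> s' ==> s' \<le> t ==> sets (F s) \<subseteq> sets (F s')"
  and U_adapted: "\<And>s k. s \<in> {0..t} ==> k < n ==> (\<lambda>w. U s w k) \<in> borel_measurable (F s)"
  and U_cont: "AE w in P. \<forall>k<n. continuous_on {0..t} (\<lambda>s. U s w k)"
  and J_measurable: "\<And>s s' k. 0 \<le> s ==> s < s' ==> s' \<le> t ==> k < n ==> J s s' k \<in> borel_measurable P"
  and increments: "\<And>s s'. 0 \<le> s ==> s < s' ==> s' \<le> t ==>
   AE w in P. \<forall>k<n. U s' w k - U s w k = integral {s..s'} (\<lambda>r. ka r * lam k * ql h (k, 1) (th r) (U r w)) + J s s' k w"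
  and J_power: "\<And>s s' k i. 0 \<le> s ==> s < s' ==> s' \<le> t ==> k < n ==> integrable P (\<lambda>w. J s s' k w ^ i)"
  and J_4: "\<And>s s' k. 0 \<le> s ==> s < s' ==> s' \<le> t ==> k < n ==> expectation (\<lambda>w. J s s' k w ^ 4) = 3 * (lam k * (th s - th s'))\<^sup>2"
  and J_1: "\<And>s s' k ps b. 0 \<le> s ==> s < s' ==> s' \<le> t ==> k < n ==> ps \<in> borel_measurable (F s) ==> (\<And>w. \<bar>ps w\<bar> \<le> b) ==>
   expectation (\<lambda>w. ps w * J s s' k w) = 0"
  and J_2: "\<And>s s' k l ps b. 0 \<le> s ==> s < s' ==> s' \<le> t ==> k < n ==> l < n ==> ps \<in> borel_measurable (F s) ==> (\<And>w. \<bar>ps w\<bar> \<le> b) ==>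
   expectation (\<lambda>w. ps w * (J s s' k w * J s s' l w)) = (if k = l then lam k * (th s - th s') * expectation ps else 0)"
begin

lemma th_range: "s \<in> {0..t} ==> th s \<in> {th t..th 0}" using th_dec[of s t] th_dec[of 0 s] by (cases "s = 0"; cases "s = t") force+

lemma F_space: "s \<in> {0..t} ==> space (F s) = space P" using subalg by (simp add: subalgebra_def)

lemma F_measurable: "s \<in> {0..t} ==> f \<in> borel_measurable (F s) ==> f \<in> borel_measurable P"
 by (rule measurable_from_subalg[OF subalg])

lemma F_measurable_mono:
 assumes "0 \<le> s" "s \<le> s'" "s' \<le> t" "f \<in> borel_measurable (F s)" shows "f \<in> borel_measurable (F s')"
proof (rule measurable_from_subalg[OF _ assms(4)])
 show "subalgebra (F s') (F s)" using subalg[of s] subalg[of s'] F_mono[OF assms(1-3)] assms by (simp add: subalgebra_def)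
qed

text \<open>Rational times make the event measurable with respect to the past; the time s itself is
  included so that the current position is bounded whether or not the path is continuous.\<close>

definition stay :: "real => real => 'v set" where
 "stay K s = {w\<in>space P. \<forall>q\<in>insert s ({0..s} \<inter> \<rat>). \<forall>k\<in>{..<n}. \<bar>U q w k\<bar> \<le> K}"

lemma stay_sets: assumes s: "s \<in> {0..t}" shows "stay K s \<in> sets (F s)"
proof -
 have "{w\<in>space (F s). \<forall>q\<in>insert s ({0..s} \<inter> \<rat>). \<forall>k\<in>{..<n}. \<bar>U q w k\<bar> \<le> K} \<in> sets (F s)"
 proof (rule sets.sets_Collect_countable_All')
  show "countable (insert s ({0..s} \<inter> \<rat>))" using countable_rat by (auto intro: countable_subset)
  fix q assume q: "q \<in> insert s ({0..s} \<inter> \<rat>)"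
  show "{w \<in> space (F s). \<forall>k\<in>{..<n}. \<bar>U q w k\<bar> \<le> K} \<in> sets (F s)"
  proof (rule sets.sets_Collect_finite_All)
   fix k assume "k \<in> {..<n}"
   then have [measurable]: "(\<lambda>w. U q w k) \<in> borel_measurable (F s)" using q s by (intro F_measurable_mono[of q s] U_adapted) auto
   show "{w \<in> space (F s). \<bar>U q w k\<bar> \<le> K} \<in> sets (F s)" by measurable
  qed simp
 qed
 then show ?thesis by (simp add: stay_def F_space[OF s])
qed

lemma stay_sets_P: "s \<in> {0..t} ==> stay K s \<in> sets P" using stay_sets[of s K] subalg[of s] by (auto simp: subalgebra_def)

lemma stay_bound:
 assumes "\<forall>k<n. continuous_on {0..t} (\<lambda>s. U s w k)" "w \<in> stay K s" "r \<in> {0..s}" "s \<in> {0..t}" "k < n"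
 shows "\<bar>U r w k\<bar> \<le> K"
proof (rule continuous_bounded_on_rationals[where s=s and r=r and f="\<lambda>r. U r w k"])
 have "continuous_on {0..t} (\<lambda>r. U r w k)" using assms by blast
 then show "continuous_on {0..s} (\<lambda>r. U r w k)" by (rule continuous_on_subset) (use assms in auto)
qed (use assms in \<open>auto simp: stay_def\<close>)

lemma stay_mono:
 assumes "\<forall>k<n. continuous_on {0..t} (\<lambda>s. U s w k)" "w \<in> stay K s'" "s \<le> s'" "s \<in> {0..t}" "s' \<in> {0..t}"
 shows "w \<in> stay K s" using stay_bound[OF assms(1,2) _ assms(5)] assms by (auto simp: stay_def)

lemma stay_now: "w \<in> stay K s ==> k < n ==> \<bar>U s w k\<bar> \<le> K" by (auto simp: stay_def)

text \<open>The quotient along the path, killed when the path has left the cube.\<close>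

definition val :: "real => real => 'v => real" where
 "val K s w = indicator (stay K s) w * qu N h (th s) (U s w)"

definition drift :: "nat => real => 'v => real" where
 "drift k r w = ql h (k, 1) (th r) (U r w)"

text \<open>The displacement not due to noise. It is set to 0 for paths that have left the cube, so
  that it is bounded almost surely.\<close>

definition disp :: "real => real => real => nat => 'v => real" where
 "disp K s s' k w = indicator (stay K s') w * (U s' w k - U s w k - J s s' k w)"

text \<open>The total defect from freezing the drift at the left end of the interval.\<close>

definition gap :: "real => real => real => 'v => real" where
 "gap K s s' w = (\<Sum>k<n. indicator (stay K s') w * \<bar>disp K s s' k w - (th s - th s') * lam k * drift k s w\<bar>)"

lemma drift_cont:
 assumes "\<forall>k<n. continuous_on {0..t} (\<lambda>s. U s w k)"
 shows "continuous_on {0..t} (\<lambda>r. drift k r w)"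
proof -
 have "continuous_on {0..t} (\<lambda>r. h d (th r) (U r w))" for d by (rule heat_family_path_continuous[OF h th_cont th_range]) (use assms in auto)
 then show ?thesis unfolding drift_def ql_def using h_pos[OF th_range] by (intro continuous_intros) (auto simp: less_le)
qed

lemma quotient_measurable:
 assumes s: "s \<in> {0..t}"
 shows "(\<lambda>w. qu N h (th s) (U s w)) \<in> borel_measurable (F s)"
  "(\<lambda>w. qc N h z (th s) (U s w)) \<in> borel_measurable (F s)"
  "(\<lambda>w. ql h z (th s) (U s w)) \<in> borel_measurable (F s)"
  "(\<lambda>w. qg N h k l (th s) (U s w)) \<in> borel_measurable (F s)"
proof -
 have [measurable]: "(\<lambda>w. N d (th s) (U s w)) \<in> borel_measurable (F s)" "(\<lambda>w. h d (th s) (U s w)) \<in> borel_measurable (F s)" for d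
  by (intro N_measurable h_measurable th_range U_adapted s; assumption)+
 show "(\<lambda>w. qu N h (th s) (U s w)) \<in> borel_measurable (F s)"
  "(\<lambda>w. qc N h z (th s) (U s w)) \<in> borel_measurable (F s)"
  "(\<lambda>w. ql h z (th s) (U s w)) \<in> borel_measurable (F s)"
  "(\<lambda>w. qg N h k l (th s) (U s w)) \<in> borel_measurable (F s)" unfolding qg_def qe_def qc_def ql_def qu_def by measurable
qed

lemma drift_measurable: "s \<in> {0..t} ==> drift k s \<in> borel_measurable P"
 unfolding drift_def[abs_def] by (rule F_measurable[OF _ quotient_measurable(3)])

lemma U_measurable: "s \<in> {0..t} ==> k < n ==> (\<lambda>w. U s w k) \<in> borel_measurable P" by (rule F_measurable[OF _ U_adapted])

lemma disp_measurable:
 assumes "0 \<le> s" "s < s'" "s' \<le> t" "k < n"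
 shows "disp K s s' k \<in> borel_measurable P" unfolding disp_def[abs_def]
 by (intro borel_measurable_times borel_measurable_indicator borel_measurable_diff U_measurable J_measurable stay_sets_P)
  (use assms in auto)

lemma gap_measurable:
 assumes "0 \<le> s" "s < s'" "s' \<le> t"
 shows "gap K s s' \<in> borel_measurable P" unfolding gap_def[abs_def]
 by (intro borel_measurable_sum borel_measurable_times borel_measurable_indicator borel_measurable_abs borel_measurable_diff
   disp_measurable drift_measurable borel_measurable_const stay_sets_P)
  (use assms in auto)

lemma disp_eq:
 assumes s: "0 \<le> s" "s < s'" "s' \<le> t"
 shows "AE w in P. \<forall>k<n. w \<in> stay K s' --> disp K s s' k w = integral {s..s'} (\<lambda>r. ka r * lam k * drift k r w)"
 using increments[OF s] by eventually_elim (auto simp: disp_def drift_def)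

lemma integral_kappa_bound:
 assumes s: "0 \<le> s" "s \<le> s'" "s' \<le> t" and f: "continuous_on {s..s'} f" "\<And>r. r \<in> {s..s'} ==> \<bar>f r\<bar> \<le> c"
 shows "\<bar>integral {s..s'} (\<lambda>r. ka r * f r)\<bar> \<le> c * (th s - th s')"
proof -
 have ka: "continuous_on {s..s'} ka" by (rule continuous_on_subset[OF ka_cont]) (use s in auto)
 have "norm (integral {s..s'} (\<lambda>r. ka r * f r)) \<le> integral {s..s'} (\<lambda>r. ka r * c)"
 proof (rule integral_norm_bound_integral)
  show "(\<lambda>r. ka r * f r) integrable_on {s..s'}" "(\<lambda>r. ka r * c) integrable_on {s..s'}" by (intro integrable_continuous_real continuous_intros ka f)+
  show "norm (ka r * f r) \<le> ka r * c" if "r \<in> {s..s'}" for r using f(2)[OF that] ka_nonneg[of r] that s by (auto simp: abs_mult intro!: mult_left_mono)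
 qed
 then show ?thesis using th_ka[OF s] by (simp add: mult.commute)
qed

lemma disp_bound:
 assumes s: "0 \<le> s" "s < s'" "s' \<le> t" and b: "0 \<le> b"
  and ql: "\<And>th' y k. th' \<in> {th t..th 0} ==> \<forall>k<n. \<bar>y k\<bar> \<le> K ==> k < n ==> \<bar>ql h (k, 1) th' y\<bar> \<le> b"
 shows "AE w in P. \<forall>k<n. \<bar>disp K s s' k w\<bar> \<le> lam k * b * (th s - th s')" using disp_eq[OF s, of K] U_cont
proof eventually_elim
 case (elim w)
 have dt: "0 < th s - th s'" using th_dec[OF s] by simp
 show ?case
 proof (intro allI impI)
  fix k assume k: "k < n"
  show "\<bar>disp K s s' k w\<bar> \<le> lam k * b * (th s - th s')"
  proof (cases "w \<in> stay K s'")
   case True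
   have "\<bar>integral {s..s'} (\<lambda>r. ka r * (lam k * drift k r w))\<bar> \<le> (lam k * b) * (th s - th s')"
   proof (rule integral_kappa_bound)
    show "continuous_on {s..s'} (\<lambda>r. lam k * drift k r w)" by (intro continuous_intros continuous_on_subset[OF drift_cont[OF elim(2)]]) (use s in auto)
    fix r assume r: "r \<in> {s..s'}"
    have "\<bar>drift k r w\<bar> \<le> b" unfolding drift_def using stay_bound[OF elim(2) True, of r] r s k by (intro ql th_range) auto
    then show "\<bar>lam k * drift k r w\<bar> \<le> lam k * b" using lam[OF k] by (simp add: abs_mult)
   qed (use s in auto)
   then show ?thesis using elim(1) True k by (simp add: mult.assoc)
  next
   case False
   then show ?thesis using dt lam[OF k] b by (simp add: disp_def)
  qed
 qed
qed

text \<open>In expectation the linear noise terms vanish, the noise products leave the diagonal, and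
  half of the second derivatives cancels the term from the heat equation. What remains of the
  diagonal is a product with the score, which the drift compensates up to \<open>gap\<close>. Paths
  that leave the cube during the step have lost their drift term; they are charged to the decrease
  of the probability of staying.\<close>

lemma expectation_step:
 "\<exists>b\<ge>0. \<exists>C\<ge>0. (\<forall>s\<in>{0..t}. \<forall>w. \<bar>val K s w\<bar> \<le> b) \<and>
  (\<forall>s s'. 0 \<le> s --> s < s' --> s' \<le> t -->
   (AE w in P. gap K s s' w \<le> C * (th s - th s')) \<and>
   expectation (val K s') \<le> expectation (val K s) + b * expectation (gap K s s')
    + C * (th s - th s') * (prob (stay K s) - prob (stay K s')) + C * (sqrt (th s - th s') * (th s - th s')))"
proof -
 obtain m where m: "0 < m" "\<forall>th'\<in>{th t..th 0}. \<forall>y. (\<forall>k<n. \<bar>y k\<bar> \<le> K + 1) --> m \<le> h z0 th' y"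
  using h_lower by blast
 interpret hq: heat_quotient n lam "th t" "th 0" K m N h by unfold_locales (use N h N_nonneg h_pos m in \<open>auto intro: less_imp_le[OF lam]\<close>)
 obtain b where b: "0 \<le> b" and bounds: "\<forall>th'\<in>{th t..th 0}. \<forall>y. (\<forall>k<n. \<bar>y k\<bar> \<le> K) -->
  \<bar>qu N h th' y\<bar> \<le> b \<and>
  (\<forall>z\<in>moves n. \<bar>qc N h z th' y\<bar> \<le> b \<and> \<bar>ql h z th' y\<bar> \<le> b \<and> (\<forall>w'\<in>moves n. \<bar>qe N h z w' th' y\<bar> \<le> b)) \<and>
  (\<forall>k<n. \<forall>l<n. \<bar>qg N h k l th' y\<bar> \<le> b)" using hq.coefficient_bounds by blast
 define La where "La = (\<Sum>k<n. lam k)"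
 have La: "0 \<le> La" unfolding La_def by (intro sum_nonneg) (auto intro: less_imp_le[OF lam])
 have lam_La: "lam k \<le> La" if "k < n" for k unfolding La_def by (rule member_le_sum) (use that in \<open>auto intro: less_imp_le[OF lam]\<close>)
 define C0 where "C0 = La * b"
 have C0: "0 \<le> C0" using La b by (simp add: C0_def)
 obtain C where C: "0 \<le> C" "\<forall>th'\<in>{th t..th 0}. \<forall>dt y be j. 0 < dt --> th' - dt \<in> {th t..th 0} --> (\<forall>k<n. \<bar>y k\<bar> \<le> K) -->
  (\<forall>k<n. \<bar>be k\<bar> \<le> C0 * dt) -->
  (if \<forall>k<n. \<bar>y k + (be k + j k)\<bar> \<le> K then qu N h (th' - dt) (\<lambda>k. y k + (be k + j k)) else 0) \<le>
   qu N h th' y + (\<Sum>k<n. (be k + j k) * qc N h (k, 1) th' y) - dt / 2 * (\<Sum>k<n. lam k * qc N h (k, 2) th' y)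
    + (\<Sum>k<n. \<Sum>l<n. j k * j l * qg N h k l th' y)
    + C * (sqrt dt * (dt + (\<Sum>k<n. (j k)\<^sup>2 + (j k) ^ 4 / dt)))" using hq.quotient_step_bound[OF C0] by blast
 \<comment> \<open>\<open>dt\<close> times the sum in parentheses is the expectation of
   \<open>dt\<close> plus the squares and the fourth powers over dt of the noise; the factor 3 is
   the fourth moment of a standard normal variable.\<close>
 define C' where "C' = C * (1 + (\<Sum>k<n. lam k + 3 * (lam k)\<^sup>2))"
 \<comment> \<open>One constant for three purposes: the expansion error, the drift lost by paths
   leaving the cube, and the bound on \<open>gap\<close>.\<close>
 define CC where "CC = C' + b * b * La + 2 * b * La"
 have C'0: "0 \<le> C'" unfolding C'_def using C(1) lam by (auto intro!: mult_nonneg_nonneg add_nonneg_nonneg sum_nonneg intro: less_imp_le)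
 have CC: "0 \<le> CC" "C' \<le> CC" "b * b * La \<le> CC" "2 * b * La \<le> CC" using C'0 b La by (auto simp: CC_def)
 have bb: "\<bar>qu N h (th s) (U s w)\<bar> \<le> b" "\<And>k. k < n ==> \<bar>qc N h (k, 1) (th s) (U s w)\<bar> \<le> b"
  "\<And>k. k < n ==> \<bar>qc N h (k, 2) (th s) (U s w)\<bar> \<le> b" "\<And>k. k < n ==> \<bar>ql h (k, 1) (th s) (U s w)\<bar> \<le> b"
  "\<And>k l. k < n ==> l < n ==> \<bar>qg N h k l (th s) (U s w)\<bar> \<le> b"
  if "s \<in> {0..t}" "w \<in> stay K s" for s w using bounds[rule_format, OF th_range[OF that(1)], of "U s w"] stay_now[OF that(2)] by (auto simp: moves_def)
 have val_b: "\<bar>val K s w\<bar> \<le> b" if "s \<in> {0..t}" for s w using bb(1)[OF that] b by (auto simp: val_def indicator_def)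
 have "(AE w in P. gap K s s' w \<le> CC * (th s - th s')) \<and>
   expectation (val K s') \<le> expectation (val K s) + b * expectation (gap K s s')
    + CC * (th s - th s') * (prob (stay K s) - prob (stay K s')) + CC * (sqrt (th s - th s') * (th s - th s'))"
  if s: "0 \<le> s" "s < s'" "s' \<le> t" for s s'
 proof -
  have st: "s \<in> {0..t}" "s' \<in> {0..t}" using s by auto
  define dt where "dt = th s - th s'"
  have dt: "0 < dt" using th_dec[OF s] by (simp add: dt_def)
  define A A' where "A = stay K s" and "A' = stay K s'"
  have A [measurable]: "A \<in> sets P" "A' \<in> sets P" "A \<in> sets (F s)" unfolding A_def A'_def using stay_sets_P stay_sets st by auto
  have dispb: "AE w in P. \<forall>k<n. \<bar>disp K s s' k w\<bar> \<le> lam k * b * dt"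
   unfolding dt_def by (rule disp_bound[OF s b]) (use bounds in \<open>auto simp: moves_def\<close>)
  define be where "be = disp K s s'"
  define j where "j = J s s'"
  define ps where "ps k w = indicator A w * qc N h (k, 1) (th s) (U s w)" for k w
  define ps2 where "ps2 k w = indicator A w * qc N h (k, 2) (th s) (U s w)" for k w
  define et where "et k l w = indicator A w * qg N h k l (th s) (U s w)" for k l w
  have jm [measurable]: "k < n ==> j k \<in> borel_measurable P" for k unfolding j_def using J_measurable s by blast
  have bem [measurable]: "k < n ==> be k \<in> borel_measurable P" for k unfolding be_def by (rule disp_measurable[OF s])
  have dm [measurable]: "drift k s \<in> borel_measurable P" for k by (rule drift_measurable[OF st(1)])
  have psF: "ps k \<in> borel_measurable (F s)" "ps2 k \<in> borel_measurable (F s)" "et k l \<in> borel_measurable (F s)" for k l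
   unfolding ps_def[abs_def] ps2_def[abs_def] et_def[abs_def] by (intro borel_measurable_times borel_measurable_indicator A quotient_measurable st)+
  note psP [measurable] = psF[THEN F_measurable[OF st(1)]]
  have psb: "\<bar>ps k w\<bar> \<le> b" "\<bar>ps2 k w\<bar> \<le> b" "l < n ==> \<bar>et k l w\<bar> \<le> b" if "k < n" for k l w
   using bb(2-5)[OF st(1), of w] that b unfolding ps_def ps2_def et_def A_def by (auto simp: indicator_def)
  have bound_int: "integrable P f" if "f \<in> borel_measurable P" "\<And>w. \<bar>f w\<bar> \<le> c" for f :: "'v => real" and c
   using that by (intro integrable_const_bound[of f c]) auto
  have iw: "integrable P (\<lambda>w. f w * g w)" if "f \<in> borel_measurable P" "\<And>w. \<bar>f w\<bar> \<le> b" "integrable P g" for f g :: "'v => real"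
   by (rule Bochner_Integration.integrable_bound[of P "\<lambda>w. b * g w"])
    (use that b in \<open>auto simp: abs_mult intro!: mult_right_mono AE_I2\<close>)
  have ibe: "integrable P (be k)" if "k < n" for k
  proof (rule integrable_const_bound[of _ "lam k * b * dt"])
   show "AE w in P. norm (be k w) \<le> lam k * b * dt" using dispb by eventually_elim (use that in \<open>simp add: be_def\<close>)
  qed (use bem that in auto)
  have ij: "integrable P (\<lambda>w. j k w ^ i)" if "k < n" for k i unfolding j_def by (rule J_power[OF s that])
  have ijj: "integrable P (\<lambda>w. j k w * j l w)" if "k < n" "l < n" for k l
  proof (rule Bochner_Integration.integrable_bound[of P "\<lambda>w. (j k w)\<^sup>2 + (j l w)\<^sup>2"])
   show "AE w in P. norm (j k w * j l w) \<le> norm ((j k w)\<^sup>2 + (j l w)\<^sup>2)"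
   proof (rule AE_I2)
    fix w
    have "2 * (\<bar>j k w\<bar> * \<bar>j l w\<bar>) \<le> (j k w)\<^sup>2 + (j l w)\<^sup>2" using sum_squares_bound[of "\<bar>j k w\<bar>" "\<bar>j l w\<bar>"] by simp
    moreover have "0 \<le> \<bar>j k w\<bar> * \<bar>j l w\<bar>" by simp
    ultimately have "\<bar>j k w\<bar> * \<bar>j l w\<bar> \<le> (j k w)\<^sup>2 + (j l w)\<^sup>2" by linarith
    then show "norm (j k w * j l w) \<le> norm ((j k w)\<^sup>2 + (j l w)\<^sup>2)" by (simp add: abs_mult)
   qed
  qed (use that ij in auto)
  \<comment> \<open>Current value, drift with noise, heat term, noise products, and error. All but
    the last carry the indicator of \<open>A\<close>; the error is nonnegative everywhere, which
    settles the paths already killed.\<close>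
  define T1 T2 T3 T4 T5 where "T1 = val K s" and "T2 = (\<lambda>w. \<Sum>k<n. ps k w * be k w + ps k w * j k w)"
   and "T3 = (\<lambda>w. dt / 2 * (\<Sum>k<n. lam k * ps2 k w))" and "T4 = (\<lambda>w. \<Sum>k<n. \<Sum>l<n. et k l w * (j k w * j l w))"
   and "T5 = (\<lambda>w. C * (sqrt dt * (dt + (\<Sum>k<n. (j k w)\<^sup>2 + (j k w) ^ 4 / dt))))"
  have valm: "val K r \<in> borel_measurable P" if "r \<in> {0..t}" for r unfolding val_def[abs_def]
   by (intro borel_measurable_times borel_measurable_indicator stay_sets_P F_measurable[OF _ quotient_measurable(1)] that)
  have iw2: "integrable P (\<lambda>w. ps k w * be k w)" "integrable P (\<lambda>w. ps k w * j k w)" if "k < n" for k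
   using iw[OF psP(1) psb(1)[OF that] ibe[OF that]] iw[OF psP(1) psb(1)[OF that], of "j k"] ij[OF that, of 1] by simp_all
  have iw4: "integrable P (\<lambda>w. et k l w * (j k w * j l w))" if kl: "k < n" "l < n" for k l by (rule iw[OF psP(3) psb(3)[OF kl] ijj[OF kl]])
  have i1: "integrable P T1" unfolding T1_def using valm val_b st by (intro bound_int) auto
  have i2: "integrable P T2" unfolding T2_def using iw2 by (intro Bochner_Integration.integrable_sum Bochner_Integration.integrable_add) auto
  have i3: "integrable P T3" unfolding T3_def using psP psb by (intro integrable_mult_right Bochner_Integration.integrable_sum bound_int) auto
  have i4: "integrable P T4" unfolding T4_def using iw4 by (intro Bochner_Integration.integrable_sum) auto
  have i5: "integrable P T5" unfolding T5_def
   using ij by (intro integrable_mult_right Bochner_Integration.integrable_sum Bochner_Integration.integrable_add integrable_divide) auto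
  have ptw: "AE w in P. val K s' w \<le> T1 w + T2 w - T3 w + T4 w + T5 w" using dispb U_cont
  proof eventually_elim
   case (elim w)
   have T5: "0 \<le> T5 w" unfolding T5_def using C(1) dt by (intro mult_nonneg_nonneg add_nonneg_nonneg sum_nonneg) auto
   show ?case
   proof (cases "w \<in> A")
    case False
    then have "w \<notin> A'" using stay_mono[OF elim(2), of K s' s] st s unfolding A_def A'_def by auto
    then have "val K s' w = 0" by (simp add: val_def A'_def)
    moreover have "T1 w = 0" "T2 w = 0" "T3 w = 0" "T4 w = 0" using False by (simp_all add: T1_def T2_def T3_def T4_def val_def ps_def ps2_def et_def A_def)
    ultimately show ?thesis using T5 by simp
   next
    case True
    define y where "y = U s w"
    have yK: "\<forall>k<n. \<bar>y k\<bar> \<le> K" unfolding y_def using stay_now True A_def by blast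
    have beta: "\<forall>k<n. \<bar>be k w\<bar> \<le> C0 * dt"
    proof (intro allI impI)
     fix k assume k: "k < n"
     have "\<bar>be k w\<bar> \<le> lam k * b * dt" using elim(1) k by (simp add: be_def)
     also have "\<dots> \<le> C0 * dt" unfolding C0_def using lam_La[OF k] b dt by (intro mult_right_mono) auto
     finally show "\<bar>be k w\<bar> \<le> C0 * dt" .
    qed
    have rng: "th s - dt \<in> {th t..th 0}" "th s - dt = th s'" using th_range[OF st(2)] by (auto simp: dt_def)
    define lhs where "lhs = (if \<forall>k<n. \<bar>y k + (be k w + j k w)\<bar> \<le> K then qu N h (th s - dt) (\<lambda>k. y k + (be k w + j k w)) else 0)"
    have "lhs \<le> qu N h (th s) y + (\<Sum>k<n. (be k w + j k w) * qc N h (k, 1) (th s) y) - dt / 2 * (\<Sum>k<n. lam k * qc N h (k, 2) (th s) y)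
     + (\<Sum>k<n. \<Sum>l<n. j k w * j l w * qg N h k l (th s) y)
     + C * (sqrt dt * (dt + (\<Sum>k<n. (j k w)\<^sup>2 + (j k w) ^ 4 / dt)))"
     unfolding lhs_def by (rule C(2)[rule_format, OF th_range[OF st(1)] dt rng(1)]) (use yK beta in auto)
    also have "\<dots> = T1 w + T2 w - T3 w + T4 w + T5 w"
     using True by (simp add: T1_def T2_def T3_def T4_def T5_def val_def ps_def ps2_def et_def A_def y_def algebra_simps)
    finally have lhs: "lhs \<le> T1 w + T2 w - T3 w + T4 w + T5 w" .
    \<comment> \<open>Only an inequality: a path may leave the cube between s and s' and be back at
      s', and then \<open>val\<close> is 0. On \<open>A'\<close> the displacement is exactly
      \<open>be + j\<close>.\<close>
    have "val K s' w \<le> lhs"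
    proof (cases "w \<in> A'")
     case False
     then have "val K s' w = 0" by (simp add: val_def A'_def)
     moreover have "0 \<le> lhs" unfolding lhs_def qu_def using N_nonneg[OF rng(1)] h_pos[OF rng(1)] by (auto intro!: divide_nonneg_pos)
     ultimately show ?thesis by simp
    next
     case True
     have eq: "y k + (be k w + j k w) = U s' w k" for k using True by (simp add: be_def j_def disp_def y_def A'_def)
     have "\<forall>k<n. \<bar>U s' w k\<bar> \<le> K" using stay_now True A'_def by blast
     then have "lhs = qu N h (th s') (\<lambda>k. U s' w k)" unfolding lhs_def eq rng(2) by simp
     then show ?thesis using True by (simp add: val_def A'_def)
    qed
    then show ?thesis using lhs by simp
   qed
  qed
  have E0: "expectation (val K s') \<le> expectation (\<lambda>w. T1 w + T2 w - T3 w + T4 w + T5 w)"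
  proof (rule integral_mono_AE[OF _ _ ptw])
   show "integrable P (val K s')" using valm[OF st(2)] val_b[OF st(2)] by (rule bound_int)
   show "integrable P (\<lambda>w. T1 w + T2 w - T3 w + T4 w + T5 w)" using i1 i2 i3 i4 i5 by simp
  qed
  have E1: "expectation (\<lambda>w. T1 w + T2 w - T3 w + T4 w + T5 w) = expectation (val K s) + expectation T2 - expectation T3 + expectation T4 + expectation T5"
   using i1 i2 i3 i4 i5 by (simp add: T1_def)
  have E2: "expectation T2 = (\<Sum>k<n. expectation (\<lambda>w. ps k w * be k w))"
  proof -
   have "expectation (\<lambda>w. ps k w * be k w + ps k w * j k w) = expectation (\<lambda>w. ps k w * be k w)" if k: "k < n" for k
    using J_1[OF s k psF(1) psb(1)[OF k]] iw2[OF k] by (simp add: j_def)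
   moreover have "integrable P (\<lambda>w. ps k w * be k w + ps k w * j k w)" if k: "k < n" for k using iw2[OF k] by simp
   ultimately show ?thesis unfolding T2_def by (subst Bochner_Integration.integral_sum) auto
  qed
  have ips: "integrable P (ps2 k)" "integrable P (ps k)" "l < n ==> integrable P (et k l)" if "k < n" for k l using bound_int psP psb that by blast+
  have E3: "expectation T3 = dt / 2 * (\<Sum>k<n. lam k * expectation (ps2 k))" unfolding T3_def using ips by (simp add: Bochner_Integration.integral_sum)
  define psl where "psl k w = ps k w * drift k s w" for k w
  have ipsl: "integrable P (psl k)" if "k < n" for k
  proof (rule bound_int[of _ "b * b"])
   show "psl k \<in> borel_measurable P" unfolding psl_def[abs_def] by measurable
   show "\<bar>psl k w\<bar> \<le> b * b" for w
   proof (cases "w \<in> A")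
    case True
    then show ?thesis unfolding psl_def using bb(4)[OF st(1), of w k] that by (intro abs_mult_le psb) (auto simp: drift_def A_def)
   next
    case False then show ?thesis using b by (simp add: psl_def ps_def)
   qed
  qed
  have E4: "expectation T4 = dt * (\<Sum>k<n. lam k * (expectation (ps2 k) / 2 - expectation (psl k)))"
  proof -
   have "expectation T4 = (\<Sum>k<n. \<Sum>l<n. expectation (\<lambda>w. et k l w * (j k w * j l w)))" unfolding T4_def using iw4
    by (subst Bochner_Integration.integral_sum; (intro Bochner_Integration.integrable_sum)?; simp add: Bochner_Integration.integral_sum)
   also have "\<dots> = (\<Sum>k<n. \<Sum>l<n. if k = l then lam k * dt * expectation (et k l) else 0)"
    using J_2[OF s _ _ psF(3) psb(3)] by (intro sum.cong refl) (auto simp: j_def dt_def)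
   also have "\<dots> = (\<Sum>k<n. lam k * dt * expectation (et k k))" by (intro sum.cong refl) simp
   also have "\<dots> = (\<Sum>k<n. lam k * dt * (expectation (ps2 k) / 2 - expectation (psl k)))"
   proof (intro sum.cong refl)
    fix k assume "k \<in> {..<n}"
    then have k: "k < n" by simp
    have "et k k = (\<lambda>w. ps2 k w / 2 - psl k w)" unfolding et_def ps2_def psl_def ps_def qg_def qe_diag drift_def by (auto simp: algebra_simps)
    then show "lam k * dt * expectation (et k k) = lam k * dt * (expectation (ps2 k) / 2 - expectation (psl k))" using ips[OF k] ipsl[OF k] by simp
   qed
   finally show ?thesis by (simp add: sum_distrib_left ac_simps)
  qed
  have E5: "expectation T5 = C' * (sqrt dt * dt)"
  proof -
   have j2: "expectation (\<lambda>w. (j k w)\<^sup>2) = lam k * dt" if "k < n" for k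
    using J_2[OF s that that, of "\<lambda>_. 1" 1] by (simp add: j_def dt_def prob_space power2_eq_square)
   have j4: "expectation (\<lambda>w. (j k w) ^ 4) = 3 * (lam k * dt)\<^sup>2" if "k < n" for k using J_4[OF s that] by (simp add: j_def dt_def)
   have "expectation (\<lambda>w. (j k w)\<^sup>2 + (j k w) ^ 4 / dt) = (lam k + 3 * (lam k)\<^sup>2) * dt" if k: "k < n" for k
   proof -
    have "expectation (\<lambda>w. (j k w)\<^sup>2 + (j k w) ^ 4 / dt) = lam k * dt + 3 * (lam k * dt)\<^sup>2 / dt" using ij[OF k] j2[OF k] j4[OF k] by simp
    also have "\<dots> = (lam k + 3 * (lam k)\<^sup>2) * dt" using dt by (simp add: power2_eq_square algebra_simps)
    finally show ?thesis .
   qed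
   moreover have "integrable P (\<lambda>w. (j k w)\<^sup>2 + (j k w) ^ 4 / dt)" if "k < n" for k using ij[OF that] by simp
   ultimately have "expectation (\<lambda>w. dt + (\<Sum>k<n. (j k w)\<^sup>2 + (j k w) ^ 4 / dt)) = dt + (\<Sum>k<n. (lam k + 3 * (lam k)\<^sup>2) * dt)"
    by (subst Bochner_Integration.integral_add) (auto simp: Bochner_Integration.integral_sum prob_space intro!: Bochner_Integration.integrable_sum)
   also have "\<dots> = (1 + (\<Sum>k<n. lam k + 3 * (lam k)\<^sup>2)) * dt" by (simp add: sum_distrib_right distrib_right)
   finally show ?thesis unfolding T5_def C'_def by (simp add: ac_simps)
  qed
  \<comment> \<open>The heat term cancels against the diagonal of the noise products by
    \<open>qe_diag\<close>; the product with the logarithmic derivative is left to be balanced by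
    the drift.\<close>
  have main: "expectation (val K s') \<le> expectation (val K s) + (\<Sum>k<n. expectation (\<lambda>w. ps k w * be k w) - dt * lam k * expectation (psl k)) + C' * (sqrt dt * dt)"
  proof -
   have "dt * (\<Sum>k<n. lam k * (expectation (ps2 k) / 2 - expectation (psl k))) = dt / 2 * (\<Sum>k<n. lam k * expectation (ps2 k)) - (\<Sum>k<n. dt * lam k * expectation (psl k))"
    by (simp add: sum_distrib_left sum_subtractf algebra_simps)
   then show ?thesis using E0 unfolding E1 E2 E3 E4 E5 sum_subtractf by linarith
  qed
  have gap_le: "AE w in P. gap K s s' w \<le> 2 * b * La * dt" using dispb U_cont
  proof eventually_elim
   case (elim w)
   have "gap K s s' w \<le> (\<Sum>k<n. 2 * b * dt * lam k)" unfolding gap_def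
   proof (rule sum_mono)
    fix k assume "k \<in> {..<n}"
    then have k: "k < n" by simp
    show "indicator (stay K s') w * \<bar>disp K s s' k w - (th s - th s') * lam k * drift k s w\<bar> \<le> 2 * b * dt * lam k"
    proof (cases "w \<in> stay K s'")
     case True
     then have "w \<in> stay K s" using stay_mono[OF elim(2), of K s' s] st s by auto
     then have "\<bar>drift k s w\<bar> \<le> b" unfolding drift_def by (intro bb(4)[OF st(1)] k)
     then have "\<bar>(dt * lam k) * drift k s w\<bar> \<le> (dt * lam k) * b" using dt lam[OF k] by (intro abs_mult_le) auto
     moreover have "\<bar>disp K s s' k w\<bar> \<le> (dt * lam k) * b" using elim(1) k by (simp add: ac_simps)
     ultimately have "\<bar>disp K s s' k w - (dt * lam k) * drift k s w\<bar> \<le> 2 * ((dt * lam k) * b)" by linarith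
     then show ?thesis using True by (simp add: dt_def ac_simps)
    next
     case False then show ?thesis using b dt lam[OF k] by simp
    qed
   qed
   also have "\<dots> = 2 * b * La * dt" unfolding La_def sum_distrib_left[symmetric] by simp
   finally show ?case .
  qed
  have gap_nonneg: "0 \<le> gap K s s' w" for w unfolding gap_def by (intro sum_nonneg) auto
  have gap_int: "integrable P (gap K s s')"
  proof (rule integrable_const_bound[of _ "2 * b * La * dt"])
   show "AE w in P. norm (gap K s s' w) \<le> 2 * b * La * dt" using gap_le by eventually_elim (simp add: gap_nonneg)
  qed (rule gap_measurable[OF s])
  have "(\<Sum>k<n. expectation (\<lambda>w. ps k w * be k w) - dt * lam k * expectation (psl k)) =
   expectation (\<lambda>w. \<Sum>k<n. ps k w * be k w - dt * lam k * psl k w)" using iw2(1) ipsl by (subst Bochner_Integration.integral_sum) auto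
  also have "\<dots> \<le> expectation (\<lambda>w. b * gap K s s' w + (indicator A w - indicator A' w) * (b * b * La * dt))"
  proof (rule integral_mono_AE)
   show "integrable P (\<lambda>w. \<Sum>k<n. ps k w * be k w - dt * lam k * psl k w)"
    using iw2(1) ipsl by (intro Bochner_Integration.integrable_sum Bochner_Integration.integrable_diff) auto
   show "integrable P (\<lambda>w. b * gap K s s' w + (indicator A w - indicator A' w) * (b * b * La * dt))"
    using gap_int by (intro Bochner_Integration.integrable_add integrable_mult_right integrable_mult_left Bochner_Integration.integrable_diff)
     (auto simp: less_top[symmetric])
   show "AE w in P. (\<Sum>k<n. ps k w * be k w - dt * lam k * psl k w) \<le> b * gap K s s' w + (indicator A w - indicator A' w) * (b * b * La * dt)" using U_cont
   proof eventually_elim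
    case (elim w)
    have sub: "w \<in> A' ==> w \<in> A" using stay_mono[OF elim, of K s' s] st s unfolding A_def A'_def by auto
    have "(\<Sum>k<n. ps k w * be k w - dt * lam k * psl k w) \<le> (\<Sum>k<n. b * (indicator A' w * \<bar>be k w - dt * lam k * drift k s w\<bar>) + (indicator A w - indicator A' w) * (b * b * dt * lam k))"
    proof (rule sum_mono)
     fix k assume "k \<in> {..<n}"
     then have k: "k < n" by simp
     have e: "ps k w * be k w - dt * lam k * psl k w = ps k w * (be k w - dt * lam k * drift k s w)" by (simp add: psl_def algebra_simps)
     show "ps k w * be k w - dt * lam k * psl k w \<le> b * (indicator A' w * \<bar>be k w - dt * lam k * drift k s w\<bar>) + (indicator A w - indicator A' w) * (b * b * dt * lam k)"
     proof (cases "w \<in> A'")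
      case True
      have "\<bar>ps k w * (be k w - dt * lam k * drift k s w)\<bar> \<le> b * \<bar>be k w - dt * lam k * drift k s w\<bar>" by (intro abs_mult_le psb k) simp
      then show ?thesis unfolding e using True sub by simp
     next
      case False
      show ?thesis
      proof (cases "w \<in> A")
       case True
       have "\<bar>ps k w * (dt * lam k * drift k s w)\<bar> \<le> b * (dt * lam k * b)"
        using bb(4)[OF st(1), of w k] True k dt lam[OF k] by (intro abs_mult_le psb) (auto simp: drift_def A_def)
       moreover have "be k w = 0" using False by (simp add: be_def disp_def A'_def)
       ultimately show ?thesis unfolding e using True False by (simp add: ac_simps)
      next
       case nA: False
       then show ?thesis using False by (simp add: psl_def ps_def)
      qed
     qed
    qed
    also have "\<dots> = b * gap K s s' w + (indicator A w - indicator A' w) * (b * b * La * dt)"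
     unfolding sum.distrib sum_distrib_left[symmetric] gap_def be_def A'_def[symmetric] dt_def[symmetric] La_def by (simp add: ac_simps)
    finally show ?case .
   qed
  qed
  also have "\<dots> = b * expectation (gap K s s') + (prob A - prob A') * (b * b * La * dt)" using gap_int by (simp add: less_top[symmetric])
  also have "\<dots> \<le> b * expectation (gap K s s') + CC * dt * (prob A - prob A')"
  proof -
   have "prob A' \<le> prob A"
   proof (rule finite_measure_mono_AE)
    show "AE w in P. w \<in> A' --> w \<in> A" using U_cont by eventually_elim (use stay_mono[of _ K s' s] st s in \<open>auto simp: A_def A'_def\<close>)
   qed (rule A)
   moreover have "b * b * La * dt \<le> CC * dt" using CC(3) dt by (intro mult_right_mono) auto
   ultimately have "(prob A - prob A') * (b * b * La * dt) \<le> (prob A - prob A') * (CC * dt)" by (intro mult_left_mono) auto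
   then show ?thesis by (simp add: ac_simps)
  qed
  finally have fin: "(\<Sum>k<n. expectation (\<lambda>w. ps k w * be k w) - dt * lam k * expectation (psl k)) \<le> b * expectation (gap K s s') + CC * dt * (prob A - prob A')" .
  have "C' * (sqrt dt * dt) \<le> CC * (sqrt dt * dt)" using CC(2) dt by (intro mult_right_mono) auto
  then have "expectation (val K s') \<le> expectation (val K s) + b * expectation (gap K s s') + CC * dt * (prob A - prob A') + CC * (sqrt dt * dt)"
   using main fin by linarith
  moreover have "AE w in P. gap K s s' w \<le> CC * dt" using gap_le
  proof eventually_elim
   case (elim w)
   have "2 * b * La * dt \<le> CC * dt" using CC(4) dt by (intro mult_right_mono) auto
   then show ?case using elim by linarith
  qed
  ultimately show ?thesis unfolding dt_def A_def A'_def by blast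
 qed
 then show ?thesis using b CC(1) val_b by blast
qed

end

section \<open>From one step to the whole interval, and from the cube to the whole space\<close>

context reverse_process
begin

lemma gap_nonneg: "0 \<le> gap K s s' w" unfolding gap_def by (intro sum_nonneg) auto

text \<open>Along a continuous path the drift is uniformly continuous, so the defect of freezing it
  vanishes with the mesh. The assumed bound telescopes to a constant, which permits dominated
  convergence.\<close>

lemma sum_gap_tendsto:
 assumes C: "\<And>s s'. 0 \<le> s ==> s < s' ==> s' \<le> t ==> AE w in P. gap K s s' w \<le> C * (th s - th s')"
 shows "(\<lambda>m. \<Sum>i<Suc m. expectation (gap K (grid 0 t m i) (grid 0 t m (Suc i)))) \<longlonglongrightarrow> 0"
proof -
 define s where "s m i = grid 0 t m i" for m i
 have rs: "0 \<le> s m i" "s m i < s m (Suc i)" "s m (Suc i) \<le> t" if "i < Suc m" for m i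
  using grid_range[of 0 t i m] grid_range[of 0 t "Suc i" m] grid_less[of 0 t m i] t that by (auto simp: s_def)
 have meas: "gap K (s m i) (s m (Suc i)) \<in> borel_measurable P" if "i < Suc m" for m i by (rule gap_measurable[OF rs[OF that]])
 have ints: "integrable P (gap K (s m i) (s m (Suc i)))" if "i < Suc m" for m i
 proof (rule integrable_const_bound[of _ "C * (th (s m i) - th (s m (Suc i)))"])
  show "AE w in P. norm (gap K (s m i) (s m (Suc i)) w) \<le> C * (th (s m i) - th (s m (Suc i)))" using C[OF rs[OF that]] by eventually_elim (simp add: gap_nonneg)
 qed (rule meas[OF that])
 have tele: "(\<Sum>i<Suc m. th (s m i) - th (s m (Suc i))) = th 0 - th t" for m
  using sum_lessThan_telescope'[of "\<lambda>i. th (s m i)" "Suc m"] by (simp add: s_def del: sum.lessThan_Suc)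
 have "(\<lambda>m. expectation (\<lambda>w. \<Sum>i<Suc m. gap K (s m i) (s m (Suc i)) w)) \<longlonglongrightarrow> expectation (\<lambda>_. 0)"
 proof (rule integral_dominated_convergence[where w="\<lambda>_. C * (th 0 - th t)"])
  show "(\<lambda>w. \<Sum>i<Suc m. gap K (s m i) (s m (Suc i)) w) \<in> borel_measurable P" for m using meas by (intro borel_measurable_sum) auto
  show "AE w in P. norm (\<Sum>i<Suc m. gap K (s m i) (s m (Suc i)) w) \<le> C * (th 0 - th t)" for m
  proof -
   have "AE w in P. \<forall>i\<in>{..<Suc m}. gap K (s m i) (s m (Suc i)) w \<le> C * (th (s m i) - th (s m (Suc i)))" using C rs by (intro AE_finite_allI) auto
   then show ?thesis
   proof eventually_elim
    case (elim w)
    have "(\<Sum>i<Suc m. gap K (s m i) (s m (Suc i)) w) \<le> (\<Sum>i<Suc m. C * (th (s m i) - th (s m (Suc i))))" using elim by (intro sum_mono) blast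
    also have "\<dots> = C * (th 0 - th t)" unfolding sum_distrib_left[symmetric] tele ..
    finally have "(\<Sum>i<Suc m. gap K (s m i) (s m (Suc i)) w) \<le> C * (th 0 - th t)" .
    moreover have "0 \<le> (\<Sum>i<Suc m. gap K (s m i) (s m (Suc i)) w)" by (intro sum_nonneg gap_nonneg)
    ultimately show ?case by simp
   qed
  qed
  \<comment> \<open>All grids together involve countably many intervals, hence a single exceptional
    null set.\<close>
  have "AE w in P. \<forall>m. \<forall>i\<in>{..<Suc m}. \<forall>k<n. w \<in> stay K (s m (Suc i)) -->
   disp K (s m i) (s m (Suc i)) k w = integral {s m i..s m (Suc i)} (\<lambda>r. ka r * lam k * drift k r w)"
   unfolding AE_all_countable using disp_eq[OF rs] by (intro allI AE_finite_allI) auto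
  then show "AE w in P. (\<lambda>m. \<Sum>i<Suc m. gap K (s m i) (s m (Suc i)) w) \<longlonglongrightarrow> 0" using U_cont
  proof eventually_elim
   case (elim w)
   define La where "La = (\<Sum>k<n. lam k)"
   have La: "0 \<le> La" unfolding La_def by (intro sum_nonneg) (auto intro: less_imp_le[OF lam])
   have D: "0 \<le> th 0 - th t" using th_range[of 0] t by simp
   show ?case
   proof (rule LIMSEQ_I)
    fix r :: real assume r: "0 < r"
    define ep where "ep = r / (La * (th 0 - th t) + 1)"
    have den: "0 < La * (th 0 - th t) + 1" using La D by (simp add: add_nonneg_pos)
    have ep: "0 < ep" unfolding ep_def using r den by simp
    have "\<forall>\<^sub>F m in sequentially. \<forall>k\<in>{..<n}. \<forall>i\<le>m. \<forall>r\<in>{grid 0 t m i..grid 0 t m (Suc i)}. \<forall>r'\<in>{grid 0 t m i..grid 0 t m (Suc i)}.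
     \<bar>drift k r w - drift k r' w\<bar> \<le> ep" using t ep by (intro eventually_ball_finite ballI grid_oscillation[where s=0 and s'=t] drift_cont[OF elim(2)]) auto
    then obtain m0 where m0: "\<forall>m\<ge>m0. \<forall>k\<in>{..<n}. \<forall>i\<le>m. \<forall>r\<in>{s m i..s m (Suc i)}. \<forall>r'\<in>{s m i..s m (Suc i)}.
     \<bar>drift k r w - drift k r' w\<bar> \<le> ep" unfolding eventually_sequentially s_def by blast
    show "\<exists>m0. \<forall>m\<ge>m0. norm ((\<Sum>i<Suc m. gap K (s m i) (s m (Suc i)) w) - 0) < r"
    proof (intro exI[of _ m0] allI impI)
     fix m assume m: "m0 \<le> m"
     have "(\<Sum>i<Suc m. gap K (s m i) (s m (Suc i)) w) \<le> (\<Sum>i<Suc m. (La * ep) * (th (s m i) - th (s m (Suc i))))"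
     proof (rule sum_mono)
      fix i assume "i \<in> {..<Suc m}"
      then have i: "i < Suc m" by simp
      let ?s = "s m i" and ?s' = "s m (Suc i)"
      have rng: "th ?s' < th ?s" by (rule th_dec[OF rs[OF i]])
      have "gap K ?s ?s' w \<le> (\<Sum>k<n. lam k * (ep * (th ?s - th ?s')))" unfolding gap_def
      proof (rule sum_mono)
       fix k assume "k \<in> {..<n}"
       then have k: "k < n" by simp
       show "indicator (stay K ?s') w * \<bar>disp K ?s ?s' k w - (th ?s - th ?s') * lam k * drift k ?s w\<bar> \<le> lam k * (ep * (th ?s - th ?s'))"
       proof (cases "w \<in> stay K ?s'")
        case False then show ?thesis using lam[OF k] ep rng by simp
       next
        case True
        have sub: "{?s..?s'} \<subseteq> {0..t}" using rs[OF i] by auto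
        have dc: "continuous_on {?s..?s'} (\<lambda>r. drift k r w)" by (rule continuous_on_subset[OF drift_cont[OF elim(2)] sub])
        have kc: "continuous_on {?s..?s'} ka" by (rule continuous_on_subset[OF ka_cont sub])
        have e1: "disp K ?s ?s' k w = integral {?s..?s'} (\<lambda>r. ka r * lam k * drift k r w)" using elim(1) i k True by auto
        have e2: "(th ?s - th ?s') * lam k * drift k ?s w = integral {?s..?s'} (\<lambda>r. ka r * lam k * drift k ?s w)" using th_ka[of ?s ?s'] rs[OF i] by simp
        have "disp K ?s ?s' k w - (th ?s - th ?s') * lam k * drift k ?s w
         = integral {?s..?s'} (\<lambda>r. ka r * lam k * drift k r w - ka r * lam k * drift k ?s w)"
         unfolding e1 e2 by (rule integral_diff[symmetric]) (intro integrable_continuous_real continuous_intros dc kc)+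
        also have "\<dots> = integral {?s..?s'} (\<lambda>r. ka r * (lam k * (drift k r w - drift k ?s w)))" by (simp add: algebra_simps)
        finally have e: "disp K ?s ?s' k w - (th ?s - th ?s') * lam k * drift k ?s w = \<dots>" .
        have "\<bar>integral {?s..?s'} (\<lambda>r. ka r * (lam k * (drift k r w - drift k ?s w)))\<bar> \<le> (lam k * ep) * (th ?s - th ?s')"
        proof (rule integral_kappa_bound)
         show "continuous_on {?s..?s'} (\<lambda>r. lam k * (drift k r w - drift k ?s w))" by (intro continuous_intros dc)
         fix r assume r: "r \<in> {?s..?s'}"
         have "\<bar>drift k r w - drift k ?s w\<bar> \<le> ep" by (rule m0[rule_format]) (use m k i r rs[OF i] in auto)
         then show "\<bar>lam k * (drift k r w - drift k ?s w)\<bar> \<le> lam k * ep" using lam[OF k] by (simp add: abs_mult)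
        qed (use rs[OF i] in auto)
        then show ?thesis unfolding e using True by (simp add: mult.assoc)
       qed
      qed
      then show "gap K ?s ?s' w \<le> (La * ep) * (th ?s - th ?s')" by (simp add: La_def sum_distrib_right mult.assoc)
     qed
     also have "\<dots> = (La * ep) * (th 0 - th t)" unfolding sum_distrib_left[symmetric] tele ..
     also have "\<dots> = ep * (La * (th 0 - th t))" by simp
     also have "\<dots> < ep * (La * (th 0 - th t) + 1)" using ep by (intro mult_strict_left_mono) auto
     also have "\<dots> = r" using den by (simp add: ep_def)
     finally have "(\<Sum>i<Suc m. gap K (s m i) (s m (Suc i)) w) < r" .
     moreover have "0 \<le> (\<Sum>i<Suc m. gap K (s m i) (s m (Suc i)) w)" by (intro sum_nonneg gap_nonneg)
     ultimately show "norm ((\<Sum>i<Suc m. gap K (s m i) (s m (Suc i)) w) - 0) < r" by simp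
    qed
   qed
  qed
 qed simp_all
 moreover have "expectation (\<lambda>w. \<Sum>i<Suc m. gap K (s m i) (s m (Suc i)) w) = (\<Sum>i<Suc m. expectation (gap K (s m i) (s m (Suc i))))" for m
  using ints by (intro Bochner_Integration.integral_sum) auto
 ultimately show ?thesis by (simp add: s_def)
qed

text \<open>On a grid where \<open>th\<close> varies by at most ep per cell, the decreases of the
  staying probability telescope with weight ep, and \<open>sqrt dt * dt <= sqrt ep * dt\<close>
  telescopes with weight \<open>sqrt ep\<close>. First the grid is refined, then ep tends to
  0.\<close>

lemma expectation_val_le: "expectation (val K t) \<le> expectation (val K 0)"
proof -
 obtain b C where b: "0 \<le> b" and C: "0 \<le> C" and val_b: "\<forall>s\<in>{0..t}. \<forall>w. \<bar>val K s w\<bar> \<le> b"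
  and step: "\<forall>s s'. 0 \<le> s --> s < s' --> s' \<le> t -->
   (AE w in P. gap K s s' w \<le> C * (th s - th s')) \<and>
   expectation (val K s') \<le> expectation (val K s) + b * expectation (gap K s s')
    + C * (th s - th s') * (prob (stay K s) - prob (stay K s')) + C * (sqrt (th s - th s') * (th s - th s'))" using expectation_step[of K] by blast
 have gap0: "(\<lambda>m. \<Sum>i<Suc m. expectation (gap K (grid 0 t m i) (grid 0 t m (Suc i)))) \<longlonglongrightarrow> 0"
  by (rule sum_gap_tendsto) (use step in blast)
 have main: "expectation (val K t) \<le> expectation (val K 0) + C * ep + C * (sqrt ep * (th 0 - th t))" if ep: "0 < ep" for ep
 proof -
  have "\<forall>\<^sub>F m in sequentially. \<forall>i\<le>m. \<forall>r\<in>{grid 0 t m i..grid 0 t m (Suc i)}. \<forall>r'\<in>{grid 0 t m i..grid 0 t m (Suc i)}. \<bar>th r - th r'\<bar> \<le> ep"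
   by (rule grid_oscillation[OF th_cont]) (use t ep in auto)
  then have "\<forall>\<^sub>F m in sequentially. expectation (val K t) \<le> expectation (val K 0)
   + b * (\<Sum>i<Suc m. expectation (gap K (grid 0 t m i) (grid 0 t m (Suc i)))) + C * ep + C * (sqrt ep * (th 0 - th t))"
  proof eventually_elim
   case (elim m)
   define s where "s i = grid 0 t m i" for i
   have rs: "0 \<le> s i" "s i < s (Suc i)" "s (Suc i) \<le> t" if "i < Suc m" for i
    using grid_range[of 0 t i m] grid_range[of 0 t "Suc i" m] grid_less[of 0 t m i] t that by (auto simp: s_def)
   have "expectation (val K (s i)) \<le> expectation (val K 0) + b * (\<Sum>j<i. expectation (gap K (s j) (s (Suc j))))
    + C * ep * (prob (stay K 0) - prob (stay K (s i))) + C * (sqrt ep * (th 0 - th (s i)))" if "i \<le> Suc m" for i using that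
   proof (induction i)
    case 0 then show ?case by (simp add: s_def)
   next
    case (Suc i)
    then have i: "i < Suc m" by simp
    define dt where "dt = th (s i) - th (s (Suc i))"
    have dt: "0 < dt" using th_dec[OF rs[OF i]] by (simp add: dt_def)
    have dtep: "dt \<le> ep" using elim[rule_format, of i "s i" "s (Suc i)"] i rs[OF i] by (simp add: s_def dt_def)
    define q where "q = prob (stay K (s i)) - prob (stay K (s (Suc i)))"
    have "prob (stay K (s (Suc i))) \<le> prob (stay K (s i))"
    proof (rule finite_measure_mono_AE)
     show "AE w in P. w \<in> stay K (s (Suc i)) --> w \<in> stay K (s i)"
      using U_cont by eventually_elim (use stay_mono[of _ K "s (Suc i)" "s i"] rs[OF i] in auto)
     show "stay K (s i) \<in> sets P" by (rule stay_sets_P) (use rs[OF i] in auto)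
    qed
    then have q: "0 \<le> q" by (simp add: q_def)
    have "expectation (val K (s (Suc i))) \<le> expectation (val K (s i)) + b * expectation (gap K (s i) (s (Suc i))) + C * dt * q + C * (sqrt dt * dt)"
     unfolding dt_def q_def using step rs[OF i] by blast
    moreover have "C * dt * q \<le> C * ep * q" using dtep C q by (intro mult_right_mono mult_left_mono)
    moreover have "C * (sqrt dt * dt) \<le> C * (sqrt ep * dt)" using dtep C dt by (intro mult_right_mono mult_left_mono) auto
    moreover have "C * ep * (prob (stay K 0) - prob (stay K (s (Suc i)))) = C * ep * (prob (stay K 0) - prob (stay K (s i))) + C * ep * q" by (simp add: q_def algebra_simps)
    moreover have "C * (sqrt ep * (th 0 - th (s (Suc i)))) = C * (sqrt ep * (th 0 - th (s i))) + C * (sqrt ep * dt)" by (simp add: dt_def algebra_simps)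
    moreover have "b * (\<Sum>j<Suc i. expectation (gap K (s j) (s (Suc j)))) = b * (\<Sum>j<i. expectation (gap K (s j) (s (Suc j)))) + b * expectation (gap K (s i) (s (Suc i)))"
     by (simp add: algebra_simps)
    ultimately show ?case using Suc.IH i by linarith
   qed
   from this[of "Suc m"]
   have "expectation (val K t) \<le> expectation (val K 0) + b * (\<Sum>j<Suc m. expectation (gap K (s j) (s (Suc j))))
    + C * ep * (prob (stay K 0) - prob (stay K t)) + C * (sqrt ep * (th 0 - th t))" by (simp add: s_def)
   moreover have "C * ep * (prob (stay K 0) - prob (stay K t)) \<le> C * ep * 1"
    using C ep prob_le_1[of "stay K 0"] measure_nonneg[of P "stay K t"] by (intro mult_left_mono) (auto simp del: prob_le_1 measure_nonneg)
   ultimately show ?case unfolding s_def by linarith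
  qed
  moreover have "(\<lambda>m. expectation (val K 0) + b * (\<Sum>i<Suc m. expectation (gap K (grid 0 t m i) (grid 0 t m (Suc i)))) + C * ep + C * (sqrt ep * (th 0 - th t)))
   \<longlonglongrightarrow> expectation (val K 0) + b * 0 + C * ep + C * (sqrt ep * (th 0 - th t))" by (intro tendsto_intros gap0)
  ultimately show ?thesis using tendsto_lowerbound by fastforce
 qed
 have "((\<lambda>ep. expectation (val K 0) + C * ep + C * (sqrt ep * (th 0 - th t))) \<longlongrightarrow> expectation (val K 0) + C * 0 + C * (sqrt 0 * (th 0 - th t))) (at_right 0)"
  by (intro tendsto_intros)
 moreover have "\<forall>\<^sub>F ep in at_right 0. expectation (val K t) \<le> expectation (val K 0) + C * ep + C * (sqrt ep * (th 0 - th t))"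
  unfolding eventually_at_filter by (intro always_eventually allI impI main) auto
 ultimately have "expectation (val K t) \<le> expectation (val K 0) + C * 0 + C * (sqrt 0 * (th 0 - th t))" by (rule tendsto_lowerbound) simp
 then show ?thesis by simp
qed

text \<open>A continuous path on a compact interval is bounded, so it stays in every sufficiently
  large cube and the killed quotient is eventually the quotient itself; Fatou's lemma transfers the
  inequality.\<close>

theorem nn_integral_quotient_le:
 "(\<integral>\<^sup>+w. ennreal (qu N h (th t) (U t w)) \<partial>P) \<le> (\<integral>\<^sup>+w. ennreal (qu N h (th 0) (U 0 w)) \<partial>P)"
proof -
 have t0: "0 \<in> {0..t}" "t \<in> {0..t}" using t by auto
 have qu_nonneg: "0 \<le> qu N h (th s) (U s w)" if "s \<in> {0..t}" for s w
  unfolding qu_def using N_nonneg[OF th_range[OF that]] h_pos[OF th_range[OF that]] by (intro divide_nonneg_pos)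
 have val_nonneg: "0 \<le> val K s w" if "s \<in> {0..t}" for K s w unfolding val_def using qu_nonneg[OF that] by simp
 have val_m: "val K s \<in> borel_measurable P" if "s \<in> {0..t}" for K s unfolding val_def[abs_def]
  by (intro borel_measurable_times borel_measurable_indicator stay_sets_P F_measurable[OF _ quotient_measurable(1)] that)
 have val_int: "integrable P (val K s)" if s: "s \<in> {0..t}" for K s
 proof -
  obtain b where "\<forall>s\<in>{0..t}. \<forall>w. \<bar>val K s w\<bar> \<le> b" using expectation_step[of K] by blast
  then show ?thesis using s by (intro integrable_const_bound[of _ b] val_m) auto
 qed
 have le: "(\<integral>\<^sup>+w. ennreal (val (real K) t w) \<partial>P) \<le> (\<integral>\<^sup>+w. ennreal (qu N h (th 0) (U 0 w)) \<partial>P)" for K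
 proof -
  have "(\<integral>\<^sup>+w. ennreal (val (real K) t w) \<partial>P) = ennreal (expectation (val (real K) t))"
   using val_nonneg[OF t0(2)] by (intro nn_integral_eq_integral val_int t0) auto
  also have "\<dots> \<le> ennreal (expectation (val (real K) 0))" by (intro ennreal_leI expectation_val_le)
  also have "\<dots> = (\<integral>\<^sup>+w. ennreal (val (real K) 0 w) \<partial>P)"
   using val_nonneg[OF t0(1)] by (intro nn_integral_eq_integral[symmetric] val_int t0) auto
  also have "\<dots> \<le> (\<integral>\<^sup>+w. ennreal (qu N h (th 0) (U 0 w)) \<partial>P)"
   using qu_nonneg[OF t0(1)] by (intro nn_integral_mono ennreal_leI) (auto simp: val_def indicator_def)
  finally show ?thesis .
 qed
 have "(\<integral>\<^sup>+w. ennreal (qu N h (th t) (U t w)) \<partial>P) \<le> (\<integral>\<^sup>+w. liminf (\<lambda>K. ennreal (val (real K) t w)) \<partial>P)"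
 proof (rule nn_integral_mono_AE)
  show "AE w in P. ennreal (qu N h (th t) (U t w)) \<le> liminf (\<lambda>K. ennreal (val (real K) t w))" using U_cont AE_space
  proof eventually_elim
   case (elim w)
   have "\<exists>C\<ge>0. \<forall>r\<in>{0..t}. \<bar>U r w k\<bar> \<le> C" if "k < n" for k by (rule continuous_on_Icc_bounded) (use elim that in blast)
   then obtain C where C: "\<And>k. k < n ==> 0 \<le> C k" "\<And>k. k < n ==> \<forall>r\<in>{0..t}. \<bar>U r w k\<bar> \<le> C k" by metis
   obtain K0 :: nat where K0: "(\<Sum>k<n. C k) \<le> real K0" using real_arch_simple by blast
   have "val (real K) t w = qu N h (th t) (U t w)" if "K0 \<le> K" for K
   proof -
    have "\<bar>U r w k\<bar> \<le> real K" if k: "k < n" and r: "r \<in> {0..t}" for r k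
    proof -
     have "\<bar>U r w k\<bar> \<le> C k" using C(2)[OF k] r by blast
     also have "\<dots> \<le> (\<Sum>k<n. C k)" by (rule member_le_sum) (use k C(1) in auto)
     finally show ?thesis using K0 \<open>K0 \<le> K\<close> by linarith
    qed
    then have "w \<in> stay (real K) t" using elim(2) t by (auto simp: stay_def)
    then show ?thesis by (simp add: val_def)
   qed
   then have "\<forall>\<^sub>F K in sequentially. ennreal (val (real K) t w) = ennreal (qu N h (th t) (U t w))"
    unfolding eventually_sequentially by (intro exI[of _ K0]) simp
   then have "(\<lambda>K. ennreal (val (real K) t w)) \<longlonglongrightarrow> ennreal (qu N h (th t) (U t w))" by (rule tendsto_eventually)
   then show ?case by (simp add: lim_imp_Liminf)
  qed
 qed
 also have "\<dots> \<le> liminf (\<lambda>K. \<integral>\<^sup>+w. ennreal (val (real K) t w) \<partial>P)"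
  by (rule nn_integral_liminf) (intro measurable_compose[OF val_m[OF t0(2)]] measurable_ennreal)
 also have "\<dots> \<le> (\<integral>\<^sup>+w. ennreal (qu N h (th 0) (U 0 w)) \<partial>P)"
 proof -
  have "liminf (\<lambda>K. \<integral>\<^sup>+w. ennreal (val (real K) t w) \<partial>P) \<le> liminf (\<lambda>K::nat. \<integral>\<^sup>+w. ennreal (qu N h (th 0) (U 0 w)) \<partial>P)"
   by (intro Liminf_mono always_eventually allI le)
  then show ?thesis by (simp add: Liminf_const)
 qed
 finally show ?thesis .
qed

end

section \<open>Fourier smoothing\<close>

text \<open>A regularised Fourier inversion: frequencies are drawn from a normal law of variance
  \<open>1 / ep\<close>, so all integrals are over a probability measure, and the regularisation
  merely adds ep to the variance.\<close>

lemma fourier_hg_0: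
 assumes ep: "0 < ep" and w': "0 \<le> w'"
 shows "integrable (normal_law 0 (1 / ep)) (\<lambda>xi. iexp (xi * y) * complex_of_real (exp (- (w' * xi\<^sup>2 / 2))))"
  and "(CLINT xi|normal_law 0 (1 / ep). iexp (xi * y) * complex_of_real (exp (- (w' * xi\<^sup>2 / 2)))) = complex_of_real (sqrt (2 * pi * ep) * hg 0 (w' + ep) y)"
proof -
 interpret G: prob_space "normal_law 0 (1 / ep)" using ep by (intro prob_space_normal_law) simp
 show "integrable (normal_law 0 (1 / ep)) (\<lambda>xi. iexp (xi * y) * complex_of_real (exp (- (w' * xi\<^sup>2 / 2))))"
 proof (rule G.integrable_const_bound[of _ 1])
  show "AE xi in normal_law 0 (1 / ep). norm (iexp (xi * y) * complex_of_real (exp (- (w' * xi\<^sup>2 / 2)))) \<le> 1" using w' by (intro AE_I2) (simp add: norm_mult)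
  have "(\<lambda>xi. iexp (xi * y) * complex_of_real (exp (- (w' * xi\<^sup>2 / 2)))) \<in> borel_measurable borel" by measurable
  then show "(\<lambda>xi. iexp (xi * y) * complex_of_real (exp (- (w' * xi\<^sup>2 / 2)))) \<in> borel_measurable (normal_law 0 (1 / ep))"
   by (simp cong: measurable_cong_sets)
 qed
 define r where "r = sqrt (ep / (w' + ep))"
 \<comment> \<open>The weights multiply to a multiple of the normal density whose precision is the
   sum \<open>w' + ep\<close>.\<close>
 have pw: "normal_density 0 (sqrt (1 / ep)) xi * exp (- (w' * xi\<^sup>2 / 2)) = r * normal_density 0 (sqrt (1 / (w' + ep))) xi" for xi
 proof -
  have nd: "normal_density 0 (sqrt (1 / q)) xi = 1 / sqrt (2 * pi / q) * exp (- (xi\<^sup>2 * q / 2))" if "0 < q" for q using that by (simp add: normal_density_def)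
  have "normal_density 0 (sqrt (1 / ep)) xi * exp (- (w' * xi\<^sup>2 / 2)) = 1 / sqrt (2 * pi / ep) * (exp (- (xi\<^sup>2 * ep / 2)) * exp (- (w' * xi\<^sup>2 / 2)))"
   unfolding nd[OF ep] by simp
  also have "exp (- (xi\<^sup>2 * ep / 2)) * exp (- (w' * xi\<^sup>2 / 2)) = exp (- (xi\<^sup>2 * (w' + ep) / 2))" by (simp add: exp_add[symmetric] field_simps)
  also have "1 / sqrt (2 * pi / ep) = r * (1 / sqrt (2 * pi / (w' + ep)))" using ep w' by (simp add: r_def real_sqrt_divide)
  finally show ?thesis using ep w' nd[of "w' + ep"] by simp
 qed
 have "(CLINT xi|normal_law 0 (1 / ep). iexp (xi * y) * complex_of_real (exp (- (w' * xi\<^sup>2 / 2)))) =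
  (CLINT xi|lborel. normal_density 0 (sqrt (1 / ep)) xi *\<^sub>R (iexp (xi * y) * complex_of_real (exp (- (w' * xi\<^sup>2 / 2)))))"
  using ep unfolding normal_law_def by (simp, subst integral_density) auto
 also have "\<dots> = (CLINT xi|lborel. r *\<^sub>R (normal_density 0 (sqrt (1 / (w' + ep))) xi *\<^sub>R iexp (xi * y)))"
 proof (intro Bochner_Integration.integral_cong refl)
  fix xi
  have "normal_density 0 (sqrt (1 / ep)) xi *\<^sub>R (iexp (xi * y) * complex_of_real (exp (- (w' * xi\<^sup>2 / 2)))) =
   (normal_density 0 (sqrt (1 / ep)) xi * exp (- (w' * xi\<^sup>2 / 2))) *\<^sub>R iexp (xi * y)" by (simp add: scaleR_conv_of_real)
  then show "normal_density 0 (sqrt (1 / ep)) xi *\<^sub>R (iexp (xi * y) * complex_of_real (exp (- (w' * xi\<^sup>2 / 2)))) =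
   r *\<^sub>R (normal_density 0 (sqrt (1 / (w' + ep))) xi *\<^sub>R iexp (xi * y))" unfolding pw by simp
 qed
 also have "\<dots> = r *\<^sub>R char (normal_law 0 (1 / (w' + ep))) y"
 proof -
  have "char (normal_law 0 (1 / (w' + ep))) y = (CLINT xi|lborel. normal_density 0 (sqrt (1 / (w' + ep))) xi *\<^sub>R iexp (xi * y))"
   using ep w' unfolding char_def normal_law_def by (simp, subst integral_density) (auto simp: mult.commute)
  then show ?thesis by (simp only: integral_scaleR_right)
 qed
 also have "\<dots> = complex_of_real (r * exp (- (y\<^sup>2 / (w' + ep) / 2)))" using ep w' by (subst char_normal_law) (auto simp: scaleR_conv_of_real)
 also have "r * exp (- (y\<^sup>2 / (w' + ep) / 2)) = sqrt (2 * pi * ep) * hg 0 (w' + ep) y"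
 proof -
  have r: "sqrt (2 * pi * ep) / sqrt (2 * pi * (w' + ep)) = r" unfolding r_def real_sqrt_divide[symmetric] by simp
  have h: "hg 0 (w' + ep) y = exp (- (y\<^sup>2 / (w' + ep) / 2)) / sqrt (2 * pi * (w' + ep))" unfolding hg.simps divide_divide_eq_left mult.commute[of 2 "w' + ep"] ..
  have "p / q * E = p * (E / q)" for p q E :: real by simp
  then show ?thesis unfolding h r[symmetric] .
 qed
 finally show "(CLINT xi|normal_law 0 (1 / ep). iexp (xi * y) * complex_of_real (exp (- (w' * xi\<^sup>2 / 2)))) = complex_of_real (sqrt (2 * pi * ep) * hg 0 (w' + ep) y)" .
qed

lemma prod_iexp: "(\<Prod>k<n::nat. iexp (a k) * complex_of_real (b k)) = iexp (\<Sum>k<n. a k) * complex_of_real (\<Prod>k<n. b k)"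
proof -
 have "iexp (\<Sum>k<n. a k) = (\<Prod>k<n. iexp (a k))" by (simp only: of_real_sum sum_distrib_left exp_sum finite_lessThan)
 then show ?thesis by (simp only: prod.distrib of_real_prod)
qed

section \<open>Gaussian mixtures are determined by characteristic functions\<close>

context mixture
begin

text \<open>The default variance 0 makes the factor at every index a probability measure, as
  infinite index families of measures require, while \<open>lam k\<close> is known to be positive
  for \<open>k < n\<close> only.\<close>

definition frequencies :: "real => (nat => real) measure" where
 "frequencies ep = (\<Pi>\<^sub>M k\<in>{..<n}. normal_law 0 (if k < n then 1 / (ep * lam k) else 0))"

lemma product_normal_law: "0 < ep ==> product_prob_space (\<lambda>k. normal_law 0 (if k < n then 1 / (ep * lam k) else 0))"
 using lam_pos by (intro product_prob_spaceI prob_space_normal_law) (simp add: less_imp_le)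

lemma prob_space_frequencies: "0 < ep ==> prob_space (frequencies ep)"
 unfolding frequencies_def using lam_pos by (intro prob_space_PiM prob_space_normal_law) (simp add: less_imp_le)

lemma frequencies_component: "k < n ==> (\<lambda>xi. xi k) \<in> borel_measurable (frequencies ep)"
 using measurable_component_singleton[of k "{..<n}" "\<lambda>k. normal_law 0 (if k < n then 1 / (ep * lam k) else 0)"]
 unfolding frequencies_def measurable_cong_sets[OF refl sets_normal_law] by simp

lemma fourier_pk:
 assumes ep: "0 < ep" and v: "0 \<le> v"
 shows "(CLINT xi|frequencies ep. iexp (\<Sum>k<n. xi k * y k) * complex_of_real (exp (- (v * (\<Sum>k<n. lam k * (xi k)\<^sup>2) / 2)))) =
  complex_of_real ((\<Prod>k<n. sqrt (2 * pi * (ep * lam k))) * pk n lam z0 (v + ep) y)"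
proof -
 interpret product_prob_space "\<lambda>k. normal_law 0 (if k < n then 1 / (ep * lam k) else 0)" by (rule product_normal_law[OF ep])
 have "(CLINT xi|frequencies ep. iexp (\<Sum>k<n. xi k * y k) * complex_of_real (exp (- (v * (\<Sum>k<n. lam k * (xi k)\<^sup>2) / 2)))) =
  (CLINT xi|frequencies ep. \<Prod>k<n. iexp (xi k * y k) * complex_of_real (exp (- (v * lam k * (xi k)\<^sup>2 / 2))))"
  unfolding prod_iexp by (simp add: exp_sum[symmetric] sum_negf sum_distrib_left sum_divide_distrib mult.assoc)
 also have "\<dots> = (\<Prod>k<n. CLINT xi|normal_law 0 (if k < n then 1 / (ep * lam k) else 0). iexp (xi * y k) * complex_of_real (exp (- (v * lam k * xi\<^sup>2 / 2))))"
  unfolding frequencies_def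
 proof (rule product_integral_prod)
  fix k assume "k \<in> {..<n}"
  then have "k < n" "0 < ep * lam k" "0 \<le> v * lam k" using lam_pos ep mult_nonneg_nonneg[OF v less_imp_le[OF lam_pos[of k]]] by auto
  then show "integrable (normal_law 0 (if k < n then 1 / (ep * lam k) else 0)) (\<lambda>xi. iexp (xi * y k) * complex_of_real (exp (- (v * lam k * xi\<^sup>2 / 2))))"
   using fourier_hg_0(1) by simp
 qed simp
 also have "\<dots> = (\<Prod>k<n. complex_of_real (sqrt (2 * pi * (ep * lam k)) * hg 0 ((v + ep) * lam k) (y k)))"
 proof (intro prod.cong refl)
  fix k assume "k \<in> {..<n}"
  then have k: "k < n" "0 < ep * lam k" "0 \<le> v * lam k" using lam_pos ep mult_nonneg_nonneg[OF v less_imp_le[OF lam_pos[of k]]] by auto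
  show "(CLINT xi|normal_law 0 (if k < n then 1 / (ep * lam k) else 0). iexp (xi * y k) * complex_of_real (exp (- (v * lam k * xi\<^sup>2 / 2)))) =
   complex_of_real (sqrt (2 * pi * (ep * lam k)) * hg 0 ((v + ep) * lam k) (y k))" using fourier_hg_0(2)[OF k(2,3), of "y k"] k(1) by (simp only: if_True distrib_right)
 qed
 also have "\<dots> = complex_of_real ((\<Prod>k<n. sqrt (2 * pi * (ep * lam k))) * pk n lam z0 (v + ep) y)" unfolding of_real_prod[symmetric] pk_def prod.distrib ..
 finally show ?thesis .
qed

lemma fourier_mix:
 assumes ep: "0 < ep" and v: "0 \<le> v"
 shows "(CLINT xi|frequencies ep. (CLINT w|M. iexp (\<Sum>k<n. xi k * X w k)) * iexp (- (\<Sum>k<n. xi k * c k)) * complex_of_real (exp (- (v * (\<Sum>k<n. lam k * (xi k)\<^sup>2) / 2)))) =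
  complex_of_real ((\<Prod>k<n. sqrt (2 * pi * (ep * lam k))) * mx z0 (v + ep) c)"
proof -
 interpret G: prob_space "frequencies ep" by (rule prob_space_frequencies[OF ep])
 interpret P: pair_prob_space "frequencies ep" M ..
 note [measurable] = frequencies_component X_measurable
 let ?f = "\<lambda>xi w. iexp (\<Sum>k<n. xi k * (X w k - c k)) * complex_of_real (exp (- (v * (\<Sum>k<n. lam k * (xi k)\<^sup>2) / 2)))"
 have "(CLINT xi|frequencies ep. (CLINT w|M. iexp (\<Sum>k<n. xi k * X w k)) * iexp (- (\<Sum>k<n. xi k * c k)) * complex_of_real (exp (- (v * (\<Sum>k<n. lam k * (xi k)\<^sup>2) / 2)))) =
  (CLINT xi|frequencies ep. CLINT w|M. ?f xi w)"
 proof (intro Bochner_Integration.integral_cong refl)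
  fix xi
  have "?f xi w = iexp (\<Sum>k<n. xi k * X w k) * (iexp (- (\<Sum>k<n. xi k * c k)) * complex_of_real (exp (- (v * (\<Sum>k<n. lam k * (xi k)\<^sup>2) / 2))))" for w
   unfolding mult.assoc[symmetric] exp_add[symmetric] by (simp add: right_diff_distrib sum_subtractf)
  then show "(CLINT w|M. iexp (\<Sum>k<n. xi k * X w k)) * iexp (- (\<Sum>k<n. xi k * c k)) * complex_of_real (exp (- (v * (\<Sum>k<n. lam k * (xi k)\<^sup>2) / 2))) = (CLINT w|M. ?f xi w)"
   by (simp add: mult.assoc)
 qed
 also have "\<dots> = (CLINT w|M. CLINT xi|frequencies ep. ?f xi w)"
 proof (rule P.Fubini_integral[symmetric], rule P.P.integrable_const_bound[of _ 1])
  have "0 \<le> v * (\<Sum>k<n. lam k * (xi k)\<^sup>2)" for xi using v lam_pos by (intro mult_nonneg_nonneg sum_nonneg) (auto intro: less_imp_le)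
  then show "AE z in frequencies ep \<Otimes>\<^sub>M M. norm (case_prod ?f z) \<le> 1" by (intro AE_I2) (auto simp: norm_mult split: prod.split)
  show "case_prod ?f \<in> borel_measurable (frequencies ep \<Otimes>\<^sub>M M)" by measurable
 qed
 also have "\<dots> = (CLINT w|M. complex_of_real ((\<Prod>k<n. sqrt (2 * pi * (ep * lam k))) * pk n lam z0 (v + ep) (\<lambda>k. c k - X w k)))"
 proof (intro Bochner_Integration.integral_cong refl)
  fix w
  have "pk n lam z0 (v + ep) (\<lambda>k. X w k - c k) = pk n lam z0 (v + ep) (\<lambda>k. c k - X w k)"
   using pk_uminus_0[of n lam "v + ep" "\<lambda>k. c k - X w k"] by simp
  then show "(CLINT xi|frequencies ep. ?f xi w) = complex_of_real ((\<Prod>k<n. sqrt (2 * pi * (ep * lam k))) * pk n lam z0 (v + ep) (\<lambda>k. c k - X w k))"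
   by (simp only: fourier_pk[OF ep v])
 qed
 also have "\<dots> = complex_of_real ((\<Prod>k<n. sqrt (2 * pi * (ep * lam k))) * mx z0 (v + ep) c)" unfolding mix_def by (simp add: integral_complex_of_real)
 finally show ?thesis .
qed

text \<open>By \<open>fourier_mix\<close> a mixture depends on its random vector only through the
  characteristic function. A Gaussian factor with parameter v has the effect of adding v to the
  variance, so the formula is used with variance 0 for \<open>Z\<close> and v for
  \<open>X\<close>.\<close>

lemma mix_eq_if_char:
 assumes Z: "\<And>k. k < n ==> (\<lambda>w. Z w k) \<in> borel_measurable M" and ep: "0 < ep" and v: "0 \<le> v"
  and char: "\<And>xi. (CLINT w|M. iexp (\<Sum>k<n. xi k * Z w k)) =
   (CLINT w|M. iexp (\<Sum>k<n. xi k * X w k)) * complex_of_real (exp (- (v * (\<Sum>k<n. lam k * (xi k)\<^sup>2) / 2)))"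
 shows "mix M Z n lam z0 ep c = mx z0 (v + ep) c"
proof -
 interpret Z: mixture M Z n lam by unfold_locales (use Z lam_pos in auto)
 have "complex_of_real ((\<Prod>k<n. sqrt (2 * pi * (ep * lam k))) * mix M Z n lam z0 ep c) =
  complex_of_real ((\<Prod>k<n. sqrt (2 * pi * (ep * lam k))) * mx z0 (v + ep) c)"
 proof -
  have key: "(A * B) * E * complex_of_real (exp (- (0 * q / 2))) = A * E * B" for A B E :: complex and q :: real by simp
  show ?thesis using Z.fourier_mix[OF ep order_refl, of c] fourier_mix[OF ep v, of c] by (simp only: char key add_0)
 qed
 moreover have "(\<Prod>k<n. sqrt (2 * pi * (ep * lam k))) \<noteq> 0" using ep lam_pos by (fastforce simp: prod_zero_iff)
 ultimately show ?thesis unfolding of_real_eq_iff by simp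
qed

end

section \<open>Identification of laws\<close>

text \<open>Taking complements reverses the inequality on closed sets, and an open set is an
  increasing union of closed ones. Hence both inequalities hold on open sets, which generate the
  Borel sets.\<close>

lemma prob_eq_if_open_le:
 fixes \<mu> \<nu> :: "'a::metric_space measure"
 assumes \<mu>: "prob_space \<mu>" "sets \<mu> = sets borel" and \<nu>: "prob_space \<nu>" "sets \<nu> = sets borel"
  and le: "\<And>S. open S ==> measure \<mu> S \<le> measure \<nu> S"
 shows "\<mu> = \<nu>"
proof -
 interpret \<mu>: prob_space \<mu> by fact
 interpret \<nu>: prob_space \<nu> by fact
 have sp: "space \<mu> = UNIV" "space \<nu> = UNIV" using \<mu>(2) \<nu>(2) sets_eq_imp_space_eq by (metis space_borel)+
 have ge: "measure \<nu> S \<le> measure \<mu> S" if S: "open S" for S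
 \<comment> \<open>The distance to the empty set is 0 by convention, so the exhaustion by distance
   to the complement fails for the whole space.\<close>
 proof (cases "S = UNIV")
  case True
  then show ?thesis using \<mu>.prob_space \<nu>.prob_space sp by simp
 next
  case False
  define C where "C m = {x. inverse (real (Suc m)) \<le> infdist x (- S)}" for m
  have C: "closed (C m)" for m unfolding C_def by (intro closed_Collect_le continuous_intros)
  have inc: "incseq C"
  proof (rule incseq_SucI)
   fix m have "inverse (real (Suc (Suc m))) \<le> inverse (real (Suc m))" by (intro le_imp_inverse_le) auto
   then show "C m \<subseteq> C (Suc m)" unfolding C_def using order_trans by blast
  qed
  have un: "(\<Union>m. C m) = S"
  proof (intro set_eqI iffI)
   fix x assume "x \<in> (\<Union>m. C m)"
   then obtain m where m: "inverse (real (Suc m)) \<le> infdist x (- S)" by (auto simp: C_def)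
   have "0 < inverse (real (Suc m))" by simp
   then have "infdist x (- S) \<noteq> 0" using m by linarith
   then show "x \<in> S" by (metis ComplI infdist_zero)
  next
   fix x assume x: "x \<in> S"
   have "infdist x (- S) \<noteq> 0" using x S False in_closed_iff_infdist_zero[of "- S" x] by auto
   then have "0 < infdist x (- S)" using infdist_nonneg[of x "- S"] by linarith
   then obtain m where "inverse (real (Suc m)) < infdist x (- S)" using reals_Archimedean by blast
   then show "x \<in> (\<Union>m. C m)" by (auto simp: C_def intro!: less_imp_le)
  qed
  have m: "range C \<subseteq> sets borel" using C by auto
  have "measure \<nu> (C m) \<le> measure \<mu> (C m)" for m
  proof -
   have "measure \<mu> (- C m) \<le> measure \<nu> (- C m)" using C by (intro le) auto
   moreover have "measure \<mu> (- C m) = 1 - measure \<mu> (C m)" "measure \<nu> (- C m) = 1 - measure \<nu> (C m)"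
    using \<mu>.prob_compl[of "C m"] \<nu>.prob_compl[of "C m"] m \<mu>(2) \<nu>(2) sp by (auto simp: Compl_eq_Diff_UNIV)
   ultimately show ?thesis by simp
  qed
  moreover have "(\<lambda>m. measure \<mu> (C m)) \<longlonglongrightarrow> measure \<mu> S" "(\<lambda>m. measure \<nu> (C m)) \<longlonglongrightarrow> measure \<nu> S"
   using \<mu>.finite_Lim_measure_incseq[of C] \<nu>.finite_Lim_measure_incseq[of C] m inc \<mu>(2) \<nu>(2) un by auto
  ultimately show ?thesis by (intro LIMSEQ_le) auto
 qed
 show ?thesis
 proof (rule measure_eqI_generator_eq[where E="{S. open S}" and \<Omega>=UNIV and A="\<lambda>_. UNIV"])
  show "Int_stable {S :: 'a set. open S}" by (auto simp: Int_stable_def)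
  show "emeasure \<mu> S = emeasure \<nu> S" if "S \<in> {S. open S}" for S using le[of S] ge[of S] that by (simp add: \<mu>.emeasure_eq_measure \<nu>.emeasure_eq_measure)
  show "sets \<mu> = sigma_sets UNIV {S. open S}" "sets \<nu> = sigma_sets UNIV {S. open S}" using \<mu>(2) \<nu>(2) by (simp_all add: borel_def)
 qed auto
qed

text \<open>In units of the standard deviation the fixed window grows to the whole line.\<close>

lemma hg_0_mass_tendsto:
 fixes ep :: "nat => real"
 assumes ep: "\<And>j. 0 < ep j" "ep \<longlonglongrightarrow> 0" and l: "0 < l" and de: "0 < de"
 shows "(\<lambda>j. \<integral>\<^sup>+x. indicator {z - de<..<z + de} x * ennreal (hg 0 (ep j * l) (x - z)) \<partial>lborel) \<longlonglongrightarrow> 1"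
proof -
 define s where "s j = sqrt (ep j * l)" for j
 have s: "0 < s j" for j using ep l by (simp add: s_def)
 have s0: "s \<longlonglongrightarrow> 0" unfolding s_def using tendsto_mult_left_zero[OF ep(2), of l] tendsto_real_sqrt by fastforce
 have eq: "(\<integral>\<^sup>+x. indicator {z - de<..<z + de} x * ennreal (hg 0 (ep j * l) (x - z)) \<partial>lborel) =
  (\<integral>\<^sup>+x. indicator {- de<..<de} (s j * x) * ennreal (std_normal_density x) \<partial>lborel)" for j
 proof -
  have [measurable]: "hg 0 (ep j * l) \<in> borel_measurable borel" by (rule borel_measurable_hg) (use ep l in simp)
  have d: "s j * hg 0 (ep j * l) (s j * x) = std_normal_density x" for x
  proof -
   have "s j * s j = ep j * l" using ep l by (simp add: s_def less_imp_le)
   then have "(s j * x)\<^sup>2 / (2 * (ep j * l)) = x\<^sup>2 / 2" using ep(1)[of j] l by (simp add: power2_eq_square field_simps)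
   moreover have "sqrt (2 * pi * (ep j * l)) = sqrt (2 * pi) * s j" by (simp add: s_def real_sqrt_mult)
   ultimately show ?thesis using s[of j] by (simp add: std_normal_density_def)
  qed
  have "(\<integral>\<^sup>+x. indicator {z - de<..<z + de} x * ennreal (hg 0 (ep j * l) (x - z)) \<partial>lborel) =
   ennreal \<bar>s j\<bar> * (\<integral>\<^sup>+x. indicator {z - de<..<z + de} (z + s j * x) * ennreal (hg 0 (ep j * l) (z + s j * x - z)) \<partial>lborel)"
   using s[of j] by (intro nn_integral_real_affine) auto
  also have "\<dots> = (\<integral>\<^sup>+x. ennreal \<bar>s j\<bar> * (indicator {z - de<..<z + de} (z + s j * x) * ennreal (hg 0 (ep j * l) (z + s j * x - z))) \<partial>lborel)"
   by (rule nn_integral_cmult[symmetric]) measurable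
  also have "\<dots> = (\<integral>\<^sup>+x. indicator {- de<..<de} (s j * x) * ennreal (std_normal_density x) \<partial>lborel)"
  proof (intro nn_integral_cong)
   fix x
   have "ennreal \<bar>s j\<bar> * ennreal (hg 0 (ep j * l) (s j * x)) = ennreal (std_normal_density x)"
    using s[of j] by (simp add: ennreal_mult'[symmetric] d del: hg.simps)
   then show "ennreal \<bar>s j\<bar> * (indicator {z - de<..<z + de} (z + s j * x) * ennreal (hg 0 (ep j * l) (z + s j * x - z))) =
    indicator {- de<..<de} (s j * x) * ennreal (std_normal_density x)" by (auto simp: indicator_def simp del: hg.simps)
  qed
  finally show ?thesis .
 qed
 have "(\<lambda>j. \<integral>\<^sup>+x. indicator {- de<..<de} (s j * x) * ennreal (std_normal_density x) \<partial>lborel) \<longlonglongrightarrow> (\<integral>\<^sup>+x. ennreal (std_normal_density x) \<partial>lborel)"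
 proof (rule nn_integral_dominated_convergence[where w="\<lambda>x. ennreal (std_normal_density x)"])
  show "(\<integral>\<^sup>+x. ennreal (std_normal_density x) \<partial>lborel) < \<infinity>"
   using nn_integral_lborel_hg_0[of 1 0] by (simp add: hg_0_eq_normal_density del: hg.simps)
  show "AE x in lborel. (\<lambda>j. indicator {- de<..<de} (s j * x) * ennreal (std_normal_density x)) \<longlonglongrightarrow> ennreal (std_normal_density x)"
  proof (rule AE_I2, rule tendsto_eventually)
   fix x
   have "(\<lambda>j. s j * x) \<longlonglongrightarrow> 0" by (rule tendsto_mult_left_zero[OF s0])
   then have "\<forall>\<^sub>F j in sequentially. dist (s j * x) 0 < de" using de by (rule tendstoD)
   then show "\<forall>\<^sub>F j in sequentially. indicator {- de<..<de} (s j * x) * ennreal (std_normal_density x) = ennreal (std_normal_density x)"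
    by eventually_elim (auto simp: indicator_def dist_real_def)
  qed
 qed (auto simp: indicator_def)
 moreover have "(\<integral>\<^sup>+x. ennreal (std_normal_density x) \<partial>lborel) = 1"
  using nn_integral_lborel_hg_0[of 1 0] by (simp add: hg_0_eq_normal_density del: hg.simps)
 ultimately show ?thesis unfolding eq by simp
qed

section \<open>Recovering densities from Gaussian smoothing\<close>

lemma sigma_finite_lborel_Rn: "sigma_finite_measure (lborel_Rn n)" unfolding lborel_Rn_def
 by (intro product_sigma_finite.sigma_finite) (auto intro: product_sigma_finite.intro sigma_finite_lborel)

lemma component_lborel_Rn: "k < n ==> (\<lambda>y. y k) \<in> borel_measurable (lborel_Rn n)" unfolding lborel_Rn_def by measurable

text \<open>The last hypothesis is lower semicontinuity at z in the coordinates below n. It suffices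
  for a lower bound: near z the function is almost \<open>w' z\<close>, and the kernel puts
  asymptotically all its mass there.\<close>

lemma pk_concentration:
 fixes w' :: "(nat => real) => real" and ep :: "nat => real"
 assumes lam: "\<And>k. k < n ==> 0 < lam k" and ep: "\<And>j. 0 < ep j" "ep \<longlonglongrightarrow> 0"
  and w': "\<And>c. 0 \<le> w' c" "w' \<in> borel_measurable (lborel_Rn n)"
  and lower: "\<And>et. 0 < et ==> \<exists>de>0. \<forall>c. (\<forall>k<n. \<bar>c k - z k\<bar> < de) --> w' z - et \<le> w' c"
 shows "ennreal (w' z) \<le> liminf (\<lambda>j. \<integral>\<^sup>+c. ennreal (w' c) * ennreal (pk n lam z0 (ep j) (\<lambda>k. c k - z k)) \<partial>lborel_Rn n)"
  (is "_ \<le> liminf ?L")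
proof -
 interpret PS: product_sigma_finite "\<lambda>_. lborel :: real measure" ..
 have main: "ennreal (w' z - et) \<le> liminf ?L" if et: "0 < et" for et
 proof (cases "0 \<le> w' z - et")
  case False then show ?thesis by (simp add: ennreal_neg)
 next
  case True
  obtain de where de: "0 < de" "\<And>c. \<forall>k<n. \<bar>c k - z k\<bar> < de ==> w' z - et \<le> w' c" using lower[OF et] by blast
  define I where "I k j = (\<integral>\<^sup>+x. indicator {z k - de<..<z k + de} x * ennreal (hg 0 (ep j * lam k) (x - z k)) \<partial>lborel)" for k j
  have pos: "0 < ep j * lam k" if "k < n" for j k using ep(1) lam[OF that] by simp
  have I_le: "I k j \<le> 1" if "k < n" for k j
  proof -
   have "I k j \<le> (\<integral>\<^sup>+x. ennreal (hg 0 (ep j * lam k) (x - z k)) \<partial>lborel)" unfolding I_def by (intro nn_integral_mono) (auto simp: indicator_def)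
   then show ?thesis using nn_integral_lborel_hg_0[OF pos[OF that]] by simp
  qed
  \<comment> \<open>The limit of a product is taken in the reals, so the one-dimensional masses,
    which are at most 1, are converted first.\<close>
  then have I_real: "I k j = ennreal (enn2real (I k j))" if "k < n" for k j using that by (metis ennreal_enn2real ennreal_one_less_top order_le_less_trans)
  have r1: "(\<lambda>j. enn2real (I k j)) \<longlonglongrightarrow> 1" if "k < n" for k
  proof -
   have "(\<lambda>j. I k j) \<longlonglongrightarrow> ennreal 1" unfolding I_def using hg_0_mass_tendsto[OF ep lam[OF that] de(1)] by simp
   then show ?thesis by (rule tendsto_enn2real) simp
  qed
  have "(\<lambda>j. (w' z - et) * (\<Prod>k<n. enn2real (I k j))) \<longlonglongrightarrow> (w' z - et) * (\<Prod>k<n. 1)"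
   by (intro tendsto_mult tendsto_const tendsto_prod) (rule r1, simp)
  then have lim: "(\<lambda>j. ennreal ((w' z - et) * (\<Prod>k<n. enn2real (I k j)))) \<longlonglongrightarrow> ennreal (w' z - et)" by (intro tendsto_ennrealI) simp
  have le: "ennreal ((w' z - et) * (\<Prod>k<n. enn2real (I k j))) \<le> ?L j" for j
  proof -
   have m: "(\<lambda>x. indicator {z k - de<..<z k + de} x * ennreal (hg 0 (ep j * lam k) (x - z k))) \<in> borel_measurable lborel" if "k < n" for k
   proof -
    note [measurable] = borel_measurable_hg[OF pos[OF that]]
    show ?thesis by measurable
   qed
   have "ennreal ((w' z - et) * (\<Prod>k<n. enn2real (I k j))) = ennreal (w' z - et) * (\<Prod>k<n. ennreal (enn2real (I k j)))"
    using True by (subst prod_ennreal) (auto simp: ennreal_mult' )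
   also have "(\<Prod>k<n. ennreal (enn2real (I k j))) = (\<Prod>k<n. I k j)" using I_real by (intro prod.cong refl) auto
   also have "\<dots> = (\<integral>\<^sup>+c. (\<Prod>k<n. indicator {z k - de<..<z k + de} (c k) * ennreal (hg 0 (ep j * lam k) (c k - z k))) \<partial>lborel_Rn n)"
    unfolding I_def lborel_Rn_def by (rule PS.product_nn_integral_prod[symmetric]) (use m in auto)
   also have "ennreal (w' z - et) * \<dots> = (\<integral>\<^sup>+c. ennreal (w' z - et) * (\<Prod>k<n. indicator {z k - de<..<z k + de} (c k) * ennreal (hg 0 (ep j * lam k) (c k - z k))) \<partial>lborel_Rn n)"
    using m component_lborel_Rn by (intro nn_integral_cmult[symmetric] borel_measurable_prod_ennreal) (auto intro!: measurable_compose[OF component_lborel_Rn] simp del: hg.simps)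
   also have "\<dots> \<le> ?L j"
   proof (rule nn_integral_mono)
    fix c
    show "ennreal (w' z - et) * (\<Prod>k<n. indicator {z k - de<..<z k + de} (c k) * ennreal (hg 0 (ep j * lam k) (c k - z k))) \<le>
     ennreal (w' c) * ennreal (pk n lam z0 (ep j) (\<lambda>k. c k - z k))"
    proof (cases "\<forall>k<n. \<bar>c k - z k\<bar> < de")
     case True
     have "c k \<in> {z k - de<..<z k + de}" if "k < n" for k using True[rule_format, OF that] by (auto simp: abs_less_iff)
     then have "(\<Prod>k<n. indicator {z k - de<..<z k + de} (c k) * ennreal (hg 0 (ep j * lam k) (c k - z k))) = (\<Prod>k<n. ennreal (hg 0 (ep j * lam k) (c k - z k)))"
      by (intro prod.cong refl) (simp del: hg.simps greaterThanLessThan_iff)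
     also have "\<dots> = ennreal (pk n lam z0 (ep j) (\<lambda>k. c k - z k))"
      unfolding pk_def using pos by (subst prod_ennreal) (auto intro!: less_imp_le[OF hg_0_pos] simp del: hg.simps)
     finally show ?thesis using de(2)[OF True] by (simp add: mult_right_mono ennreal_leI)
    next
     case False
     then obtain k where "k < n" "\<not> \<bar>c k - z k\<bar> < de" by blast
     then have "(\<Prod>k<n. indicator {z k - de<..<z k + de} (c k) * ennreal (hg 0 (ep j * lam k) (c k - z k))) = 0"
      by (intro prod_zero bexI[of _ k]) (auto simp: indicator_def abs_less_iff simp del: hg.simps)
     then show ?thesis by (simp only: mult_zero_right zero_le)
    qed
   qed
   finally show ?thesis .
  qed
  have "ennreal (w' z - et) = liminf (\<lambda>j. ennreal ((w' z - et) * (\<Prod>k<n. enn2real (I k j))))" using lim by (simp add: lim_imp_Liminf)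
  also have "\<dots> \<le> liminf ?L" by (intro Liminf_mono always_eventually allI le)
  finally show ?thesis .
 qed
 show ?thesis
 proof (rule ennreal_le_epsilon)
  fix et :: real assume et: "0 < et"
  have "ennreal (w' z) \<le> ennreal (w' z - et) + ennreal et"
  proof (cases "0 \<le> w' z - et")
   case True then show ?thesis using et by (simp add: ennreal_plus[symmetric] del: ennreal_plus)
  next
   case False then show ?thesis by (simp add: ennreal_neg ennreal_leI)
  qed
  also have "\<dots> \<le> liminf ?L + ennreal et" using main[OF et] by (rule add_right_mono)
  finally show "ennreal (w' z) \<le> liminf ?L + ennreal et" .
 qed
qed

text \<open>Fatou's lemma and an exchange of integrals isolate, for each centre c, an inner integral
  against a narrow kernel. The weight g is 1 for the forward law and the reciprocal of the density
  for the reverse law.\<close>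

lemma (in prob_space) smoothing_lower_bound:
 fixes w' :: "(nat => real) => real" and ep :: "nat => real" and U :: "'a => nat => real"
 assumes lam: "\<And>k. k < n ==> 0 < lam k" and ep: "\<And>j. 0 < ep j" "ep \<longlonglongrightarrow> 0"
  and w': "\<And>c. 0 \<le> w' c" "w' \<in> borel_measurable (lborel_Rn n)"
  and lower: "\<And>z et. 0 < et ==> \<exists>de>0. \<forall>c. (\<forall>k<n. \<bar>c k - z k\<bar> < de) --> w' z - et \<le> w' c"
  and U [measurable]: "\<And>k. k < n ==> (\<lambda>w. U w k) \<in> borel_measurable M"
  and g: "\<And>w. 0 \<le> g w" and [measurable]: "g \<in> borel_measurable M"
 shows "(\<integral>\<^sup>+w. ennreal (g w * w' (U w)) \<partial>M) \<le>
  liminf (\<lambda>j. \<integral>\<^sup>+c. ennreal (w' c) * (\<integral>\<^sup>+w. ennreal (g w * pk n lam z0 (ep j) (\<lambda>k. c k - U w k)) \<partial>M) \<partial>lborel_Rn n)"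
proof -
 interpret L: sigma_finite_measure "lborel_Rn n" by (rule sigma_finite_lborel_Rn)
 interpret LP: pair_sigma_finite M "lborel_Rn n" ..
 note [measurable] = w'(2)
 have pk1: "(\<lambda>z. pk n lam z0 (ep j) (\<lambda>k. snd z k - U (fst z) k)) \<in> borel_measurable (M \<Otimes>\<^sub>M lborel_Rn n)" for j
  by (intro borel_measurable_pk ep lam borel_measurable_diff)
   (auto intro!: measurable_compose[OF measurable_snd component_lborel_Rn] measurable_compose[OF measurable_fst U])
 have joint: "(\<lambda>z. ennreal (g (fst z) * w' (snd z)) * ennreal (pk n lam z0 (ep j) (\<lambda>k. snd z k - U (fst z) k))) \<in> borel_measurable (M \<Otimes>\<^sub>M lborel_Rn n)" for j
  using pk1[of j] by measurable
 have "(\<integral>\<^sup>+w. ennreal (g w * w' (U w)) \<partial>M) \<le>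
  (\<integral>\<^sup>+w. liminf (\<lambda>j. \<integral>\<^sup>+c. ennreal (g w * w' c) * ennreal (pk n lam z0 (ep j) (\<lambda>k. c k - U w k)) \<partial>lborel_Rn n) \<partial>M)"
 proof (intro nn_integral_mono pk_concentration lam ep)
  fix w and et :: real assume et: "0 < et"
  \<comment> \<open>The tolerance is divided by \<open>g w + 1\<close> because the function will be
    multiplied by \<open>g w\<close>, which may be 0.\<close>
  obtain de where de: "0 < de" "\<And>c. \<forall>k<n. \<bar>c k - U w k\<bar> < de ==> w' (U w) - et / (g w + 1) \<le> w' c"
   using lower[of "et / (g w + 1)" "U w"] g[of w] et by (auto simp: add_nonneg_pos)
  have "g w * w' (U w) - et \<le> g w * w' c" if "\<forall>k<n. \<bar>c k - U w k\<bar> < de" for c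
  proof -
   have "g w * (w' (U w) - et / (g w + 1)) \<le> g w * w' c" by (intro mult_left_mono de(2) that g)
   moreover have "g w * (et / (g w + 1)) \<le> et" using g[of w] et by (simp add: field_simps)
   ultimately show ?thesis by (simp add: right_diff_distrib)
  qed
  then show "\<exists>de>0. \<forall>c. (\<forall>k<n. \<bar>c k - U w k\<bar> < de) --> g w * w' (U w) - et \<le> g w * w' c" using de(1) by blast
 qed (use g w' in auto)
 also have "\<dots> \<le> liminf (\<lambda>j. \<integral>\<^sup>+w. \<integral>\<^sup>+c. ennreal (g w * w' c) * ennreal (pk n lam z0 (ep j) (\<lambda>k. c k - U w k)) \<partial>lborel_Rn n \<partial>M)"
  using L.borel_measurable_nn_integral_fst[OF joint] by (intro nn_integral_liminf) simp
 also have "\<dots> = liminf (\<lambda>j. \<integral>\<^sup>+c. ennreal (w' c) * (\<integral>\<^sup>+w. ennreal (g w * pk n lam z0 (ep j) (\<lambda>k. c k - U w k)) \<partial>M) \<partial>lborel_Rn n)"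
 proof (intro arg_cong[where f=liminf] ext)
  fix j
  have pp: "0 < pk n lam z0 (ep j) y" for y by (intro pk_0_pos ep lam)
  have pm: "(\<lambda>w. pk n lam z0 (ep j) (\<lambda>k. c k - U w k)) \<in> borel_measurable M" for c by (intro borel_measurable_pk ep lam borel_measurable_diff U) auto
  have "(\<integral>\<^sup>+w. \<integral>\<^sup>+c. ennreal (g w * w' c) * ennreal (pk n lam z0 (ep j) (\<lambda>k. c k - U w k)) \<partial>lborel_Rn n \<partial>M) =
   (\<integral>\<^sup>+c. \<integral>\<^sup>+w. ennreal (g w * w' c) * ennreal (pk n lam z0 (ep j) (\<lambda>k. c k - U w k)) \<partial>M \<partial>lborel_Rn n)"
   using joint[of j] by (intro LP.Fubini'[symmetric]) (simp add: split_beta')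
  also have "\<dots> = (\<integral>\<^sup>+c. ennreal (w' c) * (\<integral>\<^sup>+w. ennreal (g w * pk n lam z0 (ep j) (\<lambda>k. c k - U w k)) \<partial>M) \<partial>lborel_Rn n)"
  proof (intro nn_integral_cong)
   fix c
   have "ennreal (g w * w' c) * ennreal (pk n lam z0 (ep j) (\<lambda>k. c k - U w k)) = ennreal (w' c) * ennreal (g w * pk n lam z0 (ep j) (\<lambda>k. c k - U w k))" for w
    using g w' less_imp_le[OF pp[of "\<lambda>k. c k - U w k"]] by (simp add: ennreal_mult[symmetric] ac_simps)
   then show "(\<integral>\<^sup>+w. ennreal (g w * w' c) * ennreal (pk n lam z0 (ep j) (\<lambda>k. c k - U w k)) \<partial>M) =
    ennreal (w' c) * (\<integral>\<^sup>+w. ennreal (g w * pk n lam z0 (ep j) (\<lambda>k. c k - U w k)) \<partial>M)" using pm[of c] by (simp add: nn_integral_cmult)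
  qed
  finally show "(\<integral>\<^sup>+w. \<integral>\<^sup>+c. ennreal (g w * w' c) * ennreal (pk n lam z0 (ep j) (\<lambda>k. c k - U w k)) \<partial>lborel_Rn n \<partial>M) =
   (\<integral>\<^sup>+c. ennreal (w' c) * (\<integral>\<^sup>+w. ennreal (g w * pk n lam z0 (ep j) (\<lambda>k. c k - U w k)) \<partial>M) \<partial>lborel_Rn n)" .
 qed
 finally show ?thesis .
qed

text \<open>The inverse of \<open>iota e n\<close> on \<open>Hn e n\<close> when e is orthonormal;
  coordinates from n on are ignored.\<close>

definition emb :: "(nat => 'h::real_inner) => nat => (nat => real) => 'h" where
 "emb e n c = (\<Sum>k<n. c k *\<^sub>R e k)"

lemma borel_measurable_emb:
 fixes e :: "nat => 'h::{real_inner, second_countable_topology}"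
 assumes "\<And>k. k < n ==> (\<lambda>w. y w k) \<in> borel_measurable G"
 shows "(\<lambda>w. emb e n (y w)) \<in> borel_measurable G" unfolding emb_def using assms by (intro borel_measurable_sum borel_measurable_scaleR) auto

lemma emb_open:
 assumes S: "open S" "emb e n z \<in> S"
 shows "\<exists>de>0. \<forall>c. (\<forall>k<n. \<bar>c k - z k\<bar> < de) --> emb e n c \<in> S"
proof -
 obtain r where r: "0 < r" "\<And>x. dist x (emb e n z) < r ==> x \<in> S" using S by (auto simp: open_dist)
 define B where "B = (\<Sum>k<n. norm (e k))"
 have B: "0 \<le> B" unfolding B_def by (intro sum_nonneg) auto
 have "emb e n c \<in> S" if c: "\<forall>k<n. \<bar>c k - z k\<bar> < r / (B + 1)" for c
 proof (rule r(2))
  have "norm (emb e n c - emb e n z) = norm (\<Sum>k<n. (c k - z k) *\<^sub>R e k)" by (simp add: emb_def sum_subtractf scaleR_left_diff_distrib)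
  also have "\<dots> \<le> (\<Sum>k<n. \<bar>c k - z k\<bar> * norm (e k))" by (rule sum_norm_le) simp
  also have "\<dots> \<le> (\<Sum>k<n. r / (B + 1) * norm (e k))" using c by (intro sum_mono mult_right_mono) (auto intro: less_imp_le)
  also have "\<dots> = r / (B + 1) * B" unfolding B_def sum_distrib_left ..
  also have "\<dots> < r" using r(1) B by (simp add: field_simps)
  finally show "dist (emb e n c) (emb e n z) < r" by (simp add: dist_norm)
 qed
 then show ?thesis using r(1) B by (intro exI[of _ "r / (B + 1)"]) auto
qed

lemma hg_0_le:
 assumes "0 < v" "v \<le> v'"
 shows "hg 0 v y \<le> sqrt (v' / v) * hg 0 v' y"
proof -
 have "exp (- (y\<^sup>2 / (2 * v))) \<le> exp (- (y\<^sup>2 / (2 * v')))" using assms by (simp add: frac_le)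
 then have "exp (- (y\<^sup>2 / (2 * v))) / sqrt (2 * pi * v) \<le> exp (- (y\<^sup>2 / (2 * v'))) / sqrt (2 * pi * v)" using assms by (intro divide_right_mono) auto
 also have "\<dots> = sqrt (v' / v) * hg 0 v' y" using assms by (simp add: real_sqrt_divide real_sqrt_mult)
 finally show ?thesis by simp
qed

text \<open>A narrow Gaussian lies below a multiple of a wider one; this supplies the dominating
  function when the smoothing parameter tends to 0.\<close>

lemma pk_0_le:
 assumes "0 < th" "th \<le> th'" and lam: "\<And>k. k < n ==> 0 < lam k"
 shows "pk n lam z0 th y \<le> sqrt (th' / th) ^ n * pk n lam z0 th' y"
proof -
 have "pk n lam z0 th y \<le> (\<Prod>k<n. sqrt (th' / th) * hg 0 (th' * lam k) (y k))" unfolding pk_def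
 proof (rule prod_mono)
  fix k assume "k \<in> {..<n}"
  then have k: "0 < lam k" using lam by simp
  show "0 \<le> hg 0 (th * lam k) (y k) \<and> hg 0 (th * lam k) (y k) \<le> sqrt (th' / th) * hg 0 (th' * lam k) (y k)"
   using hg_0_le[of "th * lam k" "th' * lam k" "y k"] hg_0_pos[of "th * lam k" "y k"] k assms(1,2) by (simp add: less_imp_le mult_right_mono del: hg.simps)
 qed
 then show ?thesis by (simp add: pk_def prod.distrib del: hg.simps)
qed

section \<open>Identification of laws in the Hilbert space by smoothing\<close>

context mixture
begin

definition law :: "(nat => 'h::{real_inner, second_countable_topology}) => real => 'h measure" where
 "law e v = distr (density (lborel_Rn n) (\<lambda>y. ennreal (mx z0 v y))) borel (emb e n)"

lemma mix_measurable_lborel_Rn: "0 < v ==> mx d v \<in> borel_measurable (lborel_Rn n)"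
 using borel_measurable_mix[of v "\<lambda>y. y"] component_lborel_Rn by simp

lemma emb_measurable_lborel_Rn: "emb e n \<in> borel_measurable (lborel_Rn n)"
 for e :: "nat => 'h::{real_inner, second_countable_topology}"
 using borel_measurable_emb[where y="\<lambda>y. y" and G="lborel_Rn n" and e=e and n=n] component_lborel_Rn by blast

lemma prob_space_density_mix:
 assumes v: "0 < v" shows "prob_space (density (lborel_Rn n) (\<lambda>y. ennreal (mx z0 v y)))"
proof (rule prob_spaceI)
 have "emeasure (density (lborel_Rn n) (\<lambda>y. ennreal (mx z0 v y))) (space (lborel_Rn n)) =
  (\<integral>\<^sup>+y. ennreal (mx z0 v y) * indicator (space (lborel_Rn n)) y \<partial>lborel_Rn n)"
  using mix_measurable_lborel_Rn[OF v] by (intro emeasure_density) auto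
 also have "\<dots> = (\<integral>\<^sup>+y. ennreal (mx z0 v y) \<partial>lborel_Rn n)" by (intro nn_integral_cong) simp
 finally show "emeasure (density (lborel_Rn n) (\<lambda>y. ennreal (mx z0 v y))) (space (density (lborel_Rn n) (\<lambda>y. ennreal (mx z0 v y)))) = 1"
  using nn_integral_mix[OF v] by simp
qed

lemma prob_space_law: "0 < v ==> prob_space (law e v)" unfolding law_def using emb_measurable_lborel_Rn[of e]
 by (intro prob_space.prob_space_distr prob_space_density_mix) simp_all

lemma measure_law:
 assumes v: "0 < v" and S: "open S"
 shows "ennreal (measure (law e v) S) = (\<integral>\<^sup>+c. ennreal (indicator S (emb e n c) * mx z0 v c) \<partial>lborel_Rn n)"
proof -
 interpret L: prob_space "law e v" by (rule prob_space_law[OF v])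
 note [measurable] = emb_measurable_lborel_Rn[of e] mix_measurable_lborel_Rn[OF v]
 have [measurable]: "S \<in> sets borel" using S by simp
 have "ennreal (measure (law e v) S) = emeasure (law e v) S" by (simp add: L.emeasure_eq_measure)
 also have "\<dots> = (\<integral>\<^sup>+c. indicator S c \<partial>law e v)" by (simp add: law_def)
 also have "\<dots> = (\<integral>\<^sup>+c. ennreal (mx z0 v c) * indicator S (emb e n c) \<partial>lborel_Rn n)"
  unfolding law_def by (subst nn_integral_distr, simp, simp, subst nn_integral_density) auto
 also have "\<dots> = (\<integral>\<^sup>+c. ennreal (indicator S (emb e n c) * mx z0 v c) \<partial>lborel_Rn n)" by (intro nn_integral_cong) (auto simp: indicator_def)
 finally show ?thesis .
qed

lemma mix_continuous_at:
 assumes v: "0 < v" and et: "0 < et"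
 shows "\<exists>de>0. \<forall>c. (\<forall>k<n. \<bar>c k - z k\<bar> < de) --> \<bar>mx d v c - mx d v z\<bar> \<le> et"
proof -
 obtain C where C: "0 \<le> C" "\<forall>th\<in>{v..v}. \<forall>dt y de. th + dt \<in> {v..v} -->
  \<bar>mx d (th + dt) (\<lambda>k. y k + de k) - mx d th y\<bar> \<le> C * (mvs n lam dt de)" using mix_lipschitz[OF v order_refl] by blast
 have "\<bar>mx d v c - mx d v z\<bar> \<le> et" if c: "\<forall>k<n. \<bar>c k - z k\<bar> < et / (C * real n + 1)" for c
 proof -
  have "\<bar>mx d (v + 0) (\<lambda>k. z k + (c k - z k)) - mx d v z\<bar> \<le> C * (\<Sum>i\<in>moves n. \<bar>mvc lam 0 (\<lambda>k. c k - z k) i\<bar>)"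
   using C(2)[rule_format, of v 0 z "\<lambda>k. c k - z k"] by simp
  also have "(\<Sum>i\<in>moves n. \<bar>mvc lam 0 (\<lambda>k. c k - z k) i\<bar>) = (\<Sum>k<n. \<bar>c k - z k\<bar>)" by (simp add: sum_moves mvc_def)
  also have "\<dots> \<le> (\<Sum>k<n. et / (C * real n + 1))" using c by (intro sum_mono) (auto intro: less_imp_le)
  also have "C * \<dots> = et * (C * real n) / (C * real n + 1)" by simp
  also have "\<dots> \<le> et" using et C(1) add_nonneg_pos[of "C * real n" 1] by (simp add: pos_divide_le_eq algebra_simps)
  finally show ?thesis using C(1) by (simp add: mult_left_mono)
 qed
 then show ?thesis using et C(1) by (intro exI[of _ "et / (C * real n + 1)"]) (auto intro!: divide_pos_pos add_nonneg_pos)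
qed

text \<open>The product of the indicator of an open set and a nonnegative continuous function is
  lower semicontinuous: off the set the left side is at most 0, and on it a neighbourhood stays
  inside.\<close>

lemma indicator_emb_lower:
 fixes f :: "(nat => real) => real"
 assumes S: "open S" and et: "0 < et" and f: "\<And>c. 0 \<le> f c"
  and fc: "\<exists>de>0. \<forall>c. (\<forall>k<n. \<bar>c k - z k\<bar> < de) --> \<bar>f c - f z\<bar> \<le> et"
 shows "\<exists>de>0. \<forall>c. (\<forall>k<n. \<bar>c k - z k\<bar> < de) --> indicator S (emb e n z) * f z - et \<le> indicator S (emb e n c) * f c"
proof (cases "emb e n z \<in> S")
 case True
 obtain de1 where de1: "0 < de1" "\<And>c. \<forall>k<n. \<bar>c k - z k\<bar> < de1 ==> emb e n c \<in> S" using emb_open[OF S True] by blast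
 obtain de2 where de2: "0 < de2" "\<And>c. \<forall>k<n. \<bar>c k - z k\<bar> < de2 ==> \<bar>f c - f z\<bar> \<le> et" using fc by blast
 show ?thesis
 proof (intro exI[of _ "min de1 de2"] conjI allI impI)
  fix c assume "\<forall>k<n. \<bar>c k - z k\<bar> < min de1 de2"
  then have "emb e n c \<in> S" "\<bar>f c - f z\<bar> \<le> et" by (auto intro!: de1(2) de2(2))
  moreover from this have "f z - et \<le> f c" by linarith
  ultimately show "indicator S (emb e n z) * f z - et \<le> indicator S (emb e n c) * f c" using True by simp
 qed (use de1 de2 in simp)
next
 case False
 have "- et \<le> f c" for c using f[of c] et by linarith
 then show ?thesis using False et by (intro exI[of _ 1]) (auto simp: indicator_def)
qed

abbreviation eps :: "nat => real" where "eps j \<equiv> inverse (real (Suc j))"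

text \<open>Smoothing \<open>Z\<close> by ep gives the mixture with variance \<open>v + ep\<close>
  exactly. Letting ep tend to 0 bounds the probability of every open set from above, and two
  probability measures ordered on open sets agree.\<close>

lemma law_if_smoothed:
 fixes e :: "nat => 'h::{real_inner, second_countable_topology}"
 assumes Z: "\<And>k. k < n ==> (\<lambda>w. Z w k) \<in> borel_measurable M" and v: "0 < v"
  and eq: "\<And>ep c. 0 < ep ==> mix M Z n lam z0 ep c = mx z0 (v + ep) c"
 shows "distr M borel (\<lambda>w. emb e n (Z w)) = law e v"
proof (rule prob_eq_if_open_le)
 interpret Z: mixture M Z n lam by unfold_locales (use Z lam_pos in auto)
 have [measurable]: "(\<lambda>w. emb e n (Z w)) \<in> borel_measurable M" by (rule borel_measurable_emb[OF Z])
 show "prob_space (distr M borel (\<lambda>w. emb e n (Z w)))" by (rule prob_space_distr) simp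
 show "prob_space (law e v)" by (rule prob_space_law[OF v])
 fix S :: "'h set" assume S: "open S"
 then have [measurable]: "S \<in> sets borel" by simp
 note [measurable] = emb_measurable_lborel_Rn[of e]
 have "ennreal (measure (distr M borel (\<lambda>w. emb e n (Z w))) S) = (\<integral>\<^sup>+w. ennreal (1 * indicator S (emb e n (Z w))) \<partial>M)"
 proof -
  have "ennreal (measure (distr M borel (\<lambda>w. emb e n (Z w))) S) = emeasure (distr M borel (\<lambda>w. emb e n (Z w))) S"
   using prob_space_distr[of "\<lambda>w. emb e n (Z w)" borel] by (simp add: finite_measure.emeasure_eq_measure prob_space.finite_measure)
  also have "\<dots> = (\<integral>\<^sup>+x. indicator S x \<partial>distr M borel (\<lambda>w. emb e n (Z w)))" by simp
  also have "\<dots> = (\<integral>\<^sup>+w. indicator S (emb e n (Z w)) \<partial>M)" by (rule nn_integral_distr) simp_all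
  finally show ?thesis by (simp add: ennreal_indicator)
 qed
 also have "\<dots> \<le> liminf (\<lambda>j. \<integral>\<^sup>+c. ennreal (indicator S (emb e n c)) * (\<integral>\<^sup>+w. ennreal (1 * pk n lam z0 (eps j) (\<lambda>k. c k - Z w k)) \<partial>M) \<partial>lborel_Rn n)"
 proof (rule smoothing_lower_bound)
  show "eps \<longlonglongrightarrow> 0" by (rule LIMSEQ_inverse_real_of_nat)
  show "\<exists>de>0. \<forall>c. (\<forall>k<n. \<bar>c k - z k\<bar> < de) --> indicator S (emb e n z) - et \<le> (indicator S (emb e n c) :: real)" if "0 < et" for z et
   using indicator_emb_lower[OF S that, of "\<lambda>_. 1" z e] that by (auto intro: zero_less_one)
  show "(\<lambda>c. indicator S (emb e n c)) \<in> borel_measurable (lborel_Rn n)" by measurable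
 qed (use lam_pos Z in auto)
 also have "\<dots> = liminf (\<lambda>j. \<integral>\<^sup>+c. ennreal (indicator S (emb e n c) * mx z0 (v + eps j) c) \<partial>lborel_Rn n)"
 proof (intro arg_cong[where f=liminf] ext nn_integral_cong)
  fix j c
  have j: "0 < eps j" by simp
  have "(\<integral>\<^sup>+w. ennreal (1 * pk n lam z0 (eps j) (\<lambda>k. c k - Z w k)) \<partial>M) = ennreal (mix M Z n lam z0 (eps j) c)"
   unfolding mix_def using less_imp_le[OF pk_0_pos[OF j lam_pos]] by (subst nn_integral_eq_integral[symmetric, OF Z.integrable_pk[OF j]]) auto
  then show "ennreal (indicator S (emb e n c)) * (\<integral>\<^sup>+w. ennreal (1 * pk n lam z0 (eps j) (\<lambda>k. c k - Z w k)) \<partial>M) =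
   ennreal (indicator S (emb e n c) * mx z0 (v + eps j) c)" unfolding eq[OF j] by (simp add: ennreal_mult')
 qed
 also have "\<dots> = (\<integral>\<^sup>+c. ennreal (indicator S (emb e n c) * mx z0 v c) \<partial>lborel_Rn n)"
 \<comment> \<open>As \<open>eps j <= 1\<close>, all mixtures lie below a multiple of the one with
   variance \<open>v + 1\<close>, which has total mass 1.\<close>
 proof (rule lim_imp_Liminf[OF sequentially_bot], rule nn_integral_dominated_convergence[where w="\<lambda>c. ennreal (sqrt ((v + 1) / v) ^ n * mx z0 (v + 1) c)"])
  have vj: "0 < v + eps j" "v + eps j \<le> v + 1" "v \<le> v + eps j" for j using v by (auto intro: add_pos_pos simp: inverse_le_1_iff)
  have v1: "0 < v + 1" using v by simp
  note [measurable] = mix_measurable_lborel_Rn[OF vj(1)] mix_measurable_lborel_Rn[OF v] mix_measurable_lborel_Rn[OF v1]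
  show "(\<lambda>c. ennreal (indicator S (emb e n c) * mx z0 (v + eps j) c)) \<in> borel_measurable (lborel_Rn n)" for j by measurable
  show "(\<lambda>c. ennreal (indicator S (emb e n c) * mx z0 v c)) \<in> borel_measurable (lborel_Rn n)" by measurable
  show "(\<lambda>c. ennreal (sqrt ((v + 1) / v) ^ n * mx z0 (v + 1) c)) \<in> borel_measurable (lborel_Rn n)" by measurable
  have dom: "mx z0 (v + eps j) c \<le> sqrt ((v + 1) / v) ^ n * mx z0 (v + 1) c" for j c
  proof -
   have "mx z0 (v + eps j) c \<le> expectation (\<lambda>w. sqrt ((v + 1) / v) ^ n * pk n lam z0 (v + 1) (\<lambda>k. c k - X w k))" unfolding mix_def
   proof (rule integral_mono[OF integrable_pk[OF vj(1)] integrable_mult_right[OF integrable_pk[OF v1]]])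
    fix w
    have "pk n lam z0 (v + eps j) (\<lambda>k. c k - X w k) \<le> sqrt ((v + 1) / (v + eps j)) ^ n * pk n lam z0 (v + 1) (\<lambda>k. c k - X w k)"
     by (rule pk_0_le[OF vj(1,2) lam_pos])
    also have "\<dots> \<le> sqrt ((v + 1) / v) ^ n * pk n lam z0 (v + 1) (\<lambda>k. c k - X w k)"
     using vj v1 v by (intro mult_right_mono power_mono real_sqrt_le_mono divide_left_mono less_imp_le[OF pk_0_pos[OF v1 lam_pos]]) auto
    finally show "pk n lam z0 (v + eps j) (\<lambda>k. c k - X w k) \<le> sqrt ((v + 1) / v) ^ n * pk n lam z0 (v + 1) (\<lambda>k. c k - X w k)" .
   qed
   then show ?thesis by (simp add: mix_def)
  qed
  show "AE c in lborel_Rn n. ennreal (indicator S (emb e n c) * mx z0 (v + eps j) c) \<le> ennreal (sqrt ((v + 1) / v) ^ n * mx z0 (v + 1) c)" for j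
   using dom[of j] v by (intro AE_I2 ennreal_leI) (auto simp: indicator_def intro!: mult_nonneg_nonneg less_imp_le[OF mix_pos])
  show "(\<integral>\<^sup>+c. ennreal (sqrt ((v + 1) / v) ^ n * mx z0 (v + 1) c) \<partial>lborel_Rn n) < \<infinity>"
   using nn_integral_mix[OF v1] v by (simp add: ennreal_mult' nn_integral_cmult ennreal_mult_less_top)
  show "AE c in lborel_Rn n. (\<lambda>j. ennreal (indicator S (emb e n c) * mx z0 (v + eps j) c)) \<longlonglongrightarrow> ennreal (indicator S (emb e n c) * mx z0 v c)"
  proof (rule AE_I2, rule tendsto_ennrealI, rule tendsto_mult_left)
   fix c
   have "v \<le> v + 1" by simp
   from mix_lipschitz[OF v this, where d="\<lambda>_. 0"]
   obtain C where C: "0 \<le> C" "\<forall>th\<in>{v..v + 1}. \<forall>dt y de. th + dt \<in> {v..v + 1} -->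
    \<bar>mx z0 (th + dt) (\<lambda>k. y k + de k) - mx z0 th y\<bar> \<le> C * (mvs n lam dt de)" by blast
   show "(\<lambda>j. mx z0 (v + eps j) c) \<longlonglongrightarrow> mx z0 v c"
   proof (rule LIM_zero_cancel, rule Lim_null_comparison)
    show "\<forall>\<^sub>F j in sequentially. norm (mx z0 (v + eps j) c - mx z0 v c) \<le> C * (\<Sum>k<n. \<bar>eps j * lam k / 2\<bar>)"
    proof (rule always_eventually, rule allI)
     fix j
     have "v + eps j \<in> {v..v + 1}" using vj[of j] by simp
     then have "\<bar>mx z0 (v + eps j) (\<lambda>k. c k + 0) - mx z0 v c\<bar> \<le> C * (\<Sum>z\<in>moves n. \<bar>mvc lam (eps j) (\<lambda>_. 0) z\<bar>)"
      using C(2)[rule_format, of v "eps j" c "\<lambda>_. 0"] v by simp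
     then show "norm (mx z0 (v + eps j) c - mx z0 v c) \<le> C * (\<Sum>k<n. \<bar>eps j * lam k / 2\<bar>)" by (simp add: sum_moves mvc_def)
    qed
    have "(\<lambda>j. C * (\<Sum>k<n. \<bar>eps j * lam k / 2\<bar>)) \<longlonglongrightarrow> C * (\<Sum>k<n. \<bar>0 * lam k / 2\<bar>)"
     by (intro tendsto_intros LIMSEQ_inverse_real_of_nat) auto
    then show "(\<lambda>j. C * (\<Sum>k<n. \<bar>eps j * lam k / 2\<bar>)) \<longlonglongrightarrow> 0" by simp
   qed
  qed
 qed
 also have "\<dots> = ennreal (measure (law e v) S)" by (rule measure_law[OF v S, symmetric])
 finally show "measure (distr M borel (\<lambda>w. emb e n (Z w))) S \<le> measure (law e v) S" by simp
qed (simp_all add: law_def)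

text \<open>The indicator of \<open>S\<close> along \<open>U\<close> is written as g times w', with
  w' the density restricted to \<open>S\<close> and g its reciprocal. The inner integrals after
  smoothing are then those that the hypothesis bounds by 1, and the integral of w' is the mass of
  \<open>S\<close> under the candidate law.\<close>

lemma law_if_quotient_bounded:
 fixes e :: "nat => 'h::{real_inner, second_countable_topology}" and P :: "'v measure"
 assumes P: "prob_space P" and U: "\<And>k. k < n ==> (\<lambda>w. U w k) \<in> borel_measurable P" and v: "0 < v"
  and le: "\<And>ep c. 0 < ep ==> (\<integral>\<^sup>+w. ennreal (pk n lam z0 ep (\<lambda>k. c k - U w k) / mx z0 v (U w)) \<partial>P) \<le> 1"
 shows "distr P borel (\<lambda>w. emb e n (U w)) = law e v"
proof (rule prob_eq_if_open_le)
 interpret P: prob_space P by fact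
 have [measurable]: "(\<lambda>w. emb e n (U w)) \<in> borel_measurable P" by (rule borel_measurable_emb[OF U])
 show "prob_space (distr P borel (\<lambda>w. emb e n (U w)))" by (rule P.prob_space_distr) simp
 show "prob_space (law e v)" by (rule prob_space_law[OF v])
 fix S :: "'h set" assume S: "open S"
 then have [measurable]: "S \<in> sets borel" by simp
 note [measurable] = emb_measurable_lborel_Rn[of e] mix_measurable_lborel_Rn[OF v] borel_measurable_mix[OF v U]
 define w' where "w' c = indicator S (emb e n c) * mx z0 v c" for c
 define g where "g w = 1 / mx z0 v (U w)" for w
 have "ennreal (measure (distr P borel (\<lambda>w. emb e n (U w))) S) = (\<integral>\<^sup>+w. ennreal (g w * w' (U w)) \<partial>P)"
 proof -
  have "ennreal (measure (distr P borel (\<lambda>w. emb e n (U w))) S) = emeasure (distr P borel (\<lambda>w. emb e n (U w))) S"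
   using P.prob_space_distr[of "\<lambda>w. emb e n (U w)" borel] by (simp add: finite_measure.emeasure_eq_measure prob_space.finite_measure)
  also have "\<dots> = (\<integral>\<^sup>+x. indicator S x \<partial>distr P borel (\<lambda>w. emb e n (U w)))" by simp
  also have "\<dots> = (\<integral>\<^sup>+w. indicator S (emb e n (U w)) \<partial>P)" by (rule nn_integral_distr) simp_all
  also have "\<dots> = (\<integral>\<^sup>+w. ennreal (g w * w' (U w)) \<partial>P)"
   using mix_pos[OF v] by (intro nn_integral_cong) (simp add: g_def w'_def less_imp_neq[symmetric] ennreal_indicator)
  finally show ?thesis .
 qed
 also have "\<dots> \<le> liminf (\<lambda>j. \<integral>\<^sup>+c. ennreal (w' c) * (\<integral>\<^sup>+w. ennreal (g w * pk n lam z0 (eps j) (\<lambda>k. c k - U w k)) \<partial>P) \<partial>lborel_Rn n)"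
 proof (rule P.smoothing_lower_bound)
  show "eps \<longlonglongrightarrow> 0" by (rule LIMSEQ_inverse_real_of_nat)
  show "\<exists>de>0. \<forall>c. (\<forall>k<n. \<bar>c k - z k\<bar> < de) --> w' z - et \<le> w' c" if "0 < et" for z et
   unfolding w'_def by (rule indicator_emb_lower[OF S that less_imp_le[OF mix_pos[OF v]] mix_continuous_at[OF v that]])
  show "w' \<in> borel_measurable (lborel_Rn n)" unfolding w'_def[abs_def] by measurable
  show "g \<in> borel_measurable P" unfolding g_def[abs_def] by measurable
  show "0 \<le> w' c" for c unfolding w'_def using mix_pos[OF v, of c] by simp
  show "0 \<le> g w" for w unfolding g_def using mix_pos[OF v, of "U w"] by simp
 qed (use lam_pos U in auto)
 also have "\<dots> \<le> liminf (\<lambda>j::nat. \<integral>\<^sup>+c. ennreal (w' c) \<partial>lborel_Rn n)"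
 proof (intro Liminf_mono always_eventually allI nn_integral_mono)
  fix j c
  have "(\<integral>\<^sup>+w. ennreal (g w * pk n lam z0 (eps j) (\<lambda>k. c k - U w k)) \<partial>P) \<le> 1" using le[of "eps j" c] by (simp add: g_def)
  then show "ennreal (w' c) * (\<integral>\<^sup>+w. ennreal (g w * pk n lam z0 (eps j) (\<lambda>k. c k - U w k)) \<partial>P) \<le> ennreal (w' c)"
   using mult_left_mono[of _ 1 "ennreal (w' c)"] by simp
 qed
 also have "\<dots> = ennreal (measure (law e v) S)" unfolding w'_def measure_law[OF v S] by (simp add: Liminf_const)
 finally show "measure (distr P borel (\<lambda>w. emb e n (U w))) S \<le> measure (law e v) S" by simp
qed (simp_all add: law_def)

end

section \<open>The smooth density and its score\<close>

lemma Rn_iff: "x \<in> Rn n \<longleftrightarrow> (\<forall>k. n \<le> k --> x k = undefined)" by (auto simp: Rn_def PiE_iff extensional_def not_less)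

lemma space_lborel_Rn [simp]: "space (lborel_Rn n) = Rn n" by (simp add: lborel_Rn_def space_PiM Rn_def)

text \<open>The topology is that of functions on all indices. Extensional functions take the same
  value \<open>undefined\<close> from n on, so a basic open set around x constrains only the first n
  coordinates, where it is a box with nonempty open sides.\<close>

lemma open_box_not_null:
 assumes S: "open S" and x: "x \<in> S" "x \<in> Rn n"
 shows "\<exists>B\<in>sets (lborel_Rn n). B \<subseteq> S \<inter> Rn n \<and> emeasure (lborel_Rn n) B \<noteq> 0"
proof -
 interpret PS: product_sigma_finite "\<lambda>_. lborel :: real measure" ..
 obtain X where X: "x \<in> (\<Pi>\<^sub>E i\<in>UNIV. X i)" "\<forall>i. openin euclidean (X i)" "(\<Pi>\<^sub>E i\<in>UNIV. X i) \<subseteq> S"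
  using product_topology_open_contains_basis[of "\<lambda>_. euclidean" UNIV S x] S x(1) unfolding open_fun_def by blast
 have xX: "x k \<in> X k" and X_open: "open (X k)" for k using X(1,2) by (auto simp: PiE_iff)
 have m: "X k \<in> sets lborel" for k using X_open[of k] by simp
 have pos: "emeasure lborel (X k) \<noteq> 0" for k
 proof -
  obtain r where r: "0 < r" "ball (x k) r \<subseteq> X k" using X_open[of k] xX[of k] open_contains_ball by blast
  have "emeasure lborel (ball (x k) r) \<le> emeasure lborel (X k)" by (rule emeasure_mono[OF r(2) m])
  moreover have "emeasure lborel (ball (x k) r) = ennreal (2 * r)" using r(1) by (simp add: ball_eq_greaterThanLessThan)
  ultimately show ?thesis using r(1) by (auto simp: ennreal_eq_0_iff)
 qed
 have "emeasure (lborel_Rn n) (\<Pi>\<^sub>E k\<in>{..<n}. X k) = (\<Prod>k<n. emeasure lborel (X k))" unfolding lborel_Rn_def by (rule PS.emeasure_PiM) (use m in auto)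
 then have "emeasure (lborel_Rn n) (\<Pi>\<^sub>E k\<in>{..<n}. X k) \<noteq> 0" using pos by (simp add: prod_zero_iff)
 moreover have "(\<Pi>\<^sub>E k\<in>{..<n}. X k) \<in> sets (lborel_Rn n)" unfolding lborel_Rn_def using m by (intro sets_PiM_I_finite) auto
 moreover have "(\<Pi>\<^sub>E k\<in>{..<n}. X k) \<subseteq> S \<inter> Rn n"
 proof
  fix c assume c: "c \<in> (\<Pi>\<^sub>E k\<in>{..<n}. X k)"
  have "c k \<in> X k" for k
  proof (cases "k < n")
   case True then show ?thesis using c by (auto simp: PiE_iff)
  next
   case False
   then have "c k = x k" using c x(2) by (auto simp: PiE_iff extensional_def Rn_iff)
   then show ?thesis using xX by simp
  qed
  then show "c \<in> S \<inter> Rn n" using X(3) c by (auto simp: PiE_iff Rn_def)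
 qed
 ultimately show ?thesis by blast
qed

text \<open>The choice made in \<open>smooth_density\<close> is harmless on \<open>Rn n\<close>: two
  densities agree almost everywhere, and if continuous they cannot differ at a point, since they
  would then differ on a set of positive measure.\<close>

lemma (in prob_space) smooth_density_eq:
 assumes dist: "distributed M (lborel_Rn n) Z (\<lambda>x. ennreal (p x))" and pos: "\<forall>x\<in>Rn n. 0 < p x" and smooth: "smooth_Rn n p"
  and x: "x \<in> Rn n"
 shows "smooth_density M n Z x = p x"
proof -
 define q where "q = smooth_density M n Z"
 have q: "(\<forall>x\<in>Rn n. 0 < q x) \<and> smooth_Rn n q \<and> distributed M (lborel_Rn n) Z (\<lambda>x. ennreal (q x))"
  unfolding q_def smooth_density_def by (rule someI[of _ p]) (use dist pos smooth in auto)
 have cont: "continuous_on (Rn n) f" if "smooth_Rn n f" for f using that unfolding smooth_Rn_def by (auto dest: spec[of _ "[]"])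
 show ?thesis
 proof (rule ccontr)
  assume neq: "smooth_density M n Z x \<noteq> p x"
  have "continuous_on (Rn n) (\<lambda>x. q x - p x)" by (intro continuous_intros cont) (use q smooth in auto)
  then obtain S where S: "open S" "S \<inter> Rn n = (\<lambda>x. q x - p x) -` (- {0}) \<inter> Rn n"
   unfolding continuous_on_open_invariant by (metis closed_singleton open_Compl)
  then have "x \<in> S" using neq x by (auto simp: q_def)
  then obtain B where B: "B \<in> sets (lborel_Rn n)" "B \<subseteq> S \<inter> Rn n" "emeasure (lborel_Rn n) B \<noteq> 0" using open_box_not_null[OF S(1) _ x] by blast
  have "AE c in lborel_Rn n. ennreal (q c) = ennreal (p c)" using distributed_unique[of "lborel_Rn n" Z "\<lambda>x. ennreal (q x)"] q dist by blast
  then have "AE c in lborel_Rn n. c \<notin> B" using AE_space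
  proof eventually_elim
   case (elim c)
   have c: "c \<in> Rn n" using elim(2) by simp
   then have "0 < q c" "0 < p c" using q pos by auto
   then have "q c = p c" using elim(1) by (simp add: less_imp_le)
   then show ?case using B(2) S(2) by auto
  qed
  then have "emeasure (lborel_Rn n) B = 0" using B(1) by (simp add: AE_iff_null_sets[symmetric] null_sets_def)
  then show False using B(3) by simp
 qed
qed

lemma emb_inner:
 assumes "\<And>i j. e i \<bullet> e j = (if i = j then 1 else 0)"
 shows "emb e n c \<bullet> e k = (if k < n then c k else 0)"
 unfolding emb_def inner_sum_left inner_scaleR_left assms by (simp add: if_distrib[of "\<lambda>x. _ * x"] cong: if_cong)

lemma iota_emb:
 assumes "\<And>i j. e i \<bullet> e j = (if i = j then 1 else 0)" shows "iota e n (emb e n c) = restrict c {..<n}"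
 unfolding iota_def emb_inner[OF assms] by (auto simp: restrict_def)

section \<open>Smoothness and score of Gaussian mixtures\<close>

context mixture
begin

text \<open>The mixtures of all orders are closed under partial derivatives, which reduces
  smoothness to continuity and a single derivative.\<close>

lemma foldr_partial_deriv_mix:
 assumes "0 < v" "set js \<subseteq> {..<n}"
 shows "\<exists>d'. foldr partial_deriv js (mx d v) = mx d' v" using assms(2)
proof (induction js)
 case Nil then show ?case by auto
next
 case (Cons i js)
 then obtain d' where d': "foldr partial_deriv js (mx d v) = mx d' v" by auto
 have i: "i < n" using Cons.prems by simp
 have "partial_deriv i (mx d' v) = mx (bump d' (i, 1)) v"
 proof
  fix x
  have "deriv (\<lambda>s. mx d' v (x(i := s))) (x i) = mx (bump d' (i, 1)) v (x(i := x i))" by (rule DERIV_imp_deriv[OF mix_partial_derivative[OF assms(1) i]])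
  then show "partial_deriv i (mx d' v) x = mx (bump d' (i, 1)) v x" by (simp add: partial_deriv_def)
 qed
 then show ?case unfolding foldr.simps o_apply d' by blast
qed

lemma continuous_on_mix:
 assumes v: "0 < v" shows "continuous_on S (mx d v)" unfolding continuous_on_def
proof
 fix z assume "z \<in> S"
 show "(mx d v \<longlongrightarrow> mx d v z) (at z within S)"
 proof (rule tendstoI)
  fix r :: real assume r: "0 < r"
  then obtain de where de: "0 < de" "\<And>c. \<forall>k<n. \<bar>c k - z k\<bar> < de ==> \<bar>mx d v c - mx d v z\<bar> \<le> r / 2"
   using mix_continuous_at[OF v, of "r / 2" z d] by auto
  have "((\<lambda>c. c k) \<longlongrightarrow> z k) (at z within S)" for k
   using continuous_on_subset[OF continuous_on_product_coordinates, of S k] \<open>z \<in> S\<close> by (auto simp: continuous_on_def)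
  then have "\<forall>\<^sub>F c in at z within S. \<forall>k\<in>{..<n}. dist (c k) (z k) < de" using de(1) by (intro eventually_ball_finite) (auto dest: tendstoD)
  then show "\<forall>\<^sub>F c in at z within S. dist (mx d v c) (mx d v z) < r"
  proof eventually_elim
   case (elim c)
   then have "\<bar>mx d v c - mx d v z\<bar> \<le> r / 2" by (intro de(2)) (auto simp: dist_real_def)
   then show ?case using r by (simp add: dist_real_def)
  qed
 qed
qed

lemma smooth_Rn_mix: assumes v: "0 < v" shows "smooth_Rn n (mx d v)" unfolding smooth_Rn_def
proof (intro allI impI)
 fix js assume "set js \<subseteq> {..<n}"
 then obtain d' where d': "foldr partial_deriv js (mx d v) = mx d' v" using foldr_partial_deriv_mix[OF v] by blast
 show "continuous_on (Rn n) (foldr partial_deriv js (mx d v)) \<and>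
  (\<forall>i<n. \<forall>x\<in>Rn n. (\<lambda>s. foldr partial_deriv js (mx d v) (x(i := s))) differentiable (at (x i)))"
  unfolding d' real_differentiable_def using continuous_on_mix[OF v] mix_partial_derivative[OF v] by blast
qed

lemma discrete_score_component:
 assumes P: "prob_space P" and v: "0 < v"
  and dist: "distributed P (lborel_Rn n) (\<lambda>w. iota e n (Xt (T - t) w)) (\<lambda>y. ennreal (mx z0 v y))"
  and on: "\<And>i j. e i \<bullet> e j = (if i = j then 1 else 0)" and k: "k < n"
 shows "discrete_score P T \<alpha> e lam n Xt t x \<bullet> e k = \<alpha> (T - t) * lam k * ql mx (k, 1) v (iota e n x)"
proof -
 define p where "p = smooth_density P n (\<lambda>w. iota e n (Xt (T - t) w))"
 define y where "y = iota e n x"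
 have y: "y \<in> Rn n" by (simp add: y_def iota_def Rn_def)
 have p: "p z = mx z0 v z" if "z \<in> Rn n" for z unfolding p_def by (rule prob_space.smooth_density_eq[OF P dist]) (use that mix_pos[OF v] smooth_Rn_mix[OF v] in auto)
 have g: "grad n (\<lambda>y. ln (p y)) y i = ql mx (i, 1) v y" if i: "i < n" for i
 proof -
  have "y(i := s) \<in> Rn n" for s using y i by (auto simp: Rn_iff)
  then have "deriv (\<lambda>s. ln (p (y(i := s)))) (y i) = deriv (\<lambda>s. ln (mx z0 v (y(i := s)))) (y i)" by (simp add: p)
  also have "\<dots> = ql mx (i, 1) v y"
  proof (rule DERIV_imp_deriv)
   have "((\<lambda>s. ln (mx z0 v (y(i := s)))) has_real_derivative (1 / mx z0 v (y(i := y i)) * mx (bump z0 (i, 1)) v (y(i := y i)))) (at (y i))"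
    by (rule DERIV_chain2[OF DERIV_ln_divide[OF mix_pos[OF v]] mix_partial_derivative[OF v i]])
   then show "((\<lambda>s. ln (mx z0 v (y(i := s)))) has_real_derivative ql mx (i, 1) v y) (at (y i))" by (simp add: ql_def)
  qed
  finally show ?thesis using i by (simp add: grad_def partial_deriv_def)
 qed
 define G where "G = grad n (\<lambda>y. ln (p y)) y"
 have "emb e n G \<in> Hn e n" unfolding emb_def Hn_def by (intro span_sum span_scale span_base) auto
 moreover have "iota e n (emb e n G) = G" unfolding iota_emb[OF on] by (simp add: G_def grad_def)
 \<comment> \<open>\<open>emb e n G\<close> exhibits a preimage of \<open>G\<close> in
   \<open>Hn e n\<close>, so whatever preimage \<open>inv_into\<close> selects has the coordinates
   \<open>G\<close>.\<close>
 ultimately have inv: "iota e n (inv_into (Hn e n) (iota e n) G) = G" by (metis f_inv_into_f image_eqI)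
 have Gk: "e k \<bullet> inv_into (Hn e n) (iota e n) G = G k" using fun_cong[OF inv, of k] k by (simp add: iota_def inner_commute)
 have "Qn e lam n z \<bullet> e k = lam k * (e k \<bullet> z)" for z
  using k unfolding Qn_def inner_sum_left inner_scaleR_left on by (simp add: if_distrib[of "\<lambda>x. _ * x"] cong: if_cong)
 then show ?thesis using Gk g[OF k] unfolding discrete_score_def Let_def p_def[symmetric] y_def[symmetric] G_def[symmetric] by (simp add: mult.assoc)
qed

text \<open>Change of variables for densities: division of the vector by a multiplies the density by
  \<open>a ^ n\<close> and divides all variances by the square of a.\<close>

lemma mix_scale:
 assumes v: "0 < v" and a: "0 < a"
 shows "mix M (\<lambda>w k. X w k / a) n lam z0 (v / a\<^sup>2) y = a ^ n * mx z0 v (\<lambda>k. a * y k)"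
proof -
 have h: "hg 0 (v / a\<^sup>2 * l) z = a * hg 0 (v * l) (a * z)" if "0 < l" for l z
 proof -
  have "z\<^sup>2 / (2 * (v / a\<^sup>2 * l)) = (a * z)\<^sup>2 / (2 * (v * l))" using a v that by (simp add: power2_eq_square field_simps)
  moreover have "sqrt (2 * pi * (v / a\<^sup>2 * l)) = sqrt (2 * pi * (v * l)) / a" using a by (simp add: real_sqrt_divide real_sqrt_mult)
  ultimately show ?thesis by simp
 qed
 have "pk n lam z0 (v / a\<^sup>2) (\<lambda>k. y k - X w k / a) = a ^ n * pk n lam z0 v (\<lambda>k. a * y k - X w k)" for w
 proof -
  have "pk n lam z0 (v / a\<^sup>2) (\<lambda>k. y k - X w k / a) = (\<Prod>k<n. a * hg 0 (v * lam k) (a * y k - X w k))" unfolding pk_def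
  proof (intro prod.cong refl)
   fix k assume "k \<in> {..<n}"
   then have "hg 0 (v / a\<^sup>2 * lam k) (y k - X w k / a) = a * hg 0 (v * lam k) (a * (y k - X w k / a))" by (intro h lam_pos) simp
   also have "a * (y k - X w k / a) = a * y k - X w k" using a by (simp add: field_simps)
   finally show "hg 0 (v / a\<^sup>2 * lam k) (y k - X w k / a) = a * hg 0 (v * lam k) (a * y k - X w k)" .
  qed
  then show ?thesis by (simp add: pk_def prod.distrib del: hg.simps)
 qed
 then show ?thesis by (simp add: mix_def)
qed

lemma mixture_scale: "mixture M (\<lambda>w k. X w k / a) n lam" by unfold_locales (use X_measurable lam_pos in auto)

text \<open>The first derivative on the scaled side is identified by uniqueness of derivatives from
  the scaling of order 0; the factor \<open>a ^ n\<close> cancels in the logarithmic derivative, and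
  the chain rule leaves one a.\<close>

lemma ql_mix_scale:
 assumes v: "0 < v" and a: "0 < a" and k: "k < n"
 shows "ql (mix M (\<lambda>w k. X w k / a) n lam) (k, 1) (v / a\<^sup>2) y = a * ql mx (k, 1) v (\<lambda>k. a * y k)"
proof -
 interpret S: mixture M "\<lambda>w k. X w k / a" n lam by (rule mixture_scale)
 let ?z = "\<lambda>k. a * y k"
 have va: "0 < v / a\<^sup>2" using v a by simp
 have eq: "S.mx z0 (v / a\<^sup>2) (y(k := s)) = a ^ n * mx z0 v (?z(k := a * s))" for s
  unfolding mix_scale[OF v a] by (rule arg_cong[where f="\<lambda>f. a ^ n * mx z0 v f"]) auto
 have "((\<lambda>s. a ^ n * mx z0 v (?z(k := a * s))) has_real_derivative (a ^ n * (mx (bump z0 (k, 1)) v (?z(k := a * y k)) * a))) (at (y k))"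
  by (intro DERIV_cmult DERIV_chain2[where g="\<lambda>s. a * s" and f="\<lambda>s. mx z0 v (?z(k := s))"] mix_partial_derivative v k) (auto intro!: derivative_eq_intros)
 then have "((\<lambda>s. S.mx z0 (v / a\<^sup>2) (y(k := s))) has_real_derivative (a ^ n * (mx (bump z0 (k, 1)) v ?z * a))) (at (y k))"
  unfolding eq by (simp add: fun_upd_idem)
 then have "S.mx (bump z0 (k, 1)) (v / a\<^sup>2) (y(k := y k)) = a ^ n * (mx (bump z0 (k, 1)) v ?z * a)" by (rule DERIV_unique[OF S.mix_partial_derivative[OF va k]])
 then show ?thesis using a mix_pos[OF v, of ?z] by (simp add: ql_def mix_scale[OF v a])
qed

end

section \<open>The law of the truncated forward process\<close>

lemma orthonormal_basisD: "orthonormal_basis e ==> e i \<bullet> e j = (if i = j then 1 else 0)" by (simp add: orthonormal_basis_def)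

lemma orthonormal_basis_complete:
 assumes e: "orthonormal_basis e" and x: "\<And>j. x \<bullet> e j = 0" shows "x = 0"
proof -
 have "span (range e) \<subseteq> {y. x \<bullet> y = 0}" by (rule span_minimal) (use x in \<open>auto simp: subspace_def inner_add_right\<close>)
 moreover have "closed {y. x \<bullet> y = 0}" by (intro closed_Collect_eq continuous_intros)
 ultimately have "closure (span (range e)) \<subseteq> {y. x \<bullet> y = 0}" by (rule closure_minimal)
 then have "x \<in> {y. x \<bullet> y = 0}" using e unfolding orthonormal_basis_def by blast
 then show ?thesis by simp
qed

lemma emb_inner_eq:
 assumes e: "orthonormal_basis e" and x: "\<And>j. n \<le> j ==> x \<bullet> e j = 0"
 shows "emb e n (\<lambda>k. x \<bullet> e k) = x"
proof -
 have "emb e n (\<lambda>k. x \<bullet> e k) - x = 0" by (rule orthonormal_basis_complete[OF e])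
   (use x in \<open>auto simp: inner_diff_left emb_inner[OF orthonormal_basisD[OF e]]\<close>)
 then show ?thesis by simp
qed

locale forward_setting = wiener M "{0..T}" Q W
 for M :: "'w' measure" and T :: real and Q :: "'h::{real_inner, banach, second_countable_topology} => 'h" and W +
 fixes \<alpha> :: "real => real" and e :: "nat => 'h" and lam :: "nat => real" and X0 :: "'w' => 'h"
 assumes T: "0 < T" and C1: "C1_positive T \<alpha>" and trace_class: "trace_class_operator Q" and inj: "inj Q"
  and onb: "orthonormal_basis e" and eigen: "\<And>k. Q (e k) = lam k *\<^sub>R e k"
  and X0_measurable [measurable]: "X0 \<in> borel_measurable M" and indep: "independent_of_process M {0..T} X0 W"
  and X0_square: "integrable M (\<lambda>w. (norm (X0 w))\<^sup>2)"
begin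

lemmas on = orthonormal_basisD[OF onb]

lemma Q_linear: "bounded_linear Q" using trace_class by (simp add: trace_class_operator_def)

lemma lam_pos: "0 < lam k"
proof -
 have "0 \<le> lam k" using Q_nonneg[of "e k"] by (simp add: eigen on)
 moreover have "lam k \<noteq> 0"
 proof
  assume "lam k = 0"
  then have "Q (e k) = Q 0" using linear_0[OF bounded_linear.linear[OF Q_linear]] by (simp add: eigen)
  then have "e k = 0" using inj by (simp add: inj_eq)
  then show False using on[of k k] by simp
 qed
 ultimately show ?thesis by simp
qed

lemma Q_emb: "Q (emb e n xi) \<bullet> emb e n xi = (\<Sum>k<n. lam k * (xi k)\<^sup>2)"
proof -
 interpret Q: bounded_linear Q by (rule Q_linear)
 have "Q (emb e n xi) = emb e n (\<lambda>k. lam k * xi k)" unfolding emb_def Q.sum Q.scaleR eigen by (simp add: mult.commute)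
 then have "Q (emb e n xi) \<bullet> emb e n xi = (\<Sum>k<n. xi k * (emb e n (\<lambda>k. lam k * xi k) \<bullet> e k))" by (simp add: emb_def[of e n xi] inner_sum_right)
 then show ?thesis by (simp add: emb_inner[OF on] power2_eq_square ac_simps)
qed

lemma wiener_truncation_eq: "wiener_truncation e lam W n s w = truncate e n (W s w)" unfolding wiener_truncation_def KL_coeff_def truncate_def
 using lam_pos by (intro sum.cong refl) (simp add: less_imp_neq[symmetric])

lemma truncate_eq_emb: "truncate e n x = emb e n (\<lambda>k. x \<bullet> e k)" by (simp add: truncate_def emb_def)

lemma truncate_inner: "truncate e n x \<bullet> e k = (if k < n then x \<bullet> e k else 0)" unfolding truncate_eq_emb emb_inner[OF on] ..

lemma truncate_inner_emb: "truncate e n x \<bullet> emb e n xi = x \<bullet> emb e n xi" by (simp add: emb_def inner_sum_right truncate_inner)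

lemma wiener_truncation_measurable: "s \<in> {0..T} ==> wiener_truncation e lam W n s \<in> borel_measurable M"
 unfolding wiener_truncation_eq[abs_def] truncate_eq_emb by (intro borel_measurable_emb) measurable

sublocale X0: mixture M "\<lambda>w k. X0 w \<bullet> e k" n lam for n by unfold_locales (auto intro: lam_pos)

abbreviation "A \<equiv> a_fun \<alpha>"

lemma A_gt_1: "0 < r ==> r \<le> T ==> 1 < A r" using a_fun_mono(2)[OF C1, of 0 r] by simp

lemma A_square: assumes "0 < r" "r \<le> T" shows "0 < (A r)\<^sup>2 - 1" using A_gt_1[OF assms] power_strict_mono[of 1 "A r" 2] by simp

end

locale truncated_forward = forward_setting M T Q W \<alpha> e lam X0
 for M :: "'w' measure" and T :: real and Q :: "'h::{real_inner, banach, second_countable_topology} => 'h" and W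
  and \<alpha> :: "real => real" and e :: "nat => 'h" and lam :: "nat => real" and X0 :: "'w' => 'h" +
 fixes n :: nat and Xt :: "real => 'w' => 'h"
 assumes Xt: "forward_solution M T \<alpha> (wiener_truncation e lam W n) (\<lambda>w. truncate e n (X0 w)) Xt"
begin

lemma Xt_measurable [measurable]: "r \<in> {0..T} ==> Xt r \<in> borel_measurable M"
 using Xt by (simp add: forward_solution_def sde_solution_def continuous_process_def)

lemma char_forward:
 assumes r: "r \<in> {0..T}"
 shows "(CLINT w|M. iexp (\<Sum>k<n. xi k * (A r * (Xt r w \<bullet> e k)))) =
  (CLINT w|M. iexp (\<Sum>k<n. xi k * (X0 w \<bullet> e k))) * complex_of_real (exp (- (((A r)\<^sup>2 - 1) * (\<Sum>k<n. lam k * (xi k)\<^sup>2) / 2)))"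
proof -
 \<comment> \<open>The joint characteristic function at xi is the one-dimensional characteristic
   function, at 1, of the component in this direction.\<close>
 let ?h = "emb e n xi"
 have m [measurable]: "Xt r \<in> borel_measurable M" by (rule Xt_measurable[OF r])
 have "char (distr M borel (\<lambda>w. A r * (Xt r w \<bullet> ?h))) 1 =
  char (distr M borel (\<lambda>w. X0 w \<bullet> ?h)) 1 * complex_of_real (exp (- (1\<^sup>2 * ((Q ?h \<bullet> ?h) * ((A r)\<^sup>2 - 1)) / 2)))"
  by (rule forward_char[OF C1 refl r Xt wiener_truncation_measurable _ _ indep X0_measurable])
   (auto simp: wiener_truncation_eq truncate_inner_emb)
 moreover have "char (distr M borel (\<lambda>w. A r * (Xt r w \<bullet> ?h))) 1 = (CLINT w|M. iexp (\<Sum>k<n. xi k * (A r * (Xt r w \<bullet> e k))))"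
  unfolding char_def by (subst integral_distr) (auto simp: emb_def inner_sum_right sum_distrib_left ac_simps)
 moreover have "char (distr M borel (\<lambda>w. X0 w \<bullet> ?h)) 1 = (CLINT w|M. iexp (\<Sum>k<n. xi k * (X0 w \<bullet> e k)))"
  unfolding char_def by (subst integral_distr) (auto simp: emb_def inner_sum_right)
 ultimately show ?thesis unfolding Q_emb by (simp add: mult.commute)
qed

lemma law_forward:
 assumes r: "0 < r" "r \<le> T"
 shows "distr M borel (\<lambda>w. emb e n (\<lambda>k. A r * (Xt r w \<bullet> e k))) = X0.law n e ((A r)\<^sup>2 - 1)"
proof (rule X0.law_if_smoothed)
 have [measurable]: "Xt r \<in> borel_measurable M" using r by (intro Xt_measurable) auto
 show m: "(\<lambda>w. A r * (Xt r w \<bullet> e k)) \<in> borel_measurable M" for k by measurable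
 show "mix M (\<lambda>w k. A r * (Xt r w \<bullet> e k)) n lam z0 ep c = mix M (\<lambda>w k. X0 w \<bullet> e k) n lam z0 ((A r)\<^sup>2 - 1 + ep) c" if "0 < ep" for ep c
  by (rule X0.mix_eq_if_char[OF m that less_imp_le[OF A_square[OF r]] char_forward]) (use r in auto)
qed (rule A_square[OF r])

text \<open>The score is defined through the density of the unscaled process, so the initial value
  is divided by \<open>A r\<close> and the variance by its square.\<close>

lemma distributed_forward:
 assumes r: "0 < r" "r \<le> T"
 shows "distributed M (lborel_Rn n) (\<lambda>w. iota e n (Xt r w)) (\<lambda>y. ennreal (mix M (\<lambda>w k. X0 w \<bullet> e k / A r) n lam z0 (((A r)\<^sup>2 - 1) / (A r)\<^sup>2) y))"
proof -
 have a: "0 < A r" by (rule a_fun_pos)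
 interpret S: mixture M "\<lambda>w k. X0 w \<bullet> e k / A r" n lam by (rule X0.mixture_scale)
 have [measurable]: "Xt r \<in> borel_measurable M" using r by (intro Xt_measurable) auto
 define v where "v = ((A r)\<^sup>2 - 1) / (A r)\<^sup>2"
 have v: "0 < v" unfolding v_def using A_square[OF r] a by simp
 have law: "distr M borel (\<lambda>w. emb e n (\<lambda>k. Xt r w \<bullet> e k)) = S.law e v"
 proof (rule S.law_if_smoothed[OF _ v])
  show m: "(\<lambda>w. Xt r w \<bullet> e k) \<in> borel_measurable M" for k by measurable
  have char: "(CLINT w|M. iexp (\<Sum>k<n. xi k * (Xt r w \<bullet> e k))) =
   (CLINT w|M. iexp (\<Sum>k<n. xi k * (X0 w \<bullet> e k / A r))) * complex_of_real (exp (- (v * (\<Sum>k<n. lam k * (xi k)\<^sup>2) / 2)))" for xi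
  proof -
   have "((A r)\<^sup>2 - 1) * (\<Sum>k<n. lam k * (xi k / A r)\<^sup>2) = v * (\<Sum>k<n. lam k * (xi k)\<^sup>2)"
    unfolding v_def by (simp add: sum_distrib_left power_divide)
   then show ?thesis using char_forward[of r "\<lambda>k. xi k / A r"] r a by simp
  qed
  show "mix M (\<lambda>w k. Xt r w \<bullet> e k) n lam z0 ep c = S.mx z0 (v + ep) c" if "0 < ep" for ep c by (rule S.mix_eq_if_char[OF m that less_imp_le[OF v] char])
 qed
 have comp: "(\<lambda>x::'h. x \<bullet> e k) \<in> borel_measurable borel" for k by measurable
 have iota_m: "iota e n \<in> borel \<rightarrow>\<^sub>M lborel_Rn n" unfolding iota_def[abs_def] lborel_Rn_def by (rule measurable_restrict) simp
 have emb_m: "(\<lambda>w. emb e n (\<lambda>k. Xt r w \<bullet> e k)) \<in> borel_measurable M" by (rule borel_measurable_emb) measurable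
 have "iota e n (emb e n (\<lambda>k. x \<bullet> e k)) = iota e n x" for x unfolding iota_emb[OF on] by (simp add: iota_def)
 then have "distr M (lborel_Rn n) (\<lambda>w. iota e n (Xt r w)) = distr (distr M borel (\<lambda>w. emb e n (\<lambda>k. Xt r w \<bullet> e k))) (lborel_Rn n) (iota e n)"
  by (subst distr_distr[OF iota_m emb_m]) (simp add: comp_def)
 also have "\<dots> = distr (density (lborel_Rn n) (\<lambda>y. ennreal (S.mx z0 v y))) (lborel_Rn n) (\<lambda>y. iota e n (emb e n y))"
  unfolding law S.law_def using S.emb_measurable_lborel_Rn[of e] by (subst distr_distr[OF iota_m]) (simp_all add: comp_def)
 also have "\<dots> = distr (density (lborel_Rn n) (\<lambda>y. ennreal (S.mx z0 v y))) (lborel_Rn n) (\<lambda>y. y)"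
  by (rule distr_cong) (auto simp: iota_emb[OF on] Rn_def PiE_restrict)
 also have "\<dots> = density (lborel_Rn n) (\<lambda>y. ennreal (S.mx z0 v y))" by (rule distr_id2) simp
 finally show ?thesis unfolding v_def[symmetric] distributed_def using S.mix_measurable_lborel_Rn[OF v] measurable_compose[OF Xt_measurable iota_m] r by auto
qed

text \<open>Orthogonally to \<open>Hn e n\<close> the equation has no noise; the zero process is the Wiener process
 with covariance zero, so that the componentwise results apply.\<close>

lemma forward_orthogonal:
 assumes r: "r \<in> {0..T}" and j: "n \<le> j"
 shows "AE w in M. Xt r w \<bullet> e j = 0"
proof -
 have w0: "wiener_process M {0..T} (\<lambda>_. 0 :: 'h) (\<lambda>_ _. 0)" unfolding wiener_process_def
 proof (intro conjI ballI impI)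
  show "continuous_process M {0..T} (\<lambda>_ _. 0 :: 'h)" by (simp add: continuous_process_def)
  show "independent_increments M {0..T} (\<lambda>_ _. 0 :: 'h)" unfolding independent_increments_def
  proof (intro allI impI)
   fix m :: nat and ta :: "nat => real"
   assume "(\<forall>i\<le>m. ta i \<in> {0..T}) \<and> (\<forall>i<m. ta i \<le> ta (Suc i))"
   \<comment> \<open>Independence of the zero increments is inherited from those of \<open>W\<close>
     by composition with the zero map.\<close>
   then have "indep_vars (\<lambda>_. borel) (\<lambda>i w. W (ta (Suc i)) w - W (ta i) w) {..<m}"
    using wiener unfolding wiener_process_def independent_increments_def by blast
   from indep_vars_compose2[OF this, where Y="\<lambda>_ _. 0 :: 'h" and N="\<lambda>_. borel"]
   show "indep_vars (\<lambda>_. borel) (\<lambda>i w. (0 :: 'h) - 0) {..<m}" by simp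
  qed
  show "gaussian_law (distr M borel (\<lambda>w. (0 :: 'h) - 0)) 0 (\<lambda>x. (t - s) *\<^sub>R 0)" for s t
  proof -
   have "distr M borel (\<lambda>w. c) = return borel c" for c :: "'z::topological_space" by (rule measure_eqI) (auto simp: emeasure_distr indicator_def emeasure_space_1)
   then show ?thesis by (simp add: gaussian_law_def distr_return normal_law_def)
  qed
 qed simp
 interpret Z: wiener M "{0..T}" "\<lambda>_. 0 :: 'h" "\<lambda>_ _. 0" by unfold_locales (use w0 T in auto)
 obtain J where J: "J \<in> borel_measurable M" "AE w in M. A r * (Xt r w \<bullet> e j) = truncate e n (X0 w) \<bullet> e j + J w"
  "(\<lambda>m. \<integral>\<^sup>+w. ennreal ((J w - (\<Sum>i<Suc m. A (grid 0 r m i) * sqrt (\<alpha> (grid 0 r m i)) * ((0::'h) \<bullet> e j - 0 \<bullet> e j)))\<^sup>2) \<partial>M) \<longlonglongrightarrow> 0"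
  using Z.forward_component[where h="e j", OF C1 refl r Xt wiener_truncation_measurable] j by (auto simp: wiener_truncation_eq truncate_inner)
 have "(\<integral>\<^sup>+w. ennreal ((J w)\<^sup>2) \<partial>M) = 0" using LIMSEQ_unique[OF J(3), of "\<integral>\<^sup>+w. ennreal ((J w)\<^sup>2) \<partial>M"] by simp
 then have "AE w in M. ennreal ((J w)\<^sup>2) = 0" using J(1) by (subst (asm) nn_integral_0_iff_AE) auto
 then show ?thesis using J(2)
 proof eventually_elim
  case (elim w)
  then show ?case using j a_fun_pos[of \<alpha> r] by (simp add: truncate_inner ennreal_eq_0_iff)
 qed
qed

lemma forward_in_Hn:
 assumes r: "r \<in> {0..T}" shows "AE w in M. emb e n (\<lambda>k. Xt r w \<bullet> e k) = Xt r w"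
proof -
 have "AE w in M. \<forall>j. n \<le> j --> Xt r w \<bullet> e j = 0" unfolding AE_all_countable using forward_orthogonal[OF r] by auto
 then show ?thesis by eventually_elim (rule emb_inner_eq[OF onb], auto)
qed

end

section \<open>The law of the reverse process\<close>

lemma ql_mix_cong: "(\<And>k. k < n ==> y k = y' k) ==> mixture M X n lam ==> ql (mix M X n lam) z th y = ql (mix M X n lam) z th y'"
 unfolding ql_def using mixture.mix_cong[of M X n lam y y'] by metis

lemma emb_scale: "emb e n (\<lambda>k. a * c k) = a *\<^sub>R emb e n c" by (simp add: emb_def scaleR_sum_right)

locale reverse_setting = truncated_forward M T Q W \<alpha> e lam X0 n Xt
 for M :: "'w' measure" and T :: real and Q :: "'h::{real_inner, banach, second_countable_topology} => 'h" and W
  and \<alpha> :: "real => real" and e :: "nat => 'h" and lam :: "nat => real" and X0 :: "'w' => 'h"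
  and n :: nat and Xt :: "real => 'w' => 'h" +
 fixes P :: "'v measure" and F :: "real => 'v measure" and V Y :: "real => 'v => 'h"
 assumes rev: "reverse_weak_solution M T \<alpha> e lam n Xt P F V Y"
begin

lemma Qn_inner: "Qn e lam n x \<bullet> y = (\<Sum>k<n. lam k * (e k \<bullet> x) * (e k \<bullet> y))" by (simp add: Qn_def inner_sum_left mult.assoc)

sublocale FW: filtered_wiener P "{0..<T}" "Qn e lam n" V F
proof -
 have "0 \<le> Qn e lam n x \<bullet> x" for x unfolding Qn_inner mult.assoc by (intro sum_nonneg mult_nonneg_nonneg less_imp_le[OF lam_pos] zero_le_square)
 moreover have P: "prob_space P" "normal_filtration P T F" "wiener_process_wrt P F {0..<T} (Qn e lam n) V"
  using rev unfolding reverse_weak_solution_def by - (elim conjE, assumption)+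
 moreover have "\<forall>t\<in>{0..<T}. subalgebra P (F t)" "\<forall>s\<in>{0..<T}. \<forall>t\<in>{0..<T}. s \<le> t --> sets (F s) \<subseteq> sets (F t)"
  using P(2) unfolding normal_filtration_def by - (elim conjE, assumption)+
 moreover have "wiener_process P {0..<T} (Qn e lam n) V" using P(3) unfolding wiener_process_wrt_def by (elim conjE)
 ultimately show "filtered_wiener P {0..<T} (Qn e lam n) V F"
  using T by (intro filtered_wiener.intro wiener.intro wiener_axioms.intro filtered_wiener_axioms.intro) simp_all
qed

abbreviation hm :: "(nat => nat) => real => (nat => real) => real" where
 "hm \<equiv> mix M (\<lambda>w k. X0 w \<bullet> e k) n lam"

text \<open>The variance, per unit of \<open>lam k\<close>, of the noise in the rescaled forward
  process at time \<open>T - s\<close>. It decreases in reverse time, and \<open>ka\<close> is the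
  negative of its derivative.\<close>

definition th :: "real => real" where "th s = (A (T - s))\<^sup>2 - 1"
definition ka :: "real => real" where "ka r = \<alpha> (T - r) * (A (T - r))\<^sup>2"
definition U :: "real => 'v => nat => real" where "U s w k = A (T - s) * (Y s w \<bullet> e k)"

lemma Y_adapted: "s \<in> {0..<T} ==> Y s \<in> borel_measurable (F s)" using rev by (simp add: reverse_weak_solution_def)

lemma Y_measurable: "s \<in> {0..<T} ==> Y s \<in> borel_measurable P" by (rule FW.measurable_F_M[OF _ Y_adapted])

lemma th_pos: "0 \<le> s ==> s < T ==> 0 < th s" unfolding th_def by (rule A_square) auto

lemma th_strict: "0 \<le> s ==> s < s' ==> s' \<le> T ==> th s' < th s"
 unfolding th_def using a_fun_mono(2)[OF C1, of "T - s'" "T - s"] a_fun_pos[of \<alpha> "T - s'"] by (simp add: power_strict_mono less_imp_le)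

lemma A_reverse_derivative:
 assumes r: "r \<in> {0..T}"
 shows "((\<lambda>r. A (T - r)) has_real_derivative (- (1 / 2 * \<alpha> (T - r) * A (T - r)))) (at r within {0..T})"
proof -
 have "(A has_real_derivative (1 / 2 * \<alpha> (T - r) * A (T - r))) (at (T - r) within (\<lambda>r. T - r) ` {0..T})"
  by (rule has_field_derivative_subset[OF a_fun_has_derivative[OF C1_positive_continuous[OF C1]]]) (use r in auto)
 then have "((A \<circ> (\<lambda>r. T - r)) has_real_derivative (1 / 2 * \<alpha> (T - r) * A (T - r)) * (-1)) (at r within {0..T})"
  by (rule DERIV_image_chain) (auto intro!: derivative_eq_intros)
 then show ?thesis by (simp add: comp_def)
qed

lemma A_reverse_continuous: "continuous_on {0..T} (\<lambda>r. A (T - r))" by (rule DERIV_continuous_on[OF A_reverse_derivative])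

lemma \<alpha>_reverse_continuous: "continuous_on {0..T} (\<lambda>r. \<alpha> (T - r))"
 by (rule continuous_on_compose2[OF C1_positive_continuous[OF C1]]) (auto intro!: continuous_intros)

lemma \<alpha>_pos: "r \<in> {0..T} ==> 0 < \<alpha> r" using C1 by (simp add: C1_positive_def)

lemma th_cont: "continuous_on {0..T} th" unfolding th_def[abs_def] by (intro continuous_intros A_reverse_continuous)

lemma ka_cont: "continuous_on {0..T} ka" unfolding ka_def[abs_def] by (intro continuous_intros A_reverse_continuous \<alpha>_reverse_continuous)

lemma integral_ka:
 assumes s: "0 \<le> s" "s \<le> s'" "s' \<le> T"
 shows "integral {s..s'} ka = th s - th s'"
proof -
 have "(ka has_integral (- th s' - - th s)) {s..s'}"
 proof (rule fundamental_theorem_of_calculus[OF s(2)])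
  fix r assume r: "r \<in> {s..s'}"
  have "((\<lambda>r. - th r) has_real_derivative ka r) (at r within {0..T})" unfolding th_def using r s
   by (auto intro!: derivative_eq_intros A_reverse_derivative simp: ka_def power2_eq_square)
  then have "((\<lambda>r. - th r) has_real_derivative ka r) (at r within {s..s'})" by (rule has_field_derivative_subset) (use s in auto)
  then show "((\<lambda>r. - th r) has_vector_derivative ka r) (at r within {s..s'})" by (simp add: has_real_derivative_iff_has_vector_derivative)
 qed
 then show ?thesis by (simp add: integral_unique)
qed

lemma score_component:
 assumes r: "0 \<le> r" "r < T" and k: "k < n"
 shows "discrete_score M T \<alpha> e lam n Xt r x \<bullet> e k = \<alpha> (T - r) * lam k * (A (T - r) * ql hm (k, 1) (th r) (\<lambda>k. A (T - r) * (x \<bullet> e k)))"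
proof -
 interpret S: mixture M "\<lambda>w k. X0 w \<bullet> e k / A (T - r)" n lam by (rule X0.mixture_scale)
 have a: "0 < A (T - r)" by (rule a_fun_pos)
 have "0 < th r / (A (T - r))\<^sup>2" using th_pos[OF r] a by simp
 then have "discrete_score M T \<alpha> e lam n Xt r x \<bullet> e k = \<alpha> (T - r) * lam k * ql S.mx (k, 1) (th r / (A (T - r))\<^sup>2) (iota e n x)"
  using distributed_forward[of "T - r"] r by (intro S.discrete_score_component prob_space_axioms on k) (auto simp: th_def)
 also have "ql S.mx (k, 1) (th r / (A (T - r))\<^sup>2) (iota e n x) = A (T - r) * ql hm (k, 1) (th r) (\<lambda>k. A (T - r) * iota e n x k)"
  by (rule X0.ql_mix_scale[OF th_pos[OF r] a k])
 also have "ql hm (k, 1) (th r) (\<lambda>k. A (T - r) * iota e n x k) = ql hm (k, 1) (th r) (\<lambda>k. A (T - r) * (x \<bullet> e k))"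
  by (rule ql_mix_cong[OF _ X0.mixture_axioms]) (simp add: iota_def)
 finally show ?thesis .
qed

definition noise :: "real => real" where "noise r = A (T - r) * sqrt (\<alpha> (T - r))"

lemma noise_cont: "continuous_on {0..T} noise" unfolding noise_def[abs_def] by (intro continuous_intros A_reverse_continuous \<alpha>_reverse_continuous)

lemma noise_square: "r \<in> {0..T} ==> (noise r)\<^sup>2 = ka r" using \<alpha>_pos[of "T - r"] by (simp add: noise_def ka_def power_mult_distrib)

lemma integral_noise_square:
 assumes s: "0 \<le> s" "s \<le> s'" "s' \<le> T" shows "integral {s..s'} (\<lambda>r. (noise r)\<^sup>2) = th s - th s'"
 unfolding integral_ka[OF s, symmetric] by (rule integral_cong) (use s in \<open>auto intro: noise_square\<close>)

lemma hm_heat_family: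
 assumes t: "0 \<le> t" "t < T" shows "heat_family n lam (th t) (th 0) hm"
proof (rule X0.heat_family_mix[OF th_pos[OF t]])
 show "th t \<le> th 0" using th_strict[of 0 t] t by (cases "t = 0") auto
qed

lemma Y_paths: "AE w in P. continuous_on {0..<T} (\<lambda>s. Y s w)" using rev by (simp add: reverse_weak_solution_def sde_solution_def continuous_process_def)

lemma U_paths:
 assumes t: "0 \<le> t" "t < T" shows "AE w in P. \<forall>k. continuous_on {0..t} (\<lambda>s. U s w k)" using Y_paths
proof eventually_elim
 case (elim w)
 have "continuous_on {0..t} (\<lambda>s. Y s w)" by (rule continuous_on_subset[OF elim]) (use t in auto)
 moreover have "continuous_on {0..t} (\<lambda>r. A (T - r))" by (rule continuous_on_subset[OF A_reverse_continuous]) (use t in auto)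
 ultimately show ?case unfolding U_def by (intro allI continuous_intros)
qed

text \<open>The factor \<open>A (T - r)\<close> is the integrating factor of the linear drift in the
  reverse equation; after multiplication only the score is left as drift. The score of the unscaled
  density contributes another factor \<open>A\<close>, which explains the square in
  \<open>ka\<close>.\<close>

lemma increment_exists:
 assumes s: "0 \<le> s" "s < s'" "s' < T" and k: "k < n"
 shows "\<exists>J. FW.ms_limit (e k) noise s s' J \<and>
  (AE w in P. U s' w k - U s w k = integral {s..s'} (\<lambda>r. ka r * lam k * ql hm (k, 1) (th r) (U r w)) + J w)"
proof -
 interpret wi: wiener_isometry P "\<lambda>t w. V t w \<bullet> e k" "{0..<T}" "Qn e lam n (e k) \<bullet> e k" by (rule FW.wiener_isometry_component)
 define d where "d w r = \<alpha> (T - r) * lam k * (A (T - r) * ql hm (k, 1) (th r) (U r w))" for w r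
 have sub: "{0..s'} \<subseteq> {0..T}" "{0..s'} \<subseteq> {0..<T}" using s by auto
 have Ac: "continuous_on {0..s'} (\<lambda>r. A (T - r))" by (rule continuous_on_subset[OF A_reverse_continuous sub(1)])
 have \<alpha>c: "continuous_on {0..s'} (\<lambda>r. \<alpha> (T - r))" by (rule continuous_on_subset[OF \<alpha>_reverse_continuous sub(1)])
 obtain Z where Z: "\<forall>r\<in>{0..<T}. is_stoch_integral P (\<lambda>t w. V t w \<bullet> e k) (\<lambda>r. sqrt (\<alpha> (T - r))) r (Z r)"
  and eq: "AE w in P. continuous_on {0..<T} (\<lambda>t. Y t w) \<and> continuous_on {0..<T} (\<lambda>t. Y t w \<bullet> e k) \<and>
   (\<forall>r\<in>{0..<T}. Y r w \<bullet> e k = Y 0 w \<bullet> e k + integral {0..r} (\<lambda>u. ((1 / 2 * \<alpha> (T - u)) *\<^sub>R Y u w + discrete_score M T \<alpha> e lam n Xt u (Y u w)) \<bullet> e k) + Z r w)"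
 proof -
  have sol: "sde_solution P {0..<T} V (\<lambda>t y. (1 / 2 * \<alpha> (T - t)) *\<^sub>R y + discrete_score M T \<alpha> e lam n Xt t y) (\<lambda>t. sqrt (\<alpha> (T - t))) (Y 0) Y"
   using rev by (simp add: reverse_weak_solution_def)
  have I: "{0..r} \<subseteq> {0..<T}" if "r \<in> {0..<T}" for r using that by auto
  from sde_solution_component[OF sol FW.W_measurable I, of "e k"] show ?thesis using that by blast
 qed
 have UP: "AE w in P. \<forall>k. continuous_on {0..s'} (\<lambda>s. U s w k)" by (rule U_paths) (use s in auto)
 have path: "AE w in P. continuous_on {0..s'} (\<lambda>r. Y r w \<bullet> e k) \<and> continuous_on {0..s'} (d w) \<and>
  (\<forall>r\<in>{0..s'}. Y r w \<bullet> e k = Y 0 w \<bullet> e k + integral {0..r} (\<lambda>u. 1 / 2 * \<alpha> (T - u) * (Y u w \<bullet> e k) + d w u) + Z r w)"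
  using eq UP
 proof eventually_elim
  case (elim w)
  have "continuous_on {0..s'} (\<lambda>r. hm b (th r) (U r w))" for b
  proof (rule heat_family_path_continuous[OF hm_heat_family[of s']])
   show "continuous_on {0..s'} th" by (rule continuous_on_subset[OF th_cont sub(1)])
   show "th r \<in> {th s'..th 0}" if "r \<in> {0..s'}" for r using th_strict[of r s'] th_strict[of 0 r] that s by (cases "r = 0"; cases "r = s'") (auto intro: less_imp_le)
  qed (use elim s in auto)
  then have "continuous_on {0..s'} (\<lambda>r. ql hm (k, 1) (th r) (U r w))"
   unfolding ql_def using X0.mix_pos[OF th_pos] s by (intro continuous_intros) (auto simp: less_imp_neq[symmetric])
  then have dc: "continuous_on {0..s'} (d w)" unfolding d_def by (intro continuous_intros Ac \<alpha>c)
  have int: "integral {0..r} (\<lambda>u. ((1 / 2 * \<alpha> (T - u)) *\<^sub>R Y u w + discrete_score M T \<alpha> e lam n Xt u (Y u w)) \<bullet> e k) =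
    integral {0..r} (\<lambda>u. 1 / 2 * \<alpha> (T - u) * (Y u w \<bullet> e k) + d w u)" if "r \<in> {0..s'}" for r
   by (rule integral_cong) (use that s score_component[OF _ _ k] in \<open>auto simp: inner_add_left d_def U_def[abs_def]\<close>)
  show ?case
  proof (intro conjI ballI)
   show "continuous_on {0..s'} (\<lambda>r. Y r w \<bullet> e k)" by (rule continuous_on_subset[OF conjunct1[OF conjunct2[OF elim(1)]] sub(2)])
   fix r assume r: "r \<in> {0..s'}"
   show "Y r w \<bullet> e k = Y 0 w \<bullet> e k + integral {0..r} (\<lambda>u. 1 / 2 * \<alpha> (T - u) * (Y u w \<bullet> e k) + d w u) + Z r w"
    unfolding int[OF r, symmetric] by (rule bspec[OF conjunct2[OF conjunct2[OF elim(1)]]]) (use r sub(2) in blast)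
  qed (rule dc)
 qed
 have "\<exists>J\<in>borel_measurable P. (AE w in P. J w = A (T - s') * (Y s' w \<bullet> e k) - A (T - s) * (Y s w \<bullet> e k) - integral {s..s'} (\<lambda>r. A (T - r) * d w r)) \<and>
  (\<lambda>m. \<integral>\<^sup>+w. ennreal ((J w - (\<Sum>i<Suc m. A (T - grid s s' m i) * sqrt (\<alpha> (T - grid s s' m i)) * (V (grid s s' m (Suc i)) w \<bullet> e k - V (grid s s' m i) w \<bullet> e k)))\<^sup>2) \<partial>P) \<longlonglongrightarrow> 0"
 proof (rule wi.linear_sde_increment[where b=s' and A="\<lambda>r. A (T - r)" and c="\<lambda>r. 1 / 2 * \<alpha> (T - r)" and Z=Z and ?x0.0="\<lambda>w. Y 0 w \<bullet> e k" and x="\<lambda>w r. Y r w \<bullet> e k" and d=d])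
  show "continuous_on {0..s'} (\<lambda>r. sqrt (\<alpha> (T - r)))" "continuous_on {0..s'} (\<lambda>r. 1 / 2 * \<alpha> (T - r))" by (intro continuous_intros \<alpha>c)+
  show "((\<lambda>r. A (T - r)) has_real_derivative - (1 / 2 * \<alpha> (T - r) * A (T - r))) (at r within {0..s'})" if "r \<in> {0..s'}" for r
   by (rule has_field_derivative_subset[OF A_reverse_derivative sub(1)]) (use that s in auto)
 qed (use s Z path in auto)
 then obtain J where J: "J \<in> borel_measurable P"
  "AE w in P. J w = A (T - s') * (Y s' w \<bullet> e k) - A (T - s) * (Y s w \<bullet> e k) - integral {s..s'} (\<lambda>r. A (T - r) * d w r)"
  "(\<lambda>m. \<integral>\<^sup>+w. ennreal ((J w - (\<Sum>i<Suc m. A (T - grid s s' m i) * sqrt (\<alpha> (T - grid s s' m i)) * (V (grid s s' m (Suc i)) w \<bullet> e k - V (grid s s' m i) w \<bullet> e k)))\<^sup>2) \<partial>P) \<longlonglongrightarrow> 0"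
  by blast
 have ms: "FW.ms_limit (e k) noise s s' J" using J(1,3) unfolding FW.ms_limit_def FW.grid_sum_def noise_def by simp
 have Ad: "A (T - r) * d w r = ka r * lam k * ql hm (k, 1) (th r) (U r w)" for r w by (simp add: d_def ka_def power2_eq_square)
 have "AE w in P. U s' w k - U s w k = integral {s..s'} (\<lambda>r. ka r * lam k * ql hm (k, 1) (th r) (U r w)) + J w" using J(2) by eventually_elim (simp add: U_def Ad)
 with ms show ?thesis by blast
qed

text \<open>At time 0 the denominator is the density of the law of \<open>U 0\<close>, so
  integrating the quotient returns the total mass of the kernel in the numerator.\<close>

lemma initial_quotient:
 assumes ep: "0 < ep"
 shows "(\<integral>\<^sup>+w. ennreal (pk n lam z0 ep (\<lambda>k. U 0 w k - c k) / hm z0 (th 0) (U 0 w)) \<partial>P) = 1"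
proof -
 define q where "q y = pk n lam z0 ep (\<lambda>k. y k - c k) / hm z0 (th 0) y" for y
 have q_cong: "q y = q y'" if "\<And>k. k < n ==> y k = y' k" for y y'
  unfolding q_def using X0.mix_cong[OF that] pk_cong[of n "\<lambda>k. y k - c k" "\<lambda>k. y' k - c k"] that by simp
 have T0: "0 < th 0" using th_pos[of 0] T by simp
 have q_meas: "(\<lambda>x. q (y x)) \<in> borel_measurable G" if "\<And>k. k < n ==> (\<lambda>x. y x k) \<in> borel_measurable G" for y :: "'z => nat => real" and G
  unfolding q_def by (intro borel_measurable_divide borel_measurable_pk X0.borel_measurable_mix T0 ep lam_pos borel_measurable_diff that borel_measurable_const)
 \<comment> \<open>The initial condition equates laws on the Hilbert space, so the quotient is first
   turned into a function there.\<close>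
 define g where "g x = ennreal (q (\<lambda>k. x \<bullet> e k))" for x :: 'h
 have g_m [measurable]: "g \<in> borel_measurable borel" unfolding g_def[abs_def] by (intro measurable_compose[OF q_meas measurable_ennreal]) measurable
 have ge: "g (emb e n y) = ennreal (q y)" for y unfolding g_def by (intro arg_cong[where f=ennreal] q_cong) (simp add: emb_inner[OF on])
 have [measurable]: "Y 0 \<in> borel_measurable P" using T by (intro Y_measurable) auto
 have [measurable]: "Xt T \<in> borel_measurable M" using T by (intro Xt_measurable) auto
 have em: "(\<lambda>x::'h. emb e n (\<lambda>k. A T * (x \<bullet> e k))) \<in> borel_measurable borel" by (rule borel_measurable_emb) measurable
 have em': "(\<lambda>w. emb e n (\<lambda>k. A T * (Xt T w \<bullet> e k))) \<in> borel_measurable M" by (rule borel_measurable_emb) measurable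
 note mm [measurable] = X0.mix_measurable_lborel_Rn[OF T0, of n "\<lambda>_. 0"] X0.emb_measurable_lborel_Rn[of e n]
 have "(\<integral>\<^sup>+w. ennreal (q (U 0 w)) \<partial>P) = (\<integral>\<^sup>+w. g (emb e n (\<lambda>k. A T * (Y 0 w \<bullet> e k))) \<partial>P)"
  unfolding ge by (simp add: U_def[abs_def])
 also have "\<dots> = (\<integral>\<^sup>+x. g (emb e n (\<lambda>k. A T * (x \<bullet> e k))) \<partial>distr P borel (Y 0))"
  by (rule nn_integral_distr[symmetric]) (use measurable_compose[OF em g_m] in auto)
 also have "distr P borel (Y 0) = distr M borel (Xt T)" using rev by (simp add: reverse_weak_solution_def)
 also have "(\<integral>\<^sup>+x. g (emb e n (\<lambda>k. A T * (x \<bullet> e k))) \<partial>distr M borel (Xt T)) = (\<integral>\<^sup>+w. g (emb e n (\<lambda>k. A T * (Xt T w \<bullet> e k))) \<partial>M)"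
  by (rule nn_integral_distr) (use measurable_compose[OF em g_m] in auto)
 also have "\<dots> = (\<integral>\<^sup>+x. g x \<partial>distr M borel (\<lambda>w. emb e n (\<lambda>k. A T * (Xt T w \<bullet> e k))))"
  by (rule nn_integral_distr[OF em', symmetric]) (simp add: g_m)
 also have "distr M borel (\<lambda>w. emb e n (\<lambda>k. A T * (Xt T w \<bullet> e k))) = X0.law n e (th 0)"
  unfolding th_def diff_zero by (rule law_forward[OF T order_refl])
 also have "(\<integral>\<^sup>+x. g x \<partial>X0.law n e (th 0)) = (\<integral>\<^sup>+y. g (emb e n y) \<partial>density (lborel_Rn n) (\<lambda>y. ennreal (hm z0 (th 0) y)))"
  unfolding X0.law_def by (rule nn_integral_distr) simp_all
 also have "\<dots> = (\<integral>\<^sup>+y. ennreal (hm z0 (th 0) y) * g (emb e n y) \<partial>lborel_Rn n)" by (rule nn_integral_density) simp_all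
 also have "\<dots> = (\<integral>\<^sup>+y. ennreal (pk n lam z0 ep (\<lambda>k. y k - c k)) \<partial>lborel_Rn n)"
  unfolding ge using X0.mix_pos[OF T0, of n] less_imp_le[OF X0.mix_pos[OF T0, of n]]
  by (intro nn_integral_cong) (simp add: q_def ennreal_mult'[symmetric] less_imp_neq[symmetric])
 also have "\<dots> = 1" by (rule nn_integral_lborel_Rn_pk[OF ep lam_pos])
 finally show ?thesis unfolding q_def .
qed

lemma reverse_quotient_bounded:
 assumes t: "0 < t" "t < T" and ep: "0 < ep"
 shows "(\<integral>\<^sup>+w. ennreal (pk n lam z0 ep (\<lambda>k. c k - U t w k) / hm z0 (th t) (U t w)) \<partial>P) \<le> 1"
proof -
 \<comment> \<open>The noise is chosen separately for each interval and each coordinate.\<close>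
 define J where "J s s' k = (SOME J. FW.ms_limit (e k) noise s s' J \<and>
  (AE w in P. U s' w k - U s w k = integral {s..s'} (\<lambda>r. ka r * lam k * ql hm (k, 1) (th r) (U r w)) + J w))" for s s' k
 have J: "FW.ms_limit (e k) noise s s' (J s s' k)"
  "AE w in P. U s' w k - U s w k = integral {s..s'} (\<lambda>r. ka r * lam k * ql hm (k, 1) (th r) (U r w)) + J s s' k w"
  if "0 \<le> s" "s < s'" "s' \<le> t" "k < n" for s s' k using someI_ex[OF increment_exists[of s s' k]] that t unfolding J_def by auto
 \<comment> \<open>The shift makes the variance of the kernel equal to ep when the parameter is
   \<open>th t\<close>; for larger parameters it is larger, hence always positive.\<close>
 define N where "N d th' y = pk n lam d (th' + (ep - th t)) (\<lambda>k. y k - c k)" for d th' y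
 have Qk: "Qn e lam n (e k) \<bullet> e k = lam k" if "k < n" for k using that by (simp add: Qn_inner on if_distrib[of "\<lambda>x. _ * x"] cong: if_cong)
 have Qkl: "Qn e lam n (e k + e l) \<bullet> (e k + e l) = lam k + lam l" if "k < n" "l < n" "k \<noteq> l" for k l
  using that by (simp add: Qn_inner on inner_add_right algebra_simps sum.distrib if_distrib[of "\<lambda>x. _ * x"] cong: if_cong)
 have nc: "continuous_on {s..s'} noise" if "0 \<le> s" "s' \<le> t" for s s' by (rule continuous_on_subset[OF noise_cont]) (use that t in auto)
 have tT: "{0..t} \<subseteq> {0..T}" "{0..t} \<subseteq> {0..<T}" using t by auto
 have rng: "0 < th' \<and> 0 < th' + (ep - th t)" if "th' \<in> {th t..th 0}" for th' using that th_pos[of t] t ep by auto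
 have tht0: "th t \<le> th 0" using th_strict[of 0 t] t by auto
 have mom: "integrable P (\<lambda>w. J s s' k w ^ i)"
  "FW.expectation (\<lambda>w. J s s' k w ^ 4) = 3 * (lam k * (th s - th s'))\<^sup>2"
  "\<And>ps b. ps \<in> borel_measurable (F s) ==> (\<And>w. \<bar>ps w\<bar> \<le> b) ==> FW.expectation (\<lambda>w. ps w * J s s' k w) = 0"
  "\<And>ps b. ps \<in> borel_measurable (F s) ==> (\<And>w. \<bar>ps w\<bar> \<le> b) ==> FW.expectation (\<lambda>w. ps w * (J s s' k w)\<^sup>2) = lam k * (th s - th s') * FW.expectation ps"
  if s: "0 \<le> s" "s < s'" "s' \<le> t" and k: "k < n" for s s' k i
 proof -
  have s2: "s \<le> s'" "{s..s'} \<subseteq> {0..<T}" using s t by auto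
  have v: "Qn e lam n (e k) \<bullet> e k * integral {s..s'} (\<lambda>r. (noise r)\<^sup>2) = lam k * (th s - th s')"
   using Qk[OF k] integral_noise_square[of s s'] s t by simp
  note m = FW.ms_limit_moments[OF s2 nc[OF s(1,3)] J(1)[OF s k], unfolded v]
  show "integrable P (\<lambda>w. J s s' k w ^ i)" "FW.expectation (\<lambda>w. J s s' k w ^ 4) = 3 * (lam k * (th s - th s'))\<^sup>2" by (rule m(1) m(2))+
  show "FW.expectation (\<lambda>w. ps w * J s s' k w) = 0" if "ps \<in> borel_measurable (F s)" "\<And>w. \<bar>ps w\<bar> \<le> b" for ps b by (rule m(3)[OF that])
  show "FW.expectation (\<lambda>w. ps w * (J s s' k w)\<^sup>2) = lam k * (th s - th s') * FW.expectation ps" if "ps \<in> borel_measurable (F s)" "\<And>w. \<bar>ps w\<bar> \<le> b" for ps b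
   by (rule m(4)[OF that])
 qed
 \<comment> \<open>Mixed moments by polarisation: the sum of two components is the component in
   direction \<open>e k + e l\<close>, whose variance is the sum of the two, so the mixed term is
   0.\<close>
 have J2: "FW.expectation (\<lambda>w. ps w * (J s s' k w * J s s' l w)) = (if k = l then lam k * (th s - th s') * FW.expectation ps else 0)"
  if s: "0 \<le> s" "s < s'" "s' \<le> t" and k: "k < n" and l: "l < n" and ps: "ps \<in> borel_measurable (F s)" "\<And>w. \<bar>ps w\<bar> \<le> b" for s s' k l ps b
 proof (cases "k = l")
  case True
  then show ?thesis using mom(4)[OF s k ps] by (simp add: power2_eq_square)
 next
  case False
  have s2: "s \<le> s'" "{s..s'} \<subseteq> {0..<T}" using s t by auto
  have v: "Qn e lam n (e k + e l) \<bullet> (e k + e l) * integral {s..s'} (\<lambda>r. (noise r)\<^sup>2) = (lam k + lam l) * (th s - th s')"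
   using Qkl[OF k l False] integral_noise_square[of s s'] s t by simp
  note m = FW.ms_limit_moments[OF s2 nc[OF s(1,3)] FW.ms_limit_add[OF s2 J(1)[OF s k] J(1)[OF s l]], unfolded v]
  have psP [measurable]: "ps \<in> borel_measurable P" by (rule FW.measurable_F_M[OF _ ps(1)]) (use s t in auto)
  have iw: "integrable P (\<lambda>w. ps w * f w)" if "integrable P f" for f :: "'v => real"
  proof (rule Bochner_Integration.integrable_bound[of P "\<lambda>w. b * f w"])
   have "0 \<le> b" using ps(2)[of undefined] by linarith
   then show "AE w in P. norm (ps w * f w) \<le> norm (b * f w)" using ps(2) by (intro AE_I2) (simp add: abs_mult mult_right_mono)
  qed (use that in auto)
  note i = iw[OF m(1)[of 2]] iw[OF mom(1)[OF s k, of 2]] iw[OF mom(1)[OF s l, of 2]]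
  have pw: "ps w * (J s s' k w * J s s' l w) = (ps w * (J s s' k w + J s s' l w)\<^sup>2 - ps w * (J s s' k w)\<^sup>2 - ps w * (J s s' l w)\<^sup>2) / 2" for w
   by (simp add: power2_eq_square algebra_simps)
  have "FW.expectation (\<lambda>w. ps w * (J s s' k w * J s s' l w)) =
   FW.expectation (\<lambda>w. (ps w * (J s s' k w + J s s' l w)\<^sup>2 - ps w * (J s s' k w)\<^sup>2 - ps w * (J s s' l w)\<^sup>2) / 2)" unfolding pw ..
  also have "\<dots> = (FW.expectation (\<lambda>w. ps w * (J s s' k w + J s s' l w)\<^sup>2) - FW.expectation (\<lambda>w. ps w * (J s s' k w)\<^sup>2) - FW.expectation (\<lambda>w. ps w * (J s s' l w)\<^sup>2)) / 2"
   using i by simp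
  also have "\<dots> = 0" unfolding m(4)[OF ps] mom(4)[OF s k ps] mom(4)[OF s l ps] by (simp add: algebra_simps)
  finally show ?thesis using False by simp
 qed
 \<comment> \<open>The heat kernel centred at c is the mixture of a constant, so its heat equation
   estimates are those of mixtures.\<close>
 interpret C: mixture M "\<lambda>_. c" n lam by unfold_locales (auto intro: lam_pos)
 have Cmx: "C.mx d th' y = pk n lam d th' (\<lambda>k. y k - c k)" for d th' y by (simp add: mix_def prob_space)
 interpret rp: reverse_process P F t n lam th ka U J N hm
 proof (unfold_locales, goal_cases)
  case 1 show ?case by (rule t)
 next case (2 k) show ?case by (rule lam_pos)
 next case 3 show ?case by (rule continuous_on_subset[OF th_cont tT(1)])
 next case 4 show ?case by (rule continuous_on_subset[OF ka_cont tT(1)])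
 next case (5 r) then show ?case unfolding ka_def using \<alpha>_pos[of "T - r"] t by (simp add: less_imp_le)
 next case (6 s s') then show ?case using t by (intro th_strict) auto
 next case (7 s s') then show ?case using t by (intro integral_ka) auto
 next case 8
  have "heat_family n lam (th t + (ep - th t)) (th 0 + (ep - th t)) C.mx" by (rule C.heat_family_mix) (use ep tht0 in auto)
  moreover have "N = (\<lambda>d th'. C.mx d (th' + (ep - th t)))" by (intro ext) (simp only: N_def Cmx)
  ultimately show ?case by (simp only: heat_family_shift)
 next case 9 show ?case using hm_heat_family[of t] t by simp
 next case (10 th' y) then show ?case unfolding N_def using rng lam_pos by (intro less_imp_le pk_0_pos) auto
 next case (11 th' y) then show ?case using rng by (intro X0.mix_pos) auto
 next case (12 K) show ?case by (rule X0.mix_lower_bound[OF th_pos tht0]) (use t in auto)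
 next case (13 d th' y G) then show ?case unfolding N_def using rng lam_pos by (intro borel_measurable_pk borel_measurable_diff) auto
 next case (14 d th' y G) then show ?case using rng by (intro X0.borel_measurable_mix) auto
 next case (15 s) then show ?case using tT by (intro FW.subalg) auto
 next case (16 s s') then show ?case using t by (intro FW.F_mono) auto
 next case (17 s k)
  then have [measurable]: "Y s \<in> borel_measurable (F s)" using tT by (intro Y_adapted) auto
  show ?case unfolding U_def by measurable
 next case 18 show ?case using U_paths[of t] t by auto
 next case (19 s s' k) then show ?case using J(1) by (simp add: FW.ms_limit_def)
 next case (20 s s')
  have "AE w in P. \<forall>k\<in>{..<n}. U s' w k - U s w k = integral {s..s'} (\<lambda>r. ka r * lam k * ql hm (k, 1) (th r) (U r w)) + J s s' k w"
   by (intro AE_finite_allI J(2)) (use 20 in auto)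
  then show ?case by eventually_elim auto
 next case (21 s s' k i) then show ?case by (rule mom(1))
 next case (22 s s' k) then show ?case by (rule mom(2))
 next case (23 s s' k ps b) then show ?case by (intro mom(3)) auto
 next case (24 s s' k l ps b) then show ?case by (intro J2) auto
 qed
 have "(\<integral>\<^sup>+w. ennreal (pk n lam z0 ep (\<lambda>k. c k - U t w k) / hm z0 (th t) (U t w)) \<partial>P) = (\<integral>\<^sup>+w. ennreal (qu N hm (th t) (U t w)) \<partial>P)"
 proof (intro nn_integral_cong arg_cong[where f=ennreal])
  fix w
  show "pk n lam z0 ep (\<lambda>k. c k - U t w k) / hm z0 (th t) (U t w) = qu N hm (th t) (U t w)"
   using pk_uminus_0[of n lam ep "\<lambda>k. c k - U t w k"] by (simp add: qu_def N_def)
 qed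
 also have "\<dots> \<le> (\<integral>\<^sup>+w. ennreal (qu N hm (th 0) (U 0 w)) \<partial>P)" by (rule rp.nn_integral_quotient_le)
 also have "\<dots> = 1" unfolding qu_def N_def by (rule initial_quotient) (use rng[of "th 0"] tht0 in auto)
 finally show ?thesis .
qed

lemma Y_in_Hn: assumes "s \<in> {0..<T}" "w \<in> space P" shows "emb e n (\<lambda>k. Y s w \<bullet> e k) = Y s w"
proof (rule emb_inner_eq[OF onb])
 fix j assume j: "n \<le> j"
 have "Hn e n \<subseteq> {y. y \<bullet> e j = 0}" unfolding Hn_def by (rule span_minimal) (use j in \<open>auto simp: subspace_def inner_add_left on\<close>)
 moreover have "Y s w \<in> Hn e n" using rev assms by (simp add: reverse_weak_solution_def)
 ultimately show "Y s w \<bullet> e j = 0" by auto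
qed

text \<open>At t = 0 this is the initial condition. For t > 0 the bounded quotients identify the law
  of the rescaled reverse path, and division by the scale returns to \<open>Y t\<close>, which lies
  in \<open>Hn e n\<close> and is therefore recovered from its first n coordinates.\<close>

theorem reverse_law:
 assumes t: "t \<in> {0..<T}"
 shows "distr P borel (Y t) = distr M borel (Xt (T - t))"
proof (cases "t = 0")
 case True
 then show ?thesis using rev by (simp add: reverse_weak_solution_def)
next
 case False
 then have t': "0 < t" "t < T" using t by auto
 define a where "a = A (T - t)"
 have a: "0 < a" unfolding a_def by (rule a_fun_pos)
 have [measurable]: "Y t \<in> borel_measurable P" by (rule Y_measurable[OF t])
 have [measurable]: "Xt (T - t) \<in> borel_measurable M" using t' by (intro Xt_measurable) auto
 have sc [measurable]: "(\<lambda>x::'h. (1 / a) *\<^sub>R x) \<in> borel_measurable borel" by measurable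
 have mU: "(\<lambda>w. emb e n (U t w)) \<in> borel_measurable P" unfolding U_def by (rule borel_measurable_emb) measurable
 have mX: "(\<lambda>w. emb e n (\<lambda>k. a * (Xt (T - t) w \<bullet> e k))) \<in> borel_measurable M" by (rule borel_measurable_emb) measurable
 have "distr P borel (Y t) = distr (distr P borel (\<lambda>w. emb e n (U t w))) borel (\<lambda>x. (1 / a) *\<^sub>R x)" unfolding distr_distr[OF sc mU]
 proof (rule distr_cong)
  fix w assume "w \<in> space P"
  then show "Y t w = ((\<lambda>x. (1 / a) *\<^sub>R x) \<circ> (\<lambda>w. emb e n (U t w))) w"
   using a Y_in_Hn[OF t] by (simp add: U_def[abs_def] emb_scale a_def[symmetric])
 qed simp_all
 also have "distr P borel (\<lambda>w. emb e n (U t w)) = X0.law n e (th t)"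
 proof (rule X0.law_if_quotient_bounded)
  show "(\<lambda>w. U t w k) \<in> borel_measurable P" for k unfolding U_def by measurable
  show "(\<integral>\<^sup>+w. ennreal (pk n lam z0 ep (\<lambda>k. c k - U t w k) / hm z0 (th t) (U t w)) \<partial>P) \<le> 1" if "0 < ep" for ep c
   by (rule reverse_quotient_bounded[OF t' that])
 qed (use th_pos t' FW.prob_space_axioms in auto)
 also have "\<dots> = distr M borel (\<lambda>w. emb e n (\<lambda>k. a * (Xt (T - t) w \<bullet> e k)))"
  unfolding th_def a_def by (rule law_forward[symmetric]) (use t' in auto)
 also have "distr \<dots> borel (\<lambda>x. (1 / a) *\<^sub>R x) = distr M borel (Xt (T - t))" unfolding distr_distr[OF sc mX]
 proof (rule distr_cong_AE)
  have "AE w in M. emb e n (\<lambda>k. Xt (T - t) w \<bullet> e k) = Xt (T - t) w" by (rule forward_in_Hn) (use t' in auto)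
  then show "AE w in M. ((\<lambda>x. (1 / a) *\<^sub>R x) \<circ> (\<lambda>w. emb e n (\<lambda>k. a * (Xt (T - t) w \<bullet> e k)))) w = Xt (T - t) w"
   by eventually_elim (use a in \<open>simp add: emb_scale\<close>)
 qed (use measurable_comp[OF mX sc] in auto)
 finally show ?thesis .
qed

end

section \<open>Parseval's identity and the trace\<close>

lemma ennreal_mult_add: "0 \<le> b ==> 0 \<le> x ==> 0 \<le> y ==> ennreal (b * (x + y)) = ennreal b * (ennreal x + ennreal y)"
 by (subst ennreal_mult) (auto simp: ennreal_plus)

lemma emb_add: "emb e n (\<lambda>k. c k + d k) = emb e n c + emb e n d" by (simp add: emb_def scaleR_add_left sum.distrib)

lemma norm_residual_square:
 assumes e: "orthonormal_basis e"
 shows "(norm (x - emb e n (\<lambda>k. x \<bullet> e k)))\<^sup>2 = (norm x)\<^sup>2 - (\<Sum>k<n. (x \<bullet> e k)\<^sup>2)"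
proof -
 have 1: "emb e n (\<lambda>k. x \<bullet> e k) \<bullet> x = (\<Sum>k<n. (x \<bullet> e k)\<^sup>2)"
  by (simp add: emb_def inner_sum_left power2_eq_square inner_commute[of "e _" x])
 have 2: "emb e n (\<lambda>k. x \<bullet> e k) \<bullet> emb e n (\<lambda>k. x \<bullet> e k) = (\<Sum>k<n. (x \<bullet> e k)\<^sup>2)"
 proof -
  have "emb e n (\<lambda>k. x \<bullet> e k) \<bullet> emb e n (\<lambda>k. x \<bullet> e k) = (\<Sum>k<n. (x \<bullet> e k) * (emb e n (\<lambda>k. x \<bullet> e k) \<bullet> e k))"
   unfolding emb_def[of e n "\<lambda>k. x \<bullet> e k"] by (simp add: inner_sum_right)
  then show ?thesis by (simp add: emb_inner[OF orthonormal_basisD[OF e]] power2_eq_square)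
 qed
 show ?thesis using 1 2 by (simp add: power2_norm_eq_inner inner_diff_left inner_diff_right inner_commute)
qed

text \<open>Truncated expansions are best approximations, and the span of the basis is dense; so the
  squared residual, which is the defect in the sum of squares, tends to 0.\<close>

lemma Parseval:
 assumes e: "orthonormal_basis e"
 shows "(\<lambda>k. (x \<bullet> e k)\<^sup>2) sums (norm x)\<^sup>2"
proof -
 \<comment> \<open>The vectors whose expansion is exact from some index on. They form a subspace
   containing the basis.\<close>
 define S where "S = {y. \<exists>m. \<forall>n\<ge>m. emb e n (\<lambda>k. y \<bullet> e k) = y}"
 have "span (range e) \<subseteq> S"
 proof (rule span_minimal)
  show "range e \<subseteq> S"
  proof
   fix y assume "y \<in> range e"
   then obtain j where y: "y = e j" by auto
   have "emb e n (\<lambda>k. e j \<bullet> e k) = e j" if "Suc j \<le> n" for n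
    by (rule emb_inner_eq[OF e]) (use that in \<open>auto simp: orthonormal_basisD[OF e]\<close>)
   then show "y \<in> S" unfolding S_def y by blast
  qed
  show "subspace S"
  proof (rule subspaceI)
   show "0 \<in> S" by (simp add: S_def emb_def)
   fix y z assume "y \<in> S" "z \<in> S"
   then obtain m m' where "\<forall>n\<ge>m. emb e n (\<lambda>k. y \<bullet> e k) = y" "\<forall>n\<ge>m'. emb e n (\<lambda>k. z \<bullet> e k) = z" by (auto simp: S_def)
   then have "\<forall>n\<ge>max m m'. emb e n (\<lambda>k. (y + z) \<bullet> e k) = y + z" by (simp add: inner_add_left emb_add)
   then show "y + z \<in> S" unfolding S_def by blast
  next
   fix y and a :: real assume "y \<in> S"
   then obtain m where "\<forall>n\<ge>m. emb e n (\<lambda>k. y \<bullet> e k) = y" by (auto simp: S_def)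
   then have "\<forall>n\<ge>m. emb e n (\<lambda>k. (a *\<^sub>R y) \<bullet> e k) = a *\<^sub>R y" by (simp add: emb_def scaleR_sum_right[symmetric] scaleR_scaleR[symmetric] del: scaleR_scaleR)
   then show "a *\<^sub>R y \<in> S" unfolding S_def by blast
  qed
 qed
 \<comment> \<open>The residual formula is applied to \<open>x - y\<close>: truncation fixes y, so x
   and \<open>x - y\<close> have the same residual.\<close>
 have best: "(norm (x - emb e n (\<lambda>k. x \<bullet> e k)))\<^sup>2 \<le> (norm (x - y))\<^sup>2" if y: "emb e n (\<lambda>k. y \<bullet> e k) = y" for y n
 proof -
  have "(norm (x - y - emb e n (\<lambda>k. (x - y) \<bullet> e k)))\<^sup>2 \<le> (norm (x - y))\<^sup>2" unfolding norm_residual_square[OF e] by (simp add: sum_nonneg)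
  moreover have "emb e n (\<lambda>k. (x - y) \<bullet> e k) = emb e n (\<lambda>k. x \<bullet> e k) - y"
   using emb_add[of e n "\<lambda>k. (x - y) \<bullet> e k" "\<lambda>k. y \<bullet> e k"] y by (simp add: inner_diff_left)
  ultimately show ?thesis by (simp add: algebra_simps)
 qed
 have "(\<lambda>n. (norm x)\<^sup>2 - (\<Sum>k<n. (x \<bullet> e k)\<^sup>2)) \<longlonglongrightarrow> 0"
 proof (rule LIMSEQ_I)
  fix r :: real assume r: "0 < r"
  have "x \<in> closure (span (range e))" using e by (simp add: orthonormal_basis_def)
  then obtain y where y: "y \<in> span (range e)" "dist y x < sqrt r" using r unfolding closure_approachable by (metis real_sqrt_gt_zero)
  then obtain m where m: "\<forall>n\<ge>m. emb e n (\<lambda>k. y \<bullet> e k) = y" using \<open>span (range e) \<subseteq> S\<close> by (auto simp: S_def)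
  have "(norm (x - y))\<^sup>2 < (sqrt r)\<^sup>2" using y(2) by (intro power_strict_mono) (auto simp: dist_norm norm_minus_commute)
  then have "(norm (x - y))\<^sup>2 < r" using r by simp
  have "norm ((norm x)\<^sup>2 - (\<Sum>k<n. (x \<bullet> e k)\<^sup>2) - 0) < r" if "m \<le> n" for n
  proof -
   have "(norm (x - emb e n (\<lambda>k. x \<bullet> e k)))\<^sup>2 < r" using best[OF m[rule_format, OF that]] \<open>(norm (x - y))\<^sup>2 < r\<close> by linarith
   then show ?thesis unfolding norm_residual_square[OF e, symmetric] by simp
  qed
  then show "\<exists>m. \<forall>n\<ge>m. norm ((norm x)\<^sup>2 - (\<Sum>k<n. (x \<bullet> e k)\<^sup>2) - 0) < r" by blast
 qed
 then have "(\<lambda>n. (norm x)\<^sup>2 - ((norm x)\<^sup>2 - (\<Sum>k<n. (x \<bullet> e k)\<^sup>2))) \<longlonglongrightarrow> (norm x)\<^sup>2 - 0" by (intro tendsto_diff tendsto_const)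
 then show ?thesis by (simp add: sums_def)
qed

section \<open>The trace of the remainder and the limit of the bound\<close>

context forward_setting
begin

text \<open>\<open>op_trace\<close> is a definite description: its uniqueness follows by evaluation
  in the given basis, whereas existence for \<open>Q - Qn\<close> must be shown in every orthonormal
  basis.\<close>

lemma trace_sums: "lam sums op_trace Q" "op_trace (\<lambda>x. Q x - Qn e lam n x) = op_trace Q - (\<Sum>k<n. lam k)"
proof -
 obtain ta where ta: "has_op_trace Q ta" using trace_class by (auto simp: trace_class_operator_def)
 have eq: "op_trace B = ta'" if "has_op_trace B ta'" for B :: "'h => 'h" and ta' unfolding op_trace_def
 proof (rule the_equality[where P="has_op_trace B", OF that])
  fix ta'' assume "has_op_trace B ta''"
  then show "ta'' = ta'" using that onb unfolding has_op_trace_def by (metis sums_unique2)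
 qed
 have "(\<lambda>k. Q (e k) \<bullet> e k) sums ta" using ta onb by (simp add: has_op_trace_def)
 then show "lam sums op_trace Q" unfolding eq[OF ta] by (simp add: eigen on)
 have "has_op_trace (\<lambda>x. Q x - Qn e lam n x) (ta - (\<Sum>k<n. lam k))" unfolding has_op_trace_def
 proof (intro allI impI)
  fix f :: "nat => 'h" assume f: "orthonormal_basis f"
  \<comment> \<open>Parseval's identity for each \<open>e i\<close> in the basis f shows that the
    truncated operator has the same trace in every basis.\<close>
  have "(\<lambda>k. \<Sum>i<n. lam i * (e i \<bullet> f k)\<^sup>2) sums (\<Sum>i<n. lam i * (norm (e i))\<^sup>2)" by (intro sums_sum sums_mult Parseval f)
  moreover have "(norm (e i))\<^sup>2 = 1" for i by (simp add: power2_norm_eq_inner on)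
  moreover have "(\<lambda>k. Q (f k) \<bullet> f k) sums ta" using ta f by (simp add: has_op_trace_def)
  moreover have "Qn e lam n (f k) \<bullet> f k = (\<Sum>i<n. lam i * (e i \<bullet> f k)\<^sup>2)" for k by (simp add: Qn_def inner_sum_left power2_eq_square mult.assoc)
  ultimately show "(\<lambda>k. (Q (f k) - Qn e lam n (f k)) \<bullet> f k) sums (ta - (\<Sum>k<n. lam k))" by (simp add: inner_diff_left sums_diff)
 qed
 then show "op_trace (\<lambda>x. Q x - Qn e lam n x) = op_trace Q - (\<Sum>k<n. lam k)" using eq eq[OF ta] by simp
qed

lemma trace_tail: "(\<lambda>k. if k < n then 0 else lam k) sums op_trace (\<lambda>x. Q x - Qn e lam n x)"
proof -
 have "(\<lambda>k. lam k - (if k < n then lam k else 0)) sums (op_trace Q - (\<Sum>k<n. lam k))"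
  using sums_If_finite[of "\<lambda>k. k < n" lam] trace_sums(1) by (intro sums_diff) (simp_all add: lessThan_def)
 moreover have "(\<lambda>k. lam k - (if k < n then lam k else 0)) = (\<lambda>k. if k < n then 0 else lam k)" by auto
 ultimately show ?thesis by (simp add: trace_sums(2))
qed

lemma truncate_measurable: "(\<lambda>w. truncate e n (X0 w)) \<in> borel_measurable M" unfolding truncate_eq_emb by (rule borel_measurable_emb) measurable

lemma residual_le: "(norm (x - truncate e n x))\<^sup>2 \<le> (norm x)\<^sup>2" unfolding truncate_eq_emb norm_residual_square[OF onb] by (simp add: sum_nonneg)

lemma residual_norm_le: "norm (x - truncate e n x) \<le> norm x" by (rule power2_le_imp_le[OF residual_le norm_ge_zero])

lemma residual_integrable: "integrable M (\<lambda>w. (norm (X0 w - truncate e n (X0 w)))\<^sup>2)"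
proof (rule Bochner_Integration.integrable_bound[OF X0_square])
 note [measurable] = truncate_measurable
 show "(\<lambda>w. (norm (X0 w - truncate e n (X0 w)))\<^sup>2) \<in> borel_measurable M" by measurable
qed (auto intro!: AE_I2 residual_norm_le)

lemma bound_tendsto:
 "(\<lambda>n. 2 * b * expectation (\<lambda>w. (norm (X0 w - truncate e n (X0 w)))\<^sup>2) + 2 * c * op_trace (\<lambda>x. Q x - Qn e lam n x)) \<longlonglongrightarrow> 0"
proof -
 have "(\<lambda>n. expectation (\<lambda>w. (norm (X0 w - truncate e n (X0 w)))\<^sup>2)) \<longlonglongrightarrow> expectation (\<lambda>_. 0)"
 proof (rule integral_dominated_convergence[OF _ _ X0_square])
  show "(\<lambda>w. (norm (X0 w - truncate e n (X0 w)))\<^sup>2) \<in> borel_measurable M" for n using residual_integrable by (rule borel_measurable_integrable)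
  have "(\<lambda>n. (norm (x - truncate e n x))\<^sup>2) \<longlonglongrightarrow> (norm x)\<^sup>2 - (norm x)\<^sup>2" for x
   unfolding truncate_eq_emb norm_residual_square[OF onb] using Parseval[OF onb, of x] by (intro tendsto_diff tendsto_const) (simp add: sums_def)
  then show "AE w in M. (\<lambda>n. (norm (X0 w - truncate e n (X0 w)))\<^sup>2) \<longlonglongrightarrow> 0" by simp
 qed (auto intro!: AE_I2 residual_norm_le)
 moreover have "(\<lambda>n. op_trace (\<lambda>x. Q x - Qn e lam n x)) \<longlonglongrightarrow> op_trace Q - op_trace Q"
  unfolding trace_sums(2) using trace_sums(1) by (intro tendsto_diff tendsto_const) (simp add: sums_def)
 ultimately have "(\<lambda>n. 2 * b * expectation (\<lambda>w. (norm (X0 w - truncate e n (X0 w)))\<^sup>2) + 2 * c * op_trace (\<lambda>x. Q x - Qn e lam n x)) \<longlonglongrightarrow> 2 * b * 0 + 2 * c * 0"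
  by (intro tendsto_add tendsto_mult tendsto_const) simp_all
 then show ?thesis by simp
qed

end

section \<open>The truncation error\<close>

context truncated_forward
begin

text \<open>From index n on, the difference of the two processes is the initial value plus the
  noise, divided by \<open>A r\<close>. Bounding the square of the sum by twice the sum of squares,
  coordinate by coordinate, produces the two factors 2.\<close>

lemma forward_error:
 assumes X: "forward_solution M T \<alpha> W X0 X" and r: "r \<in> {0..T}"
 shows "(\<integral>\<^sup>+w. ennreal ((norm (Xt r w - X r w))\<^sup>2) \<partial>M) \<le>
  ennreal (2 * (1 / (A r)\<^sup>2) * expectation (\<lambda>w. (norm (X0 w - truncate e n (X0 w)))\<^sup>2)
   + 2 * (1 - 1 / (A r)\<^sup>2) * op_trace (\<lambda>x. Q x - Qn e lam n x))"
proof -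
 define a where "a = A r"
 have a: "0 < a" unfolding a_def by (rule a_fun_pos)
 have a1: "1 \<le> a\<^sup>2" unfolding a_def using a_fun_mono(1)[OF C1, of 0 r] r by (simp add: one_le_power)
 define g where "g = (\<lambda>r. A r * sqrt (\<alpha> r))"
 have r0: "0 \<le> r" "{0..r} \<subseteq> {0..T}" using r by auto
 have "\<exists>J. ms_limit (e k) g 0 r J \<and> (AE w in M. a * (X r w \<bullet> e k) = X0 w \<bullet> e k + J w)" for k
  using forward_component[where h="e k", OF C1 refl r X W_measurable] unfolding ms_limit_def grid_sum_def g_def a_def by auto
 then obtain J where J: "\<And>k. ms_limit (e k) g 0 r (J k)" "\<And>k. AE w in M. a * (X r w \<bullet> e k) = X0 w \<bullet> e k + J k w" by metis
 have Jm [measurable]: "J k \<in> borel_measurable M" for k using J(1)[of k] by (simp add: ms_limit_def)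
 have J2: "integrable M (\<lambda>w. (J k w)\<^sup>2)" "expectation (\<lambda>w. (J k w)\<^sup>2) = lam k * (a\<^sup>2 - 1)" for k
  using forward_second_moment[OF C1 refl r J(1)[of k, unfolded g_def]] by (simp_all add: eigen on a_def)
 \<comment> \<open>Both components are the same initial value plus a limit of the same grid sums,
   and such limits are almost surely unique.\<close>
 have same: "AE w in M. Xt r w \<bullet> e k = X r w \<bullet> e k" if k: "k < n" for k
 proof -
  have "\<exists>J'. ms_limit (e k) g 0 r J' \<and> (AE w in M. a * (Xt r w \<bullet> e k) = X0 w \<bullet> e k + J' w)"
   using forward_component[where h="e k", OF C1 refl r Xt wiener_truncation_measurable] k
   unfolding ms_limit_def grid_sum_def g_def a_def by (auto simp: wiener_truncation_eq truncate_inner)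
  then obtain J' where J': "ms_limit (e k) g 0 r J'" "AE w in M. a * (Xt r w \<bullet> e k) = X0 w \<bullet> e k + J' w" by blast
  have "AE w in M. J k w = J' w" by (rule ms_limit_unique[OF r0 J(1) J'(1)])
  then show ?thesis using J(2)[of k] J'(2)
  proof eventually_elim
   case (elim w)
   then have "a * (Xt r w \<bullet> e k) = a * (X r w \<bullet> e k)" by simp
   then show ?case using a by simp
  qed
 qed
 define R where "R w = X0 w - truncate e n (X0 w)" for w
 have [measurable]: "R \<in> borel_measurable M" unfolding R_def[abs_def] using truncate_measurable by measurable
 have R: "R w \<bullet> e k = (if k < n then 0 else X0 w \<bullet> e k)" for w k by (simp add: R_def inner_diff_left truncate_inner)
 define j where "j k w = (if k < n then 0 else (J k w)\<^sup>2)" for k w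
 have [measurable]: "j k \<in> borel_measurable M" for k unfolding j_def[abs_def] by measurable
 have jn: "0 \<le> j k w" for k w by (simp add: j_def)
 have suminf_eq: "(\<Sum>k. ennreal ((x \<bullet> e k)\<^sup>2)) = ennreal ((norm x)\<^sup>2)" for x by (rule suminf_ennreal_eq[OF _ Parseval[OF onb]]) simp
 have ae: "AE w in M. \<forall>k. a * (X r w \<bullet> e k) = X0 w \<bullet> e k + J k w \<and> (k < n --> Xt r w \<bullet> e k = X r w \<bullet> e k) \<and> (n \<le> k --> Xt r w \<bullet> e k = 0)"
  unfolding AE_all_countable using J(2) same forward_orthogonal[OF r] by auto
 have "(\<integral>\<^sup>+w. ennreal ((norm (Xt r w - X r w))\<^sup>2) \<partial>M) \<le> (\<integral>\<^sup>+w. ennreal (2 / a\<^sup>2) * (ennreal ((norm (R w))\<^sup>2) + (\<Sum>k. ennreal (j k w))) \<partial>M)"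
 proof (rule nn_integral_mono_AE)
  show "AE w in M. ennreal ((norm (Xt r w - X r w))\<^sup>2) \<le> ennreal (2 / a\<^sup>2) * (ennreal ((norm (R w))\<^sup>2) + (\<Sum>k. ennreal (j k w)))" using ae
  proof eventually_elim
   case (elim w)
   have le: "((Xt r w - X r w) \<bullet> e k)\<^sup>2 \<le> 2 / a\<^sup>2 * ((R w \<bullet> e k)\<^sup>2 + j k w)" for k
   proof (cases "k < n")
    case True then show ?thesis using elim by (simp add: inner_diff_left jn)
   next
    case False
    then have "(Xt r w - X r w) \<bullet> e k = - ((X0 w \<bullet> e k + J k w) / a)" using elim a by (simp add: inner_diff_left field_simps)
    then have "((Xt r w - X r w) \<bullet> e k)\<^sup>2 = (X0 w \<bullet> e k + J k w)\<^sup>2 / a\<^sup>2" by (simp add: power_divide)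
    also have "\<dots> \<le> 2 * ((X0 w \<bullet> e k)\<^sup>2 + (J k w)\<^sup>2) / a\<^sup>2"
     using sum_squares_bound[of "X0 w \<bullet> e k" "J k w"] by (intro divide_right_mono) (simp_all add: power2_sum)
    finally show ?thesis using False by (simp add: R j_def)
   qed
   have "ennreal ((norm (Xt r w - X r w))\<^sup>2) = (\<Sum>k. ennreal (((Xt r w - X r w) \<bullet> e k)\<^sup>2))" by (simp only: suminf_eq)
   also have "\<dots> \<le> (\<Sum>k. ennreal (2 / a\<^sup>2) * (ennreal ((R w \<bullet> e k)\<^sup>2) + ennreal (j k w)))"
   proof (rule suminf_le)
    fix k
    have "ennreal (2 / a\<^sup>2 * ((R w \<bullet> e k)\<^sup>2 + j k w)) = ennreal (2 / a\<^sup>2) * (ennreal ((R w \<bullet> e k)\<^sup>2) + ennreal (j k w))"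
     using jn a by (intro ennreal_mult_add) auto
    then show "ennreal (((Xt r w - X r w) \<bullet> e k)\<^sup>2) \<le> ennreal (2 / a\<^sup>2) * (ennreal ((R w \<bullet> e k)\<^sup>2) + ennreal (j k w))"
     using ennreal_leI[OF le[of k]] by simp
   qed simp_all
   also have "\<dots> = ennreal (2 / a\<^sup>2) * (ennreal ((norm (R w))\<^sup>2) + (\<Sum>k. ennreal (j k w)))" by (simp add: suminf_add[symmetric] suminf_eq)
   finally show ?case .
  qed
 qed
 also have "\<dots> = ennreal (2 / a\<^sup>2) * ((\<integral>\<^sup>+w. ennreal ((norm (R w))\<^sup>2) \<partial>M) + (\<Sum>k. \<integral>\<^sup>+w. ennreal (j k w) \<partial>M))"
  by (simp add: nn_integral_cmult nn_integral_add nn_integral_suminf)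
 also have "(\<integral>\<^sup>+w. ennreal ((norm (R w))\<^sup>2) \<partial>M) = ennreal (expectation (\<lambda>w. (norm (R w))\<^sup>2))"
  unfolding R_def using residual_integrable by (intro nn_integral_eq_integral) auto
 also have "(\<Sum>k. \<integral>\<^sup>+w. ennreal (j k w) \<partial>M) = (\<Sum>k. ennreal ((if k < n then 0 else lam k) * (a\<^sup>2 - 1)))"
 proof (intro suminf_cong)
  fix k
  have "(\<integral>\<^sup>+w. ennreal ((J k w)\<^sup>2) \<partial>M) = ennreal (lam k * (a\<^sup>2 - 1))"
   unfolding J2(2)[symmetric] using J2(1) by (intro nn_integral_eq_integral) auto
  then show "(\<integral>\<^sup>+w. ennreal (j k w) \<partial>M) = ennreal ((if k < n then 0 else lam k) * (a\<^sup>2 - 1))" by (simp add: j_def)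
 qed
 also have "\<dots> = ennreal (op_trace (\<lambda>x. Q x - Qn e lam n x) * (a\<^sup>2 - 1))"
  using a1 less_imp_le[OF lam_pos] by (intro suminf_ennreal_eq sums_mult2 trace_tail) auto
 also have "ennreal (2 / a\<^sup>2) * (ennreal (expectation (\<lambda>w. (norm (R w))\<^sup>2)) + \<dots>) =
  ennreal (2 / a\<^sup>2 * (expectation (\<lambda>w. (norm (R w))\<^sup>2) + op_trace (\<lambda>x. Q x - Qn e lam n x) * (a\<^sup>2 - 1)))"
 proof -
  have "0 \<le> op_trace (\<lambda>x. Q x - Qn e lam n x)" using sums_le[OF _ sums_zero trace_tail[of n]] less_imp_le[OF lam_pos] by simp
  then have "0 \<le> op_trace (\<lambda>x. Q x - Qn e lam n x) * (a\<^sup>2 - 1)" using a1 by simp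
  then show ?thesis using a by (intro ennreal_mult_add[symmetric]) auto
 qed
 also have "2 / a\<^sup>2 * (expectation (\<lambda>w. (norm (R w))\<^sup>2) + op_trace (\<lambda>x. Q x - Qn e lam n x) * (a\<^sup>2 - 1)) =
  2 * (1 / a\<^sup>2) * expectation (\<lambda>w. (norm (R w))\<^sup>2) + 2 * (1 - 1 / a\<^sup>2) * op_trace (\<lambda>x. Q x - Qn e lam n x)"
  using a by (simp add: field_simps)
 finally show ?thesis unfolding a_def R_def .
qed

end

lemma wasserstein2_le:
 fixes Z Z' :: "'w' => 'h::{real_inner, second_countable_topology}"
 assumes [measurable]: "Z \<in> borel_measurable M" "Z' \<in> borel_measurable M"
  and le: "(\<integral>\<^sup>+w. ennreal ((norm (Z w - Z' w))\<^sup>2) \<partial>M) \<le> ennreal B"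
 shows "(wasserstein2 (distr M borel Z) (distr M borel Z'))\<^sup>2 \<le> ennreal B"
proof -
 define \<pi> where "\<pi> = distr M (borel \<Otimes>\<^sub>M borel) (\<lambda>w. (Z w, Z' w))"
 define c where "c = (INF \<pi>\<in>couplings (distr M borel Z) (distr M borel Z'). \<integral>\<^sup>+ z. ennreal ((norm (fst z - snd z))\<^sup>2) \<partial>\<pi>)"
 have "\<pi> \<in> couplings (distr M borel Z) (distr M borel Z')" unfolding couplings_def \<pi>_def by (simp add: distr_distr comp_def)
 then have "c \<le> (\<integral>\<^sup>+ z. ennreal ((norm (fst z - snd z))\<^sup>2) \<partial>\<pi>)" unfolding c_def by (rule INF_lower)
 also have "\<dots> = (\<integral>\<^sup>+w. ennreal ((norm (Z w - Z' w))\<^sup>2) \<partial>M)" unfolding \<pi>_def by (subst nn_integral_distr) simp_all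
 finally have c: "c \<le> ennreal B" using le by (rule order_trans)
 \<comment> \<open>Finiteness of the infimum selects the real-valued branch in the definition of the
   distance.\<close>
 then have top: "c < \<top>" using ennreal_less_top[of B] by (rule order_le_less_trans)
 then have "(wasserstein2 (distr M borel Z) (distr M borel Z'))\<^sup>2 = (ennreal (sqrt (enn2real c)))\<^sup>2"
  unfolding wasserstein2_def c_def[symmetric] Let_def by simp
 also have "\<dots> = c" using top by (simp add: ennreal_power)
 finally show ?thesis using c by simp
qed

section \<open>Convergence of the discretized reverse process\<close>

theorem corollary3p5:
  fixes M :: "'w measure"
    and T :: real and \<alpha> :: "real \<Rightarrow> real"
    and Q :: "'h::{real_inner, banach, second_countable_topology} \<Rightarrow> 'h"
    and e :: "nat \<Rightarrow> 'h" and lam :: "nat \<Rightarrow> real"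
    and W :: "real \<Rightarrow> 'w \<Rightarrow> 'h" and X0 :: "'w \<Rightarrow> 'h"
    and X :: "real \<Rightarrow> 'w \<Rightarrow> 'h" and Xn :: "nat \<Rightarrow> real \<Rightarrow> 'w \<Rightarrow> 'h"
  assumes "prob_space M"
    and "0 < T" and "C1_positive T \<alpha>"
    and "trace_class_operator Q" and "inj Q"
    and "orthonormal_basis e" and "\<And>k. Q (e k) = lam k *\<^sub>R e k"
    and "wiener_process M {0..T} Q W"
    and "X0 \<in> borel_measurable M"
    and "independent_of_process M {0..T} X0 W"
    and "integrable M (\<lambda>\<omega>. (norm (X0 \<omega>))\<^sup>2)"
    and "forward_solution M T \<alpha> W X0 X"
    and "\<And>n. n \<ge> 1 \<Longrightarrow>
           forward_solution M T \<alpha> (wiener_truncation e lam W n) (\<lambda>\<omega>. truncate e n (X0 \<omega>)) (Xn n)"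
  shows "let rhs = (\<lambda>n t.
             2 * (1 / (a_fun \<alpha> (T - t))\<^sup>2) *
               prob_space.expectation M (\<lambda>\<omega>. (norm (X0 \<omega> - truncate e n (X0 \<omega>)))\<^sup>2)
             + 2 * (1 - 1 / (a_fun \<alpha> (T - t))\<^sup>2) * op_trace (\<lambda>x. Q x - Qn e lam n x))
         in
         (\<forall>n\<ge>1. has_Lebesgue_density M n (\<lambda>\<omega>. iota e n (truncate e n (X0 \<omega>))) \<longrightarrow>
            (\<forall>(N :: 'v measure) F V Y. reverse_weak_solution M T \<alpha> e lam n (Xn n) N F V Y \<longrightarrow>
               (\<forall>t\<in>{0..<T}.
                  (wasserstein2 (distr N borel (Y t)) (distr M borel (X (T - t))))\<^sup>2
                    \<le> ennreal (rhs n t)))) \<and>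
         (\<forall>t\<in>{0..<T}. (\<lambda>n. rhs n t) \<longlonglongrightarrow> 0)"
proof -
  have Q_nonneg: "0 \<le> Q h \<bullet> h" for h using assms(4) unfolding trace_class_operator_def by blast
  interpret S: forward_setting M T Q W \<alpha> e lam X0
    using assms(1-11) Q_nonneg
    by (intro forward_setting.intro forward_setting_axioms.intro wiener.intro wiener_axioms.intro) auto
  show ?thesis
    unfolding Let_def
  proof (intro conjI allI ballI impI)
    fix n :: nat and N :: "'v measure" and F V Y t
    assume n: "1 \<le> n" and rev: "reverse_weak_solution M T \<alpha> e lam n (Xn n) N F V Y" and t: "t \<in> {0..<T}"
    interpret R: reverse_setting M T Q W \<alpha> e lam X0 n "Xn n" N F V Y
      by (intro reverse_setting.intro truncated_forward.intro truncated_forward_axioms.intro reverse_setting_axioms.intro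
          S.forward_setting_axioms assms(13) n rev)
    have r: "T - t \<in> {0..T}" using t by auto
    have X: "X (T - t) \<in> borel_measurable M"
      using assms(12) r by (simp add: forward_solution_def sde_solution_def continuous_process_def)
    show "(wasserstein2 (distr N borel (Y t)) (distr M borel (X (T - t))))\<^sup>2
      \<le> ennreal (2 * (1 / (a_fun \<alpha> (T - t))\<^sup>2) * S.expectation (\<lambda>\<omega>. (norm (X0 \<omega> - truncate e n (X0 \<omega>)))\<^sup>2)
             + 2 * (1 - 1 / (a_fun \<alpha> (T - t))\<^sup>2) * op_trace (\<lambda>x. Q x - Qn e lam n x))"
      unfolding R.reverse_law[OF t]
      by (rule wasserstein2_le[OF R.Xt_measurable[OF r] X R.forward_error[OF assms(12) r]])
  qed (rule S.bound_tendsto)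
qed

end
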